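(* Let $\Omega\subset\mathbb{R}^3$ be a bounded domain with $C^2$ boundary, let $\sigma:\mathbb{R}\to\mathbb{R}$ be continuous with $\sigma_1\le\sigma(s)\le\sigma_2$ for all $s$ ($0<\sigma_1\le\sigma_2$ constants) and $|\sigma(s)-\sigma(t)|\le L|s-t|$ for all $s,t$ ($L>0$). Let $(u^0,\mathbf{E}^0)\in W^{1,q}(\Omega)\times L^q(\Omega,\mathbb{R}^3)$ for some $q>3$, with $\nabla\times\mathbf{E}^0=\mathbf{0}$ in $\Omega$. Then there exists $\eta>0$ such that if $\|\mathbf{E}^0\|_{L^q(\Omega)}<\eta$, then (P$_E$) has a unique weak solution in the space $H^1(\Omega)\times[H_0(\mathrm{div}0,\Omega)\cap H(\mathrm{curl},\Omega)\cap\mathbb{H}_N(\Omega)^\perp]$.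
   Context: Let $\nu$ be the outer unit normal. Problem (P$_E$): $\nabla\times[\sigma(u)^{-1}\nabla\times\mathbf{H}]=\mathbf{0}$, $\nabla\cdot\mathbf{H}=0$, $-\Delta u=\sigma(u)^{-1}|\nabla\times\mathbf{H}|^2$ in $\Omega$; $u=u^0$, $\nu\cdot\mathbf{H}=0$, $\nu\times[\sigma(u)^{-1}\nabla\times\mathbf{H}]=\nu\times\mathbf{E}^0$ on $\partial\Omega$. $H_0(\mathrm{div}0,\Omega)=\{\mathbf{u}\in L^2(\Omega,\mathbb{R}^3):\nabla\cdot\mathbf{u}=0,\ \nu\cdot\mathbf{u}=0\text{ on }\partial\Omega\}$; $H(\mathrm{curl},\Omega)=\{\mathbf{u}\in L^2:\nabla\times\mathbf{u}\in L^2\}$; $\mathbb{H}_N(\Omega)=\{\mathbf{u}\in L^2:\nabla\times\mathbf{u}=\mathbf{0},\nabla\cdot\mathbf{u}=0,\ \nu\cdot\mathbf{u}=0\text{ on }\partial\Omega\}$, $\perp$ = $L^2$-orthogonal complement. A weak solution of (P$_E$) is $(u,\mathbf{H})\in H^1(\Omega)\times[H_0(\mathrm{div}0,\Omega)\cap H(\mathrm{curl},\Omega)]$ with $u=u^0$ on $\partial\Omega$ (trace), $\int_\Omega\nabla u\cdot\nabla v=\int_\Omega\sigma(u)^{-1}|\nabla\times\mathbf{H}|^2v$ for all $v\in H^1_0(\Omega)\cap L^\infty(\Omega)$, and $\int_\Omega\sigma(u)^{-1}(\nabla\times\mathbf{H})\cdot(\nabla\times\mathbf{w})=\int_\Omega\mathbf{E}^0\cdot\nabla\times\mathbf{w}$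 for all $\mathbf{w}\in H_0(\mathrm{div}0,\Omega)\cap H(\mathrm{curl},\Omega)$. *)

theory Defs
  imports "HOL-Analysis.Analysis"
begin

definition partial :: "'n::finite \<Rightarrow> (real^'n \<Rightarrow> real) \<Rightarrow> real^'n \<Rightarrow> real" where
  "partial i f x = frechet_derivative f (at x) (axis i 1)"

fun Ck_on :: "nat \<Rightarrow> (real^'n::finite) set \<Rightarrow> (real^'n \<Rightarrow> real) \<Rightarrow> bool" where
  "Ck_on 0 S f = continuous_on S f"
| "Ck_on (Suc k) S f = ((\<forall>x\<in>S. f differentiable (at x)) \<and> (\<forall>i. Ck_on k S (partial i f)))"

definition smooth_on :: "(real^'n::finite) set \<Rightarrow> (real^'n \<Rightarrow> real) \<Rightarrow> bool" where
  "smooth_on S f = (\<forall>k. Ck_on k S f)"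

definition grad :: "(real^'n::finite \<Rightarrow> real) \<Rightarrow> real^'n \<Rightarrow> real^'n" where
  "grad f x = (\<chi> i. partial i f x)"

definition ccurl :: "(real^3 \<Rightarrow> real^3) \<Rightarrow> real^3 \<Rightarrow> real^3" where
  "ccurl F x = vector
     [partial (2::3) (\<lambda>y. F y $ 3) x - partial (3::3) (\<lambda>y. F y $ 2) x,
      partial (3::3) (\<lambda>y. F y $ 1) x - partial (1::3) (\<lambda>y. F y $ 3) x,
      partial (1::3) (\<lambda>y. F y $ 2) x - partial (2::3) (\<lambda>y. F y $ 1) x]"

definition test_fun :: "(real^3) set \<Rightarrow> (real^3 \<Rightarrow> real) \<Rightarrow> bool" where
  "test_fun \<Omega> \<phi> = (smooth_on UNIV \<phi> \<and> bounded {x. \<phi> x \<noteq> 0} \<and> closure {x. \<phi> x \<noteq> 0} \<subseteq> \<Omega>)"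

definition vec_test :: "(real^3) set \<Rightarrow> (real^3 \<Rightarrow> real^3) \<Rightarrow> bool" where
  "vec_test \<Omega> \<Phi> = (\<forall>j. test_fun \<Omega> (\<lambda>x. \<Phi> x $ j))"

definition Lp :: "real \<Rightarrow> (real^3) set \<Rightarrow> (real^3 \<Rightarrow> real) \<Rightarrow> bool" where
  "Lp q \<Omega> f = (set_borel_measurable lebesgue \<Omega> f \<and>
                 set_integrable lebesgue \<Omega> (\<lambda>x. \<bar>f x\<bar> powr q))"

definition Lp_vec :: "real \<Rightarrow> (real^3) set \<Rightarrow> (real^3 \<Rightarrow> real^3) \<Rightarrow> bool" where
  "Lp_vec q \<Omega> F = (set_borel_measurable lebesgue \<Omega> F \<and>
                     set_integrable lebesgue \<Omega> (\<lambda>x. norm (F x) powr q))"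

definition Lp_norm :: "real \<Rightarrow> (real^3) set \<Rightarrow> (real^3 \<Rightarrow> real) \<Rightarrow> real" where
  "Lp_norm q \<Omega> f = (LINT x:\<Omega>|lebesgue. \<bar>f x\<bar> powr q) powr (1/q)"

definition Lp_norm_vec :: "real \<Rightarrow> (real^3) set \<Rightarrow> (real^3 \<Rightarrow> real^3) \<Rightarrow> real" where
  "Lp_norm_vec q \<Omega> F = (LINT x:\<Omega>|lebesgue. norm (F x) powr q) powr (1/q)"

definition Linfty :: "(real^3) set \<Rightarrow> (real^3 \<Rightarrow> real) \<Rightarrow> bool" where
  "Linfty \<Omega> v = (set_borel_measurable lebesgue \<Omega> v \<and>
                  (\<exists>C. AE x in lebesgue. x \<in> \<Omega> \<longrightarrow> \<bar>v x\<bar> \<le> C))"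

definition weak_grad :: "(real^3) set \<Rightarrow> (real^3 \<Rightarrow> real) \<Rightarrow> (real^3 \<Rightarrow> real^3) \<Rightarrow> bool" where
  "weak_grad \<Omega> u g = (\<forall>\<phi>. test_fun \<Omega> \<phi> \<longrightarrow>
     (\<forall>i. (LINT x:\<Omega>|lebesgue. u x * partial i \<phi> x) = - (LINT x:\<Omega>|lebesgue. g x $ i * \<phi> x)))"

definition W1 :: "real \<Rightarrow> (real^3) set \<Rightarrow> (real^3 \<Rightarrow> real) \<Rightarrow> bool" where
  "W1 q \<Omega> u = (Lp q \<Omega> u \<and> (\<exists>g. Lp_vec q \<Omega> g \<and> weak_grad \<Omega> u g))"

abbreviation H1 :: "(real^3) set \<Rightarrow> (real^3 \<Rightarrow> real) \<Rightarrow> bool" where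
  "H1 \<equiv> W1 2"

text \<open>The weak gradient (unique up to a.e. equality).\<close>
definition wgrad :: "(real^3) set \<Rightarrow> (real^3 \<Rightarrow> real) \<Rightarrow> real^3 \<Rightarrow> real^3" where
  "wgrad \<Omega> u = (SOME g. Lp_vec 1 \<Omega> g \<and> weak_grad \<Omega> u g)"

definition H10 :: "(real^3) set \<Rightarrow> (real^3 \<Rightarrow> real) \<Rightarrow> bool" where
  "H10 \<Omega> w = (H1 \<Omega> w \<and> (\<exists>\<phi>s. (\<forall>n. test_fun \<Omega> (\<phi>s n)) \<and>
      (\<lambda>n. Lp_norm 2 \<Omega> (\<lambda>x. \<phi>s n x - w x)) \<longlonglongrightarrow> 0 \<and>
      (\<lambda>n. Lp_norm_vec 2 \<Omega> (\<lambda>x. grad (\<phi>s n) x - wgrad \<Omega> w x)) \<longlonglongrightarrow> 0))"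

definition weak_curl :: "(real^3) set \<Rightarrow> (real^3 \<Rightarrow> real^3) \<Rightarrow> (real^3 \<Rightarrow> real^3) \<Rightarrow> bool" where
  "weak_curl \<Omega> H c = (\<forall>\<Phi>. vec_test \<Omega> \<Phi> \<longrightarrow>
     (LINT x:\<Omega>|lebesgue. H x \<bullet> ccurl \<Phi> x) = (LINT x:\<Omega>|lebesgue. c x \<bullet> \<Phi> x))"

definition wcurl :: "(real^3) set \<Rightarrow> (real^3 \<Rightarrow> real^3) \<Rightarrow> real^3 \<Rightarrow> real^3" where
  "wcurl \<Omega> H = (SOME c. Lp_vec 1 \<Omega> c \<and> weak_curl \<Omega> H c)"

definition Hcurl :: "(real^3) set \<Rightarrow> (real^3 \<Rightarrow> real^3) \<Rightarrow> bool" where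
  "Hcurl \<Omega> H = (Lp_vec 2 \<Omega> H \<and> (\<exists>c. Lp_vec 2 \<Omega> c \<and> weak_curl \<Omega> H c))"

text \<open>H_0(div0): L^2 fields with div = 0 in \<Omega> and \<nu>\<cdot>H = 0 on the boundary, both in
  the weak (Green's formula) sense: \<integral> H \<cdot> \<nabla>\<phi> = 0 for all \<phi> smooth up to the boundary.\<close>
definition H0div0 :: "(real^3) set \<Rightarrow> (real^3 \<Rightarrow> real^3) \<Rightarrow> bool" where
  "H0div0 \<Omega> H = (Lp_vec 2 \<Omega> H \<and>
     (\<forall>\<phi>. smooth_on UNIV \<phi> \<longrightarrow> (LINT x:\<Omega>|lebesgue. H x \<bullet> grad \<phi> x) = 0))"

definition HN :: "(real^3) set \<Rightarrow> (real^3 \<Rightarrow> real^3) \<Rightarrow> bool" where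
  "HN \<Omega> H = (Lp_vec 2 \<Omega> H \<and> weak_curl \<Omega> H (\<lambda>_. 0) \<and> H0div0 \<Omega> H)"

definition perp_HN :: "(real^3) set \<Rightarrow> (real^3 \<Rightarrow> real^3) \<Rightarrow> bool" where
  "perp_HN \<Omega> H = (\<forall>h. HN \<Omega> h \<longrightarrow> (LINT x:\<Omega>|lebesgue. H x \<bullet> h x) = 0)"

definition C2_boundary_domain :: "(real^3) set \<Rightarrow> bool" where
  "C2_boundary_domain \<Omega> = (open \<Omega> \<and> connected \<Omega> \<and> \<Omega> \<noteq> {} \<and> bounded \<Omega> \<and>
     (\<forall>p\<in>frontier \<Omega>. \<exists>(R::real^3 \<Rightarrow> real^3) (\<gamma>::real^2 \<Rightarrow> real) r.
        orthogonal_transformation R \<and> Ck_on 2 UNIV \<gamma> \<and> r > 0 \<and>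
        (\<forall>x\<in>ball p r. x \<in> \<Omega> \<longleftrightarrow>
            R (x - p) $ 3 < \<gamma> (vector [R (x - p) $ 1, R (x - p) $ 2]))))"

definition weak_solution ::
  "(real^3) set \<Rightarrow> (real \<Rightarrow> real) \<Rightarrow> (real^3 \<Rightarrow> real) \<Rightarrow> (real^3 \<Rightarrow> real^3)
    \<Rightarrow> (real^3 \<Rightarrow> real) \<Rightarrow> (real^3 \<Rightarrow> real^3) \<Rightarrow> bool" where
  "weak_solution \<Omega> \<sigma> u0 E0 u H =
    (H1 \<Omega> u \<and> H0div0 \<Omega> H \<and> Hcurl \<Omega> H \<and> H10 \<Omega> (\<lambda>x. u x - u0 x) \<and>
     (\<forall>v. H10 \<Omega> v \<and> Linfty \<Omega> v \<longrightarrow>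
        (LINT x:\<Omega>|lebesgue. wgrad \<Omega> u x \<bullet> wgrad \<Omega> v x)
        = (LINT x:\<Omega>|lebesgue. (norm (wcurl \<Omega> H x))\<^sup>2 / \<sigma> (u x) * v x)) \<and>
     (\<forall>w. H0div0 \<Omega> w \<and> Hcurl \<Omega> w \<longrightarrow>
        (LINT x:\<Omega>|lebesgue. (wcurl \<Omega> H x \<bullet> wcurl \<Omega> w x) / \<sigma> (u x))
        = (LINT x:\<Omega>|lebesgue. E0 x \<bullet> wcurl \<Omega> w x)))"

end

theory Submission
  imports Defs "HOL-Analysis.Analysis"
begin

text \<open>Write \<open>\<sigma>(u)\<inverse> curl H = E\<^sub>0 + \<nabla>\<psi>\<close>. For every test field \<open>\<Phi>\<close> there is a function \<open>F\<close>, smooth on the whole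
  space and locally constant near the complement of \<open>\<Omega>\<close>, with \<open>\<parallel>\<Phi> - \<nabla>F\<parallel> \<le> C \<parallel>curl \<Phi>\<parallel>\<close>; by duality, the
  orthogonal complement of the curls is the \<open>L\<^sup>2\<close>-closure of such gradients, so the system for \<open>H\<close> becomes the
  scalar equation \<open>div (\<sigma>(u) (E\<^sub>0 + \<nabla>\<psi>)) = 0\<close>, with \<open>\<psi>\<close> constant on each boundary component. Stampacchia's
  truncation bounds \<open>\<psi>\<close> by a multiple of \<open>\<parallel>E\<^sub>0\<parallel>\<^sub>q\<close>, and testing the equation with \<open>\<psi> \<phi>\<^sup>2\<close> gives
  \<open>\<parallel>\<phi> (E\<^sub>0 + \<nabla>\<psi>)\<parallel> \<le> K \<parallel>E\<^sub>0\<parallel>\<^sub>q \<parallel>\<nabla>\<phi>\<parallel>\<close> for test functions \<open>\<phi>\<close>. This form bound replaces higher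
  integrability: it makes the map from a temperature gradient to the next one, which solves
  the heat equation with the Joule source of the previous step, a contraction of the closed space of gradients
  vanishing on the boundary as soon as \<open>\<parallel>E\<^sub>0\<parallel>\<^sub>q\<close> is small.\<close>

section \<open>Square-integrable fields\<close>

text \<open>The Joule heat is quadratic in the field and thus a priori only integrable; such a
  source need not be a bounded functional on H^1_0 in dimension 3. The form bound removes this
  obstacle: the product of a temperature test function v with the field E is square integrable, so
  the source acts on v as the L^2 pairing of s E with v E. The bound on the potential behind it sees
  the coefficient s only through \<sigma>1 and \<sigma>2, so one constant K serves every
  temperature. In the difference of two Joule terms one form bound is spent on the test function and
  a second on the temperature difference; the Lipschitz constant therefore carries the square of K
  times the size of the data, against the fixed factor L (1 + 2 \<sigma>2 / \<sigma>1). The delicate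
  point of the curl estimate is topological: local potentials near the exterior are determined up to
  constants, and these must be matched along chains of overlapping patches. Finally H is recovered
  from its curl; the kernel of that step is H_N, which explains the orthogonality condition.\<close>

definition sqint :: "(real^3 \<Rightarrow> 'b::euclidean_space) \<Rightarrow> bool" where
  "sqint f \<longleftrightarrow> f \<in> borel_measurable lebesgue \<and> integrable lebesgue (\<lambda>x. (norm (f x))\<^sup>2)"

lemma sqint_measurable [measurable_dest]: "sqint f \<Longrightarrow> f \<in> borel_measurable lebesgue"
  by (simp add: sqint_def)

lemma sqint_integrable: "sqint f \<Longrightarrow> integrable lebesgue (\<lambda>x. (norm (f x))\<^sup>2)"
  by (simp add: sqint_def)

lemma sqint_bound:
  assumes "f \<in> borel_measurable lebesgue" "integrable lebesgue g"
    and "AE x in lebesgue. (norm (f x))\<^sup>2 \<le> g x"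
  shows "sqint f"
  unfolding sqint_def
proof
  show "integrable lebesgue (\<lambda>x. (norm (f x))\<^sup>2)"
  proof (rule Bochner_Integration.integrable_bound[OF assms(2)])
    show "(\<lambda>x. (norm (f x))\<^sup>2) \<in> borel_measurable lebesgue" using assms(1) by measurable
    show "AE x in lebesgue. norm ((norm (f x))\<^sup>2) \<le> norm (g x)"
      using assms(3) by eventually_elim auto
  qed
qed (fact assms(1))

lemma sqint_zero [simp]: "sqint (\<lambda>x. 0)"
  by (simp add: sqint_def)

lemma sqint_add:
  assumes "sqint f" "sqint g" shows "sqint (\<lambda>x. f x + g x)"
proof (rule sqint_bound)
  show "(\<lambda>x. f x + g x) \<in> borel_measurable lebesgue"
    using assms by (intro borel_measurable_add sqint_measurable)
  show "integrable lebesgue (\<lambda>x. 2 * (norm (f x))\<^sup>2 + 2 * (norm (g x))\<^sup>2)"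
    using assms by (auto simp: sqint_def)
  show "AE x in lebesgue. (norm (f x + g x))\<^sup>2 \<le> 2 * (norm (f x))\<^sup>2 + 2 * (norm (g x))\<^sup>2"
  proof (intro always_eventually allI)
    fix x
    have "(norm (f x + g x))\<^sup>2 \<le> (norm (f x) + norm (g x))\<^sup>2"
      by (intro power_mono norm_triangle_ineq) auto
    also have "\<dots> \<le> 2 * (norm (f x))\<^sup>2 + 2 * (norm (g x))\<^sup>2"
      using sum_squares_bound[of "norm (f x)" "norm (g x)"] by (simp add: power2_sum)
    finally show "(norm (f x + g x))\<^sup>2 \<le> 2 * (norm (f x))\<^sup>2 + 2 * (norm (g x))\<^sup>2" .
  qed
qed

lemma sqint_bounded_mult:
  fixes s :: "real^3 \<Rightarrow> real"
  assumes "s \<in> borel_measurable lebesgue" "sqint f" "AE x in lebesgue. \<bar>s x\<bar> \<le> C"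
  shows "sqint (\<lambda>x. s x *\<^sub>R f x)"
proof (rule sqint_bound)
  show "(\<lambda>x. s x *\<^sub>R f x) \<in> borel_measurable lebesgue"
    by (rule borel_measurable_scaleR[OF assms(1) sqint_measurable[OF assms(2)]])
  show "integrable lebesgue (\<lambda>x. C\<^sup>2 * (norm (f x))\<^sup>2)"
    using assms by (auto simp: sqint_def)
  show "AE x in lebesgue. (norm (s x *\<^sub>R f x))\<^sup>2 \<le> C\<^sup>2 * (norm (f x))\<^sup>2"
    using assms(3)
  proof eventually_elim
    case (elim x)
    then have "\<bar>s x\<bar>\<^sup>2 \<le> C\<^sup>2" by (intro power_mono) auto
    then show ?case by (simp add: power_mult_distrib mult_right_mono)
  qed
qed

lemma sqint_scaleR: "sqint f \<Longrightarrow> sqint (\<lambda>x. c *\<^sub>R f x)"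
  by (rule sqint_bounded_mult[of "\<lambda>_. c" f "\<bar>c\<bar>"]) auto

lemma sqint_minus: "sqint f \<Longrightarrow> sqint (\<lambda>x. - f x)"
  by (simp add: sqint_def)

lemma sqint_diff: "sqint f \<Longrightarrow> sqint g \<Longrightarrow> sqint (\<lambda>x. f x - g x)"
  using sqint_add[OF _ sqint_minus, of f g] by simp

lemma sqint_inner_integrable:
  assumes "sqint f" "sqint g" shows "integrable lebesgue (\<lambda>x. f x \<bullet> g x)"
proof (rule Bochner_Integration.integrable_bound)
  show "integrable lebesgue (\<lambda>x. (norm (f x))\<^sup>2 + (norm (g x))\<^sup>2)"
    using assms by (auto simp: sqint_def)
  show "(\<lambda>x. f x \<bullet> g x) \<in> borel_measurable lebesgue"
    using assms by (intro borel_measurable_inner sqint_measurable)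
  show "AE x in lebesgue. norm (f x \<bullet> g x) \<le> norm ((norm (f x))\<^sup>2 + (norm (g x))\<^sup>2)"
  proof (intro always_eventually allI)
    fix x
    have "norm (f x \<bullet> g x) \<le> norm (f x) * norm (g x)" by (simp add: Cauchy_Schwarz_ineq2)
    also have "\<dots> \<le> (norm (f x))\<^sup>2 + (norm (g x))\<^sup>2"
      using sum_squares_bound[of "norm (f x)" "norm (g x)"] mult_nonneg_nonneg[OF norm_ge_zero norm_ge_zero, of "f x" "g x"]
      by (simp only: mult.assoc)
    finally show "norm (f x \<bullet> g x) \<le> norm ((norm (f x))\<^sup>2 + (norm (g x))\<^sup>2)" by simp
  qed
qed

lemma sqint_AE_cong:
  assumes "sqint f" "g \<in> borel_measurable lebesgue" "AE x in lebesgue. f x = g x"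
  shows "sqint g"
  by (rule sqint_bound[OF assms(2) sqint_integrable[OF assms(1)]]) (use assms(3) in auto)

section \<open>The Hilbert space of classes of square-integrable fields\<close>

definition lsq_rel :: "(real^3 \<Rightarrow> 'b::euclidean_space) \<Rightarrow> (real^3 \<Rightarrow> 'b) \<Rightarrow> bool" where
  "lsq_rel f g \<longleftrightarrow> sqint f \<and> sqint g \<and> (AE x in lebesgue. f x = g x)"

\<comment> \<open>The partial quotient restricts to square-integrable functions and identifies them
  almost everywhere in one step; every representative returned by \<open>fn\<close> is then square
  integrable.\<close>
quotient_type (overloaded) 'b lsq = "real^3 \<Rightarrow> 'b::euclidean_space" / partial: lsq_rel
proof (rule part_equivpI)
  show "\<exists>f :: real^3 \<Rightarrow> 'b. lsq_rel f f" by (rule exI[of _ "\<lambda>_. 0"]) (simp add: lsq_rel_def)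
  show "symp (lsq_rel :: (real^3 \<Rightarrow> 'b) \<Rightarrow> _)"
    by (rule sympI) (auto simp: lsq_rel_def elim: eventually_mono)
  show "transp (lsq_rel :: (real^3 \<Rightarrow> 'b) \<Rightarrow> _)"
    by (rule transpI) (auto simp: lsq_rel_def elim: eventually_elim2)
qed

text \<open>\<open>toL2\<close> is total but meaningful only on square-integrable arguments, so
  computing with it requires \<open>sqint\<close> facts.\<close>

definition toL2 :: "(real^3 \<Rightarrow> 'b::euclidean_space) \<Rightarrow> 'b lsq" where "toL2 = abs_lsq"
definition fn :: "'b::euclidean_space lsq \<Rightarrow> real^3 \<Rightarrow> 'b" where "fn = rep_lsq"

lemma sqint_fn [simp]: "sqint (fn x)"
  unfolding fn_def using Quotient3_rep_reflp[OF Quotient3_lsq] by (auto simp: lsq_rel_def)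

lemma toL2_fn [simp]: "toL2 (fn x) = x"
  unfolding fn_def toL2_def by (rule Quotient3_abs_rep[OF Quotient3_lsq])

lemma toL2_eq_iff:
  "sqint f \<Longrightarrow> sqint g \<Longrightarrow> toL2 f = toL2 g \<longleftrightarrow> (AE x in lebesgue. f x = g x)"
  unfolding toL2_def using Quotient3_rel[OF Quotient3_lsq, of f g] by (auto simp: lsq_rel_def)

lemma fn_toL2: "sqint f \<Longrightarrow> AE x in lebesgue. fn (toL2 f) x = f x"
  using toL2_eq_iff[of "fn (toL2 f)" f] by simp

lemma lsq_cases: obtains f where "sqint f" "x = toL2 f"
  using that[of "fn x"] by simp

instantiation lsq :: (euclidean_space) real_vector
begin

definition zero_lsq :: "'a lsq" where "zero_lsq = toL2 (\<lambda>_. 0)"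
definition plus_lsq :: "'a lsq \<Rightarrow> 'a lsq \<Rightarrow> 'a lsq" where
  "plus_lsq x y = toL2 (\<lambda>t. fn x t + fn y t)"
definition minus_lsq :: "'a lsq \<Rightarrow> 'a lsq \<Rightarrow> 'a lsq" where
  "minus_lsq x y = toL2 (\<lambda>t. fn x t - fn y t)"
definition uminus_lsq :: "'a lsq \<Rightarrow> 'a lsq" where
  "uminus_lsq x = toL2 (\<lambda>t. - fn x t)"
definition scaleR_lsq :: "real \<Rightarrow> 'a lsq \<Rightarrow> 'a lsq" where
  "scaleR_lsq c x = toL2 (\<lambda>t. c *\<^sub>R fn x t)"

lemma toL2_add: "sqint f \<Longrightarrow> sqint g \<Longrightarrow> toL2 f + toL2 g = toL2 (\<lambda>t. f t + g t :: 'a)"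
  unfolding plus_lsq_def
  by (subst toL2_eq_iff, simp_all add: sqint_add) (use fn_toL2[of f] fn_toL2[of g] in auto)

lemma toL2_diff: "sqint f \<Longrightarrow> sqint g \<Longrightarrow> toL2 f - toL2 g = toL2 (\<lambda>t. f t - g t :: 'a)"
  unfolding minus_lsq_def
  by (subst toL2_eq_iff, simp_all add: sqint_diff) (use fn_toL2[of f] fn_toL2[of g] in auto)

lemma toL2_uminus: "sqint f \<Longrightarrow> - toL2 f = toL2 (\<lambda>t. - f t :: 'a)"
  unfolding uminus_lsq_def
  by (subst toL2_eq_iff, simp_all add: sqint_minus) (use fn_toL2[of f] in auto)

lemma toL2_scaleR: "sqint f \<Longrightarrow> c *\<^sub>R toL2 f = toL2 (\<lambda>t. c *\<^sub>R f t :: 'a)"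
  unfolding scaleR_lsq_def
  by (subst toL2_eq_iff, simp_all add: sqint_scaleR) (use fn_toL2[of f] in auto)

lemmas toL2_simps = toL2_add toL2_diff toL2_uminus toL2_scaleR
  sqint_add sqint_diff sqint_minus sqint_scaleR

instance
proof
  fix x y z :: "'a lsq" and c d :: real
  show "x + y + z = x + (y + z)" "x + y = y + x" "c *\<^sub>R (x + y) = c *\<^sub>R x + c *\<^sub>R y"
    "(c + d) *\<^sub>R x = c *\<^sub>R x + d *\<^sub>R x" "c *\<^sub>R d *\<^sub>R x = (c * d) *\<^sub>R x"
    "1 *\<^sub>R x = x" "- x + x = 0" "x - y = x + - y" "0 + x = x"
    by (cases x rule: lsq_cases, cases y rule: lsq_cases, cases z rule: lsq_cases;
        simp add: toL2_simps zero_lsq_def add_ac scaleR_add_right scaleR_add_left)+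
qed

end

instantiation lsq :: (euclidean_space) real_inner
begin

definition inner_lsq :: "'a lsq \<Rightarrow> 'a lsq \<Rightarrow> real" where
  "inner_lsq x y = (LINT t|lebesgue. fn x t \<bullet> fn y t)"
definition norm_lsq :: "'a lsq \<Rightarrow> real" where "norm_lsq x = sqrt (inner x x)"
definition dist_lsq :: "'a lsq \<Rightarrow> 'a lsq \<Rightarrow> real" where "dist_lsq x y = norm (x - y)"
definition sgn_lsq :: "'a lsq \<Rightarrow> 'a lsq" where "sgn_lsq x = x /\<^sub>R norm x"
definition uniformity_lsq :: "('a lsq \<times> 'a lsq) filter" where
  "uniformity_lsq = (INF e\<in>{0<..}. principal {(x, y). dist x y < e})"
definition open_lsq :: "'a lsq set \<Rightarrow> bool" where
  "open_lsq U \<longleftrightarrow> (\<forall>x\<in>U. eventually (\<lambda>(x', y). x' = x \<longrightarrow> y \<in> U) uniformity)"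

lemma toL2_inner:
  assumes "sqint f" "sqint g"
  shows "inner (toL2 f) (toL2 g) = (LINT t|lebesgue. f t \<bullet> (g t :: 'a))"
  unfolding inner_lsq_def
proof (rule integral_cong_AE)
  show "(\<lambda>t. fn (toL2 f) t \<bullet> fn (toL2 g) t) \<in> borel_measurable lebesgue"
    by (intro borel_measurable_inner sqint_measurable sqint_fn)
  show "(\<lambda>t. f t \<bullet> g t) \<in> borel_measurable lebesgue"
    using assms by (intro borel_measurable_inner sqint_measurable)
  show "AE t in lebesgue. fn (toL2 f) t \<bullet> fn (toL2 g) t = f t \<bullet> g t"
    using fn_toL2[OF assms(1)] fn_toL2[OF assms(2)] by eventually_elim simp
qed

instance
proof
  fix x y z :: "'a lsq" and c d :: real
  show "dist x y = norm (x - y)" by (simp add: dist_lsq_def)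
  show "norm x = sqrt (inner x x)" by (simp add: norm_lsq_def)
  show "sgn x = x /\<^sub>R norm x" by (simp add: sgn_lsq_def)
  show "uniformity = (INF e\<in>{0<..}. principal {(x, y). dist x (y::'a lsq) < e})"
    by (simp add: uniformity_lsq_def)
  show "open U \<longleftrightarrow> (\<forall>x\<in>U. eventually (\<lambda>(x', y). x' = x \<longrightarrow> y \<in> U) uniformity)" for U :: "'a lsq set"
    by (simp add: open_lsq_def)
  show "inner x y = inner y x"
    by (cases x rule: lsq_cases, cases y rule: lsq_cases) (simp add: toL2_inner inner_commute)
  show "inner (x + y) z = inner x z + inner y z" "inner (c *\<^sub>R x) y = c * inner x y"
    by (cases x rule: lsq_cases, cases y rule: lsq_cases, cases z rule: lsq_cases;
        simp add: toL2_simps toL2_inner inner_add_left sqint_inner_integrable)+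
  show "0 \<le> inner x x"
    by (cases x rule: lsq_cases) (simp add: toL2_inner)
  show "inner x x = 0 \<longleftrightarrow> x = 0"
  proof (cases x rule: lsq_cases)
    case (1 f)
    have "inner x x = 0 \<longleftrightarrow> (AE t in lebesgue. f t \<bullet> f t = 0)"
      unfolding 1(2) toL2_inner[OF 1(1) 1(1)]
      by (rule integral_nonneg_eq_0_iff_AE) (auto simp: sqint_inner_integrable 1)
    also have "\<dots> \<longleftrightarrow> x = 0"
      unfolding 1(2) zero_lsq_def by (subst toL2_eq_iff) (auto simp: 1)
    finally show ?thesis .
  qed
qed

end

section \<open>Limits in L^2 and completeness\<close>

lemma norm_toL2_sq: "sqint f \<Longrightarrow> (norm (toL2 f))\<^sup>2 = (LINT t|lebesgue. (norm (f t))\<^sup>2)"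
  by (simp add: power2_norm_eq_inner toL2_inner)

lemma nn_integral_toL2: "sqint f \<Longrightarrow> (\<integral>\<^sup>+t. ennreal ((norm (f t))\<^sup>2) \<partial>lebesgue) = ennreal ((norm (toL2 f))\<^sup>2)"
  by (simp add: norm_toL2_sq sqint_integrable nn_integral_eq_integral)

lemma sqint_nn:
  assumes "f \<in> borel_measurable lebesgue" "(\<integral>\<^sup>+t. ennreal ((norm (f t))\<^sup>2) \<partial>lebesgue) \<le> ennreal (c\<^sup>2)" "c \<ge> 0"
  shows "sqint f" "norm (toL2 f) \<le> c"
proof -
  have [measurable]: "f \<in> borel_measurable lebesgue" by fact
  show s: "sqint f"
    unfolding sqint_def
  proof
    show "integrable lebesgue (\<lambda>x. (norm (f x))\<^sup>2)"
      by (rule integrableI_bounded) (use assms(2) in \<open>auto simp: less_top[symmetric] top_unique\<close>)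
  qed fact
  have "ennreal ((norm (toL2 f))\<^sup>2) \<le> ennreal (c\<^sup>2)"
    using assms(2) nn_integral_toL2[OF s] by simp
  then have "(norm (toL2 f))\<^sup>2 \<le> c\<^sup>2" by (simp add: ennreal_le_iff)
  then show "norm (toL2 f) \<le> c" using assms(3) by (rule power2_le_imp_le)
qed

text \<open>Passes norm bounds to almost-everywhere limits. The bounds \<open>C n\<close> may vary
  and only their limit survives, so estimates by the gradient norms of approximants become estimates
  by the norm of the limit gradient.\<close>

lemma sqint_Fatou:
  assumes f: "\<And>n. sqint (F n)" and m: "f \<in> borel_measurable lebesgue"
    and lim: "AE x in lebesgue. (\<lambda>n. F n x) \<longlonglongrightarrow> f x"
    and c: "\<And>n. norm (toL2 (F n)) \<le> C n" "C \<longlonglongrightarrow> c"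
  shows "sqint f" "norm (toL2 f) \<le> c"
proof -
  have [measurable]: "\<And>n. F n \<in> borel_measurable lebesgue" "f \<in> borel_measurable lebesgue"
    by (rule sqint_measurable[OF f], rule m)
  have "0 \<le> C n" for n using c(1)[of n] norm_ge_zero[of "toL2 (F n)"] by linarith
  then have "c \<ge> 0" using c(2) by (intro LIMSEQ_le_const[OF c(2)]) auto
  have "(\<integral>\<^sup>+t. ennreal ((norm (f t))\<^sup>2) \<partial>lebesgue) = (\<integral>\<^sup>+t. liminf (\<lambda>n. ennreal ((norm (F n t))\<^sup>2)) \<partial>lebesgue)"
  proof (rule nn_integral_cong_AE, use lim in eventually_elim)
    case (elim x)
    have "(\<lambda>n. ennreal ((norm (F n x))\<^sup>2)) \<longlonglongrightarrow> ennreal ((norm (f x))\<^sup>2)"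
      by (intro tendsto_ennrealI tendsto_intros elim)
    then show ?case using lim_imp_Liminf trivial_limit_sequentially by metis
  qed
  also have "\<dots> \<le> liminf (\<lambda>n. \<integral>\<^sup>+t. ennreal ((norm (F n t))\<^sup>2) \<partial>lebesgue)"
    by (rule nn_integral_liminf) measurable
  also have "\<dots> \<le> liminf (\<lambda>n. ennreal ((C n)\<^sup>2))"
    by (intro Liminf_mono always_eventually allI)
       (auto simp: nn_integral_toL2 f c(1) intro!: ennreal_leI power_mono)
  also have "\<dots> = ennreal (c\<^sup>2)"
    by (intro lim_imp_Liminf tendsto_ennrealI tendsto_intros c) auto
  finally have *: "(\<integral>\<^sup>+t. ennreal ((norm (f t))\<^sup>2) \<partial>lebesgue) \<le> ennreal (c\<^sup>2)" .
  show "sqint f" "norm (toL2 f) \<le> c"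
    using sqint_nn[OF m * \<open>c \<ge> 0\<close>] by auto
qed

lemma lsq_AE_subseq:
  assumes f: "\<And>n. sqint (F n)" "sqint f" and lim: "(\<lambda>n. toL2 (F n)) \<longlonglongrightarrow> toL2 f"
  obtains r :: "nat \<Rightarrow> nat" where "strict_mono r" "AE x in lebesgue. (\<lambda>n. F (r n) x) \<longlonglongrightarrow> f x"
proof -
  have "(\<lambda>n. (norm (toL2 (F n) - toL2 f))\<^sup>2) \<longlonglongrightarrow> 0\<^sup>2"
    by (rule tendsto_power[OF tendsto_norm_zero[OF LIM_zero[OF lim]]])
  then have *: "(\<lambda>n. LINT x|lebesgue. norm ((norm (F n x - f x))\<^sup>2)) \<longlonglongrightarrow> 0"
    by (simp add: toL2_diff f norm_toL2_sq sqint_diff)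
  have "integrable lebesgue (\<lambda>x. (norm (F n x - f x))\<^sup>2)" for n
    by (rule sqint_integrable[OF sqint_diff[OF f]])
  from tendsto_L1_AE_subseq[OF this *] obtain r :: "nat \<Rightarrow> nat" where
    r: "strict_mono r" "AE x in lebesgue. (\<lambda>n. (norm (F (r n) x - f x))\<^sup>2) \<longlonglongrightarrow> 0" by auto
  have "AE x in lebesgue. (\<lambda>n. F (r n) x) \<longlonglongrightarrow> f x"
    using r(2)
  proof eventually_elim
    case (elim x)
    then have "(\<lambda>n. sqrt ((norm (F (r n) x - f x))\<^sup>2)) \<longlonglongrightarrow> sqrt 0" by (rule tendsto_real_sqrt)
    then have "(\<lambda>n. norm (F (r n) x - f x)) \<longlonglongrightarrow> 0" by simp
    then show ?case by (rule LIM_zero_cancel[OF tendsto_norm_zero_cancel])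
  qed
  with r(1) show thesis by (rule that)
qed

lemma lsq_dominated:
  assumes f: "\<And>n. F n \<in> borel_measurable lebesgue" "f \<in> borel_measurable lebesgue"
    and g: "sqint g"
    and lim: "AE x in lebesgue. (\<lambda>n. F n x) \<longlonglongrightarrow> f x"
    and b: "\<And>n. AE x in lebesgue. norm (F n x) \<le> norm (g x)"
  shows "\<And>n. sqint (F n)" "sqint f" "(\<lambda>n. toL2 (F n)) \<longlonglongrightarrow> toL2 f"
proof -
  have [measurable]: "\<And>n. F n \<in> borel_measurable lebesgue" "f \<in> borel_measurable lebesgue" "g \<in> borel_measurable lebesgue"
    using f g sqint_measurable by auto
  have bf: "AE x in lebesgue. norm (f x) \<le> norm (g x)"
  proof -
    have "AE x in lebesgue. \<forall>n. norm (F n x) \<le> norm (g x)" using b by (simp add: AE_all_countable)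
    with lim show ?thesis
      by eventually_elim (rule LIMSEQ_le_const2[OF tendsto_norm], auto)
  qed
  show s: "\<And>n. sqint (F n)" "sqint f"
    by (rule sqint_bound[OF _ sqint_integrable[OF g]];
        (fact f | (use b bf in \<open>auto elim!: eventually_mono intro!: power_mono\<close>)))+
  have "(\<lambda>n. LINT x|lebesgue. (norm (F n x - f x))\<^sup>2) \<longlonglongrightarrow> (LINT x|(lebesgue :: (real^3) measure). (0::real))"
  proof (rule integral_dominated_convergence)
    show "integrable lebesgue (\<lambda>x. 4 * (norm (g x))\<^sup>2)" using sqint_integrable[OF g] by simp
    show "AE x in lebesgue. (\<lambda>n. (norm (F n x - f x))\<^sup>2) \<longlonglongrightarrow> 0"
      using lim
    proof eventually_elim
      case (elim x)
      have "(\<lambda>n. (norm (F n x - f x))\<^sup>2) \<longlonglongrightarrow> 0\<^sup>2"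
        by (rule tendsto_power[OF tendsto_norm_zero[OF LIM_zero[OF elim]]])
      then show ?case by simp
    qed
    show "AE x in lebesgue. norm ((norm (F n x - f x))\<^sup>2) \<le> 4 * (norm (g x))\<^sup>2" for n
      using b[of n] bf
    proof eventually_elim
      case (elim x)
      have "norm (F n x - f x) \<le> 2 * norm (g x)" using elim norm_triangle_ineq4[of "F n x" "f x"] by simp
      then have "(norm (F n x - f x))\<^sup>2 \<le> (2 * norm (g x))\<^sup>2" by (intro power_mono) auto
      then show ?case by (simp add: power_mult_distrib)
    qed
  qed measurable
  then have "(\<lambda>n. (norm (toL2 (F n) - toL2 f))\<^sup>2) \<longlonglongrightarrow> 0"
    by (simp add: toL2_diff s norm_toL2_sq sqint_diff)
  then have "(\<lambda>n. sqrt ((norm (toL2 (F n) - toL2 f))\<^sup>2)) \<longlonglongrightarrow> sqrt 0" by (rule tendsto_real_sqrt)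
  then have "(\<lambda>n. norm (toL2 (F n) - toL2 f)) \<longlonglongrightarrow> 0" by simp
  then show "(\<lambda>n. toL2 (F n)) \<longlonglongrightarrow> toL2 f"
    by (rule LIM_zero_cancel[OF tendsto_norm_zero_cancel])
qed

text \<open>Riesz-Fischer: along a subsequence with steps below \<open>(1/2)^n\<close> the fields
  converge almost everywhere, Fatou's lemma turns this into convergence in norm, and a Cauchy
  sequence follows its convergent subsequence.\<close>

instance lsq :: (euclidean_space) complete_space
proof
  fix X :: "nat \<Rightarrow> 'a lsq" assume C: "Cauchy X"
  have "\<exists>r. \<forall>n. True \<and> (r (Suc n) > r n \<and> (\<forall>i\<ge>r (Suc n). \<forall>j\<ge>r (Suc n). dist (X i) (X j) < (1/2)^n))"
  proof (intro dependent_nat_choice)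
    fix x n :: nat
    obtain N where N: "\<forall>i\<ge>N. \<forall>j\<ge>N. dist (X i) (X j) < (1/2)^n"
      using metric_CauchyD[OF C, of "(1/2)^n"] by auto
    show "\<exists>y. True \<and> y > x \<and> (\<forall>i\<ge>y. \<forall>j\<ge>y. dist (X i) (X j) < (1/2)^n)"
      by (rule exI[of _ "max N (Suc x)"]) (use N in auto)
  qed auto
  then obtain r where r0: "\<forall>n. True \<and> (r (Suc n) > r n \<and> (\<forall>i\<ge>r (Suc n). \<forall>j\<ge>r (Suc n). dist (X i) (X j) < (1/2)^n))" ..
  have r: "r (Suc n) > r n" "i \<ge> r (Suc n) \<Longrightarrow> j \<ge> r (Suc n) \<Longrightarrow> dist (X i) (X j) < (1/2)^n" for n i j
    using r0 by auto
  define F where "F n = fn (X (r (Suc n)))" for n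
  have sF: "sqint (F n)" for n by (simp add: F_def)
  have tF: "toL2 (F n) = X (r (Suc n))" for n by (simp add: F_def)
  have [measurable]: "F n \<in> borel_measurable lebesgue" for n using sF sqint_measurable by auto
  \<comment> \<open>The squared step has integral at most \<open>(1/4)^n\<close>, so it remains
    summable after weighting by \<open>2^n\<close>. Finiteness of the weighted sum makes the step
    itself decay like \<open>(sqrt (1/2))^n\<close> almost everywhere, which is summable.\<close>
  define d where "d n x = (norm (F (Suc n) x - F n x))\<^sup>2" for n x
  have d: "(\<integral>\<^sup>+x. ennreal (2^n * d n x) \<partial>lebesgue) \<le> ennreal ((1/2)^n)" for n
  proof -
    have "norm (toL2 (\<lambda>x. F (Suc n) x - F n x)) \<le> (1/2)^n"
      using r(2)[of n "r (Suc (Suc n))" "r (Suc n)"] r(1)[of "Suc n"]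
      by (simp add: toL2_diff[symmetric] sF tF dist_norm)
    then have *: "(norm (toL2 (\<lambda>x. F (Suc n) x - F n x)))\<^sup>2 \<le> ((1/2)^n)\<^sup>2" by (intro power_mono) auto
    have "(\<integral>\<^sup>+x. ennreal (2^n * d n x) \<partial>lebesgue) = ennreal (2^n) * (\<integral>\<^sup>+x. ennreal (d n x) \<partial>lebesgue)"
      by (simp add: ennreal_mult' d_def nn_integral_cmult)
    also have "\<dots> = ennreal (2^n) * ennreal ((norm (toL2 (\<lambda>x. F (Suc n) x - F n x)))\<^sup>2)"
      by (simp add: d_def nn_integral_toL2 sF sqint_diff)
    also have "\<dots> = ennreal (2^n * (norm (toL2 (\<lambda>x. F (Suc n) x - F n x)))\<^sup>2)"
      by (simp add: ennreal_mult')
    also have "\<dots> \<le> ennreal (2^n * ((1/2)^n)\<^sup>2)" by (intro ennreal_leI mult_left_mono *) auto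
    also have "2^n * ((1/2::real)^n)\<^sup>2 = (1/2)^n"
      by (simp add: power2_eq_square field_simps)
    finally show ?thesis .
  qed
  have "(\<integral>\<^sup>+x. (\<Sum>n. ennreal (2^n * d n x)) \<partial>lebesgue) = (\<Sum>n. \<integral>\<^sup>+x. ennreal (2^n * d n x) \<partial>lebesgue)"
    by (rule nn_integral_suminf) (simp add: d_def)
  also have "\<dots> \<le> (\<Sum>n. ennreal ((1/2)^n))" by (intro suminf_le d) auto
  also have "\<dots> = ennreal (\<Sum>n. (1/2)^n)" by (rule suminf_ennreal2) (auto simp: summable_geometric)
  also have "\<dots> < \<infinity>" by simp
  finally have fin: "(\<integral>\<^sup>+x. (\<Sum>n. ennreal (2^n * d n x)) \<partial>lebesgue) \<noteq> \<infinity>" by simp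
  have "AE x in lebesgue. (\<Sum>n. ennreal (2^n * d n x)) \<noteq> \<infinity>"
    by (rule nn_integral_PInf_AE[OF _ fin]) (simp add: d_def)
  then have conv: "AE x in lebesgue. convergent (\<lambda>n. F n x)"
  proof eventually_elim
    case (elim x)
    have "summable (\<lambda>n. 2^n * d n x)"
      by (rule summable_suminf_not_top) (use elim in \<open>auto simp: d_def\<close>)
    then have "(\<lambda>n. 2^n * d n x) \<longlonglongrightarrow> 0" by (rule summable_LIMSEQ_zero)
    then have "Bseq (\<lambda>n. 2^n * d n x)" using convergent_imp_Bseq convergentI by blast
    then obtain K where K: "K > 0" "\<And>n. norm (2^n * d n x) \<le> K" by (auto elim: BseqE)
    have le: "norm (F (Suc n) x - F n x) \<le> sqrt K * (sqrt (1/2))^n" for n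
    proof -
      have "d n x \<le> K * (1/2)^n" using K(2)[of n] by (simp add: d_def field_simps)
      then have "sqrt (d n x) \<le> sqrt (K * (1/2)^n)" by simp
      then show ?thesis by (simp add: d_def real_sqrt_mult real_sqrt_power)
    qed
    have "summable (\<lambda>n. sqrt K * (sqrt (1/2))^n)"
      by (rule summable_mult[OF summable_geometric]) auto
    then have "summable (\<lambda>n. F (Suc n) x - F n x)" by (rule summable_comparison_test') (use le in auto)
    then obtain l where "(\<lambda>n. \<Sum>k<n. F (Suc k) x - F k x) \<longlonglongrightarrow> l"
      by (auto simp: summable_def sums_def)
    then have "(\<lambda>n. F n x - F 0 x) \<longlonglongrightarrow> l"
      unfolding sum_lessThan_telescope[of "\<lambda>k. F k x"] .
    from tendsto_add[OF this tendsto_const[of "F 0 x"]] have "(\<lambda>n. F n x) \<longlonglongrightarrow> l + F 0 x"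
      unfolding diff_add_cancel .
    then show ?case by (rule convergentI)
  qed
  define f where "f x = lim (\<lambda>n. F n x)" for x
  have m[measurable]: "f \<in> borel_measurable lebesgue" unfolding f_def by measurable
  have lim: "AE x in lebesgue. (\<lambda>n. F n x) \<longlonglongrightarrow> f x"
    using conv by eventually_elim (simp add: f_def convergent_LIMSEQ_iff)
  have est: "sqint (\<lambda>x. F n x - f x) \<and> norm (toL2 (\<lambda>x. F n x - f x)) \<le> (1/2)^n" for n
  proof -
    have "norm (toL2 (\<lambda>x. F n x - F (m + n) x)) \<le> (1/2)^n" for m
    proof -
      have "r (Suc (m + n)) \<ge> r (Suc n)" by (rule lift_Suc_mono_le[of r]) (auto intro: less_imp_le r(1))
      then show ?thesis using r(2)[of n "r (Suc n)" "r (Suc (m + n))"]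
        by (simp add: toL2_diff[symmetric] sF tF dist_norm)
    qed
    note b = this
    have l: "AE x in lebesgue. (\<lambda>m. F n x - F (m + n) x) \<longlonglongrightarrow> F n x - f x"
      using lim by eventually_elim (intro tendsto_intros LIMSEQ_ignore_initial_segment)
    show ?thesis
      using sqint_Fatou[of "\<lambda>m x. F n x - F (m + n) x" "\<lambda>x. F n x - f x" "\<lambda>_. (1/2)^n", OF _ _ l b tendsto_const]
      by (simp add: sqint_diff sF)
  qed
  have sf: "sqint f" using sqint_diff[OF sF[of 0] conjunct1[OF est[of 0]]] by simp
  have "(\<lambda>n. X (r (Suc n))) \<longlonglongrightarrow> toL2 f"
  proof (rule metric_LIMSEQ_I)
    fix e :: real assume "e > 0"
    then obtain N where N: "(1/2::real)^N < e" using real_arch_pow_inv[of e "1/2"] by auto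
    have "dist (X (r (Suc n))) (toL2 f) < e" if "n \<ge> N" for n
    proof -
      have "dist (X (r (Suc n))) (toL2 f) \<le> (1/2)^n"
        using est[of n] by (simp add: dist_norm tF[symmetric] toL2_diff sF sf)
      also have "\<dots> \<le> (1/2)^N" using that by (intro power_decreasing) auto
      finally show ?thesis using N by simp
    qed
    then show "\<exists>N. \<forall>n\<ge>N. dist (X (r (Suc n))) (toL2 f) < e" by blast
  qed
  moreover have "strict_mono (\<lambda>n. r (Suc n))" using r(1) by (simp add: strict_mono_Suc_iff)
  ultimately have "X \<longlonglongrightarrow> toL2 f"
    using C Cauchy_converges_subseq[of X "\<lambda>n. r (Suc n)"] by (simp add: o_def)
  then show "convergent X" by (rule convergentI)
qed

text \<open>The functional is given by its graph: it is minimised together with the energy.\<close>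
lemma riesz_graph:
  fixes S :: "('a::{real_inner,complete_space} \<times> real) set"
  assumes S: "subspace S" and "C \<ge> 0" and b: "\<And>s r. (s, r) \<in> S \<Longrightarrow> \<bar>r\<bar> \<le> C * norm s"
  shows "\<exists>g \<in> closure (fst ` S). norm g \<le> C \<and> (\<forall>(s, r)\<in>S. g \<bullet> s = r)"
proof -
  \<comment> \<open>Minimising \<open>J\<close> is the variational form of the problem: its Euler
    equation on the subspace \<open>S\<close> is \<open>g \<bullet> s = r\<close>.\<close>
  define J where "J p = (norm (fst p))\<^sup>2 / 2 - snd p" for p :: "'a \<times> real"
  have zero: "(0,0) \<in> S" using subspace_0[OF S] by (simp add: zero_prod_def)
  have bdd: "- C\<^sup>2 / 2 \<le> J p" if "p \<in> S" for p
  proof -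
    have "J p \<ge> (norm (fst p))\<^sup>2 / 2 - C * norm (fst p)"
      using b[of "fst p" "snd p"] that by (simp add: J_def)
    moreover have "(norm (fst p))\<^sup>2 / 2 - C * norm (fst p) + C\<^sup>2 / 2 = (norm (fst p) - C)\<^sup>2 / 2"
      by (simp add: power2_diff algebra_simps diff_divide_distrib add_divide_distrib)
    moreover have "(norm (fst p) - C)\<^sup>2 / 2 \<ge> 0" by simp
    ultimately show ?thesis by linarith
  qed
  define I where "I = (INF p\<in>S. J p)"
  have bb: "bdd_below (J ` S)" using bdd by (intro bdd_belowI2)
  have Ile: "I \<le> J p" if "p \<in> S" for p unfolding I_def by (rule cINF_lower[OF bb that])
  have "\<exists>p\<in>S. J p < I + e" if "e > 0" for e
    using cINF_less_iff[of S J "I + e"] bb zero that unfolding I_def by auto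
  then have "\<forall>n. \<exists>p\<in>S. J p < I + 1 / real (Suc n)" by simp
  then obtain P where P: "\<And>n. P n \<in> S" "\<And>n. J (P n) < I + 1 / real (Suc n)" by metis
  \<comment> \<open>Parallelogram identity: the midpoint of two pairs lies in \<open>S\<close> and
    has energy at least \<open>I\<close>, so near-minimisers are close to each other.\<close>
  have par: "(norm (fst (P m) - fst (P n)))\<^sup>2 \<le> 4 * (1 / real (Suc m) + 1 / real (Suc n))" for m n
  proof -
    have "(1/2) *\<^sub>R (P m + P n) \<in> S" using S P(1) by (intro subspace_scale subspace_add)
    then have "I \<le> J ((1/2) *\<^sub>R (P m + P n))" by (rule Ile)
    moreover have "(norm (fst (P m) - fst (P n)))\<^sup>2 =
        4 * (J (P m) + J (P n) - 2 * J ((1/2) *\<^sub>R (P m + P n)))"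
      unfolding J_def power2_norm_eq_inner
      by (simp add: inner_simps inner_commute algebra_simps)
    ultimately show ?thesis using P(2)[of m] P(2)[of n] by argo
  qed
  have "Cauchy (\<lambda>n. fst (P n))"
  proof (rule metric_CauchyI)
    fix e :: real assume e: "e > 0"
    obtain N where N: "1 / real (Suc N) < e\<^sup>2 / 8"
      using reals_Archimedean[of "e\<^sup>2 / 8"] e by (auto simp: inverse_eq_divide)
    have "dist (fst (P m)) (fst (P n)) < e" if "m \<ge> N" "n \<ge> N" for m n
    proof -
      have "1 / real (Suc m) \<le> 1 / real (Suc N)" "1 / real (Suc n) \<le> 1 / real (Suc N)"
        using that by (auto intro!: divide_left_mono)
      then have "(norm (fst (P m) - fst (P n)))\<^sup>2 < e\<^sup>2" using par[of m n] N by argo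
      then show ?thesis using e by (simp add: dist_norm power2_less_imp_less)
    qed
    then show "\<exists>M. \<forall>m\<ge>M. \<forall>n\<ge>M. dist (fst (P m)) (fst (P n)) < e" by blast
  qed
  then obtain g where g: "(\<lambda>n. fst (P n)) \<longlonglongrightarrow> g" using Cauchy_convergent convergent_def by blast
  have gcl: "g \<in> closure (fst ` S)" unfolding closure_sequential
    by (intro exI[of _ "\<lambda>n. fst (P n)"] conjI allI imageI P(1) g)
  have eq: "g \<bullet> s = r" if sr: "(s, r) \<in> S" for s r
  proof (rule ccontr)
    assume ne: "g \<bullet> s \<noteq> r"
    define a where "a = g \<bullet> s - r"
    define q where "q = (norm s)\<^sup>2"
    \<comment> \<open>The quadratic in \<open>t\<close> would be minimal at \<open>- a / q\<close>;
      the added 1 keeps the choice meaningful for \<open>s = 0\<close> and still produces a negative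
      value.\<close>
    define t where "t = - a / (q + 1)"
    have q: "q \<ge> 0" by (simp add: q_def)
    have "- (1 / real (Suc n)) \<le> t * (fst (P n) \<bullet> s - r) + t\<^sup>2 * q / 2" for n
    proof -
      have "P n + t *\<^sub>R (s, r) \<in> S" using S P(1) sr by (intro subspace_scale subspace_add)
      then have "I \<le> J (P n + t *\<^sub>R (s, r))" by (rule Ile)
      also have "\<dots> = J (P n) + t * (fst (P n) \<bullet> s - r) + t\<^sup>2 * q / 2"
        unfolding J_def q_def power2_norm_eq_inner
        by (simp add: inner_simps inner_commute algebra_simps power2_eq_square)
      finally show ?thesis using P(2)[of n] by argo
    qed
    moreover have "(\<lambda>n. - (1 / real (Suc n))) \<longlonglongrightarrow> - 0"
      by (intro tendsto_minus LIMSEQ_Suc[OF lim_1_over_n])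
    moreover have "(\<lambda>n. t * (fst (P n) \<bullet> s - r) + t\<^sup>2 * q / 2) \<longlonglongrightarrow> t * a + t\<^sup>2 * q / 2"
      unfolding a_def by (intro tendsto_intros g)
    ultimately have "- 0 \<le> t * a + t\<^sup>2 * q / 2" by (intro LIMSEQ_le) auto
    moreover have "t * a + t\<^sup>2 * q / 2 = - (a\<^sup>2 / (q + 1)) * (1 - q / (2 * (q + 1)))"
    proof -
      define u where "u = 1 / (q + 1)"
      have "t = - (a * u)" "a\<^sup>2 / (q + 1) = a\<^sup>2 * u" "q / (2 * (q + 1)) = q * u / 2"
        by (simp_all add: t_def u_def)
      then show ?thesis by (simp only:) (simp add: power2_eq_square algebra_simps)
    qed
    moreover have "a\<^sup>2 / (q + 1) > 0" using ne q by (simp add: a_def)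
    moreover have "1 - q / (2 * (q + 1)) > 0" using q by (simp add: field_simps)
    ultimately show False
      using mult_pos_pos[of "a\<^sup>2 / (q + 1)" "1 - q / (2 * (q + 1))"] by linarith
  qed
  have "norm g \<le> C"
  proof -
    have "g \<bullet> g \<le> C * norm g"
    proof (rule LIMSEQ_le)
      show "(\<lambda>n. g \<bullet> fst (P n)) \<longlonglongrightarrow> g \<bullet> g" by (intro tendsto_intros g)
      show "(\<lambda>n. C * norm (fst (P n))) \<longlonglongrightarrow> C * norm g" by (intro tendsto_intros g)
      have "g \<bullet> fst (P n) \<le> C * norm (fst (P n))" for n
        using eq[of "fst (P n)" "snd (P n)"] b[of "fst (P n)" "snd (P n)"] P(1)[of n] by simp
      then show "\<exists>N. \<forall>n\<ge>N. g \<bullet> fst (P n) \<le> C * norm (fst (P n))" by blast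
    qed
    then have "norm g * norm g \<le> C * norm g" by (simp add: power2_norm_eq_inner[symmetric] power2_eq_square)
    then show ?thesis using \<open>C \<ge> 0\<close>
      by (cases "norm g = 0") (auto simp: mult_le_cancel_right)
  qed
  then show ?thesis using gcl eq by blast
qed

text \<open>The orthogonal projection is the Riesz representative of the functional sending v to h
  \<bullet> v on \<open>V\<close>. The representative lies in the closure of \<open>V\<close>, hence
  in \<open>V\<close>.\<close>

lemma closed_projection:
  fixes V :: "'a::{real_inner,complete_space} set"
  assumes "subspace V" "closed V"
  obtains g where "g \<in> V" "\<And>v. v \<in> V \<Longrightarrow> (h - g) \<bullet> v = 0"
proof -
  have "subspace ((\<lambda>v. (v, h \<bullet> v)) ` V)"
    using assms(1) by (intro linear_subspace_image) (auto intro!: linearI simp: inner_simps)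
  moreover have "\<bar>r\<bar> \<le> norm h * norm s" if "(s, r) \<in> (\<lambda>v. (v, h \<bullet> v)) ` V" for s r
    using that by (auto simp: Cauchy_Schwarz_ineq2)
  ultimately have "\<exists>g\<in>closure (fst ` (\<lambda>v. (v, h \<bullet> v)) ` V). norm g \<le> norm h \<and>
      (\<forall>(s,r)\<in>(\<lambda>v. (v, h \<bullet> v)) ` V. g \<bullet> s = r)" by (intro riesz_graph norm_ge_zero)
  then obtain g where "g \<in> closure (fst ` (\<lambda>v. (v, h \<bullet> v)) ` V)" "\<forall>(s,r)\<in>(\<lambda>v. (v, h \<bullet> v)) ` V. g \<bullet> s = r"
    by meson
  then show ?thesis using that[of g] assms(2) by (auto simp: image_image inner_diff_left)
qed

lemma orthogonal_closure:
  fixes y :: "'a::real_inner"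
  assumes "\<And>s. s \<in> S \<Longrightarrow> y \<bullet> s = 0" "x \<in> closure S"
  shows "y \<bullet> x = 0"
proof -
  have "closure S \<subseteq> {x. y \<bullet> x = 0}"
    using assms(1) by (intro closure_minimal closed_hyperplane) auto
  then show ?thesis using assms(2) by auto
qed

lemma double_orthogonal:
  fixes V :: "'a::{real_inner,complete_space} set"
  assumes "subspace V" "closed V" "\<And>z. (\<And>v. v \<in> V \<Longrightarrow> z \<bullet> v = 0) \<Longrightarrow> z \<bullet> x = 0"
  shows "x \<in> V"
proof -
  obtain g where g: "g \<in> V" "\<And>v. v \<in> V \<Longrightarrow> (x - g) \<bullet> v = 0"
    using closed_projection[OF assms(1,2)] by metis
  have "(x - g) \<bullet> x = 0" using assms(3) g(2) by blast
  then have "(x - g) \<bullet> (x - g) = 0" using g by (simp add: inner_diff_right)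
  then show ?thesis using g(1) by simp
qed

section \<open>Smooth functions and integration by parts\<close>

abbreviation smooth :: "(real^'n::finite \<Rightarrow> real) \<Rightarrow> bool" where
  "smooth f \<equiv> smooth_on UNIV f"

lemma partial_eq: "(f has_derivative f') (at x) \<Longrightarrow> partial i f x = f' (axis i 1)"
  unfolding partial_def using frechet_derivative_at by metis

lemma grad_nth [simp]: "grad f x $ i = partial i f x"
  by (simp add: grad_def)

lemma axis_inner [simp]: "axis i 1 \<bullet> (v :: real^'n) = v $ i"
  by (simp add: inner_axis')

lemma has_derivative_grad:
  fixes f :: "real^'n::finite \<Rightarrow> real"
  assumes "f differentiable (at x)"
  shows "(f has_derivative (\<lambda>v. v \<bullet> grad f x)) (at x)"
proof -
  obtain f' where f': "(f has_derivative f') (at x)" using assms by (auto simp: differentiable_def)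
  have lin: "linear f'" using f' has_derivative_bounded_linear bounded_linear.linear by blast
  have "f' v = v \<bullet> grad f x" for v
  proof -
    have "f' v = f' (\<Sum>i\<in>UNIV. (v $ i) *\<^sub>R axis i 1)"
      using basis_expansion[of v] by (simp add: scalar_mult_eq_scaleR)
    also have "\<dots> = (\<Sum>i\<in>UNIV. v $ i * f' (axis i 1))"
      by (simp add: linear_sum[OF lin] linear_scale[OF lin])
    also have "\<dots> = v \<bullet> grad f x"
      by (simp add: inner_vec_def partial_eq[OF f'])
    finally show ?thesis .
  qed
  then have "f' = (\<lambda>v. v \<bullet> grad f x)" by auto
  with f' show ?thesis by simp
qed

lemma has_grad_differentiable:
  "(f has_derivative f') (at x) \<Longrightarrow> f differentiable (at x)"
  by (auto simp: differentiable_def)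

lemma Ck_SucD: "Ck_on (Suc k) UNIV f \<Longrightarrow> Ck_on k UNIV f"
proof (induction k arbitrary: f)
  case 0
  then show ?case
    by (auto intro!: continuous_at_imp_continuous_on differentiable_imp_continuous_within)
next
  case (Suc k)
  then show ?case by simp
qed

lemma smooth_iff:
  "smooth f \<longleftrightarrow> (\<forall>x. f differentiable (at x)) \<and> (\<forall>i. smooth (partial i f))"
proof
  assume *: "smooth f"
  then have "Ck_on (Suc k) UNIV f" for k by (simp only: smooth_on_def)
  then show "(\<forall>x. f differentiable (at x)) \<and> (\<forall>i. smooth (partial i f))"
    by (auto simp: smooth_on_def)
next
  assume *: "(\<forall>x. f differentiable (at x)) \<and> (\<forall>i. smooth (partial i f))"
  then have "Ck_on (Suc k) UNIV f" for k by (auto simp: smooth_on_def)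
  then show "smooth f" unfolding smooth_on_def using Ck_SucD by blast
qed

lemma smooth_differentiable: "smooth f \<Longrightarrow> f differentiable (at x)"
  by (subst (asm) smooth_iff) auto

lemma smooth_partial: "smooth f \<Longrightarrow> smooth (partial i f)"
  by (subst (asm) smooth_iff) auto

lemma smooth_continuous: "smooth f \<Longrightarrow> continuous_on S f"
  by (auto intro!: continuous_at_imp_continuous_on differentiable_imp_continuous_within smooth_differentiable)

lemma smooth_deriv: "smooth f \<Longrightarrow> (f has_derivative (\<lambda>v. v \<bullet> grad f x)) (at x)"
  by (intro has_derivative_grad smooth_differentiable)

lemma smooth_grad_continuous: "smooth f \<Longrightarrow> continuous_on S (grad f)"
  unfolding grad_def by (intro continuous_on_vec_lambda smooth_continuous smooth_partial)

lemma partial_const [simp]: "partial i (\<lambda>x. c) = (\<lambda>x. 0)"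
  by (rule ext, subst partial_eq[OF has_derivative_const]) simp

lemma partial_add:
  assumes "f differentiable (at x)" "g differentiable (at x)"
  shows "partial i (\<lambda>x. f x + g x) x = partial i f x + partial i g x"
  by (subst partial_eq[OF has_derivative_add[OF has_derivative_grad[OF assms(1)] has_derivative_grad[OF assms(2)]]]) simp

lemma partial_mult:
  assumes "f differentiable (at x)" "g differentiable (at x)"
  shows "partial i (\<lambda>x. f x * g x) x = partial i f x * g x + f x * partial i g x"
  by (subst partial_eq[OF has_derivative_mult[OF has_derivative_grad[OF assms(1)] has_derivative_grad[OF assms(2)]]]) simp

lemma Ck_const: "Ck_on k UNIV (\<lambda>x. c)"
  by (induction k arbitrary: c) auto

lemma Ck_add: "Ck_on k UNIV f \<Longrightarrow> Ck_on k UNIV g \<Longrightarrow> Ck_on k UNIV (\<lambda>x. f x + g x)"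
proof (induction k arbitrary: f g)
  case 0 then show ?case by (auto intro: continuous_on_add)
next
  case (Suc k)
  then have "partial i (\<lambda>x. f x + g x) = (\<lambda>x. partial i f x + partial i g x)" for i
    by (intro ext partial_add) auto
  with Suc show ?case by (auto intro: differentiable_add)
qed

lemma Ck_mult: "Ck_on k UNIV f \<Longrightarrow> Ck_on k UNIV g \<Longrightarrow> Ck_on k UNIV (\<lambda>x. f x * g x)"
proof (induction k arbitrary: f g)
  case 0 then show ?case by (auto intro: continuous_on_mult)
next
  case (Suc k)
  then have eq: "partial i (\<lambda>x. f x * g x) = (\<lambda>x. partial i f x * g x + f x * partial i g x)" for i
    by (intro ext partial_mult) auto
  have "Ck_on k UNIV f" "Ck_on k UNIV g" using Suc.prems Ck_SucD by blast+
  moreover have "Ck_on k UNIV (partial i f)" "Ck_on k UNIV (partial i g)" for i using Suc.prems by auto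
  ultimately have "Ck_on k UNIV (partial i (\<lambda>x. f x * g x))" for i
    unfolding eq by (intro Ck_add Suc.IH)
  then show ?case using Suc.prems by (auto intro: differentiable_mult)
qed

lemma smooth_const [simp]: "smooth (\<lambda>x. c)" by (simp add: smooth_on_def Ck_const)
lemma smooth_add: "smooth f \<Longrightarrow> smooth g \<Longrightarrow> smooth (\<lambda>x. f x + g x)"
  by (simp add: smooth_on_def Ck_add)
lemma smooth_mult: "smooth f \<Longrightarrow> smooth g \<Longrightarrow> smooth (\<lambda>x. f x * g x)"
  by (simp add: smooth_on_def Ck_mult)
lemma smooth_minus: "smooth f \<Longrightarrow> smooth (\<lambda>x. - f x)"
  using smooth_mult[of "\<lambda>_. -1" f] by simp
lemma smooth_diff: "smooth f \<Longrightarrow> smooth g \<Longrightarrow> smooth (\<lambda>x. f x - g x)"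
  using smooth_add[of f "\<lambda>x. - g x"] smooth_minus by auto
lemma smooth_power: "smooth f \<Longrightarrow> smooth (\<lambda>x. f x ^ n)"
  by (induction n) (auto intro: smooth_mult)
lemma smooth_sum: "(\<And>i. i \<in> I \<Longrightarrow> smooth (f i)) \<Longrightarrow> smooth (\<lambda>x. \<Sum>i\<in>I. f i x)"
  by (induction I rule: infinite_finite_induct) (auto intro: smooth_add)
lemma smooth_prod: "(\<And>i. i \<in> I \<Longrightarrow> smooth (f i)) \<Longrightarrow> smooth (\<lambda>x. \<Prod>i\<in>I. f i x)"
  by (induction I rule: infinite_finite_induct) (auto intro: smooth_mult)

lemma partial_cmult: "f differentiable (at x) \<Longrightarrow> partial i (\<lambda>x. c * f x) x = c * partial i f x"
  by (subst partial_mult) auto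

lemma grad_add: "smooth f \<Longrightarrow> smooth g \<Longrightarrow> grad (\<lambda>x. f x + g x) x = grad f x + grad g x"
  by (simp add: vec_eq_iff partial_add smooth_differentiable)

lemma grad_cmult: "smooth f \<Longrightarrow> grad (\<lambda>x. c * f x) x = c *\<^sub>R grad f x"
  by (simp add: vec_eq_iff partial_cmult smooth_differentiable)

lemma grad_diff: "smooth f \<Longrightarrow> smooth g \<Longrightarrow> grad (\<lambda>x. f x - g x) x = grad f x - grad g x"
  using grad_add[of f "\<lambda>x. - 1 * g x" x] grad_cmult[of g "-1" x] smooth_minus[of g] by simp

lemma grad_mult: "smooth f \<Longrightarrow> smooth g \<Longrightarrow> grad (\<lambda>x. f x * g x) x = g x *\<^sub>R grad f x + f x *\<^sub>R grad g x"
  by (simp add: vec_eq_iff partial_mult smooth_differentiable)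

lemma grad_const [simp]: "grad (\<lambda>x. c) x = 0"
  by (simp add: vec_eq_iff)

lemma smooth_component [simp]:
  fixes i :: "'n::finite"
  shows "smooth (\<lambda>x::real^'n. x $ i)"
proof -
  have d: "((\<lambda>x::real^'n. x $ i) has_derivative (\<lambda>x. x $ i)) (at x)" for x
    by (rule bounded_linear_imp_has_derivative[OF bounded_linear_vec_nth])
  have "partial j (\<lambda>x::real^'n. x $ i) = (\<lambda>x. axis j 1 $ i)" for j
    by (intro ext) (rule partial_eq[OF d])
  then show ?thesis
    by (subst smooth_iff) (auto intro: has_grad_differentiable[OF d])
qed

text \<open>The whole sequence of derivatives is part of the definition, so that compositions can be
  treated for all derivatives of \<open>h\<close> simultaneously by induction on the order.\<close>

definition rsmooth :: "(real \<Rightarrow> real) \<Rightarrow> bool" where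
  "rsmooth h \<longleftrightarrow> (\<exists>D :: nat \<Rightarrow> real \<Rightarrow> real. D 0 = h \<and> (\<forall>n t. (D n has_real_derivative D (Suc n) t) (at t)))"

lemma has_derivative_comp_real:
  fixes f :: "real^'n::finite \<Rightarrow> real"
  assumes "(h has_real_derivative h') (at (f x))" "f differentiable (at x)"
  shows "((\<lambda>x. h (f x)) has_derivative (\<lambda>v. h' * (v \<bullet> grad f x))) (at x)"
  using has_derivative_compose[OF has_derivative_grad[OF assms(2)] assms(1)[unfolded has_field_derivative_def]]
  by simp

lemma partial_comp_real:
  assumes "(h has_real_derivative h') (at (f x))" "f differentiable (at x)"
  shows "partial i (\<lambda>x. h (f x)) x = h' * partial i f x"
  by (subst partial_eq[OF has_derivative_comp_real[OF assms]]) simp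

lemma grad_comp_real:
  assumes "(h has_real_derivative h') (at (f x))" "f differentiable (at x)"
  shows "grad (\<lambda>x. h (f x)) x = h' *\<^sub>R grad f x"
  by (simp add: vec_eq_iff partial_comp_real[OF assms])

lemma smooth_comp:
  assumes "rsmooth h" "smooth f"
  shows "smooth (\<lambda>x. h (f x))"
proof -
  obtain D where D: "D 0 = h" "\<And>n t. (D n has_real_derivative D (Suc n) t) (at t)"
    using assms(1) by (auto simp: rsmooth_def)
  have "Ck_on k UNIV f \<Longrightarrow> Ck_on k UNIV (\<lambda>x. D n (f x))" for k n
  proof (induction k arbitrary: n)
    case 0
    have "continuous_on UNIV (D n)"
      by (intro continuous_at_imp_continuous_on ballI DERIV_isCont[OF D(2)])
    then show ?case using 0 continuous_on_compose2[of UNIV "D n" UNIV f] by auto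
  next
    case (Suc k)
    have diff: "f differentiable (at x)" for x using Suc.prems by simp
    have eq: "partial i (\<lambda>x. D n (f x)) = (\<lambda>x. D (Suc n) (f x) * partial i f x)" for i
      by (intro ext partial_comp_real D(2) diff)
    have "(\<lambda>x. D n (f x)) differentiable (at x)" for x
      by (rule has_grad_differentiable[OF has_derivative_comp_real[OF D(2) diff]])
    moreover have "Ck_on k UNIV (partial i (\<lambda>x. D n (f x)))" for i
      unfolding eq by (intro Ck_mult Suc.IH Ck_SucD[OF Suc.prems]) (use Suc.prems in simp)
    ultimately show ?case by simp
  qed
  from this[of _ 0] show ?thesis using assms(2) by (auto simp: smooth_on_def D(1))
qed

text \<open>\<open>smooth_comp\<close> does not apply, since \<open>inverse\<close> is not
  differentiable at 0. Instead the derivative of the reciprocal is expressed through the reciprocal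
  itself, which closes an induction on the order.\<close>

lemma smooth_inverse:
  assumes "smooth f" "\<And>x. f x \<noteq> 0"
  shows "smooth (\<lambda>x. inverse (f x))"
proof -
  have "Ck_on k UNIV f \<Longrightarrow> Ck_on k UNIV (\<lambda>x. inverse (f x))" for k
  proof (induction k)
    case 0
    then show ?case by (auto intro!: continuous_on_inverse simp: assms(2))
  next
    case (Suc k)
    have diff: "f differentiable (at x)" for x using Suc.prems by simp
    have d: "(inverse has_real_derivative - (inverse (f x) * inverse (f x))) (at (f x))" for x
      using DERIV_inverse[OF assms(2)[of x]] by (simp add: power2_eq_square)
    have eq: "partial i (\<lambda>x. inverse (f x)) = (\<lambda>x. (-1) * (inverse (f x) * inverse (f x)) * partial i f x)" for i
      by (intro ext) (simp add: partial_comp_real[OF d diff])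
    have "(\<lambda>x. inverse (f x)) differentiable (at x)" for x
      by (rule has_grad_differentiable[OF has_derivative_comp_real[OF d diff]])
    moreover have "Ck_on k UNIV (\<lambda>x. inverse (f x))" by (rule Suc.IH[OF Ck_SucD[OF Suc.prems]])
    then have "Ck_on k UNIV (partial i (\<lambda>x. inverse (f x)))" for i
      unfolding eq using Suc.prems by (intro Ck_mult Ck_const) auto
    ultimately show ?case by simp
  qed
  then show ?thesis using assms(1) by (auto simp: smooth_on_def)
qed

section \<open>Differentiation and integration along lines\<close>

lemma line_deriv:
  fixes f :: "real^'n::finite \<Rightarrow> real"
  assumes "smooth f"
  shows "((\<lambda>s. f (x + s *\<^sub>R e)) has_real_derivative (e \<bullet> grad f (x + s *\<^sub>R e))) (at s within S)"
proof -
  have "((\<lambda>s. x + s *\<^sub>R e) has_derivative (\<lambda>h. h *\<^sub>R e)) (at s within S)"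
    by (auto intro!: derivative_eq_intros)
  from has_derivative_compose[OF this smooth_deriv[OF assms]]
  show ?thesis by (rule has_derivative_imp_has_field_derivative) simp
qed

lemma line_FTC:
  fixes f :: "real^'n::finite \<Rightarrow> real"
  assumes "smooth f" "0 \<le> T"
  shows "integral {0..T} (\<lambda>s. e \<bullet> grad f (x + s *\<^sub>R e)) = f (x + T *\<^sub>R e) - f x"
proof -
  have "((\<lambda>s. e \<bullet> grad f (x + s *\<^sub>R e)) has_integral (f (x + T *\<^sub>R e) - f (x + 0 *\<^sub>R e))) {0..T}"
    by (rule fundamental_theorem_of_calculus[OF assms(2)])
       (rule line_deriv[OF assms(1), unfolded has_real_derivative_iff_has_vector_derivative])
  then show ?thesis by (simp add: integral_unique)
qed

lemma continuous_on_line: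
  fixes f :: "'a::real_normed_vector \<Rightarrow> 'b::topological_space"
  shows "continuous_on UNIV f \<Longrightarrow> continuous_on S (\<lambda>s::real. f (x + s *\<^sub>R e))"
  by (rule continuous_on_compose2[of UNIV f]) (auto intro!: continuous_intros)

lemma line_integral_deriv:
  fixes f :: "real^'n::finite \<Rightarrow> real"
  assumes "smooth f"
  shows "(\<lambda>x. integral {0..T} (\<lambda>s. f (x + s *\<^sub>R e))) differentiable (at x)"
    and "partial i (\<lambda>x. integral {0..T} (\<lambda>s. f (x + s *\<^sub>R e))) x =
      integral {0..T} (\<lambda>s. partial i f (x + s *\<^sub>R e))"
proof -
  define g where "g x s = blinfun_inner_left (grad f (x + s *\<^sub>R e))" for x and s :: real
  have gc: "continuous_on UNIV (\<lambda>y. blinfun_inner_left (grad f y))"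
    by (rule bounded_linear.continuous_on[OF bounded_linear_blinfun_inner_left smooth_grad_continuous[OF assms]])
  have D: "((\<lambda>x. integral (cbox 0 T) (\<lambda>s. f (x + s *\<^sub>R e))) has_derivative integral (cbox 0 T) (g x)) (at x within UNIV)"
  proof (rule leibniz_rule)
    fix y :: "real^'n" and t :: real
    have "((\<lambda>x. x + t *\<^sub>R e) has_derivative (\<lambda>h. h)) (at y)"
      by (auto intro!: derivative_eq_intros)
    from has_derivative_compose[OF this smooth_deriv[OF assms]]
    show "((\<lambda>x. f (x + t *\<^sub>R e)) has_derivative blinfun_apply (g y t)) (at y within UNIV)"
      by (simp add: g_def blinfun_inner_left.rep_eq)
    show "(\<lambda>s. f (y + s *\<^sub>R e)) integrable_on cbox 0 T"
      by (intro integrable_continuous continuous_on_line smooth_continuous assms)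
  next
    show "continuous_on (UNIV \<times> cbox 0 T) (\<lambda>(x, t). g x t)"
      unfolding g_def case_prod_unfold
      by (rule continuous_on_compose2[OF gc]) (auto intro!: continuous_intros)
  qed auto
  then show "(\<lambda>x. integral {0..T} (\<lambda>s. f (x + s *\<^sub>R e))) differentiable (at x)"
    by (auto simp: differentiable_def)
  have "g x integrable_on cbox 0 T"
    unfolding g_def by (intro integrable_continuous continuous_on_line gc)
  then show "partial i (\<lambda>x. integral {0..T} (\<lambda>s. f (x + s *\<^sub>R e))) x =
      integral {0..T} (\<lambda>s. partial i f (x + s *\<^sub>R e))"
    using partial_eq[OF D, of i] by (simp add: blinfun_apply_integral g_def)
qed

lemma smooth_line_integral:
  fixes f :: "real^'n::finite \<Rightarrow> real"
  assumes "smooth f"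
  shows "smooth (\<lambda>x. integral {0..T} (\<lambda>s. f (x + s *\<^sub>R e)))"
proof -
  have "smooth f \<Longrightarrow> Ck_on k UNIV (\<lambda>x. integral {0..T} (\<lambda>s. f (x + s *\<^sub>R e)))" for k
  proof (induction k arbitrary: f)
    case 0
    then show ?case
      by (auto intro!: continuous_at_imp_continuous_on differentiable_imp_continuous_within line_integral_deriv)
  next
    case (Suc k)
    have "partial i (\<lambda>x. integral {0..T} (\<lambda>s. f (x + s *\<^sub>R e))) =
        (\<lambda>x. integral {0..T} (\<lambda>s. partial i f (x + s *\<^sub>R e)))" for i
      by (intro ext line_integral_deriv Suc.prems)
    with Suc show ?case by (auto intro: line_integral_deriv smooth_partial)
  qed
  with assms show ?thesis by (simp add: smooth_on_def)
qed

text \<open>Clairaut: both mixed derivatives integrate along \<open>e\<^sub>i\<close> to the same increment of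
  \<open>\<partial>\<^sub>j f\<close>, one by differentiating under the integral.\<close>
lemma partial_commute:
  fixes f :: "real^'n::finite \<Rightarrow> real"
  assumes f: "smooth f"
  shows "partial j (partial i f) x = partial i (partial j f) x"
proof -
  let ?e = "axis i 1 :: real^'n"
  define g where "g s = partial j (partial i f) (x + s *\<^sub>R ?e) - partial i (partial j f) (x + s *\<^sub>R ?e)" for s
  have c1: "continuous_on S (\<lambda>s. partial j (partial i f) (x + s *\<^sub>R ?e))"
    and c2: "continuous_on S (\<lambda>s. partial i (partial j f) (x + s *\<^sub>R ?e))" for S
    by (intro continuous_on_line smooth_continuous smooth_partial f)+
  have zero: "integral {0..t} g = 0" if "t \<ge> 0" for t
  proof -
    have 1: "integral {0..t} (\<lambda>s. partial j (partial i f) (y + s *\<^sub>R ?e)) = partial j f (y + t *\<^sub>R ?e) - partial j f y" for y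
    proof -
      have tr: "((\<lambda>y. y + t *\<^sub>R ?e) has_derivative (\<lambda>h. h)) (at y)"
        by (auto intro!: derivative_eq_intros)
      have ft: "((\<lambda>y. f (y + t *\<^sub>R ?e)) has_derivative (\<lambda>v. v \<bullet> grad f (y + t *\<^sub>R ?e))) (at y)"
        by (rule has_derivative_compose[OF tr smooth_deriv[OF f]])
      have "(\<lambda>y. f (y + t *\<^sub>R ?e) - f y) = (\<lambda>y. integral {0..t} (\<lambda>s. partial i f (y + s *\<^sub>R ?e)))"
        using line_FTC[OF f that, of ?e] by (auto simp: fun_eq_iff)
      then have "partial j (\<lambda>y. f (y + t *\<^sub>R ?e) - f y) y = integral {0..t} (\<lambda>s. partial j (partial i f) (y + s *\<^sub>R ?e))"
        using line_integral_deriv(2)[OF smooth_partial[OF f]] by simp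
      moreover have "partial j (\<lambda>y. f (y + t *\<^sub>R ?e) - f y) y = partial j f (y + t *\<^sub>R ?e) - partial j f y"
        by (subst partial_eq[OF has_derivative_diff[OF ft smooth_deriv[OF f]]]) simp
      ultimately show ?thesis by simp
    qed
    have 2: "integral {0..t} (\<lambda>s. partial i (partial j f) (x + s *\<^sub>R ?e)) = partial j f (x + t *\<^sub>R ?e) - partial j f x"
      using line_FTC[OF smooth_partial[OF f, of j] that, where e="?e" and x=x] by simp
    show ?thesis unfolding g_def
      using integral_diff[OF integrable_continuous_real[OF c1[of "{0..t}"]] integrable_continuous_real[OF c2[of "{0..t}"]]] 1[of x] 2 by simp
  qed
  \<comment> \<open>The integral of the difference over every interval from 0 to t vanishes, so its
    derivative at 0, taken within the interval, recovers the integrand at \<open>x\<close>.\<close>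
  have "continuous_on {0..1} g" unfolding g_def by (intro continuous_on_diff c1 c2)
  then have "((\<lambda>u. integral {0..u} g) has_vector_derivative g 0) (at 0 within {0..1})"
    by (rule integral_has_vector_derivative) simp
  then have "((\<lambda>u. 0) has_vector_derivative g 0) (at 0 within {0..1})"
    by (rule has_vector_derivative_transform[rotated 2]) (auto simp: zero)
  moreover have "((\<lambda>u. 0::real) has_vector_derivative 0) (at (0::real) within {0..1})"
    by (rule has_vector_derivative_const)
  ultimately have "g 0 = 0"
    using vector_derivative_unique_within_closed_interval[of 0 1 0 "\<lambda>_. 0" "g 0" 0] by simp
  then show ?thesis by (simp add: g_def)
qed

section \<open>Compactly supported functions and integration by parts\<close>

lemma compact_support_bounded:
  fixes f :: "'a::euclidean_space \<Rightarrow> 'b::euclidean_space"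
  assumes "continuous_on UNIV f" "bounded {x. f x \<noteq> 0}"
  obtains C where "C > 0" "\<And>x. norm (f x) \<le> C"
proof -
  obtain r where r: "{x. f x \<noteq> 0} \<subseteq> cball 0 r" using assms(2) by (auto simp: bounded_iff subset_eq)
  have "compact (f ` cball 0 r)"
    by (rule compact_continuous_image[OF continuous_on_subset[OF assms(1)]]) auto
  then obtain C where C: "\<And>x. x \<in> cball 0 r \<Longrightarrow> norm (f x) \<le> C"
    using compact_imp_bounded bounded_iff by (metis imageI)
  show ?thesis
  proof (rule that[of "\<bar>C\<bar> + 1"])
    fix x show "norm (f x) \<le> \<bar>C\<bar> + 1"
    proof (cases "f x = 0")
      case False
      then have "norm (f x) \<le> C" using r C by blast
      then show ?thesis by simp
    qed simp
  qed simp
qed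

lemma compact_support_integrable:
  fixes f :: "'a::euclidean_space \<Rightarrow> 'b::euclidean_space"
  assumes "continuous_on UNIV f" "bounded {x. f x \<noteq> 0}"
  shows "integrable lborel f" "integrable lebesgue f"
proof -
  obtain r where r: "{x. f x \<noteq> 0} \<subseteq> cball 0 r" using assms(2) by (auto simp: bounded_iff subset_eq)
  have "integrable lborel (\<lambda>x. indicator (cball 0 r) x *\<^sub>R f x)"
    by (rule borel_integrable_compact[OF compact_cball continuous_on_subset[OF assms(1)]]) simp
  moreover have "(\<lambda>x. indicator (cball 0 r) x *\<^sub>R f x) = f"
    using r by (auto simp: fun_eq_iff indicator_def)
  ultimately show 1: "integrable lborel f" by simp
  then show "integrable lebesgue f"
    using borel_measurable_continuous_onI[OF assms(1)] by (simp add: integrable_completion)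
qed

lemma integral_lebesgue_lborel:
  fixes f :: "'a::euclidean_space \<Rightarrow> 'b::euclidean_space"
  shows "continuous_on UNIV f \<Longrightarrow> integral\<^sup>L lebesgue f = integral\<^sup>L lborel f"
  using borel_measurable_continuous_onI[of f] by (simp add: integral_completion)

lemma partial_support:
  assumes "x \<notin> closure {x. f x \<noteq> 0}" shows "partial i f x = 0"
proof -
  have z: "f y = 0" if "y \<notin> closure {x. f x \<noteq> 0}" for y
    using closure_subset[of "{x. f x \<noteq> 0}"] that by auto
  have "(f has_derivative (\<lambda>h. 0)) (at x)"
  proof (rule has_derivative_transform_within_open[OF has_derivative_const])
    show "open (- closure {x. f x \<noteq> 0})" by (rule open_Compl[OF closed_closure])
    show "x \<in> - closure {x. f x \<noteq> 0}" using assms by simp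
    fix y assume "y \<in> - closure {x. f x \<noteq> 0}"
    then have "y \<notin> closure {x. f x \<noteq> 0}" by (rule ComplD)
    from z[OF this] show "0 = f y" by (rule sym)
  qed
  from partial_eq[OF this] show ?thesis by simp
qed

lemma partial_support_subset: "{x. partial i f x \<noteq> 0} \<subseteq> closure {x. f x \<noteq> 0}"
  using partial_support by blast

text \<open>Difference quotients integrate to 0 because Lebesgue measure is translation invariant;
  the mean value theorem bounds them by the supremum of the partial derivative, so they converge
  under the integral.\<close>

lemma integral_partial_zero:
  fixes f :: "real^'n::finite \<Rightarrow> real"
  assumes f: "smooth f" and b: "bounded {x. f x \<noteq> 0}"
  shows "(LINT x|lebesgue. partial i f x) = 0"
proof -
  let ?e = "axis i 1 :: real^'n"
  have pb: "bounded {x. partial i f x \<noteq> 0}"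
    by (rule bounded_subset[OF bounded_closure[OF b] partial_support_subset])
  obtain C where C: "C > 0" "\<And>x. norm (partial i f x) \<le> C"
    using compact_support_bounded[OF smooth_continuous[OF smooth_partial[OF f]] pb] by metis
  obtain r where r: "\<And>x. f x \<noteq> 0 \<Longrightarrow> norm x \<le> r" using b by (auto simp: bounded_iff)
  \<comment> \<open>Steps of size at most 1 keep all difference quotients supported in the ball of
    radius \<open>r + 1\<close>, where the dominating function is constant.\<close>
  define h where "h n = 1 / real (Suc n)" for n
  have h: "h n > 0" "h n \<le> 1" for n by (auto simp: h_def)
  define D where "D n x = (f (x + h n *\<^sub>R ?e) - f x) / h n" for n x
  have cD: "continuous_on UNIV (D n)" for n
    unfolding D_def using h(1)[of n]
    by (intro continuous_intros continuous_on_compose2[OF smooth_continuous[OF f, of UNIV]] smooth_continuous[OF f]) auto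
  have "(\<lambda>n. LINT x|lborel. D n x) \<longlonglongrightarrow> (LINT x|lborel. partial i f x)"
  proof (rule integral_dominated_convergence)
    show "partial i f \<in> borel_measurable lborel"
      using borel_measurable_continuous_onI[OF smooth_continuous[OF smooth_partial[OF f]]] by simp
    show "D n \<in> borel_measurable lborel" for n
      using borel_measurable_continuous_onI[OF cD] by simp
    show "integrable lborel (\<lambda>x. indicator (cball 0 (r + 1)) x *\<^sub>R C)"
      by (rule borel_integrable_compact) auto
    show "AE x in lborel. (\<lambda>n. D n x) \<longlonglongrightarrow> partial i f x"
    proof (intro always_eventually allI)
      fix x
      have "((\<lambda>s. f (x + s *\<^sub>R ?e)) has_real_derivative partial i f x) (at 0)"
        using line_deriv[OF f, of x ?e 0 UNIV] by simp
      then have "((\<lambda>s. (f (x + s *\<^sub>R ?e) - f x) / s) \<longlongrightarrow> partial i f x) (at 0)"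
        by (simp add: DERIV_def)
      moreover have "filterlim h (at 0) sequentially"
        unfolding filterlim_at
        using h(1) LIMSEQ_Suc[OF lim_1_over_n[where 'a=real]]
        by (auto simp: h_def[abs_def])
      ultimately show "(\<lambda>n. D n x) \<longlonglongrightarrow> partial i f x"
        unfolding D_def by (rule filterlim_compose)
    qed
    show "AE x in lborel. norm (D n x) \<le> indicator (cball 0 (r + 1)) x *\<^sub>R C" for n
    proof (intro always_eventually allI)
      fix x
      show "norm (D n x) \<le> indicator (cball 0 (r + 1)) x *\<^sub>R C"
      proof (cases "x \<in> cball 0 (r + 1)")
        case True
        have "\<exists>z>0. z < h n \<and> f (x + h n *\<^sub>R ?e) - f (x + 0 *\<^sub>R ?e) = (h n - 0) * partial i f (x + z *\<^sub>R ?e)"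
          by (rule MVT2[OF h(1)]) (use line_deriv[OF f, of x ?e _ UNIV] in simp)
        then obtain z where "D n x = partial i f (x + z *\<^sub>R ?e)" using h(1)[of n] by (auto simp: D_def)
        then show ?thesis using C(2) True by simp
      next
        case False
        have "norm (h n *\<^sub>R ?e) \<le> 1" using h[of n] by simp
        then have "norm (x + h n *\<^sub>R ?e) > r" using False norm_triangle_ineq2[of x "- (h n *\<^sub>R ?e)"] by (simp add: not_le)
        then have "f x = 0" "f (x + h n *\<^sub>R ?e) = 0" using r False by (fastforce simp: not_le)+
        then show ?thesis using C(1) by (simp add: D_def)
      qed
    qed
  qed
  moreover have "(LINT x|lborel. D n x) = 0" for n
  proof -
    have i1: "integrable lborel f" by (rule compact_support_integrable[OF smooth_continuous[OF f] b])
    have m: "f \<in> borel_measurable borel" by (rule borel_measurable_continuous_onI[OF smooth_continuous[OF f]])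
    have eq: "(LINT x|lborel. f (h n *\<^sub>R ?e + x)) = (LINT x|lborel. f x)"
      using integral_distr[of "(+) (h n *\<^sub>R ?e)" lborel borel f] m lborel_distr_plus[of "h n *\<^sub>R ?e"] by simp
    have i2: "integrable lborel (\<lambda>x. f (h n *\<^sub>R ?e + x))"
      using integrable_distr_eq[of "(+) (h n *\<^sub>R ?e)" lborel borel f] m i1 lborel_distr_plus[of "h n *\<^sub>R ?e"] by simp
    show ?thesis using eq i1 i2 by (simp add: D_def add.commute)
  qed
  ultimately have "(LINT x|lborel. partial i f x) = 0" using LIMSEQ_unique[OF _ tendsto_const] by simp
  then show ?thesis
    using integral_lebesgue_lborel[OF smooth_continuous[OF smooth_partial[OF f]]] by simp
qed

lemma set_integral_support:
  "(\<And>x. x \<notin> A \<Longrightarrow> h x = 0) \<Longrightarrow> (LINT x:A|M. h x) = (LINT x|M. h x)"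
  unfolding set_lebesgue_integral_def
  by (rule Bochner_Integration.integral_cong) (auto simp: indicator_def)

lemma integral_by_parts:
  fixes f g :: "real^'n::finite \<Rightarrow> real"
  assumes f: "smooth f" and g: "smooth g" "bounded {x. g x \<noteq> 0}"
  shows "(LINT x|lebesgue. partial i f x * g x) = - (LINT x|lebesgue. f x * partial i g x)"
proof -
  have "(LINT x|lebesgue. partial i (\<lambda>x. f x * g x) x) = 0"
    by (intro integral_partial_zero smooth_mult f g bounded_subset[OF g(2)]) auto
  moreover have "partial i (\<lambda>x. f x * g x) x = partial i f x * g x + f x * partial i g x" for x
    by (intro partial_mult smooth_differentiable f g)
  moreover have "integrable lebesgue (\<lambda>x. partial i f x * g x)"
    by (intro compact_support_integrable continuous_on_mult smooth_continuous smooth_partial f g bounded_subset[OF g(2)]) auto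
  moreover have "integrable lebesgue (\<lambda>x. f x * partial i g x)"
    by (intro compact_support_integrable continuous_on_mult smooth_continuous smooth_partial f g
        bounded_subset[OF bounded_closure[OF g(2)]]) (use partial_support in \<open>auto simp del: mem_Collect_eq\<close>)
  ultimately show ?thesis by simp
qed

section \<open>Test functions and test fields\<close>

lemma test_funD:
  assumes "test_fun \<Omega> \<phi>"
  shows "smooth \<phi>" "bounded {x. \<phi> x \<noteq> 0}" "closure {x. \<phi> x \<noteq> 0} \<subseteq> \<Omega>" "x \<notin> \<Omega> \<Longrightarrow> \<phi> x = 0"
  using assms closure_subset[of "{x. \<phi> x \<noteq> 0}"] by (auto simp: test_fun_def)

lemma test_fun_subset:
  assumes "test_fun \<Omega> f" "smooth g" "{x. g x \<noteq> 0} \<subseteq> closure {x. f x \<noteq> 0}"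
  shows "test_fun \<Omega> g"
proof -
  have "closure {x. g x \<noteq> 0} \<subseteq> closure {x. f x \<noteq> 0}" by (rule closure_minimal[OF assms(3) closed_closure])
  then show ?thesis
    using assms bounded_subset[OF bounded_closure assms(3)] by (auto simp: test_fun_def)
qed

lemma test_fun_partial: "test_fun \<Omega> f \<Longrightarrow> test_fun \<Omega> (partial i f)"
  by (rule test_fun_subset[of \<Omega> f]) (auto simp: test_funD smooth_partial intro: partial_support ccontr)

lemma test_fun_mult:
  assumes "test_fun \<Omega> f" "smooth g"
  shows "test_fun \<Omega> (\<lambda>x. f x * g x)" "test_fun \<Omega> (\<lambda>x. g x * f x)"
  using closure_subset[of "{x. f x \<noteq> 0}"]
  by (auto intro!: test_fun_subset[OF assms(1)] smooth_mult assms(2) test_funD(1)[OF assms(1)])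

lemma test_fun_add:
  assumes "test_fun \<Omega> f" "test_fun \<Omega> g" shows "test_fun \<Omega> (\<lambda>x. f x + g x)"
proof -
  have sub: "{x. f x + g x \<noteq> 0} \<subseteq> {x. f x \<noteq> 0} \<union> {x. g x \<noteq> 0}" by auto
  have "closure {x. f x + g x \<noteq> 0} \<subseteq> closure {x. f x \<noteq> 0} \<union> closure {x. g x \<noteq> 0}"
    using closure_mono[OF sub] by (simp add: closure_Un)
  moreover have "bounded {x. f x + g x \<noteq> 0}"
    by (rule bounded_subset[OF _ sub]) (use assms in \<open>simp add: test_fun_def\<close>)
  ultimately show ?thesis using assms by (auto simp: test_fun_def intro: smooth_add)
qed

lemma test_fun_cmult: "test_fun \<Omega> f \<Longrightarrow> test_fun \<Omega> (\<lambda>x. c * f x)"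
  by (rule test_fun_mult(2)) auto

lemma test_fun_diff: "test_fun \<Omega> f \<Longrightarrow> test_fun \<Omega> g \<Longrightarrow> test_fun \<Omega> (\<lambda>x. f x - g x)"
  using test_fun_add[of \<Omega> f "\<lambda>x. (-1) * g x"] test_fun_cmult[of \<Omega> g "-1"] by simp

lemma test_fun_zero [simp]: "test_fun \<Omega> (\<lambda>x. 0)"
  by (simp add: test_fun_def)

lemma vec_test_ccurl: "vec_test \<Omega> \<Phi> \<Longrightarrow> vec_test \<Omega> (ccurl \<Phi>)"
  unfolding vec_test_def
proof (intro allI)
  fix j :: 3 assume a: "\<forall>j. test_fun \<Omega> (\<lambda>x. \<Phi> x $ j)"
  have t: "test_fun \<Omega> (\<lambda>x. partial i (\<lambda>y. \<Phi> y $ k) x - partial i' (\<lambda>y. \<Phi> y $ k') x)" for i k i' k'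
    by (intro test_fun_diff test_fun_partial a[rule_format])
  show "test_fun \<Omega> (\<lambda>x. ccurl \<Phi> x $ j)"
    using exhaust_3[of j] by (auto simp: ccurl_def vector_3 t)
qed

text \<open>The support condition concerns the gradient: \<open>f\<close> may take different
  constant values on the components of the complement and still yield a curl-free test
  field.\<close>

lemma vec_test_grad: "smooth f \<Longrightarrow> closure {x. grad f x \<noteq> 0} \<subseteq> \<Omega> \<Longrightarrow> bounded {x. grad f x \<noteq> 0} \<Longrightarrow> vec_test \<Omega> (grad f)"
  unfolding vec_test_def
proof (intro allI)
  fix j :: 3 assume *: "smooth f" "closure {x. grad f x \<noteq> 0} \<subseteq> \<Omega>" "bounded {x. grad f x \<noteq> 0}"
  have sub: "{x. partial j f x \<noteq> 0} \<subseteq> {x. grad f x \<noteq> 0}" by (auto simp: vec_eq_iff)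
  show "test_fun \<Omega> (\<lambda>x. grad f x $ j)"
    using *(2) closure_mono[OF sub] bounded_subset[OF *(3) sub] smooth_partial[OF *(1)]
    by (auto simp: test_fun_def)
qed

lemma ccurl_grad: "smooth f \<Longrightarrow> ccurl (grad f) x = 0"
  unfolding ccurl_def vec_eq_iff forall_3 by (simp add: vector_3 partial_commute)

lemma vec_test_test: "vec_test \<Omega> \<Phi> \<Longrightarrow> test_fun \<Omega> (\<lambda>x. \<Phi> x $ j)"
  by (simp add: vec_test_def)

lemma vec_test_continuous: "vec_test \<Omega> \<Phi> \<Longrightarrow> continuous_on S \<Phi>"
proof -
  assume *: "vec_test \<Omega> \<Phi>"
  have "continuous_on S (\<lambda>x. \<chi> j. \<Phi> x $ j)"
    by (intro continuous_on_vec_lambda smooth_continuous test_funD(1)[OF vec_test_test[OF *]])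
  then show ?thesis by simp
qed

lemma vec_test_bounded: "vec_test \<Omega> \<Phi> \<Longrightarrow> bounded {x. \<Phi> x \<noteq> 0}"
proof -
  assume "vec_test \<Omega> \<Phi>"
  then have "bounded (\<Union>j\<in>UNIV. {x. \<Phi> x $ j \<noteq> 0})" by (intro bounded_UN) (auto simp: vec_test_def test_fun_def)
  moreover have "{x. \<Phi> x \<noteq> 0} \<subseteq> (\<Union>j\<in>UNIV. {x. \<Phi> x $ j \<noteq> 0})" by (auto simp: vec_eq_iff)
  ultimately show ?thesis by (rule bounded_subset)
qed

lemma vec_test_zero: "vec_test \<Omega> \<Phi> \<Longrightarrow> x \<notin> \<Omega> \<Longrightarrow> \<Phi> x = 0"
  by (auto simp: vec_eq_iff intro: test_funD(4)[OF vec_test_test])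

text \<open>Integration by parts moves the gradient onto \<open>ccurl \<Phi>\<close>, whose
  divergence vanishes because partial derivatives commute; the compact support of
  \<open>\<Phi>\<close> disposes of boundary terms.\<close>

lemma grad_orth_ccurl:
  assumes f: "smooth f" and P: "vec_test \<Omega> \<Phi>"
  shows "(LINT x|lebesgue. grad f x \<bullet> ccurl \<Phi> x) = 0"
proof -
  have c: "vec_test \<Omega> (ccurl \<Phi>)" by (rule vec_test_ccurl[OF P])
  have s: "smooth (\<lambda>x. ccurl \<Phi> x $ j)" "bounded {x. ccurl \<Phi> x $ j \<noteq> 0}" for j
    using vec_test_test[OF c] by (auto simp: test_fun_def)
  have i1: "integrable lebesgue (\<lambda>x. partial i f x * ccurl \<Phi> x $ j)" for i j
    by (intro compact_support_integrable continuous_on_mult smooth_continuous smooth_partial f s bounded_subset[OF s(2)[of j]]) auto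
  have i2: "integrable lebesgue (\<lambda>x. f x * partial i (\<lambda>x. ccurl \<Phi> x $ j) x)" for i j
    by (intro compact_support_integrable continuous_on_mult smooth_continuous smooth_partial f s
        bounded_subset[OF bounded_closure[OF s(2)[of j]]]) (use partial_support_subset[of i "\<lambda>x. ccurl \<Phi> x $ j"] in auto)
  have d: "(\<lambda>x. \<Phi> x $ k) differentiable (at x)" "partial j (\<lambda>y. \<Phi> y $ k) differentiable (at x)" for k j x
    by (intro smooth_differentiable smooth_partial test_funD(1)[OF vec_test_test[OF P]])+
  have pd: "partial i (\<lambda>x. g x - h x) x = partial i g x - partial i h x" if "g differentiable (at x)" "h differentiable (at x)" for g h :: "real^3 \<Rightarrow> real" and i x
    by (subst partial_eq[OF has_derivative_diff[OF has_derivative_grad[OF that(1)] has_derivative_grad[OF that(2)]]]) simp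
  have comm: "partial i (partial j (\<lambda>y. \<Phi> y $ k)) x = partial j (partial i (\<lambda>y. \<Phi> y $ k)) x" for i j k x
    by (rule partial_commute[OF test_funD(1)[OF vec_test_test[OF P]]])
  have div: "partial 1 (\<lambda>x. ccurl \<Phi> x $ 1) x + partial 2 (\<lambda>x. ccurl \<Phi> x $ 2) x + partial 3 (\<lambda>x. ccurl \<Phi> x $ 3) x = 0" for x
    using comm[of 1 2 3 x] comm[of 1 3 2 x] comm[of 2 3 1 x] by (simp add: ccurl_def vector_3 pd d)
  have "(LINT x|lebesgue. grad f x \<bullet> ccurl \<Phi> x) = (\<Sum>i\<in>UNIV. LINT x|lebesgue. partial i f x * ccurl \<Phi> x $ i)"
    by (simp add: inner_vec_def i1)
  also have "\<dots> = (\<Sum>i\<in>UNIV. - (LINT x|lebesgue. f x * partial i (\<lambda>x. ccurl \<Phi> x $ i) x))"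
    by (intro sum.cong refl integral_by_parts f s)
  also have "\<dots> = - (LINT x|lebesgue. (\<Sum>i\<in>UNIV. f x * partial i (\<lambda>x. ccurl \<Phi> x $ i) x))"
    by (simp add: sum_negf i2)
  also have "(\<lambda>x. \<Sum>i\<in>UNIV. f x * partial i (\<lambda>x. ccurl \<Phi> x $ i) x) = (\<lambda>x. 0)"
  proof
    fix x
    show "(\<Sum>i\<in>UNIV. f x * partial i (\<lambda>x. ccurl \<Phi> x $ i) x) = 0"
      using div[of x] by (simp add: sum_3 ring_distribs[symmetric])
  qed
  finally show ?thesis by simp
qed

section \<open>Explicit smooth functions\<close>

definition bump :: "real \<Rightarrow> real" where
  "bump t = (if t > 0 then exp (- inverse t) else 0)"

lemma poly_div_exp_tendsto_0: "((\<lambda>s. s ^ k * poly p s / exp s) \<longlongrightarrow> (0::real)) at_top"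
proof (induction p arbitrary: k)
  case 0
  then show ?case by simp
next
  case (pCons a p)
  have "((\<lambda>s. a * (s ^ k / exp s) + s ^ Suc k * poly p s / exp s) \<longlongrightarrow> a * 0 + 0) at_top"
    by (intro tendsto_add tendsto_mult tendsto_const tendsto_power_div_exp_0 pCons.IH)
  moreover have "a * (s ^ k / exp s) + s ^ Suc k * poly p s / exp s = s ^ k * poly (pCons a p) s / exp s" for s :: real
    by (simp add: algebra_simps add_divide_distrib)
  ultimately show ?case by simp
qed

text \<open>Every derivative has the form p(1/t) exp(-1/t) for positive t and is 0 otherwise;
  differentiation sends the polynomial p to (p - p') X^2. At 0 the difference quotients vanish
  identically from the left, and from the right because the exponential beats every
  polynomial.\<close>

lemma rsmooth_bump: "rsmooth bump"
proof -
  define F where "F p t = (if t > 0 then poly p (inverse t) * exp (- inverse t) else 0)" for p :: "real poly" and t :: real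
  have D: "(F p has_real_derivative F ((p - pderiv p) * [:0, 0, 1:]) t) (at t)" for p t
  proof -
    consider "t > 0" | "t < 0" | "t = 0" by linarith
    then show ?thesis
    proof cases
      case 1
      have "((\<lambda>t. poly p (inverse t) * exp (- inverse t)) has_real_derivative F ((p - pderiv p) * [:0, 0, 1:]) t) (at t)"
        using 1 by (auto intro!: derivative_eq_intros DERIV_chain2[OF poly_DERIV]
            simp: F_def algebra_simps power2_eq_square)
      then show ?thesis
        by (rule has_field_derivative_transform_within_open[of _ _ _ "{0<..}"]) (use 1 in \<open>auto simp: F_def\<close>)
    next
      case 2
      have "((\<lambda>t. 0) has_real_derivative F ((p - pderiv p) * [:0, 0, 1:]) t) (at t)"
        using 2 by (simp add: F_def)
      then show ?thesis
        by (rule has_field_derivative_transform_within_open[of _ _ _ "{..<0}"]) (use 2 in \<open>auto simp: F_def\<close>)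
    next
      case 3
      have "((\<lambda>h. F p h / h) \<longlongrightarrow> 0) (at_left 0)"
      proof (rule tendsto_eventually)
        show "\<forall>\<^sub>F h in at_left 0. F p h / h = 0"
          by (simp add: F_def eventually_at_filter)
      qed
      moreover have "((\<lambda>h. F p h / h) \<longlongrightarrow> 0) (at_right 0)"
      proof (rule Lim_transform_eventually)
        show "((\<lambda>h. inverse h ^ 1 * poly p (inverse h) / exp (inverse h)) \<longlongrightarrow> 0) (at_right (0::real))"
          by (rule filterlim_compose[OF poly_div_exp_tendsto_0 filterlim_inverse_at_top_right])
        show "\<forall>\<^sub>F h in at_right 0. inverse h ^ 1 * poly p (inverse h) / exp (inverse h) = F p h / h"
          by (simp add: F_def eventually_at_filter exp_minus field_simps)
      qed
      ultimately have "((\<lambda>h. F p h / h) \<longlongrightarrow> 0) (at 0)" by (rule filterlim_split_at)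
      then show ?thesis by (simp add: DERIV_def 3 F_def)
    qed
  qed
  define P where "P = rec_nat (1 :: real poly) (\<lambda>_ p. (p - pderiv p) * [:0, 0, 1:])"
  have P: "P 0 = 1" "P (Suc n) = (P n - pderiv (P n)) * [:0, 0, 1:]" for n by (auto simp: P_def)
  have "F (P 0) = bump" by (auto simp: F_def P bump_def)
  moreover have "(F (P n) has_real_derivative F (P (Suc n)) t) (at t)" for n t unfolding P(2) by (rule D)
  ultimately show ?thesis unfolding rsmooth_def by (intro exI[of _ "\<lambda>n. F (P n)"]) auto
qed

lemma bump_bounds: "0 \<le> bump t" "bump t \<le> 1" "0 < bump t \<longleftrightarrow> 0 < t"
  by (auto simp: bump_def)

text \<open>A smooth substitute for the truncation \<open>max (t - k) 0\<close>, approached as the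
  sharpness \<open>a\<close> grows; \<open>logistic\<close> is its derivative. Composition with it
  keeps potentials smooth, so truncation needs only the chain rule for smooth functions and a
  limit.\<close>

definition softplus :: "real \<Rightarrow> real \<Rightarrow> real \<Rightarrow> real" where
  "softplus a k t = ln (1 + exp (a * (t - k))) / a"
definition logistic :: "real \<Rightarrow> real \<Rightarrow> real \<Rightarrow> real" where
  "logistic a k t = 1 / (1 + exp (- (a * (t - k))))"

lemma logistic_bounds: "0 < logistic a k t" "logistic a k t < 1"
  by (auto simp: logistic_def add_pos_pos)

lemma logistic_deriv:
  "(logistic a k has_real_derivative a * (logistic a k t * (1 - logistic a k t))) (at t)"
proof -
  have nz: "1 + exp (- (a * (t - k))) \<noteq> 0" using exp_gt_zero[of "- (a * (t - k))"] by linarith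
  have "(logistic a k has_real_derivative (a * exp (- (a * (t - k)))) / (1 + exp (- (a * (t - k))))\<^sup>2) (at t)"
    unfolding logistic_def[abs_def] using nz
    by (auto intro!: derivative_eq_intros simp: power2_eq_square)
  moreover have "(a * exp (- (a * (t - k)))) / (1 + exp (- (a * (t - k))))\<^sup>2 = a * (logistic a k t * (1 - logistic a k t))"
    using nz by (simp add: logistic_def power2_eq_square field_simps)
  ultimately show ?thesis by simp
qed

lemma softplus_deriv:
  assumes "a > 0" shows "(softplus a k has_real_derivative logistic a k t) (at t)"
proof -
  have pos: "1 + exp (a * (t - k)) > 0" by (simp add: add_pos_pos)
  have "(softplus a k has_real_derivative (1 / (1 + exp (a * (t - k))) * (exp (a * (t - k)) * a)) / a) (at t)"
    unfolding softplus_def[abs_def] using pos assms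
    by (auto intro!: derivative_eq_intros)
  moreover have "(1 / (1 + exp (a * (t - k))) * (exp (a * (t - k)) * a)) / a = logistic a k t"
  proof -
    define E where "E = exp (a * (t - k))"
    have "E > 0" "exp (- (a * (t - k))) = inverse E" by (auto simp: E_def exp_minus)
    from this(2) have eq: "logistic a k t = 1 / (1 + inverse E)" by (simp only: logistic_def)
    have i: "1 + inverse E = (1 + E) / E" using \<open>E > 0\<close> by (simp add: field_simps)
    show ?thesis unfolding eq i E_def[symmetric] using assms by simp
  qed
  ultimately show ?thesis by simp
qed

text \<open>The derivative of \<open>logistic\<close> is \<open>a\<close> times y (1 - y), where y
  is its value, so all further derivatives are polynomials in \<open>logistic\<close>, generated by
  the recursion for \<open>P\<close>.\<close>

lemma rsmooth_softplus: assumes "a > 0" shows "rsmooth (softplus a k)"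
proof -
  define P where "P = rec_nat ([:0, 1:] :: real poly) (\<lambda>_ p. smult a (pderiv p * [:0, 1, -1:]))"
  have P: "P 0 = [:0, 1:]" "P (Suc n) = smult a (pderiv (P n) * [:0, 1, -1:])" for n by (auto simp: P_def)
  have "((\<lambda>t. poly (P n) (logistic a k t)) has_real_derivative poly (P (Suc n)) (logistic a k t)) (at t)" for n t
    using DERIV_chain2[OF poly_DERIV[of "P n"] logistic_deriv[of a k t]] by (simp add: P algebra_simps)
  moreover have "(softplus a k has_real_derivative poly (P 0) (logistic a k t)) (at t)" for t
    using softplus_deriv[OF assms] by (simp add: P)
  ultimately show ?thesis unfolding rsmooth_def
    by (intro exI[of _ "\<lambda>n. case n of 0 \<Rightarrow> softplus a k | Suc n \<Rightarrow> (\<lambda>t. poly (P n) (logistic a k t))"])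
       (auto split: nat.split)
qed

lemma smooth_norm_sq: "smooth (\<lambda>x::real^'n::finite. (norm (x - c))\<^sup>2)"
proof -
  have "(norm (x - c))\<^sup>2 = (\<Sum>i\<in>UNIV. (x $ i - c $ i)\<^sup>2)" for x :: "real^'n"
    unfolding power2_norm_eq_inner inner_vec_def by (simp add: power2_eq_square)
  then show ?thesis by (simp add: smooth_sum smooth_power smooth_diff)
qed

text \<open>The quotient a / (a + b), where \<open>a\<close> vanishes outside the larger ball and
  \<open>b\<close> inside the smaller one. As \<open>r1 < r2\<close>, the two never vanish together
  and the denominator stays positive.\<close>

lemma smooth_cutoff:
  fixes c :: "real^'n::finite"
  assumes "0 < r1" "r1 < r2"
  obtains \<beta> where "smooth \<beta>" "\<And>x. 0 \<le> \<beta> x" "\<And>x. \<beta> x \<le> 1" "\<And>x. x \<in> cball c r1 \<Longrightarrow> \<beta> x = 1"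
    "\<And>x. x \<notin> ball c r2 \<Longrightarrow> \<beta> x = 0"
proof -
  define a where "a x = bump (r2\<^sup>2 - (norm (x - c))\<^sup>2)" for x
  define b where "b x = bump ((norm (x - c))\<^sup>2 - r1\<^sup>2)" for x
  have r: "r1\<^sup>2 < r2\<^sup>2" using assms by (simp add: power_strict_mono)
  have ab: "a x \<ge> 0" "b x \<ge> 0" "a x + b x > 0" for x
    using r bump_bounds(1)[of "r2\<^sup>2 - (norm (x - c))\<^sup>2"] bump_bounds(1)[of "(norm (x - c))\<^sup>2 - r1\<^sup>2"]
      bump_bounds(3)[of "r2\<^sup>2 - (norm (x - c))\<^sup>2"] bump_bounds(3)[of "(norm (x - c))\<^sup>2 - r1\<^sup>2"]
    unfolding a_def b_def by linarith+
  have sa: "smooth a" "smooth b" unfolding a_def[abs_def] b_def[abs_def]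
    by (intro smooth_comp[OF rsmooth_bump] smooth_diff smooth_norm_sq smooth_const)+
  show ?thesis
  proof (rule that[of "\<lambda>x. a x * inverse (a x + b x)"])
    show "smooth (\<lambda>x. a x * inverse (a x + b x))"
      using ab(3) by (intro smooth_mult sa smooth_inverse smooth_add) (simp add: less_imp_neq[symmetric])
    fix x
    show "0 \<le> a x * inverse (a x + b x)" using ab[of x] by simp
    show "a x * inverse (a x + b x) \<le> 1" using ab[of x] by (simp add: field_simps)
    show "a x * inverse (a x + b x) = 1" if "x \<in> cball c r1"
    proof -
      have "norm (x - c) \<le> r1" using that by (simp add: dist_norm norm_minus_commute)
      then have "(norm (x - c))\<^sup>2 \<le> r1\<^sup>2" by (intro power_mono) auto
      then have "b x = 0" by (simp add: b_def bump_def)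
      then show ?thesis using ab(3)[of x] by simp
    qed
    show "a x * inverse (a x + b x) = 0" if "x \<notin> ball c r2"
    proof -
      have "r2 \<le> norm (x - c)" using that by (simp add: dist_norm norm_minus_commute)
      then have "r2\<^sup>2 \<le> (norm (x - c))\<^sup>2" using assms by (intro power_mono) auto
      then have "a x = 0" by (simp add: a_def bump_def)
      then show ?thesis by simp
    qed
  qed
qed

lemma bump_limit: "(\<lambda>n. bump (real (Suc n) * d)) \<longlonglongrightarrow> (if d > 0 then 1 else 0)"
proof (cases "d > 0")
  case True
  have "(\<lambda>n. exp (- (inverse (real (Suc n)) * inverse d))) \<longlonglongrightarrow> exp (- (0 * inverse d))"
    by (intro tendsto_exp tendsto_minus tendsto_mult LIMSEQ_inverse_real_of_nat tendsto_const)
  moreover have "bump (real (Suc n) * d) = exp (- (inverse (real (Suc n)) * inverse d))" for n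
    using True by (simp add: bump_def)
  ultimately show ?thesis using True by simp
next
  case False
  then have "bump (real (Suc n) * d) = 0" for n by (simp add: bump_def mult_nonneg_nonpos not_less)
  then show ?thesis using False by simp
qed

section \<open>The fundamental lemma of the calculus of variations\<close>

lemma test_fun_box_approx:
  assumes "cbox a b \<subseteq> \<Omega>"
  obtains \<phi> where "\<And>n. test_fun \<Omega> (\<phi> n)" "\<And>n x. \<bar>\<phi> n x\<bar> \<le> 1"
    "\<And>x. (\<lambda>n. \<phi> n x) \<longlonglongrightarrow> indicator (box a b) x"
proof -
  define \<phi> where "\<phi> n x = (\<Prod>i\<in>UNIV. bump (real (Suc n) * (x $ i - a $ i)) * bump (real (Suc n) * (b $ i - x $ i)))" for n :: nat and x :: "real^3"
  show ?thesis
  proof (rule that[of \<phi>])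
    fix n
    have "smooth (\<phi> n)" unfolding \<phi>_def[abs_def]
      by (intro smooth_prod smooth_mult smooth_comp[OF rsmooth_bump] smooth_diff smooth_const smooth_component)
    moreover have sub: "{x. \<phi> n x \<noteq> 0} \<subseteq> cbox a b"
    proof
      fix x assume "x \<in> {x. \<phi> n x \<noteq> 0}"
      then have "bump (real (Suc n) * (x $ i - a $ i)) \<noteq> 0 \<and> bump (real (Suc n) * (b $ i - x $ i)) \<noteq> 0" for i
        by (auto simp: \<phi>_def)
      then have "0 < real (Suc n) * (x $ i - a $ i) \<and> 0 < real (Suc n) * (b $ i - x $ i)" for i
        by (meson bump_def)
      then have "a $ i \<le> x $ i \<and> x $ i \<le> b $ i" for i
        by (auto simp: zero_less_mult_iff dest!: spec less_imp_le)
      then show "x \<in> cbox a b" by (simp add: mem_box_cart)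
    qed
    moreover have "closure {x. \<phi> n x \<noteq> 0} \<subseteq> cbox a b" by (rule closure_minimal[OF sub closed_cbox])
    ultimately show "test_fun \<Omega> (\<phi> n)"
      using assms bounded_subset[OF bounded_cbox sub] by (auto simp: test_fun_def)
    fix x
    have "0 \<le> \<phi> n x" unfolding \<phi>_def by (intro prod_nonneg mult_nonneg_nonneg ballI bump_bounds)
    moreover have "\<phi> n x \<le> (\<Prod>i\<in>(UNIV::3 set). 1)" unfolding \<phi>_def
      by (intro prod_mono conjI mult_nonneg_nonneg bump_bounds mult_le_one)
    ultimately show "\<bar>\<phi> n x\<bar> \<le> 1" by simp
  next
    fix x :: "real^3"
    have "(\<lambda>n. \<phi> n x) \<longlonglongrightarrow> (\<Prod>i\<in>UNIV. (if x $ i - a $ i > 0 then 1 else 0) * (if b $ i - x $ i > 0 then 1 else 0))"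
      unfolding \<phi>_def by (intro tendsto_prod tendsto_mult bump_limit)
    moreover have "(\<Prod>i\<in>UNIV. (if x $ i - a $ i > 0 then 1 else 0) * (if b $ i - x $ i > 0 then 1 else 0)) = (indicator (box a b) x :: real)"
    proof (cases "x \<in> box a b")
      case True
      then show ?thesis by (simp add: mem_box_cart)
    next
      case False
      then obtain i where "\<not> (a $ i < x $ i \<and> x $ i < b $ i)" by (auto simp: mem_box_cart)
      then have "(\<Prod>i\<in>UNIV. (if x $ i - a $ i > 0 then 1 else 0) * (if b $ i - x $ i > 0 then 1 else 0)) = (0::real)"
        by (intro prod_zero) (auto intro!: exI[of _ i])
      then show ?thesis using False by simp
    qed
    ultimately show "(\<lambda>n. \<phi> n x) \<longlonglongrightarrow> indicator (box a b) x" by simp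
  qed
qed

text \<open>Dynkin's argument: boxes form an intersection-stable generator of the Borel sets, and
  the sets with zero integral are closed under countable disjoint unions. Closure under complements
  is what the vanishing total integral provides.\<close>

lemma integral_boxes_zero:
  fixes G :: "'a::euclidean_space \<Rightarrow> real"
  assumes G: "integrable lborel G" and z: "integral\<^sup>L lborel G = 0"
    and b: "\<And>c d. (LINT x:box c d|lborel. G x) = 0"
  shows "AE x in lborel. G x = 0"
proof (rule sigma_finite_measure.density_zero[OF lborel.sigma_finite_measure_axioms G])
  fix A :: "'a set" assume "A \<in> sets lborel"
  then have A: "A \<in> sigma_sets UNIV (range (\<lambda>(a, b). box a b))"
    by (simp add: borel_eq_box)
  have ibl: "A \<in> sets borel \<Longrightarrow> integrable lborel (\<lambda>x. indicator A x *\<^sub>R G x)" for A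
    by (rule integrable_mult_indicator[OF _ G]) simp
  have bor: "A \<in> sets borel" if "A \<in> sigma_sets UNIV (range (\<lambda>(a, b). box a b))" for A :: "'a set"
    using that by (simp add: borel_eq_box)
  have ist: "Int_stable (range (\<lambda>(a, b). box a b :: 'a set))" by (auto simp: Int_stable_def box_Int_box)
  have sub: "range (\<lambda>(a, b). box a b :: 'a set) \<subseteq> Pow UNIV" by auto
  from ist sub A show "(LINT x:A|lborel. G x) = 0"
  proof (induction rule: sigma_sets_induct_disjoint)
    case (basic A)
    then show ?case using b by auto
  next
    case empty
    then show ?case by (simp add: set_lebesgue_integral_def)
  next
    case (compl A)
    have "(LINT x:UNIV - A|lborel. G x) = (LINT x|lborel. G x - indicator A x *\<^sub>R G x)"
      unfolding set_lebesgue_integral_def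
      by (rule Bochner_Integration.integral_cong) (auto simp: indicator_def)
    also have "\<dots> = 0" using compl ibl[OF bor] G z by (simp add: set_lebesgue_integral_def)
    finally show ?case .
  next
    case (union A)
    have "(LINT x:(\<Union>i. A i)|lborel. G x) = (\<Sum>i. LINT x:A i|lborel. G x)"
    proof (rule lebesgue_integral_countable_add)
      show "A i \<in> sets lborel" for i using union bor by auto
      then show "set_integrable lborel (\<Union>i. A i) G"
        unfolding set_integrable_def by (intro ibl) auto
      show "\<And>i j. i \<noteq> j \<Longrightarrow> A i \<inter> A j = {}" using union by (auto simp: disjoint_family_on_def)
    qed
    then show ?case using union by simp
  qed
qed

text \<open>Test functions converging boundedly to the indicator of a box show that \<open>g\<close>
  has zero integral over every box whose closed version lies in \<open>\<Omega>\<close>. This forces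
  \<open>g\<close> to vanish on such boxes, and countably many of them, with negligible faces,
  exhaust \<open>\<Omega>\<close>.\<close>

lemma fundamental_lemma:
  fixes g :: "real^3 \<Rightarrow> real"
  assumes \<Omega>: "open \<Omega>" and g: "set_integrable lebesgue \<Omega> g"
    and t: "\<And>\<phi>. test_fun \<Omega> \<phi> \<Longrightarrow> (LINT x:\<Omega>|lebesgue. g x * \<phi> x) = 0"
  shows "AE x in lebesgue. x \<in> \<Omega> \<longrightarrow> g x = 0"
proof -
  have gi: "integrable lebesgue (\<lambda>x. indicator \<Omega> x *\<^sub>R g x)" using g by (simp add: set_integrable_def)
  have gm[measurable]: "(\<lambda>x. indicator \<Omega> x *\<^sub>R g x) \<in> borel_measurable lebesgue" by (rule borel_measurable_integrable[OF gi])
  have sub_eq: "(\<lambda>x. indicator (box a b) x *\<^sub>R g x) = (\<lambda>x. indicator (box a b) x *\<^sub>R (indicator \<Omega> x *\<^sub>R g x))"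
    if "cbox a b \<subseteq> \<Omega>" for a b
    using that box_subset_cbox[of a b] by (auto simp: fun_eq_iff indicator_def)
  have box_zero: "(LINT x:box a b|lebesgue. g x) = 0" if ab: "cbox a b \<subseteq> \<Omega>" for a b
  proof -
    obtain \<phi> where \<phi>: "\<And>n. test_fun \<Omega> (\<phi> n)" "\<And>n x. \<bar>\<phi> n x\<bar> \<le> 1"
      "\<And>x. (\<lambda>n. \<phi> n x) \<longlonglongrightarrow> indicator (box a b) x"
      using test_fun_box_approx[OF ab] by blast
    have [measurable]: "\<phi> n \<in> borel_measurable lebesgue" for n
      using borel_measurable_continuous_onI[OF smooth_continuous[OF test_funD(1)[OF \<phi>(1)]]]
      by (intro measurable_completion) simp
    have "(\<lambda>n. LINT x|lebesgue. indicator \<Omega> x *\<^sub>R (g x * \<phi> n x)) \<longlonglongrightarrow> (LINT x|lebesgue. indicator (box a b) x *\<^sub>R g x)"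
    proof (rule integral_dominated_convergence)
      show "(\<lambda>x. indicator (box a b) x *\<^sub>R g x) \<in> borel_measurable lebesgue"
        unfolding sub_eq[OF ab] by (intro borel_measurable_scaleR borel_measurable_indicator gm) simp
      have "(\<lambda>x. (indicator \<Omega> x *\<^sub>R g x) * \<phi> n x) \<in> borel_measurable lebesgue" for n by measurable
      then show "(\<lambda>x. indicator \<Omega> x *\<^sub>R (g x * \<phi> n x)) \<in> borel_measurable lebesgue" for n
        by (simp add: mult.assoc)
      show "integrable lebesgue (\<lambda>x. norm (indicator \<Omega> x *\<^sub>R g x))" using gi by (rule integrable_norm)
      show "AE x in lebesgue. (\<lambda>n. indicator \<Omega> x *\<^sub>R (g x * \<phi> n x)) \<longlonglongrightarrow> indicator (box a b) x *\<^sub>R g x"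
      proof (intro always_eventually allI)
        fix x
        have "(\<lambda>n. indicator \<Omega> x *\<^sub>R (g x * \<phi> n x)) \<longlonglongrightarrow> indicator \<Omega> x *\<^sub>R (g x * indicator (box a b) x)"
          by (intro tendsto_intros \<phi>)
        moreover have "indicator \<Omega> x *\<^sub>R (g x * indicator (box a b) x) = indicator (box a b) x *\<^sub>R g x"
          using ab box_subset_cbox[of a b] by (auto simp: indicator_def)
        ultimately show "(\<lambda>n. indicator \<Omega> x *\<^sub>R (g x * \<phi> n x)) \<longlonglongrightarrow> indicator (box a b) x *\<^sub>R g x"
          by (simp only:)
      qed
      show "AE x in lebesgue. norm (indicator \<Omega> x *\<^sub>R (g x * \<phi> n x)) \<le> norm (indicator \<Omega> x *\<^sub>R g x)" for n
        using \<phi>(2)[of n] by (intro always_eventually allI) (auto simp: abs_mult indicator_def mult_left_le)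
    qed
    moreover have "(LINT x|lebesgue. indicator \<Omega> x *\<^sub>R (g x * \<phi> n x)) = 0" for n
      using t[OF \<phi>(1)] by (simp add: set_lebesgue_integral_def)
    ultimately show ?thesis
      using LIMSEQ_unique[OF _ tendsto_const] by (simp add: set_lebesgue_integral_def)
  qed
  have on_box: "AE x in lebesgue. x \<in> box a b \<longrightarrow> g x = 0" if ab: "cbox a b \<subseteq> \<Omega>" for a b
  proof -
    define G where "G x = indicator (box a b) x *\<^sub>R g x" for x
    have Gi: "integrable lebesgue G"
      unfolding G_def[abs_def] sub_eq[OF ab] by (rule integrable_mult_indicator[OF _ gi]) simp
    \<comment> \<open>A Borel representative is taken because the generator argument lives on Borel
      sets, whereas \<open>g\<close> is only Lebesgue measurable.\<close>
    obtain G' where G'[measurable]: "G' \<in> borel_measurable lborel" and eq: "AE x in lborel. G x = G' x"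
      using completion_ex_borel_measurable_real[OF borel_measurable_integrable[OF Gi]] by blast
    have eqc: "AE x in lebesgue. G x = G' x" using eq by (rule AE_completion)
    have G'm: "G' \<in> borel_measurable lebesgue" by (rule measurable_completion[OF G'])
    have G'i: "integrable lebesgue G'"
      using Gi integrable_cong_AE[OF borel_measurable_integrable[OF Gi] G'm eqc] by simp
    have "AE x in lborel. G' x = 0"
    proof (rule integral_boxes_zero)
      show "integrable lborel G'" using G'i by (simp add: integrable_completion)
      have set: "(LINT x:A|lborel. G' x) = (LINT x:A|lebesgue. G x)" if "A \<in> sets borel" for A
      proof -
        have [measurable]: "A \<in> sets borel" by fact
        have "(LINT x:A|lborel. G' x) = (LINT x|lebesgue. indicator A x *\<^sub>R G' x)"
          unfolding set_lebesgue_integral_def by (rule integral_completion[symmetric]) measurable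
        also have "\<dots> = (LINT x|lebesgue. indicator A x *\<^sub>R G x)"
        proof (rule integral_cong_AE)
          show "AE x in lebesgue. indicator A x *\<^sub>R G' x = indicator A x *\<^sub>R G x" using eqc by auto
          show "(\<lambda>x. indicator A x *\<^sub>R G' x) \<in> borel_measurable lebesgue"
            by (rule measurable_completion) measurable
          show "(\<lambda>x. indicator A x *\<^sub>R G x) \<in> borel_measurable lebesgue"
            using integrable_mult_indicator[OF _ Gi, of A] that by (auto intro: borel_measurable_integrable)
        qed
        finally show ?thesis by (simp add: set_lebesgue_integral_def)
      qed
      show b0: "(LINT x:box c d|lborel. G' x) = 0" for c d
      proof -
        obtain e f where ef: "box c d \<inter> box a b = box e f" "cbox e f \<subseteq> cbox a b"
        proof
          show "box c d \<inter> box a b = box (\<chi> i. max (c $ i) (a $ i)) (\<chi> i. min (d $ i) (b $ i))"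
            by (auto simp: mem_box_cart)
          show "cbox (\<chi> i. max (c $ i) (a $ i)) (\<chi> i. min (d $ i) (b $ i)) \<subseteq> cbox a b"
            by (auto simp: mem_box_cart)
        qed
        have "(LINT x:box c d|lborel. G' x) = (LINT x:box c d|lebesgue. G x)" by (rule set) simp
        also have "\<dots> = (LINT x:box c d \<inter> box a b|lebesgue. g x)"
          unfolding set_lebesgue_integral_def G_def
          by (rule Bochner_Integration.integral_cong) (auto simp: indicator_def)
        also have "\<dots> = 0" unfolding ef(1) by (rule box_zero) (use ef(2) ab in auto)
        finally show ?thesis .
      qed
      have "integral\<^sup>L lborel G' = (LINT x:UNIV|lborel. G' x)" by (simp add: set_lebesgue_integral_def)
      also have "\<dots> = (LINT x:UNIV|lebesgue. G x)" by (rule set) simp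
      also have "\<dots> = (LINT x:box a b|lebesgue. g x)" by (simp add: set_lebesgue_integral_def G_def)
      finally show "integral\<^sup>L lborel G' = 0" using box_zero[OF ab] by simp
    qed
    then have "AE x in lebesgue. G' x = 0" by (rule AE_completion)
    with eqc show ?thesis by eventually_elim (auto simp: G_def)
  qed
  obtain \<D> where \<D>: "countable \<D>" "\<D> \<subseteq> Pow \<Omega>" "\<And>X. X \<in> \<D> \<Longrightarrow> \<exists>a b. X = cbox a b" "\<Union>\<D> = \<Omega>"
    using open_countable_Union_open_cbox[OF \<Omega>] by metis
  have "AE x in lebesgue. x \<in> X \<longrightarrow> g x = 0" if X: "X \<in> \<D>" for X
  proof -
    obtain a b where ab: "X = cbox a b" using \<D>(3)[OF X] by blast
    have "AE x in lebesgue. x \<notin> cbox a b - box a b"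
      by (rule AE_not_in) (simp add: negligible_iff_null_sets[symmetric] negligible_frontier_interval)
    moreover have "AE x in lebesgue. x \<in> box a b \<longrightarrow> g x = 0" by (rule on_box) (use \<D>(2) X ab in auto)
    ultimately show ?thesis unfolding ab by eventually_elim auto
  qed
  then have "AE x in lebesgue. \<forall>X\<in>\<D>. x \<in> X \<longrightarrow> g x = 0"
    by (subst AE_ball_countable[OF \<D>(1)]) (rule ballI)
  then show ?thesis
  proof eventually_elim
    case (elim x)
    then show ?case using \<D>(4) by blast
  qed
qed

section \<open>Sobolev and Poincare inequalities\<close>

lemma ennreal_le_of_sq_le:
  fixes x y :: ennreal
  assumes "x\<^sup>2 \<le> y\<^sup>2" shows "x \<le> y"
proof (cases x; cases y)
  fix r s assume rs: "x = ennreal r" "0 \<le> r" "y = ennreal s" "0 \<le> s"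
  then have "r\<^sup>2 \<le> s\<^sup>2" using assms by (simp add: ennreal_power)
  then show "x \<le> y" using rs power2_le_imp_le[of r s] by (simp add: ennreal_leI)
next
  fix s assume "x = top" "y = ennreal s" "0 \<le> s"
  then show "x \<le> y" using assms by (simp add: power2_eq_square ennreal_mult[symmetric] top_unique)
qed auto

text \<open>\<open>a\<close> and \<open>b\<close> play the role of squares; in this shape the
  inequality can be iterated one coordinate at a time. Vanishing and infinite integrals are treated
  apart, as the square roots of \<open>a\<close> and \<open>b\<close> are formed through real
  numbers.\<close>

lemma nn_integral_Cauchy_Schwarz:
  fixes g a b :: "'a \<Rightarrow> ennreal"
  assumes [measurable]: "g \<in> borel_measurable M" "a \<in> borel_measurable M" "b \<in> borel_measurable M"
    and le: "\<And>x. (g x)\<^sup>2 \<le> a x * b x"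
  shows "(\<integral>\<^sup>+x. g x \<partial>M)\<^sup>2 \<le> (\<integral>\<^sup>+x. a x \<partial>M) * (\<integral>\<^sup>+x. b x \<partial>M)"
proof -
  have zero: "(\<integral>\<^sup>+x. g x \<partial>M) = 0" if "(\<integral>\<^sup>+x. a x \<partial>M) = 0 \<or> (\<integral>\<^sup>+x. b x \<partial>M) = 0"
  proof -
    have "AE x in M. a x = 0 \<or> b x = 0"
      using that by (auto simp: nn_integral_0_iff_AE elim: eventually_mono)
    then have "AE x in M. g x = 0"
    proof eventually_elim
      case (elim x)
      then have "(g x)\<^sup>2 \<le> 0" using le[of x] by auto
      then show ?case by simp
    qed
    then show ?thesis by (simp add: nn_integral_0_iff_AE)
  qed
  show ?thesis
  proof (cases "(\<integral>\<^sup>+x. a x \<partial>M) = 0 \<or> (\<integral>\<^sup>+x. b x \<partial>M) = 0")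
    case True
    then show ?thesis using zero by simp
  next
    case nz: False
    show ?thesis
    proof (cases "(\<integral>\<^sup>+x. a x \<partial>M) = \<infinity> \<or> (\<integral>\<^sup>+x. b x \<partial>M) = \<infinity>")
      case True
      then have "(\<integral>\<^sup>+x. a x \<partial>M) * (\<integral>\<^sup>+x. b x \<partial>M) = \<infinity>"
        using nz by (auto simp: ennreal_mult_eq_top_iff)
      then show ?thesis by simp
    next
      case False
      define a' where "a' x = ennreal (sqrt (enn2real (a x)))" for x
      define b' where "b' x = ennreal (sqrt (enn2real (b x)))" for x
      have [measurable]: "a' \<in> borel_measurable M" "b' \<in> borel_measurable M" unfolding a'_def b'_def by measurable
      have fa: "AE x in M. a x \<noteq> \<infinity>" "AE x in M. b x \<noteq> \<infinity>"
        by (rule nn_integral_PInf_AE; use False in simp)+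
      have sq: "(ennreal (sqrt (enn2real c)))\<^sup>2 = c" if "c \<noteq> \<infinity>" for c
        using that by (cases c) (auto simp: ennreal_power)
      have aeq: "AE x in M. (a' x)\<^sup>2 = a x" using fa(1) by eventually_elim (auto simp: a'_def sq)
      have beq: "AE x in M. (b' x)\<^sup>2 = b x" using fa(2) by eventually_elim (auto simp: b'_def sq)
      have "AE x in M. g x \<le> a' x * b' x"
        using aeq beq
      proof eventually_elim
        case (elim x)
        then have "(g x)\<^sup>2 \<le> (a' x * b' x)\<^sup>2" using le[of x] by (simp add: power_mult_distrib)
        then show ?case by (rule ennreal_le_of_sq_le)
      qed
      then have "(\<integral>\<^sup>+x. g x \<partial>M)\<^sup>2 \<le> (\<integral>\<^sup>+x. a' x * b' x \<partial>M)\<^sup>2"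
        by (intro power_mono nn_integral_mono_AE) auto
      also have "\<dots> \<le> (\<integral>\<^sup>+x. (a' x)\<^sup>2 \<partial>M) * (\<integral>\<^sup>+x. (b' x)\<^sup>2 \<partial>M)"
        by (rule Cauchy_Schwarz_nn_integral) measurable
      also have "\<dots> = (\<integral>\<^sup>+x. a x \<partial>M) * (\<integral>\<^sup>+x. b x \<partial>M)"
        using nn_integral_cong_AE[OF aeq] nn_integral_cong_AE[OF beq] by simp
      finally show ?thesis .
    qed
  qed
qed

section \<open>Integration by coordinates and the Loomis-Whitney inequality\<close>

definition vec3 :: "real \<Rightarrow> real \<Rightarrow> real \<Rightarrow> real^3" where
  "vec3 x y z = x *\<^sub>R axis 1 1 + (y *\<^sub>R axis 2 1 + z *\<^sub>R axis 3 1)"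

lemma vec3_nth [simp]: "vec3 x y z $ 1 = x" "vec3 x y z $ 2 = y" "vec3 x y z $ 3 = z"
  by (auto simp: vec3_def axis_def)

lemma vec3_measurable [measurable (raw)]:
  assumes "f \<in> borel_measurable M" "g \<in> borel_measurable M" "h \<in> borel_measurable M"
  shows "(\<lambda>w. vec3 (f w) (g w) (h w)) \<in> borel_measurable M"
  unfolding vec3_def
  by (intro borel_measurable_add borel_measurable_scaleR borel_measurable_const assms)

text \<open>Lebesgue measure is determined by its values on boxes, and the preimage of a box under
  \<open>vec3\<close> is a product of three intervals.\<close>

lemma lborel_vec3:
  "(lborel :: (real^3) measure) = distr (lborel \<Otimes>\<^sub>M (lborel \<Otimes>\<^sub>M lborel)) borel (\<lambda>(x, y, z). vec3 x y z)"
proof (rule lborel_eqI)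
  fix l u :: "real^3" assume le: "\<And>b. b \<in> Basis \<Longrightarrow> l \<bullet> b \<le> u \<bullet> b"
  have le': "l $ i \<le> u $ i" for i using le[of "axis i 1"] by (simp add: inner_axis axis_in_Basis_iff)
  have "(\<lambda>(x, y, z). vec3 x y z) -` box l u = {l$1<..<u$1} \<times> ({l$2<..<u$2} \<times> {l$3<..<u$3})"
    by (auto simp: mem_box_cart forall_3)
  then have "emeasure (distr (lborel \<Otimes>\<^sub>M (lborel \<Otimes>\<^sub>M lborel)) borel (\<lambda>(x, y, z). vec3 x y z)) (box l u)
    = emeasure (lborel \<Otimes>\<^sub>M (lborel \<Otimes>\<^sub>M lborel)) ({l$1<..<u$1} \<times> ({l$2<..<u$2} \<times> {l$3<..<u$3}))"
    by (subst emeasure_distr) (auto simp: space_pair_measure)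
  also have "\<dots> = ennreal (u$1 - l$1) * (ennreal (u$2 - l$2) * ennreal (u$3 - l$3))"
  proof -
    have "emeasure (lborel \<Otimes>\<^sub>M (lborel \<Otimes>\<^sub>M lborel)) ({l$1<..<u$1} \<times> ({l$2<..<u$2} \<times> {l$3<..<u$3}))
       = emeasure lborel {l$1<..<u$1} * emeasure (lborel \<Otimes>\<^sub>M lborel) ({l$2<..<u$2} \<times> {l$3<..<u$3})"
      unfolding lborel_prod
      by (subst lborel_prod[symmetric], rule lborel.emeasure_pair_measure_Times) (auto simp: borel_prod[symmetric])
    moreover have "emeasure (lborel \<Otimes>\<^sub>M lborel) ({l$2<..<u$2} \<times> {l$3<..<u$3}) = emeasure lborel {l$2<..<u$2} * emeasure lborel {l$3<..<u$3}"
      by (rule lborel.emeasure_pair_measure_Times) auto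
    ultimately show ?thesis using le' by simp
  qed
  also have "\<dots> = ennreal (\<Prod>b\<in>Basis. (u - l) \<bullet> b)"
  proof -
    have "(\<Prod>b\<in>Basis. (u - l) \<bullet> b) = (\<Prod>i\<in>UNIV. (u - l) $ i)"
    proof (rule prod.reindex_cong[of "\<lambda>i. axis i (1::real)"])
      show "inj_on (\<lambda>i. axis i (1::real) :: real^3) UNIV" by (auto simp: inj_on_def axis_eq_axis)
      show "(Basis :: (real^3) set) = range (\<lambda>i. axis i 1)" by (auto simp: Basis_vec_def)
    qed (simp add: inner_axis)
    also have "\<dots> = (u$1 - l$1) * ((u$2 - l$2) * (u$3 - l$3))" unfolding UNIV_3 by simp
    finally have eq: "(\<Prod>b\<in>Basis. (u - l) \<bullet> b) = (u$1 - l$1) * ((u$2 - l$2) * (u$3 - l$3))" .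
    have "0 \<le> u $ i - l $ i" for i using le'[of i] by simp
    then show ?thesis unfolding eq by (simp only: ennreal_mult mult_nonneg_nonneg)
  qed
  finally show "emeasure (distr (lborel \<Otimes>\<^sub>M (lborel \<Otimes>\<^sub>M lborel)) borel (\<lambda>(x, y, z). vec3 x y z)) (box l u) = ennreal (\<Prod>b\<in>Basis. (u - l) \<bullet> b)" .
qed simp

lemma nn_integral_vec3:
  assumes [measurable]: "h \<in> borel_measurable borel"
  shows "(\<integral>\<^sup>+v. h v \<partial>lborel) = (\<integral>\<^sup>+x. \<integral>\<^sup>+y. \<integral>\<^sup>+z. h (vec3 x y z) \<partial>lborel \<partial>lborel \<partial>lborel)"
proof -
  have "(\<integral>\<^sup>+v. h v \<partial>lborel) = (\<integral>\<^sup>+p. h (case p of (x, y, z) \<Rightarrow> vec3 x y z) \<partial>(lborel \<Otimes>\<^sub>M (lborel \<Otimes>\<^sub>M lborel)))"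
    by (subst lborel_vec3, subst nn_integral_distr) auto
  also have "\<dots> = (\<integral>\<^sup>+x. \<integral>\<^sup>+q. h (case (x, q) of (x, y, z) \<Rightarrow> vec3 x y z) \<partial>(lborel \<Otimes>\<^sub>M lborel) \<partial>lborel)"
  proof -
    have sf: "sigma_finite_measure (lborel \<Otimes>\<^sub>M lborel :: (real \<times> real) measure)"
      unfolding lborel_prod by (rule lborel.sigma_finite_measure_axioms)
    show ?thesis
      by (rule sigma_finite_measure.nn_integral_fst[OF sf, symmetric]) measurable
  qed
  also have "\<dots> = (\<integral>\<^sup>+x. \<integral>\<^sup>+y. \<integral>\<^sup>+z. h (vec3 x y z) \<partial>lborel \<partial>lborel \<partial>lborel)"
  proof (rule nn_integral_cong)
    fix x :: real
    show "(\<integral>\<^sup>+q. h (case (x, q) of (x, y, z) \<Rightarrow> vec3 x y z) \<partial>(lborel \<Otimes>\<^sub>M lborel)) = (\<integral>\<^sup>+y. \<integral>\<^sup>+z. h (vec3 x y z) \<partial>lborel \<partial>lborel)"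
      by (subst lborel.nn_integral_fst[symmetric]) auto
  qed
  finally show ?thesis .
qed

text \<open>Cauchy-Schwarz in \<open>z\<close>, then \<open>y\<close>, then \<open>x\<close>. Each
  of the three factors omits one variable: in the first step \<open>c\<close> is constant while the
  integrals of \<open>a\<close> and \<open>b\<close> split off, and the later steps separate what
  remains in the same way.\<close>

lemma Loomis_Whitney:
  fixes K :: "real^3 \<Rightarrow> ennreal" and a b c :: "real \<Rightarrow> real \<Rightarrow> ennreal"
  assumes [measurable]: "K \<in> borel_measurable borel"
    "case_prod a \<in> borel_measurable (lborel \<Otimes>\<^sub>M lborel)" "case_prod b \<in> borel_measurable (lborel \<Otimes>\<^sub>M lborel)"
    "case_prod c \<in> borel_measurable (lborel \<Otimes>\<^sub>M lborel)"
    and le: "\<And>x y z. (K (vec3 x y z))\<^sup>2 \<le> a y z * b x z * c x y"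
  shows "(\<integral>\<^sup>+x. \<integral>\<^sup>+y. \<integral>\<^sup>+z. K (vec3 x y z) \<partial>lborel \<partial>lborel \<partial>lborel)\<^sup>2 \<le>
    (\<integral>\<^sup>+y. \<integral>\<^sup>+z. a y z \<partial>lborel \<partial>lborel) * (\<integral>\<^sup>+x. \<integral>\<^sup>+z. b x z \<partial>lborel \<partial>lborel) * (\<integral>\<^sup>+x. \<integral>\<^sup>+y. c x y \<partial>lborel \<partial>lborel)"
proof -
  define A where "A y = (\<integral>\<^sup>+z. a y z \<partial>lborel)" for y
  define B where "B x = (\<integral>\<^sup>+z. b x z \<partial>lborel)" for x
  define C where "C x = (\<integral>\<^sup>+y. c x y \<partial>lborel)" for x
  have [measurable]: "A \<in> borel_measurable borel" "B \<in> borel_measurable borel" "C \<in> borel_measurable borel"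
    unfolding A_def[abs_def] B_def[abs_def] C_def[abs_def] by measurable
  have 1: "(\<integral>\<^sup>+z. K (vec3 x y z) \<partial>lborel)\<^sup>2 \<le> (c x y * A y) * B x" for x y
  proof -
    have "(\<integral>\<^sup>+z. K (vec3 x y z) \<partial>lborel)\<^sup>2 \<le> (\<integral>\<^sup>+z. c x y * a y z \<partial>lborel) * (\<integral>\<^sup>+z. b x z \<partial>lborel)"
      by (rule nn_integral_Cauchy_Schwarz) (use le[of x y] in \<open>auto simp: mult_ac\<close>)
    also have "(\<integral>\<^sup>+z. c x y * a y z \<partial>lborel) = c x y * A y"
      unfolding A_def by (rule nn_integral_cmult) measurable
    finally show ?thesis by (simp add: B_def)
  qed
  define AA where "AA = (\<integral>\<^sup>+y. A y \<partial>lborel)"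
  have 2: "(\<integral>\<^sup>+y. \<integral>\<^sup>+z. K (vec3 x y z) \<partial>lborel \<partial>lborel)\<^sup>2 \<le> C x * (AA * B x)" for x
  proof -
    have "(\<integral>\<^sup>+y. \<integral>\<^sup>+z. K (vec3 x y z) \<partial>lborel \<partial>lborel)\<^sup>2 \<le> (\<integral>\<^sup>+y. c x y \<partial>lborel) * (\<integral>\<^sup>+y. A y * B x \<partial>lborel)"
      by (rule nn_integral_Cauchy_Schwarz) (use 1[of x] in \<open>auto simp: mult_ac\<close>)
    also have "(\<integral>\<^sup>+y. A y * B x \<partial>lborel) = AA * B x"
      unfolding AA_def by (rule nn_integral_multc) measurable
    finally show ?thesis by (simp add: C_def)
  qed
  have "(\<integral>\<^sup>+x. \<integral>\<^sup>+y. \<integral>\<^sup>+z. K (vec3 x y z) \<partial>lborel \<partial>lborel \<partial>lborel)\<^sup>2 \<le> (\<integral>\<^sup>+x. C x \<partial>lborel) * (\<integral>\<^sup>+x. AA * B x \<partial>lborel)"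
    by (rule nn_integral_Cauchy_Schwarz; (rule 2 | measurable))
  also have "(\<integral>\<^sup>+x. AA * B x \<partial>lborel) = AA * (\<integral>\<^sup>+x. B x \<partial>lborel)"
    by (rule nn_integral_cmult) measurable
  finally show ?thesis by (simp add: AA_def A_def B_def C_def mult_ac)
qed

lemma nn_integral_translate:
  fixes h :: "'a::euclidean_space \<Rightarrow> ennreal"
  assumes "h \<in> borel_measurable borel"
  shows "(\<integral>\<^sup>+s. h (c + s) \<partial>lborel) = (\<integral>\<^sup>+s. h s \<partial>lborel)"
proof -
  have "(\<integral>\<^sup>+s. h s \<partial>lborel) = (\<integral>\<^sup>+s. h s \<partial>(distr lborel borel ((+) c)))" by (simp add: lborel_distr_plus)
  also have "\<dots> = (\<integral>\<^sup>+s. h (c + s) \<partial>lborel)" using assms by (subst nn_integral_distr) auto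
  finally show ?thesis by simp
qed

lemma integral_le_nn_integral:
  fixes k :: "real \<Rightarrow> real"
  assumes "continuous_on UNIV k"
  shows "ennreal \<bar>integral {a..b} k\<bar> \<le> (\<integral>\<^sup>+s. indicator {a..b} s * ennreal \<bar>k s\<bar> \<partial>lborel)"
proof -
  have si: "set_integrable lborel {a..b} k"
    by (rule borel_integrable_atLeastAtMost'[OF continuous_on_subset[OF assms]]) simp
  have "integral {a..b} k = (LINT s|lborel. indicator {a..b} s *\<^sub>R k s)"
    using set_borel_integral_eq_integral(2)[OF si] by (simp add: set_lebesgue_integral_def)
  then have "ennreal \<bar>integral {a..b} k\<bar> \<le> (\<integral>\<^sup>+s. ennreal (norm (indicator {a..b} s *\<^sub>R k s)) \<partial>lborel)"
    using integral_norm_bound_ennreal[of lborel "\<lambda>s. indicator {a..b} s *\<^sub>R k s"] si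
    by (simp add: set_integrable_def)
  also have "\<dots> = (\<integral>\<^sup>+s. indicator {a..b} s * ennreal \<bar>k s\<bar> \<partial>lborel)"
    by (rule nn_integral_cong) (auto simp: indicator_def)
  finally show ?thesis .
qed

text \<open>The line through \<open>v\<close> in direction \<open>e\<close> leaves the support, so
  the value at \<open>v\<close> is minus an integral of the directional derivative; enlarging the
  domain to the whole line removes the dependence on the endpoint.\<close>

lemma compact_support_line_bound:
  fixes f :: "real^'n::finite \<Rightarrow> real"
  assumes f: "smooth f" and b: "bounded {x. f x \<noteq> 0}" and e: "norm e = 1"
  shows "ennreal \<bar>f v\<bar> \<le> (\<integral>\<^sup>+s. ennreal \<bar>e \<bullet> grad f (v + s *\<^sub>R e)\<bar> \<partial>lborel)"
proof -
  obtain r where r: "\<And>x. f x \<noteq> 0 \<Longrightarrow> norm x \<le> r" using b by (auto simp: bounded_iff)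
  define T where "T = \<bar>r\<bar> + norm v + 1"
  have "norm (v + T *\<^sub>R e) \<ge> T - norm v"
    using norm_triangle_ineq2[of "T *\<^sub>R e" "- v"] e by (simp add: T_def add.commute)
  then have "norm (v + T *\<^sub>R e) > r" by (simp add: T_def)
  then have "f (v + T *\<^sub>R e) = 0" using r by fastforce
  then have "integral {0..T} (\<lambda>s. e \<bullet> grad f (v + s *\<^sub>R e)) = - f v"
    using line_FTC[OF f, of T e v] by (simp add: T_def)
  then have "ennreal \<bar>f v\<bar> = ennreal \<bar>integral {0..T} (\<lambda>s. e \<bullet> grad f (v + s *\<^sub>R e))\<bar>" by simp
  also have "\<dots> \<le> (\<integral>\<^sup>+s. indicator {0..T} s * ennreal \<bar>e \<bullet> grad f (v + s *\<^sub>R e)\<bar> \<partial>lborel)"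
    by (intro integral_le_nn_integral continuous_intros continuous_on_line smooth_grad_continuous f)
  also have "\<dots> \<le> (\<integral>\<^sup>+s. ennreal \<bar>e \<bullet> grad f (v + s *\<^sub>R e)\<bar> \<partial>lborel)"
    by (intro nn_integral_mono) (auto simp: indicator_def)
  finally show ?thesis .
qed

text \<open>Sobolev's inequality from Loomis-Whitney applied to \<open>f ^ 4\<close>.\<close>
lemma Sobolev_6:
  fixes f :: "real^3 \<Rightarrow> real"
  assumes f: "smooth f" and b: "bounded {x. f x \<noteq> 0}"
  shows "(\<integral>\<^sup>+v. ennreal (f v ^ 6) \<partial>lborel) \<le> 4096 * (\<integral>\<^sup>+v. ennreal ((norm (grad f v))\<^sup>2) \<partial>lborel) ^ 3"
proof -
  have cf: "continuous_on UNIV f" and cg: "continuous_on UNIV (grad f)" by (intro smooth_continuous smooth_grad_continuous f)+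
  define H where "H i v = ennreal (4 * \<bar>f v\<bar> ^ 3 * \<bar>partial i f v\<bar>)" for i v
  have [measurable]: "f \<in> borel_measurable borel" "grad f \<in> borel_measurable borel" "\<And>i. partial i f \<in> borel_measurable borel"
    using cf cg smooth_continuous[OF smooth_partial[OF f]] by (auto intro: borel_measurable_continuous_onI)
  have H[measurable]: "H i \<in> borel_measurable borel" for i unfolding H_def by measurable
  have f4: "smooth (\<lambda>x. f x ^ 4)" "bounded {x. f x ^ 4 \<noteq> 0}" using b by (auto intro: smooth_power f)
  have g4: "grad (\<lambda>x. f x ^ 4) x = (4 * f x ^ 3) *\<^sub>R grad f x" for x
    by (rule grad_comp_real) (auto intro!: derivative_eq_intros smooth_differentiable f)
  have line: "ennreal (f v ^ 4) \<le> (\<integral>\<^sup>+s. H i (v + s *\<^sub>R axis i 1) \<partial>lborel)" for v i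
    using compact_support_line_bound[OF f4, of "axis i 1" v]
    by (simp add: g4 H_def abs_mult power_abs)
  have L1: "ennreal (f (vec3 x y z) ^ 4) \<le> (\<integral>\<^sup>+s. H 1 (vec3 s y z) \<partial>lborel)" for x y z
  proof -
    have "ennreal (f (vec3 x y z) ^ 4) \<le> (\<integral>\<^sup>+s. H 1 (vec3 (x + s) y z) \<partial>lborel)"
      using line[of "vec3 x y z" 1] by (simp add: vec3_def algebra_simps)
    also have "\<dots> = (\<integral>\<^sup>+s. H 1 (vec3 s y z) \<partial>lborel)" by (rule nn_integral_translate) measurable
    finally show ?thesis .
  qed
  have L2: "ennreal (f (vec3 x y z) ^ 4) \<le> (\<integral>\<^sup>+s. H 2 (vec3 x s z) \<partial>lborel)" for x y z
  proof -
    have "ennreal (f (vec3 x y z) ^ 4) \<le> (\<integral>\<^sup>+s. H 2 (vec3 x (y + s) z) \<partial>lborel)"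
      using line[of "vec3 x y z" 2] by (simp add: vec3_def algebra_simps)
    also have "\<dots> = (\<integral>\<^sup>+s. H 2 (vec3 x s z) \<partial>lborel)" by (rule nn_integral_translate) measurable
    finally show ?thesis .
  qed
  have L3: "ennreal (f (vec3 x y z) ^ 4) \<le> (\<integral>\<^sup>+s. H 3 (vec3 x y s) \<partial>lborel)" for x y z
  proof -
    have "ennreal (f (vec3 x y z) ^ 4) \<le> (\<integral>\<^sup>+s. H 3 (vec3 x y (z + s)) \<partial>lborel)"
      using line[of "vec3 x y z" 3] by (simp add: vec3_def algebra_simps)
    also have "\<dots> = (\<integral>\<^sup>+s. H 3 (vec3 x y s) \<partial>lborel)" by (rule nn_integral_translate) measurable
    finally show ?thesis .
  qed
  define I where "I = (\<integral>\<^sup>+v. ennreal (f v ^ 6) \<partial>lborel)"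
  define G where "G = (\<integral>\<^sup>+v. ennreal ((norm (grad f v))\<^sup>2) \<partial>lborel)"
  define A where "A i = (\<integral>\<^sup>+v. H i v \<partial>lborel)" for i
  have A1: "A 1 = (\<integral>\<^sup>+y. \<integral>\<^sup>+z. \<integral>\<^sup>+x. H 1 (vec3 x y z) \<partial>lborel \<partial>lborel \<partial>lborel)"
  proof -
    have "A 1 = (\<integral>\<^sup>+x. \<integral>\<^sup>+y. \<integral>\<^sup>+z. H 1 (vec3 x y z) \<partial>lborel \<partial>lborel \<partial>lborel)"
      unfolding A_def by (rule nn_integral_vec3) measurable
    also have "\<dots> = (\<integral>\<^sup>+y. \<integral>\<^sup>+x. \<integral>\<^sup>+z. H 1 (vec3 x y z) \<partial>lborel \<partial>lborel \<partial>lborel)"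
      by (rule lborel_pair.Fubini'[symmetric]) measurable
    also have "\<dots> = (\<integral>\<^sup>+y. \<integral>\<^sup>+z. \<integral>\<^sup>+x. H 1 (vec3 x y z) \<partial>lborel \<partial>lborel \<partial>lborel)"
      by (intro nn_integral_cong lborel_pair.Fubini'[symmetric]) measurable
    finally show ?thesis .
  qed
  have A2: "A 2 = (\<integral>\<^sup>+x. \<integral>\<^sup>+z. \<integral>\<^sup>+y. H 2 (vec3 x y z) \<partial>lborel \<partial>lborel \<partial>lborel)"
  proof -
    have "A 2 = (\<integral>\<^sup>+x. \<integral>\<^sup>+y. \<integral>\<^sup>+z. H 2 (vec3 x y z) \<partial>lborel \<partial>lborel \<partial>lborel)"
      unfolding A_def by (rule nn_integral_vec3) measurable
    also have "\<dots> = (\<integral>\<^sup>+x. \<integral>\<^sup>+z. \<integral>\<^sup>+y. H 2 (vec3 x y z) \<partial>lborel \<partial>lborel \<partial>lborel)"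
      by (intro nn_integral_cong lborel_pair.Fubini'[symmetric]) measurable
    finally show ?thesis .
  qed
  have A3: "A 3 = (\<integral>\<^sup>+x. \<integral>\<^sup>+y. \<integral>\<^sup>+z. H 3 (vec3 x y z) \<partial>lborel \<partial>lborel \<partial>lborel)"
    unfolding A_def by (rule nn_integral_vec3) measurable
  have "I\<^sup>2 \<le> A 1 * A 2 * A 3"
  proof -
    have "I = (\<integral>\<^sup>+x. \<integral>\<^sup>+y. \<integral>\<^sup>+z. ennreal (f (vec3 x y z) ^ 6) \<partial>lborel \<partial>lborel \<partial>lborel)"
      unfolding I_def by (rule nn_integral_vec3) measurable
    \<comment> \<open>The square of \<open>f ^ 6\<close> consists of three copies of
      \<open>f ^ 4\<close>, one for each coordinate direction; the line bound in that direction
      makes the copy independent of one coordinate.\<close>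
    moreover have "(ennreal (f (vec3 x y z) ^ 6))\<^sup>2 \<le> (\<integral>\<^sup>+s. H 1 (vec3 s y z) \<partial>lborel) * (\<integral>\<^sup>+s. H 2 (vec3 x s z) \<partial>lborel) * (\<integral>\<^sup>+s. H 3 (vec3 x y s) \<partial>lborel)" for x y z
    proof -
      let ?f = "f (vec3 x y z)"
      have "(ennreal (?f ^ 6))\<^sup>2 = ennreal (?f ^ 4) * ennreal (?f ^ 4) * ennreal (?f ^ 4)"
        by (simp add: ennreal_power ennreal_mult[symmetric] flip: power_mult power_add)
      also have "\<dots> \<le> (\<integral>\<^sup>+s. H 1 (vec3 s y z) \<partial>lborel) * (\<integral>\<^sup>+s. H 2 (vec3 x s z) \<partial>lborel) * (\<integral>\<^sup>+s. H 3 (vec3 x y s) \<partial>lborel)"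
        by (intro mult_mono L1 L2 L3) auto
      finally show ?thesis .
    qed
    ultimately show ?thesis unfolding A1 A2 A3
      by (simp only:) (rule Loomis_Whitney[where K="\<lambda>v. ennreal (f v ^ 6)"]; measurable)
  qed
  \<comment> \<open>Cauchy-Schwarz returns \<open>I\<close> once in each squared factor; the product
    gives I^4 at most 16^3 I^3 G^3, whence the constant 4096 after cancelling I^3.\<close>
  moreover have A: "(A i)\<^sup>2 \<le> 16 * (I * G)" for i
  proof -
    have "(A i)\<^sup>2 \<le> (\<integral>\<^sup>+v. 16 * ennreal (f v ^ 6) \<partial>lborel) * (\<integral>\<^sup>+v. ennreal ((norm (grad f v))\<^sup>2) \<partial>lborel)"
      unfolding A_def
    proof (rule nn_integral_Cauchy_Schwarz)
      fix v
      have "(partial i f v)\<^sup>2 \<le> (norm (grad f v))\<^sup>2"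
        using component_le_norm_cart[of "grad f v" i] by (simp add: abs_le_square_iff[symmetric])
      then have "16 * f v ^ 6 * (partial i f v)\<^sup>2 \<le> 16 * f v ^ 6 * (norm (grad f v))\<^sup>2"
        by (intro mult_left_mono) auto
      moreover have "(4 * \<bar>f v\<bar> ^ 3 * \<bar>partial i f v\<bar>)\<^sup>2 = 16 * f v ^ 6 * (partial i f v)\<^sup>2"
        by (simp add: power_mult_distrib flip: power_mult)
      ultimately have "ennreal ((4 * \<bar>f v\<bar> ^ 3 * \<bar>partial i f v\<bar>)\<^sup>2) \<le> ennreal (16 * f v ^ 6 * (norm (grad f v))\<^sup>2)"
        by (intro ennreal_leI) simp
      then show "(H i v)\<^sup>2 \<le> 16 * ennreal (f v ^ 6) * ennreal ((norm (grad f v))\<^sup>2)"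
        unfolding H_def by (subst ennreal_power) (auto simp: ennreal_mult simp del: power_mult_distrib)
    qed measurable
    then show ?thesis by (simp add: nn_integral_cmult I_def G_def mult.assoc)
  qed
  ultimately have "(I\<^sup>2)\<^sup>2 \<le> (A 1 * A 2 * A 3)\<^sup>2" by (intro power_mono) auto
  also have "\<dots> \<le> (16 * (I * G)) * (16 * (I * G)) * (16 * (I * G))"
    unfolding power_mult_distrib by (intro mult_mono A) auto
  finally have main: "I ^ 4 \<le> I ^ 3 * (4096 * G ^ 3)"
    by (simp add: power_mult[symmetric] power3_eq_cube mult_ac)
  \<comment> \<open>The cancellation of I^3 is legitimate only for finite \<open>I\<close>, which
    compact support provides.\<close>
  have fin: "I < \<infinity>"
  proof -
    have "integrable lborel (\<lambda>v. f v ^ 6)"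
      by (intro compact_support_integrable continuous_intros cf) (use b in auto)
    then have "(\<integral>\<^sup>+v. ennreal (norm (f v ^ 6)) \<partial>lborel) < \<infinity>" by (simp add: integrable_iff_bounded)
    then show ?thesis by (simp add: I_def)
  qed
  have "I \<le> 4096 * G ^ 3"
  proof (cases "I = 0")
    case False
    have "I ^ 3 * I \<le> I ^ 3 * (4096 * G ^ 3)" using main by (simp add: numeral_eq_Suc mult_ac)
    then show ?thesis
      by (rule ennreal_mult_le_mult_iff[THEN iffD1, rotated 2])
         (use fin False in \<open>cases I; auto simp: ennreal_power\<close>)+
  qed simp
  then show ?thesis by (simp add: I_def G_def)
qed

text \<open>Young's inequality applied to the functions divided by their norms; when a norm is 0 the
  product vanishes almost everywhere.\<close>

lemma Holder_inequality:
  fixes f g :: "'a \<Rightarrow> real"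
  assumes pq: "p > 1" "q > 1" "1/p + 1/q = 1"
    and [measurable]: "f \<in> borel_measurable M" "g \<in> borel_measurable M"
    and fi: "integrable M (\<lambda>x. \<bar>f x\<bar> powr p)" and gi: "integrable M (\<lambda>x. \<bar>g x\<bar> powr q)"
  shows "integrable M (\<lambda>x. f x * g x)"
    and "(LINT x|M. \<bar>f x * g x\<bar>) \<le> (LINT x|M. \<bar>f x\<bar> powr p) powr (1/p) * (LINT x|M. \<bar>g x\<bar> powr q) powr (1/q)"
proof -
  have Y: "\<bar>f x * g x\<bar> \<le> \<bar>f x\<bar> powr p / p + \<bar>g x\<bar> powr q / q" for x
    using Youngs_inequality[OF pq, of "\<bar>f x\<bar>" "\<bar>g x\<bar>"] by (simp add: abs_mult)
  show i: "integrable M (\<lambda>x. f x * g x)"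
    by (rule Bochner_Integration.integrable_bound[of _ "\<lambda>x. \<bar>f x\<bar> powr p / p + \<bar>g x\<bar> powr q / q"])
       (use fi gi Y pq in \<open>auto intro!: always_eventually\<close>)
  define A where "A = (LINT x|M. \<bar>f x\<bar> powr p)"
  define B where "B = (LINT x|M. \<bar>g x\<bar> powr q)"
  have nn: "A \<ge> 0" "B \<ge> 0" by (auto simp: A_def B_def)
  have "(LINT x|M. \<bar>f x * g x\<bar>) \<le> A powr (1/p) * B powr (1/q)"
  proof (cases "A = 0 \<or> B = 0")
    case True
    then have "AE x in M. f x * g x = 0"
    proof
      assume "A = 0"
      then have "AE x in M. \<bar>f x\<bar> powr p = 0"
        using integral_nonneg_eq_0_iff_AE[OF fi] by (simp add: A_def)
      then show ?thesis by eventually_elim auto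
    next
      assume "B = 0"
      then have "AE x in M. \<bar>g x\<bar> powr q = 0"
        using integral_nonneg_eq_0_iff_AE[OF gi] by (simp add: B_def)
      then show ?thesis by eventually_elim auto
    qed
    then have "(LINT x|M. \<bar>f x * g x\<bar>) = (LINT x|M. 0)" by (intro integral_cong_AE) auto
    then show ?thesis by simp
  next
    case False
    then have pos: "A > 0" "B > 0" using nn by auto
    define a where "a = A powr (1/p)"
    define b where "b = B powr (1/q)"
    have ab: "a > 0" "b > 0" "a powr p = A" "b powr q = B" using pos pq by (auto simp: a_def b_def powr_powr)
    have "(LINT x|M. \<bar>f x * g x\<bar>) / (a * b) = (LINT x|M. \<bar>f x * g x\<bar> / (a * b))" by simp
    also have "\<dots> \<le> (LINT x|M. \<bar>f x\<bar> powr p / (A * p) + \<bar>g x\<bar> powr q / (B * q))"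
    proof (rule integral_mono)
      show "integrable M (\<lambda>x. \<bar>f x * g x\<bar> / (a * b))" using i by simp
      show "integrable M (\<lambda>x. \<bar>f x\<bar> powr p / (A * p) + \<bar>g x\<bar> powr q / (B * q))" using fi gi by simp
      fix x
      have "(\<bar>f x\<bar> / a) * (\<bar>g x\<bar> / b) \<le> (\<bar>f x\<bar> / a) powr p / p + (\<bar>g x\<bar> / b) powr q / q"
        using ab by (intro Youngs_inequality[OF pq]) auto
      then show "\<bar>f x * g x\<bar> / (a * b) \<le> \<bar>f x\<bar> powr p / (A * p) + \<bar>g x\<bar> powr q / (B * q)"
        using ab by (simp add: abs_mult powr_divide)
    qed
    also have "\<dots> = A / (A * p) + B / (B * q)" using fi gi by (simp add: A_def B_def)
    also have "\<dots> = 1" using pos pq by simp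
    finally show ?thesis using ab by (simp add: a_def b_def field_simps)
  qed
  then show "(LINT x|M. \<bar>f x * g x\<bar>) \<le> (LINT x|M. \<bar>f x\<bar> powr p) powr (1/p) * (LINT x|M. \<bar>g x\<bar> powr q) powr (1/q)"
    by (simp add: A_def B_def)
qed

text \<open>One factor \<open>T\<close> comes from Cauchy-Schwarz in \<open>s\<close>, the other
  from integrating over \<open>s\<close> after translation invariance has removed the shift by
  \<open>s *\<^sub>R e\<close>.\<close>

lemma line_average_L2:
  fixes k :: "'a::euclidean_space \<Rightarrow> ennreal"
  assumes [measurable]: "k \<in> borel_measurable borel" and "T \<ge> 0"
  shows "(\<integral>\<^sup>+x. (\<integral>\<^sup>+s. indicator {0..T} s * k (x + s *\<^sub>R e) \<partial>lborel)\<^sup>2 \<partial>lborel) \<le> ennreal (T\<^sup>2) * (\<integral>\<^sup>+x. (k x)\<^sup>2 \<partial>lborel)"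
proof -
  have "(\<integral>\<^sup>+s. indicator {0..T} s * k (x + s *\<^sub>R e) \<partial>lborel)\<^sup>2 \<le> ennreal T * (\<integral>\<^sup>+s. indicator {0..T} s * (k (x + s *\<^sub>R e))\<^sup>2 \<partial>lborel)" for x
  proof -
    have "(\<integral>\<^sup>+s. indicator {0..T} s * k (x + s *\<^sub>R e) \<partial>lborel)\<^sup>2 \<le> (\<integral>\<^sup>+s. indicator {0..T} s \<partial>lborel) * (\<integral>\<^sup>+s. indicator {0..T} s * (k (x + s *\<^sub>R e))\<^sup>2 \<partial>lborel)"
      by (rule nn_integral_Cauchy_Schwarz) (auto simp: indicator_def)
    then show ?thesis using assms(2) by (simp add: nn_integral_indicator)
  qed
  then have "(\<integral>\<^sup>+x. (\<integral>\<^sup>+s. indicator {0..T} s * k (x + s *\<^sub>R e) \<partial>lborel)\<^sup>2 \<partial>lborel) \<le> (\<integral>\<^sup>+x. ennreal T * (\<integral>\<^sup>+s. indicator {0..T} s * (k (x + s *\<^sub>R e))\<^sup>2 \<partial>lborel) \<partial>lborel)"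
    by (intro nn_integral_mono)
  also have "\<dots> = ennreal T * (\<integral>\<^sup>+x. \<integral>\<^sup>+s. indicator {0..T} s * (k (x + s *\<^sub>R e))\<^sup>2 \<partial>lborel \<partial>lborel)"
    by (rule nn_integral_cmult) measurable
  also have "(\<integral>\<^sup>+x. \<integral>\<^sup>+s. indicator {0..T} s * (k (x + s *\<^sub>R e))\<^sup>2 \<partial>lborel \<partial>lborel) = (\<integral>\<^sup>+s. \<integral>\<^sup>+x. indicator {0..T} s * (k (x + s *\<^sub>R e))\<^sup>2 \<partial>lborel \<partial>lborel)"
    by (rule lborel_pair.Fubini'[symmetric]) measurable
  also have "\<dots> = (\<integral>\<^sup>+s. indicator {0..T} s * (\<integral>\<^sup>+x. (k x)\<^sup>2 \<partial>lborel) \<partial>lborel)"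
  proof (rule nn_integral_cong)
    fix s :: real
    have "(\<integral>\<^sup>+x. indicator {0..T} s * (k (x + s *\<^sub>R e))\<^sup>2 \<partial>lborel) = indicator {0..T} s * (\<integral>\<^sup>+x. (k (s *\<^sub>R e + x))\<^sup>2 \<partial>lborel)"
      by (subst nn_integral_cmult) (auto simp: add.commute)
    also have "(\<integral>\<^sup>+x. (k (s *\<^sub>R e + x))\<^sup>2 \<partial>lborel) = (\<integral>\<^sup>+x. (k x)\<^sup>2 \<partial>lborel)"
      by (rule nn_integral_translate) measurable
    finally show "(\<integral>\<^sup>+x. indicator {0..T} s * (k (x + s *\<^sub>R e))\<^sup>2 \<partial>lborel) = indicator {0..T} s * (\<integral>\<^sup>+x. (k x)\<^sup>2 \<partial>lborel)" .
  qed
  also have "\<dots> = ennreal T * (\<integral>\<^sup>+x. (k x)\<^sup>2 \<partial>lborel)"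
    using assms(2) by (subst nn_integral_multc) auto
  finally show ?thesis using assms(2) by (simp add: power2_eq_square ennreal_mult mult.assoc)
qed

lemma nn_integral_affine:
  fixes h :: "'a::euclidean_space \<Rightarrow> ennreal"
  assumes "h \<in> borel_measurable borel" "t \<noteq> 0"
  shows "(\<integral>\<^sup>+s. h s \<partial>lborel) = ennreal (\<bar>t\<bar> ^ DIM('a)) * (\<integral>\<^sup>+s. h (b + t *\<^sub>R s) \<partial>lborel)"
  using assms
  by (subst lborel_affine[OF assms(2), of b])
     (simp add: nn_integral_density nn_integral_distr nn_integral_cmult)

text \<open>Averaging over the base point \<open>a\<close>: for \<open>t \<ge> 1/2\<close> change variables in \<open>x\<close>, otherwise in \<open>a\<close>.\<close>
lemma Poincare_ball:
  fixes f :: "real^3 \<Rightarrow> real"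
  assumes f: "smooth f" and \<rho>: "\<rho> > 0"
  shows "\<exists>m. (\<integral>\<^sup>+x. indicator (ball c \<rho>) x * ennreal ((f x - m)\<^sup>2) \<partial>lborel) \<le>
    ennreal (64 * \<rho>\<^sup>2) * (\<integral>\<^sup>+x. indicator (ball c \<rho>) x * ennreal ((norm (grad f x))\<^sup>2) \<partial>lborel)"
proof -
  let ?U = "ball c \<rho>"
  have [measurable]: "f \<in> borel_measurable borel" "grad f \<in> borel_measurable borel"
    by (intro borel_measurable_continuous_onI smooth_continuous smooth_grad_continuous f)+
  have [measurable]: "?U \<in> sets borel" by simp
  define q where "q v = indicator ?U v * ennreal (4 * \<rho>\<^sup>2 * (norm (grad f v))\<^sup>2)" for v
  have [measurable]: "q \<in> borel_measurable borel" unfolding q_def by measurable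
  define Q where "Q = (\<integral>\<^sup>+v. q v \<partial>lborel)"
  define h where "h a = (\<integral>\<^sup>+x. indicator ?U x * ennreal ((f x - f a)\<^sup>2) \<partial>lborel)" for a
  have [measurable]: "h \<in> borel_measurable borel" unfolding h_def by measurable
  define I :: "real \<Rightarrow> ennreal" where "I = indicator {0..1}"
  have [measurable]: "I \<in> borel_measurable borel" unfolding I_def by measurable
  \<comment> \<open>The difference of two values is the integral of the derivative along the
    segment, which stays in the convex ball; its length, at most \<open>2 * \<rho>\<close>, accounts
    for the factor \<open>4 * \<rho>\<^sup>2\<close> in \<open>q\<close>.\<close>
  have pw: "ennreal ((f x - f a)\<^sup>2) \<le> (\<integral>\<^sup>+t. I t * q (a + t *\<^sub>R (x - a)) \<partial>lborel)" if "x \<in> ?U" "a \<in> ?U" for x a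
  proof -
    let ?k = "\<lambda>t. (x - a) \<bullet> grad f (a + t *\<^sub>R (x - a))"
    have ck: "continuous_on UNIV ?k" by (intro continuous_intros continuous_on_line smooth_grad_continuous f)
    then have [measurable]: "?k \<in> borel_measurable borel" by (rule borel_measurable_continuous_onI)
    have "f x - f a = integral {0..1} ?k" using line_FTC[OF f, of 1 "x - a" a] by simp
    then have "ennreal \<bar>f x - f a\<bar> \<le> (\<integral>\<^sup>+t. I t * ennreal \<bar>?k t\<bar> \<partial>lborel)"
      using integral_le_nn_integral[OF ck, of 0 1] by (simp add: I_def)
    then have "(ennreal \<bar>f x - f a\<bar>)\<^sup>2 \<le> (\<integral>\<^sup>+t. I t * ennreal \<bar>?k t\<bar> \<partial>lborel)\<^sup>2" by (intro power_mono) auto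
    also have "\<dots> \<le> (\<integral>\<^sup>+t. I t \<partial>lborel) * (\<integral>\<^sup>+t. I t * (ennreal \<bar>?k t\<bar>)\<^sup>2 \<partial>lborel)"
      by (rule nn_integral_Cauchy_Schwarz) (auto simp: I_def indicator_def)
    also have "(\<integral>\<^sup>+t. I t \<partial>lborel) = 1" by (simp add: I_def nn_integral_indicator)
    also have "1 * (\<integral>\<^sup>+t. I t * (ennreal \<bar>?k t\<bar>)\<^sup>2 \<partial>lborel) \<le> (\<integral>\<^sup>+t. I t * q (a + t *\<^sub>R (x - a)) \<partial>lborel)"
    proof (simp, rule nn_integral_mono)
      fix t :: real
      show "I t * (ennreal \<bar>?k t\<bar>)\<^sup>2 \<le> I t * q (a + t *\<^sub>R (x - a))"
      proof (cases "t \<in> {0..1}")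
        case True
        have "(1 - t) *\<^sub>R a + t *\<^sub>R x \<in> ?U"
          using convexD_alt[OF convex_ball that(2,1), of t] True by simp
        then have inU: "a + t *\<^sub>R (x - a) \<in> ?U" by (simp add: algebra_simps)
        have "norm (x - a) \<le> 2 * \<rho>"
          using that dist_triangle[of x a c] by (simp add: dist_norm[symmetric] dist_commute)
        then have "\<bar>?k t\<bar> \<le> 2 * \<rho> * norm (grad f (a + t *\<^sub>R (x - a)))"
          using Cauchy_Schwarz_ineq2[of "x - a" "grad f (a + t *\<^sub>R (x - a))"]
          by (meson mult_right_mono norm_ge_zero order_trans)
        then have "\<bar>?k t\<bar>\<^sup>2 \<le> (2 * \<rho> * norm (grad f (a + t *\<^sub>R (x - a))))\<^sup>2" by (intro power_mono) auto
        then have "\<bar>?k t\<bar>\<^sup>2 \<le> 4 * \<rho>\<^sup>2 * (norm (grad f (a + t *\<^sub>R (x - a))))\<^sup>2" by (simp add: power_mult_distrib)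
        then show ?thesis using inU by (simp add: q_def ennreal_power ennreal_leI mult_left_mono)
      qed (simp add: I_def)
    qed
    finally show ?thesis by (simp add: ennreal_power)
  qed
  \<comment> \<open>The Jacobian \<open>t ^ 3\<close> is at least 1/8 here, which is the origin of
    the factor 8.\<close>
  have aff: "(\<integral>\<^sup>+x. q (b + t *\<^sub>R x) \<partial>lborel) \<le> 8 * Q" if t: "t \<ge> 1/2" for b t
  proof -
    have "Q = ennreal (t ^ 3) * (\<integral>\<^sup>+x. q (b + t *\<^sub>R x) \<partial>lborel)"
      unfolding Q_def using nn_integral_affine[of q t b] t by simp
    then have "8 * Q = ennreal (8 * t ^ 3) * (\<integral>\<^sup>+x. q (b + t *\<^sub>R x) \<partial>lborel)"
      using t by (simp add: ennreal_mult mult.assoc)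
    moreover have "1 \<le> 8 * t ^ 3" using power_mono[OF t, of 3] by (simp add: power_divide)
    then have "1 * (\<integral>\<^sup>+x. q (b + t *\<^sub>R x) \<partial>lborel) \<le> ennreal (8 * t ^ 3) * (\<integral>\<^sup>+x. q (b + t *\<^sub>R x) \<partial>lborel)"
      by (intro mult_right_mono) (auto simp: ennreal_1[symmetric] simp del: ennreal_1 intro!: ennreal_leI)
    ultimately show ?thesis by simp
  qed
  let ?i = "indicator ?U :: real^3 \<Rightarrow> ennreal"
  have tslice: "(\<integral>\<^sup>+a. \<integral>\<^sup>+x. ?i a * ?i x * (I t * q (a + t *\<^sub>R (x - a))) \<partial>lborel \<partial>lborel) \<le> I t * (emeasure lborel ?U * (8 * Q))" for t
  proof (cases "t \<in> {0..1}")
    case False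
    then show ?thesis by (simp add: I_def)
  next
    case True
    then have It: "I t = 1" by (simp add: I_def)
    show ?thesis
    proof (cases "t \<ge> 1/2")
      case t: True
      have "(\<integral>\<^sup>+a. \<integral>\<^sup>+x. ?i a * ?i x * (I t * q (a + t *\<^sub>R (x - a))) \<partial>lborel \<partial>lborel) \<le> (\<integral>\<^sup>+a. \<integral>\<^sup>+x. ?i a * q ((1 - t) *\<^sub>R a + t *\<^sub>R x) \<partial>lborel \<partial>lborel)"
        by (intro nn_integral_mono) (auto simp: It indicator_def algebra_simps)
      also have "\<dots> = (\<integral>\<^sup>+a. ?i a * (\<integral>\<^sup>+x. q ((1 - t) *\<^sub>R a + t *\<^sub>R x) \<partial>lborel) \<partial>lborel)"
        by (intro nn_integral_cong nn_integral_cmult) measurable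
      also have "\<dots> \<le> (\<integral>\<^sup>+a. ?i a * (8 * Q) \<partial>lborel)"
        by (intro nn_integral_mono mult_left_mono aff t) auto
      also have "\<dots> = emeasure lborel ?U * (8 * Q)" by (subst nn_integral_multc) auto
      finally show ?thesis by (simp add: It)
    next
      case t: False
      have "(\<integral>\<^sup>+a. \<integral>\<^sup>+x. ?i a * ?i x * (I t * q (a + t *\<^sub>R (x - a))) \<partial>lborel \<partial>lborel) = (\<integral>\<^sup>+x. \<integral>\<^sup>+a. ?i a * ?i x * (I t * q (a + t *\<^sub>R (x - a))) \<partial>lborel \<partial>lborel)"
        by (rule lborel_pair.Fubini'[symmetric]) measurable
      also have "\<dots> \<le> (\<integral>\<^sup>+x. \<integral>\<^sup>+a. ?i x * q (t *\<^sub>R x + (1 - t) *\<^sub>R a) \<partial>lborel \<partial>lborel)"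
        by (intro nn_integral_mono) (auto simp: It indicator_def algebra_simps)
      also have "\<dots> = (\<integral>\<^sup>+x. ?i x * (\<integral>\<^sup>+a. q (t *\<^sub>R x + (1 - t) *\<^sub>R a) \<partial>lborel) \<partial>lborel)"
        by (intro nn_integral_cong nn_integral_cmult) measurable
      also have "\<dots> \<le> (\<integral>\<^sup>+x. ?i x * (8 * Q) \<partial>lborel)"
        using t by (intro nn_integral_mono mult_left_mono aff) auto
      also have "\<dots> = emeasure lborel ?U * (8 * Q)" by (subst nn_integral_multc) auto
      finally show ?thesis by (simp add: It)
    qed
  qed
  have total: "(\<integral>\<^sup>+a. ?i a * h a \<partial>lborel) \<le> emeasure lborel ?U * (8 * Q)"
  proof -
    have "(\<integral>\<^sup>+a. ?i a * h a \<partial>lborel) = (\<integral>\<^sup>+a. \<integral>\<^sup>+x. ?i a * (?i x * ennreal ((f x - f a)\<^sup>2)) \<partial>lborel \<partial>lborel)"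
      unfolding h_def by (intro nn_integral_cong nn_integral_cmult[symmetric]) measurable
    also have "\<dots> \<le> (\<integral>\<^sup>+a. \<integral>\<^sup>+x. ?i a * ?i x * (\<integral>\<^sup>+t. I t * q (a + t *\<^sub>R (x - a)) \<partial>lborel) \<partial>lborel \<partial>lborel)"
      by (intro nn_integral_mono) (auto simp: indicator_def intro: pw)
    also have "\<dots> = (\<integral>\<^sup>+a. \<integral>\<^sup>+x. \<integral>\<^sup>+t. ?i a * ?i x * (I t * q (a + t *\<^sub>R (x - a))) \<partial>lborel \<partial>lborel \<partial>lborel)"
      by (intro nn_integral_cong nn_integral_cmult[symmetric]) measurable
    also have "\<dots> = (\<integral>\<^sup>+a. \<integral>\<^sup>+t. \<integral>\<^sup>+x. ?i a * ?i x * (I t * q (a + t *\<^sub>R (x - a))) \<partial>lborel \<partial>lborel \<partial>lborel)"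
      by (intro nn_integral_cong lborel_pair.Fubini'[symmetric]) measurable
    also have "\<dots> = (\<integral>\<^sup>+t. \<integral>\<^sup>+a. \<integral>\<^sup>+x. ?i a * ?i x * (I t * q (a + t *\<^sub>R (x - a))) \<partial>lborel \<partial>lborel \<partial>lborel)"
      by (rule lborel_pair.Fubini'[symmetric]) measurable
    also have "\<dots> \<le> (\<integral>\<^sup>+t. I t * (emeasure lborel ?U * (8 * Q)) \<partial>lborel)"
      by (intro nn_integral_mono tslice)
    also have "\<dots> = emeasure lborel ?U * (8 * Q)"
      by (subst nn_integral_multc) (auto simp: I_def)
    finally show ?thesis .
  qed
  have Upos: "emeasure lborel ?U \<noteq> 0" "emeasure lborel ?U \<noteq> \<infinity>"
    using \<rho> unit_ball_vol_3
    by (auto simp: emeasure_ball)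
  \<comment> \<open>The mean of \<open>h\<close> over the ball is at most 8 Q. If \<open>h\<close>
    exceeded twice this bound everywhere, integration would give 16 Q \<le> 8 Q; for Q = 0 the
    contradiction is instead that \<open>h\<close> is positive everywhere but 0 almost everywhere on
    the ball.\<close>
  have "\<exists>a. h a \<le> 16 * Q"
  proof (rule ccontr)
    assume "\<nexists>a. h a \<le> 16 * Q"
    then have gt: "h a > 16 * Q" for a by (simp add: not_le)
    have fin: "Q < \<infinity>"
    proof (rule ccontr)
      assume "\<not> Q < \<infinity>"
      then have "Q = top" by (simp add: less_top[symmetric])
      then show False using gt[of c] by (simp add: ennreal_mult_top)
    qed
    show False
    proof (cases "Q = 0")
      case True
      then have "AE a in lborel. ?i a * h a = 0" using total by (subst nn_integral_0_iff_AE[symmetric]) auto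
      then have "AE a in lborel. a \<notin> ?U"
      proof eventually_elim
        case (elim a)
        then show ?case using gt[of a] True by (auto simp: indicator_def split: if_splits)
      qed
      then have "emeasure lborel ?U = 0" by (subst (asm) AE_iff_measurable[of "?U"]) auto
      then show False using Upos by simp
    next
      case False
      have "emeasure lborel ?U * (16 * Q) = (\<integral>\<^sup>+a. ?i a * (16 * Q) \<partial>lborel)"
        by (subst nn_integral_multc) auto
      also have "\<dots> \<le> (\<integral>\<^sup>+a. ?i a * h a \<partial>lborel)"
        by (intro nn_integral_mono mult_left_mono) (auto intro: less_imp_le gt)
      also have "\<dots> \<le> emeasure lborel ?U * (8 * Q)" by (rule total)
      finally have "16 * Q \<le> 8 * Q"
        by (rule ennreal_mult_le_mult_iff[THEN iffD1, rotated 2]) (use Upos in auto)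
      then show False using False fin
        by (cases Q) (auto simp: ennreal_mult[symmetric] simp flip: ennreal_numeral)
    qed
  qed
  then obtain a where a: "h a \<le> 16 * Q" ..
  have "16 * Q = ennreal (64 * \<rho>\<^sup>2) * (\<integral>\<^sup>+x. ?i x * ennreal ((norm (grad f x))\<^sup>2) \<partial>lborel)"
  proof -
    have "Q = (\<integral>\<^sup>+x. ennreal (4 * \<rho>\<^sup>2) * (?i x * ennreal ((norm (grad f x))\<^sup>2)) \<partial>lborel)"
      unfolding Q_def q_def by (intro nn_integral_cong) (auto simp: ennreal_mult mult_ac)
    also have "\<dots> = ennreal (4 * \<rho>\<^sup>2) * (\<integral>\<^sup>+x. ?i x * ennreal ((norm (grad f x))\<^sup>2) \<partial>lborel)"
      by (rule nn_integral_cmult) measurable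
    finally show ?thesis by (simp add: mult.assoc[symmetric] ennreal_mult[symmetric] flip: ennreal_numeral)
  qed
  then show ?thesis using a unfolding h_def by (intro exI[of _ "f a"]) simp
qed

section \<open>Estimating a test field by its curl, up to a gradient\<close>

lemma Ck_continuous: "Ck_on k UNIV f \<Longrightarrow> continuous_on UNIV f"
proof (induction k)
  case (Suc k)
  then show ?case using Ck_SucD by blast
qed simp

text \<open>Only continuity of the boundary graphs is used: the direction \<open>e\<close> points out of the
  domain uniformly near the boundary point.\<close>
lemma exterior_patch:
  assumes \<Omega>: "C2_boundary_domain \<Omega>" and x0: "x0 \<notin> \<Omega>"
  shows "\<exists>\<rho> e T. 0 < \<rho> \<and> \<rho> \<le> 1 \<and> norm e = 1 \<and> 0 \<le> T \<and>
      (\<forall>x\<in>cball x0 \<rho>. x + T *\<^sub>R e \<notin> \<Omega> \<and> (x \<notin> \<Omega> \<longrightarrow> (\<forall>s\<in>{0..T}. x + s *\<^sub>R e \<notin> \<Omega>)))"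
    and "x0 \<in> closure (interior (- \<Omega>))"
proof -
  have op: "open \<Omega>" using \<Omega> by (simp add: C2_boundary_domain_def)
  have "(\<exists>\<rho> e T. 0 < \<rho> \<and> \<rho> \<le> 1 \<and> norm e = 1 \<and> 0 \<le> T \<and>
      (\<forall>x\<in>cball x0 \<rho>. x + T *\<^sub>R e \<notin> \<Omega> \<and> (x \<notin> \<Omega> \<longrightarrow> (\<forall>s\<in>{0..T}. x + s *\<^sub>R e \<notin> \<Omega>)))) \<and>
      x0 \<in> closure (interior (- \<Omega>))"
  proof (cases "x0 \<in> closure \<Omega>")
    case False
    then obtain r where r: "r > 0" "ball x0 r \<subseteq> - closure \<Omega>"
      using open_contains_ball[of "- closure \<Omega>"] by auto
    have "\<forall>x\<in>cball x0 (min 1 (r/2)). x \<notin> \<Omega>"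
    proof
      fix x assume "x \<in> cball x0 (min 1 (r/2))"
      then have "x \<in> ball x0 r" using r(1) by simp
      then show "x \<notin> \<Omega>" using r(2) closure_subset by blast
    qed
    then have "\<exists>\<rho> e T. 0 < \<rho> \<and> \<rho> \<le> 1 \<and> norm e = 1 \<and> 0 \<le> T \<and>
      (\<forall>x\<in>cball x0 \<rho>. x + T *\<^sub>R e \<notin> \<Omega> \<and> (x \<notin> \<Omega> \<longrightarrow> (\<forall>s\<in>{0..T}. x + s *\<^sub>R e \<notin> \<Omega>)))"
      using r(1) by (intro exI[of _ "min 1 (r/2)"] exI[of _ "axis 1 1"] exI[of _ 0]) auto
    moreover have "x0 \<in> interior (- \<Omega>)"
      using False by (simp add: interior_complement)
    ultimately show ?thesis using closure_subset by blast
  next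
    case True
    then have fr: "x0 \<in> frontier \<Omega>" using x0 op by (simp add: frontier_def interior_open)
    then obtain L :: "real^3 \<Rightarrow> real^3" and \<gamma> :: "real^2 \<Rightarrow> real" and r where
      L: "orthogonal_transformation L" and \<gamma>: "Ck_on 2 UNIV \<gamma>" and r: "r > 0"
      and iff: "\<And>x. x \<in> ball x0 r \<Longrightarrow> x \<in> \<Omega> \<longleftrightarrow> L (x - x0) $ 3 < \<gamma> (vector [L (x - x0) $ 1, L (x - x0) $ 2])"
      using \<Omega> unfolding C2_boundary_domain_def by blast
    have lin: "linear L" using L by (simp add: orthogonal_transformation_def)
    have c\<gamma>: "continuous_on UNIV \<gamma>" by (rule Ck_continuous[OF \<gamma>])
    \<comment> \<open>\<open>h\<close> is the signed height above the boundary graph in rotated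
      coordinates: inside the chart it is negative exactly on \<open>\<Omega>\<close>, it is zero at
      \<open>x0\<close>, and it grows at unit speed along \<open>e\<close>, the preimage of the
      vertical axis.\<close>
    define h where "h x = L (x - x0) $ 3 - \<gamma> (L (x - x0) $ 1 *\<^sub>R axis 1 1 + L (x - x0) $ 2 *\<^sub>R axis 2 1)" for x
    have vec: "vector [a, b] = a *\<^sub>R axis 1 1 + b *\<^sub>R (axis 2 1 :: real^2)" for a b :: real
      by (simp add: vec_eq_iff forall_2 vector_2 axis_def)
    have iff': "x \<in> \<Omega> \<longleftrightarrow> h x < 0" if "x \<in> ball x0 r" for x
      using iff[OF that] by (simp add: h_def vec)
    have cL: "continuous_on UNIV L" using lin linear_continuous_on linear_linear by blast
    have cLx: "continuous_on UNIV (\<lambda>x. L (x - x0))"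
      by (rule continuous_on_compose2[OF cL]) (auto intro!: continuous_intros)
    have ch: "continuous_on UNIV h" unfolding h_def
      by (intro continuous_on_diff continuous_on_compose2[OF c\<gamma>] continuous_intros cLx) auto
    obtain e where e: "L e = axis 3 1" using orthogonal_transformation_surj[OF L] by (metis surjD)
    have ne: "norm e = 1" using orthogonal_transformation_norm[OF L, of e] by (simp add: e)
    have hs: "h (x + s *\<^sub>R e) = h x + s" for x s
    proof -
      have "L (x + s *\<^sub>R e - x0) = L (x - x0) + s *\<^sub>R axis 3 1"
        using linear_add[OF lin, of "x - x0" "s *\<^sub>R e"] linear_scale[OF lin, of s e] e
        by (simp add: algebra_simps)
      then show ?thesis by (simp add: h_def axis_def)
    qed
    have opp: "open {x. h x > 0}" by (rule open_Collect_less[OF continuous_on_const ch])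
    have h0: "h x0 = 0"
    proof (rule antisym)
      show "h x0 \<ge> 0" using iff'[of x0] r x0 by auto
      show "h x0 \<le> 0"
      proof (rule ccontr)
        assume "\<not> h x0 \<le> 0"
        then have "x0 \<in> {x. h x > 0} \<inter> ball x0 r" using r by auto
        moreover have "open ({x. h x > 0} \<inter> ball x0 r)" by (intro open_Int opp open_ball)
        ultimately have "\<Omega> \<inter> ({x. h x > 0} \<inter> ball x0 r) \<noteq> {}"
          using True open_Int_closure_eq_empty[of "{x. h x > 0} \<inter> ball x0 r" \<Omega>] by blast
        then show False using iff' by fastforce
      qed
    qed
    have "isCont h x0" using ch by (simp add: continuous_on_eq_continuous_at)
    then obtain \<delta> where \<delta>: "\<delta> > 0" "\<And>x. dist x x0 < \<delta> \<Longrightarrow> \<bar>h x\<bar> < r / 2"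
      unfolding continuous_at_eps_delta using r h0 by (metis dist_real_def diff_zero half_gt_zero)
    \<comment> \<open>The bound by r / 4 keeps segments of length r / 2 inside the chart; the bound
      by \<delta> / 2 keeps the height below r / 2 in absolute value, so that moving by T = r / 2
      lifts every point out of \<open>\<Omega>\<close>.\<close>
    define \<rho> where "\<rho> = min 1 (min (r / 4) (\<delta> / 2))"
    have \<rho>: "0 < \<rho>" "\<rho> \<le> 1" "\<rho> \<le> r / 4" "\<rho> < \<delta>" using r \<delta>(1) by (auto simp: \<rho>_def)
    have inb: "x + s *\<^sub>R e \<in> ball x0 r" if "x \<in> cball x0 \<rho>" "s \<in> {0..r/2}" for x s
    proof -
      have "dist x0 (x + s *\<^sub>R e) \<le> dist x0 x + dist x (x + s *\<^sub>R e)" by (rule dist_triangle)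
      also have "dist x (x + s *\<^sub>R e) \<le> r / 2" using that ne by (simp add: dist_norm)
      also have "dist x0 x \<le> r / 4" using that \<rho> by simp
      finally show ?thesis using r by simp
    qed
    have "x + (r/2) *\<^sub>R e \<notin> \<Omega> \<and> (x \<notin> \<Omega> \<longrightarrow> (\<forall>s\<in>{0..r/2}. x + s *\<^sub>R e \<notin> \<Omega>))" if x: "x \<in> cball x0 \<rho>" for x
    proof -
      have xb: "x \<in> ball x0 r" using inb[OF x, of 0] r by simp
      have "\<bar>h x\<bar> < r / 2" using x \<rho>(4) by (intro \<delta>(2)) (simp add: dist_commute)
      then have "x + (r/2) *\<^sub>R e \<notin> \<Omega>" using iff'[OF inb[OF x, of "r/2"]] r by (simp add: hs)
      moreover have "x + s *\<^sub>R e \<notin> \<Omega>" if "x \<notin> \<Omega>" "s \<in> {0..r/2}" for s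
        using iff'[OF inb[OF x that(2)]] iff'[OF xb] that by (simp add: hs)
      ultimately show ?thesis by blast
    qed
    moreover have "x0 \<in> closure (interior (- \<Omega>))"
    proof (unfold closure_approachable, intro allI impI)
      fix \<epsilon> :: real assume "\<epsilon> > 0"
      define s where "s = min (\<epsilon> / 2) (r / 2)"
      have s: "0 < s" "s < \<epsilon>" "s < r" using \<open>\<epsilon> > 0\<close> r by (auto simp: s_def)
      have "x0 + s *\<^sub>R e \<in> {x. h x > 0} \<inter> ball x0 r" using s ne by (simp add: hs h0 dist_norm)
      moreover have "open ({x. h x > 0} \<inter> ball x0 r)" by (intro open_Int opp open_ball)
      moreover have "{x. h x > 0} \<inter> ball x0 r \<subseteq> - \<Omega>" using iff' by fastforce
      ultimately have "x0 + s *\<^sub>R e \<in> interior (- \<Omega>)" by (meson interiorI)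
      then show "\<exists>y\<in>interior (- \<Omega>). dist y x0 < \<epsilon>"
        using s ne by (intro bexI[of _ "x0 + s *\<^sub>R e"]) (auto simp: dist_norm)
    qed
    ultimately show ?thesis using \<rho> ne r
      by (intro conjI exI[of _ \<rho>] exI[of _ e] exI[of _ "r/2"]) auto
  qed
  then show "\<exists>\<rho> e T. 0 < \<rho> \<and> \<rho> \<le> 1 \<and> norm e = 1 \<and> 0 \<le> T \<and>
      (\<forall>x\<in>cball x0 \<rho>. x + T *\<^sub>R e \<notin> \<Omega> \<and> (x \<notin> \<Omega> \<longrightarrow> (\<forall>s\<in>{0..T}. x + s *\<^sub>R e \<notin> \<Omega>)))"
    and "x0 \<in> closure (interior (- \<Omega>))" by blast+
qed

text \<open>If the segment from \<open>x\<close> in direction \<open>e\<close> ends outside the support of \<open>\<Phi>\<close>, then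
  \<open>\<Phi> - grad (pot e T \<Phi>)\<close> is at \<open>x\<close> a line integral of the curl of \<open>\<Phi>\<close>.\<close>
definition pot :: "real^3 \<Rightarrow> real \<Rightarrow> (real^3 \<Rightarrow> real^3) \<Rightarrow> real^3 \<Rightarrow> real" where
  "pot e T \<Phi> x = - integral {0..T} (\<lambda>s. \<Phi> (x + s *\<^sub>R e) \<bullet> e)"

definition curl_energy :: "(real^3 \<Rightarrow> real^3) \<Rightarrow> ennreal" where
  "curl_energy \<Phi> = (\<integral>\<^sup>+x. ennreal ((norm (ccurl \<Phi> x))\<^sup>2) \<partial>lborel)"

lemma smooth_vec_test: "vec_test \<Omega> \<Phi> \<Longrightarrow> smooth (\<lambda>x. \<Phi> x $ j)"
  by (rule test_funD(1)[OF vec_test_test])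

lemma smooth_inner_const: "vec_test \<Omega> \<Phi> \<Longrightarrow> smooth (\<lambda>x. \<Phi> x \<bullet> e)"
  unfolding inner_vec_def inner_real_def
  by (intro smooth_sum smooth_mult smooth_const smooth_vec_test)

lemma smooth_pot: "vec_test \<Omega> \<Phi> \<Longrightarrow> smooth (pot e T \<Phi>)"
  unfolding pot_def[abs_def] by (intro smooth_minus smooth_line_integral smooth_inner_const)

lemma abs_mixed_le_ccurl:
  "\<bar>partial j (\<lambda>y. \<Phi> y $ k) x - partial k (\<lambda>y. \<Phi> y $ j) x\<bar> \<le> norm (ccurl \<Phi> x)"
proof -
  have c: "\<bar>ccurl \<Phi> x $ i\<bar> \<le> norm (ccurl \<Phi> x)" for i by (rule component_le_norm_cart)
  show ?thesis using exhaust_3[of j] exhaust_3[of k] c[of 1] c[of 2] c[of 3]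
    by (auto simp: ccurl_def vector_3 abs_minus_commute)
qed

text \<open>Differentiating \<open>pot\<close> and writing the increment of each component of
  \<open>\<Phi>\<close> by the fundamental theorem leaves antisymmetric combinations of derivatives,
  that is, components of the curl. The endpoint value is kept in the estimate, which therefore holds
  at every point. The 9 is 3 terms in each component times 3 components.\<close>

lemma pot_error:
  assumes P: "vec_test \<Omega> \<Phi>" and T: "0 \<le> T" and e: "norm e = 1"
  shows "ennreal (norm (\<Phi> x - grad (pot e T \<Phi>) x - \<Phi> (x + T *\<^sub>R e))) \<le>
    (\<integral>\<^sup>+s. indicator {0..T} s * ennreal (9 * norm (ccurl \<Phi> (x + s *\<^sub>R e))) \<partial>lborel)"
proof -
  let ?W = "\<Phi> x - grad (pot e T \<Phi>) x - \<Phi> (x + T *\<^sub>R e)"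
  define I where "I = (\<integral>\<^sup>+s. indicator {0..T} s * ennreal (norm (ccurl \<Phi> (x + s *\<^sub>R e))) \<partial>lborel)"
  have cm: "ccurl \<Phi> \<in> borel_measurable borel"
    by (rule borel_measurable_continuous_onI[OF vec_test_continuous[OF vec_test_ccurl[OF P]]])
  note [measurable] = cm
  define k where "k j y = (\<Sum>l\<in>UNIV. e $ l * (partial j (\<lambda>y. \<Phi> y $ l) y - partial l (\<lambda>y. \<Phi> y $ j) y))" for j y
  have ck: "continuous_on UNIV (k j)" for j
    unfolding k_def by (intro continuous_intros smooth_continuous smooth_partial smooth_vec_test[OF P])
  have comp: "?W $ j = integral {0..T} (\<lambda>s. k j (x + s *\<^sub>R e))" for j
  proof -
    let ?a = "\<lambda>y. \<Sum>l\<in>UNIV. e $ l * partial j (\<lambda>y. \<Phi> y $ l) y"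
    let ?b = "\<lambda>y. e \<bullet> grad (\<lambda>y. \<Phi> y $ j) y"
    have ca: "continuous_on UNIV ?a" "continuous_on UNIV ?b"
      by (intro continuous_intros smooth_continuous smooth_grad_continuous smooth_partial smooth_vec_test[OF P])+
    have pa: "partial j (\<lambda>y. \<Phi> y \<bullet> e) y = ?a y" for y
    proof -
      have "((\<lambda>y. \<Phi> y \<bullet> e) has_derivative (\<lambda>v. \<Sum>l\<in>UNIV. v \<bullet> grad (\<lambda>y. \<Phi> y $ l) y * e $ l)) (at y)"
        unfolding inner_vec_def[of "\<Phi> _"] inner_real_def
        by (intro has_derivative_sum has_derivative_mult_left smooth_deriv smooth_vec_test[OF P])
      from partial_eq[OF this] show ?thesis by (simp add: mult.commute)
    qed
    have pp: "partial j (pot e T \<Phi>) x = - integral {0..T} (\<lambda>s. ?a (x + s *\<^sub>R e))"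
    proof -
      have dl: "(\<lambda>x. integral {0..T} (\<lambda>s. \<Phi> (x + s *\<^sub>R e) \<bullet> e)) differentiable (at x)"
        by (rule line_integral_deriv(1)[OF smooth_inner_const[OF P]])
      have "partial j (\<lambda>x. integral {0..T} (\<lambda>s. \<Phi> (x + s *\<^sub>R e) \<bullet> e)) x = integral {0..T} (\<lambda>s. partial j (\<lambda>y. \<Phi> y \<bullet> e) (x + s *\<^sub>R e))"
        by (rule line_integral_deriv(2)[OF smooth_inner_const[OF P]])
      then show ?thesis
        using partial_cmult[OF dl, where c="-1" and i=j] pa by (simp add: pot_def[abs_def])
    qed
    have "\<Phi> (x + T *\<^sub>R e) $ j - \<Phi> x $ j = integral {0..T} (\<lambda>s. ?b (x + s *\<^sub>R e))"
      using line_FTC[OF smooth_vec_test[OF P] T, where e=e and x=x] by simp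
    then have "?W $ j = integral {0..T} (\<lambda>s. ?a (x + s *\<^sub>R e)) - integral {0..T} (\<lambda>s. ?b (x + s *\<^sub>R e))"
      by (simp add: pp)
    also have "\<dots> = integral {0..T} (\<lambda>s. ?a (x + s *\<^sub>R e) - ?b (x + s *\<^sub>R e))"
      by (rule integral_diff[symmetric]) (intro integrable_continuous_real continuous_on_line ca)+
    also have "\<dots> = integral {0..T} (\<lambda>s. k j (x + s *\<^sub>R e))"
      by (simp add: k_def inner_vec_def sum_subtractf[symmetric] right_diff_distrib)
    finally show ?thesis .
  qed
  have kb: "\<bar>k j y\<bar> \<le> 3 * norm (ccurl \<Phi> y)" for j y
  proof -
    have "\<bar>k j y\<bar> \<le> (\<Sum>l\<in>UNIV. \<bar>e $ l * (partial j (\<lambda>y. \<Phi> y $ l) y - partial l (\<lambda>y. \<Phi> y $ j) y)\<bar>)"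
      unfolding k_def by (rule sum_abs)
    also have "\<dots> \<le> (\<Sum>l\<in>(UNIV :: 3 set). 1 * norm (ccurl \<Phi> y))"
      unfolding abs_mult
      by (intro sum_mono mult_mono abs_mixed_le_ccurl) (use component_le_norm_cart[of e] e in auto)
    finally show ?thesis by simp
  qed
  have "ennreal \<bar>?W $ j\<bar> \<le> 3 * I" for j
  proof -
    have "ennreal \<bar>?W $ j\<bar> \<le> (\<integral>\<^sup>+s. indicator {0..T} s * ennreal \<bar>k j (x + s *\<^sub>R e)\<bar> \<partial>lborel)"
      unfolding comp by (intro integral_le_nn_integral continuous_on_line ck)
    also have "\<dots> \<le> (\<integral>\<^sup>+s. 3 * (indicator {0..T} s * ennreal (norm (ccurl \<Phi> (x + s *\<^sub>R e)))) \<partial>lborel)"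
    proof (rule nn_integral_mono)
      fix s
      have "ennreal \<bar>k j (x + s *\<^sub>R e)\<bar> \<le> 3 * ennreal (norm (ccurl \<Phi> (x + s *\<^sub>R e)))"
        using kb[of j "x + s *\<^sub>R e"] by (simp add: ennreal_mult'[symmetric] ennreal_leI flip: ennreal_numeral)
      then show "indicator {0..T} s * ennreal \<bar>k j (x + s *\<^sub>R e)\<bar> \<le> 3 * (indicator {0..T} s * ennreal (norm (ccurl \<Phi> (x + s *\<^sub>R e))))"
        by (auto simp: indicator_def)
    qed
    also have "\<dots> = 3 * I" unfolding I_def by (rule nn_integral_cmult) measurable
    finally show ?thesis .
  qed
  then have s3: "(\<Sum>j\<in>UNIV. ennreal \<bar>?W $ j\<bar>) \<le> (\<Sum>j\<in>(UNIV :: 3 set). 3 * I)" by (intro sum_mono)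
  have "ennreal (norm ?W) \<le> ennreal (\<Sum>j\<in>UNIV. \<bar>?W $ j\<bar>)"
    by (rule ennreal_leI[OF norm_le_l1_cart])
  also have "\<dots> = (\<Sum>j\<in>UNIV. ennreal \<bar>?W $ j\<bar>)" by (rule sum_ennreal[symmetric]) simp
  also note s3
  also have "(\<Sum>j\<in>(UNIV :: 3 set). 3 * I) = 9 * I" by (simp add: mult.assoc[symmetric])
  also have "9 * I = (\<integral>\<^sup>+s. 9 * (indicator {0..T} s * ennreal (norm (ccurl \<Phi> (x + s *\<^sub>R e)))) \<partial>lborel)"
    unfolding I_def by (rule nn_integral_cmult[symmetric]) measurable
  also have "\<dots> = (\<integral>\<^sup>+s. indicator {0..T} s * ennreal (9 * norm (ccurl \<Phi> (x + s *\<^sub>R e))) \<partial>lborel)"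
    by (rule nn_integral_cong) (auto simp: indicator_def ennreal_mult)
  finally show ?thesis .
qed

lemma pot_error_L2:
  assumes P: "vec_test \<Omega> \<Phi>" and T: "0 \<le> T" and e: "norm e = 1"
  shows "(\<integral>\<^sup>+x. ennreal ((norm (\<Phi> x - grad (pot e T \<Phi>) x - \<Phi> (x + T *\<^sub>R e)))\<^sup>2) \<partial>lborel) \<le>
    ennreal (81 * T\<^sup>2) * curl_energy \<Phi>"
proof -
  have [measurable]: "ccurl \<Phi> \<in> borel_measurable borel"
    by (rule borel_measurable_continuous_onI[OF vec_test_continuous[OF vec_test_ccurl[OF P]]])
  have "(\<integral>\<^sup>+x. ennreal ((norm (\<Phi> x - grad (pot e T \<Phi>) x - \<Phi> (x + T *\<^sub>R e)))\<^sup>2) \<partial>lborel) \<le>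
    (\<integral>\<^sup>+x. (\<integral>\<^sup>+s. indicator {0..T} s * ennreal (9 * norm (ccurl \<Phi> (x + s *\<^sub>R e))) \<partial>lborel)\<^sup>2 \<partial>lborel)"
  proof (rule nn_integral_mono)
    fix x
    show "ennreal ((norm (\<Phi> x - grad (pot e T \<Phi>) x - \<Phi> (x + T *\<^sub>R e)))\<^sup>2) \<le>
       (\<integral>\<^sup>+s. indicator {0..T} s * ennreal (9 * norm (ccurl \<Phi> (x + s *\<^sub>R e))) \<partial>lborel)\<^sup>2"
      using power_mono[OF pot_error[OF P T e, of x], of 2] by (simp add: ennreal_power)
  qed
  also have "\<dots> \<le> ennreal (T\<^sup>2) * (\<integral>\<^sup>+x. (ennreal (9 * norm (ccurl \<Phi> x)))\<^sup>2 \<partial>lborel)"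
    by (rule line_average_L2[OF _ T]) measurable
  also have "(\<integral>\<^sup>+x. (ennreal (9 * norm (ccurl \<Phi> x)))\<^sup>2 \<partial>lborel) = (\<integral>\<^sup>+x. 81 * ennreal ((norm (ccurl \<Phi> x))\<^sup>2) \<partial>lborel)"
    by (rule nn_integral_cong) (simp add: ennreal_power power_mult_distrib ennreal_mult)
  also have "\<dots> = 81 * curl_energy \<Phi>" unfolding curl_energy_def by (rule nn_integral_cmult) measurable
  finally show ?thesis using T by (simp add: ennreal_mult mult_ac)
qed

text \<open>Such \<open>f\<close> are constant on each component of a neighbourhood of the complement of \<open>\<Omega>\<close>, with constant 0 on
  the unbounded one only.\<close>
definition TX :: "(real^3) set \<Rightarrow> real \<Rightarrow> (real^3 \<Rightarrow> real) set" where
  "TX \<Omega> R = {f. smooth f \<and> (\<forall>x. norm x > R \<longrightarrow> f x = 0) \<and> closure {x. grad f x \<noteq> 0} \<subseteq> \<Omega>}"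

lemma emeasure_lborel_open_pos:
  fixes W :: "'a::euclidean_space set"
  assumes "open W" "W \<noteq> {}" shows "emeasure lborel W > 0"
proof -
  obtain x where "x \<in> W" using assms(2) by blast
  then obtain r where r: "r > 0" "ball x r \<subseteq> W" using assms(1) open_contains_ball by blast
  have "0 < emeasure lborel (ball x r)" using r(1) by (simp add: emeasure_ball)
  also have "\<dots> \<le> emeasure lborel W" using r(2) assms(1) by (intro emeasure_mono) auto
  finally show ?thesis .
qed

lemma sum_sq_le: "((a::real) + b)\<^sup>2 \<le> 2 * a\<^sup>2 + 2 * b\<^sup>2"
  using sum_squares_bound[of a b] by (simp add: power2_sum)

lemma diff_sq_le: "((a::real) - b)\<^sup>2 \<le> 2 * a\<^sup>2 + 2 * b\<^sup>2"
  using sum_sq_le[of a "- b"] by simp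

lemma norm_diff_sq_le: "(norm (a - b))\<^sup>2 \<le> 2 * (norm a)\<^sup>2 + 2 * (norm b)\<^sup>2"
proof -
  have "(norm (a - b))\<^sup>2 \<le> (norm a + norm b)\<^sup>2"
    by (rule power_mono[OF norm_triangle_ineq4 norm_ge_zero])
  with sum_sq_le[of "norm a" "norm b"] show ?thesis by linarith
qed

lemma ennreal_2_add: "0 \<le> a \<Longrightarrow> 0 \<le> b \<Longrightarrow> ennreal (2 * a + 2 * b) = 2 * ennreal a + 2 * ennreal b"
  by (simp add: ennreal_mult)

lemma ennreal_le_2_add:
  "0 \<le> a \<Longrightarrow> 0 \<le> b \<Longrightarrow> x \<le> 2 * a + 2 * b \<Longrightarrow> ennreal x \<le> 2 * ennreal a + 2 * ennreal b"
  by (metis ennreal_2_add ennreal_leI)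

section \<open>Gluing local potentials along the exterior\<close>

text \<open>\<open>leave\<close> makes the endpoint term of a local potential vanish on its ball,
  \<open>stay\<close> makes the potential itself vanish off \<open>\<Omega>\<close>, and
  \<open>ext\<close> guarantees that overlaps off \<open>\<Omega>\<close> contain open exterior
  sets. The halved radii in \<open>cover\<close> leave room for cut-offs, and the radius R + 2
  provides an annulus around \<open>\<Omega>\<close> for the normalisation at infinity.\<close>

locale patch_cover =
  fixes \<Omega> :: "(real^3) set" and R :: real and n :: nat and c e :: "nat \<Rightarrow> real^3" and \<rho> T :: "nat \<Rightarrow> real"
  assumes op: "open \<Omega>" and R: "R > 0" and sub: "\<Omega> \<subseteq> ball 0 R"
    and par: "\<And>i. i < n \<Longrightarrow> 0 < \<rho> i \<and> \<rho> i \<le> 1 \<and> norm (e i) = 1 \<and> 0 \<le> T i \<and> norm (c i) \<le> R + 2"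
    and leave: "\<And>i x. i < n \<Longrightarrow> x \<in> cball (c i) (\<rho> i) \<Longrightarrow> x + T i *\<^sub>R e i \<notin> \<Omega>"
    and stay: "\<And>i x s. i < n \<Longrightarrow> x \<in> cball (c i) (\<rho> i) \<Longrightarrow> x \<notin> \<Omega> \<Longrightarrow> s \<in> {0..T i} \<Longrightarrow> x + s *\<^sub>R e i \<notin> \<Omega>"
    and cover: "cball 0 (R + 2) - \<Omega> \<subseteq> (\<Union>i<n. ball (c i) (\<rho> i / 2))"
    and ext: "\<And>x. x \<notin> \<Omega> \<Longrightarrow> x \<in> closure (interior (- \<Omega>))"
begin

definition "U i = ball (c i) (\<rho> i)"
text \<open>The length 2 R + 4 moves every point of norm below R + 3, in particular every patch, out
  of the ball containing \<open>\<Omega>\<close>. So \<open>P\<close> is a single potential for all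
  patches, but it need not be locally constant off \<open>\<Omega>\<close>; the local
  \<open>Q i\<close> vanish there, and \<open>d i\<close> measures the mismatch.\<close>

definition "P \<Phi> = pot (axis 1 1) (2 * R + 4) \<Phi>"
definition "Q i \<Phi> = pot (e i) (T i) \<Phi>"
definition "d i \<Phi> x = P \<Phi> x - Q i \<Phi> x"
definition "\<beta> i = (SOME b. smooth b \<and> (\<forall>x. 0 \<le> b x \<and> b x \<le> 1) \<and> (\<forall>x\<in>cball (c i) (\<rho> i / 2). b x = 1) \<and>
  (\<forall>x. x \<notin> ball (c i) (3 * \<rho> i / 4) \<longrightarrow> b x = (0::real)))"
text \<open>The usual ordered partition: the sum telescopes to one minus a product, hence to 1
  wherever some \<open>\<beta> i\<close> equals 1. This covers a neighbourhood of the relevant part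
  of the complement, not the whole of \<open>\<Omega>\<close>.\<close>

definition "\<zeta> i x = \<beta> i x * (\<Prod>j<i. 1 - \<beta> j x)"

lemma U_sets [measurable]: "U i \<in> sets borel" by (simp add: U_def)

lemma \<beta>:
  assumes "i < n"
  shows "smooth (\<beta> i)" "0 \<le> \<beta> i x" "\<beta> i x \<le> 1" "x \<in> cball (c i) (\<rho> i / 2) \<Longrightarrow> \<beta> i x = 1"
    "x \<notin> ball (c i) (3 * \<rho> i / 4) \<Longrightarrow> \<beta> i x = 0"
proof -
  have "0 < \<rho> i / 2" "\<rho> i / 2 < 3 * \<rho> i / 4" using par[OF assms] by auto
  from smooth_cutoff[OF this, of "c i"] obtain b where "smooth b" "\<And>x. 0 \<le> b x" "\<And>x. b x \<le> 1"
    "\<And>x. x \<in> cball (c i) (\<rho> i / 2) \<Longrightarrow> b x = 1" "\<And>x. x \<notin> ball (c i) (3 * \<rho> i / 4) \<Longrightarrow> b x = 0" by metis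
  then have "\<exists>b. smooth b \<and> (\<forall>x. 0 \<le> b x \<and> b x \<le> 1) \<and> (\<forall>x\<in>cball (c i) (\<rho> i / 2). b x = 1) \<and>
    (\<forall>x. x \<notin> ball (c i) (3 * \<rho> i / 4) \<longrightarrow> b x = (0::real))" by (intro exI[of _ b]) auto
  from someI_ex[OF this] show "smooth (\<beta> i)" "0 \<le> \<beta> i x" "\<beta> i x \<le> 1" "x \<in> cball (c i) (\<rho> i / 2) \<Longrightarrow> \<beta> i x = 1"
    "x \<notin> ball (c i) (3 * \<rho> i / 4) \<Longrightarrow> \<beta> i x = 0" unfolding \<beta>_def[symmetric] by auto
qed

lemma \<zeta>:
  assumes "i < n"
  shows "smooth (\<zeta> i)" "0 \<le> \<zeta> i x" "\<zeta> i x \<le> 1" "x \<notin> ball (c i) (3 * \<rho> i / 4) \<Longrightarrow> \<zeta> i x = 0"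
proof -
  have lt: "j < n" if "j < i" for j using that assms by simp
  show "smooth (\<zeta> i)" unfolding \<zeta>_def[abs_def]
    by (intro smooth_mult smooth_prod smooth_diff smooth_const \<beta>(1)) (use lt assms in auto)
  have p: "0 \<le> (\<Prod>j<i. 1 - \<beta> j x)" "(\<Prod>j<i. 1 - \<beta> j x) \<le> 1"
    using \<beta>(2,3)[OF lt] by (auto intro!: prod_nonneg prod_le_1)
  show "0 \<le> \<zeta> i x" "\<zeta> i x \<le> 1" unfolding \<zeta>_def using p \<beta>(2,3)[OF assms, of x]
    by (auto intro!: mult_le_one)
  show "x \<notin> ball (c i) (3 * \<rho> i / 4) \<Longrightarrow> \<zeta> i x = 0" unfolding \<zeta>_def using \<beta>(5)[OF assms, of x] by simp
qed

lemma sum_\<zeta>: "(\<Sum>i<k. \<zeta> i x) = 1 - (\<Prod>i<k. 1 - \<beta> i x)"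
  by (induction k) (auto simp: \<zeta>_def algebra_simps)

lemma smooth_PQ: "vec_test \<Omega> \<Phi> \<Longrightarrow> smooth (P \<Phi>)" "vec_test \<Omega> \<Phi> \<Longrightarrow> smooth (Q i \<Phi>)"
  "vec_test \<Omega> \<Phi> \<Longrightarrow> smooth (d i \<Phi>)"
  unfolding d_def[abs_def] P_def Q_def by (auto intro: smooth_pot smooth_diff)

lemma U_norm: "i < n \<Longrightarrow> x \<in> U i \<Longrightarrow> norm x < R + 3"
  using par[of i] norm_triangle_sub[of x "c i"] by (auto simp: U_def dist_norm norm_minus_commute)

lemma far: assumes "norm x < R + 3" shows "x + (2 * R + 4) *\<^sub>R axis 1 1 \<notin> \<Omega>"
proof -
  have "norm ((2 * R + 4) *\<^sub>R axis 1 1 :: real^3) \<le> norm (x + (2 * R + 4) *\<^sub>R axis 1 1) + norm x"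
    using norm_triangle_ineq4[of "x + (2 * R + 4) *\<^sub>R axis 1 1" x] by simp
  then have "norm (x + (2 * R + 4) *\<^sub>R axis 1 1) > R" using assms R by simp
  then show ?thesis using sub by (auto simp: subset_eq)
qed

text \<open>The errors of the two potentials, endpoint values included: in this form they are
  controlled on the whole space, and on the patches the endpoint values are 0.\<close>

definition "WP \<Phi> x = \<Phi> x - grad (P \<Phi>) x - \<Phi> (x + (2 * R + 4) *\<^sub>R axis 1 1)"
definition "WQ i \<Phi> x = \<Phi> x - grad (Q i \<Phi>) x - \<Phi> (x + T i *\<^sub>R e i)"

lemma WP_eq: "vec_test \<Omega> \<Phi> \<Longrightarrow> norm x < R + 3 \<Longrightarrow> WP \<Phi> x = \<Phi> x - grad (P \<Phi>) x"
  using vec_test_zero[OF _ far] by (simp add: WP_def)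

lemma WQ_eq: "vec_test \<Omega> \<Phi> \<Longrightarrow> i < n \<Longrightarrow> x \<in> U i \<Longrightarrow> WQ i \<Phi> x = \<Phi> x - grad (Q i \<Phi>) x"
  using vec_test_zero[OF _ leave[of i x]] by (simp add: WQ_def U_def)

lemma WP_L2: "vec_test \<Omega> \<Phi> \<Longrightarrow> (\<integral>\<^sup>+x. ennreal ((norm (WP \<Phi> x))\<^sup>2) \<partial>lborel) \<le> ennreal (81 * (2 * R + 4)\<^sup>2) * curl_energy \<Phi>"
  unfolding WP_def P_def by (rule pot_error_L2) (use R in auto)

lemma WQ_L2: "vec_test \<Omega> \<Phi> \<Longrightarrow> i < n \<Longrightarrow> (\<integral>\<^sup>+x. ennreal ((norm (WQ i \<Phi> x))\<^sup>2) \<partial>lborel) \<le> ennreal (81 * (T i)\<^sup>2) * curl_energy \<Phi>"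
  unfolding WQ_def Q_def by (rule pot_error_L2) (use par in auto)

lemma W_measurable:
  assumes "vec_test \<Omega> \<Phi>"
  shows "WP \<Phi> \<in> borel_measurable borel" "WQ i \<Phi> \<in> borel_measurable borel"
proof -
  have c: "continuous_on UNIV (\<lambda>x. \<Phi> (x + a))" for a
    by (rule continuous_on_compose2[OF vec_test_continuous[OF assms, of UNIV]]) (auto intro!: continuous_intros)
  show "WP \<Phi> \<in> borel_measurable borel" "WQ i \<Phi> \<in> borel_measurable borel"
    unfolding WP_def[abs_def] WQ_def[abs_def]
    by (intro borel_measurable_continuous_onI continuous_intros c vec_test_continuous[OF assms] smooth_grad_continuous smooth_PQ assms)+
qed

text \<open>162 is 81, the constant of the potential error, doubled by splitting the square of a
  difference. Summing over the patches gives one constant for all of them.\<close>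

definition "K0 = 162 * ((\<Sum>i<n. (T i)\<^sup>2) + (2 * R + 4)\<^sup>2)"

lemma K0: "0 \<le> K0" "i < n \<Longrightarrow> 162 * ((T i)\<^sup>2 + (2 * R + 4)\<^sup>2) \<le> K0"
proof -
  show "0 \<le> K0" by (auto simp: K0_def intro!: add_nonneg_nonneg sum_nonneg)
  show "162 * ((T i)\<^sup>2 + (2 * R + 4)\<^sup>2) \<le> K0" if "i < n"
    using member_le_sum[of i "{..<n}" "\<lambda>i. (T i)\<^sup>2"] that by (simp add: K0_def)
qed

lemma grad_d_L2:
  assumes \<Phi>: "vec_test \<Omega> \<Phi>" and i: "i < n"
  shows "(\<integral>\<^sup>+x. indicator (U i) x * ennreal ((norm (grad (d i \<Phi>) x))\<^sup>2) \<partial>lborel) \<le> ennreal K0 * curl_energy \<Phi>"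
proof -
  note [measurable] = W_measurable[OF \<Phi>]
  have "(\<integral>\<^sup>+x. indicator (U i) x * ennreal ((norm (grad (d i \<Phi>) x))\<^sup>2) \<partial>lborel) \<le>
    (\<integral>\<^sup>+x. 2 * ennreal ((norm (WQ i \<Phi> x))\<^sup>2) + 2 * ennreal ((norm (WP \<Phi> x))\<^sup>2) \<partial>lborel)"
  proof (rule nn_integral_mono)
    fix x
    show "indicator (U i) x * ennreal ((norm (grad (d i \<Phi>) x))\<^sup>2) \<le> 2 * ennreal ((norm (WQ i \<Phi> x))\<^sup>2) + 2 * ennreal ((norm (WP \<Phi> x))\<^sup>2)"
    proof (cases "x \<in> U i")
      case True
      have "grad (d i \<Phi>) x = WQ i \<Phi> x - WP \<Phi> x"
        unfolding d_def[abs_def] using WQ_eq[OF \<Phi> i True] WP_eq[OF \<Phi> U_norm[OF i True]]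
        by (simp add: grad_diff smooth_PQ \<Phi>)
      then have "(norm (grad (d i \<Phi>) x))\<^sup>2 \<le> 2 * (norm (WQ i \<Phi> x))\<^sup>2 + 2 * (norm (WP \<Phi> x))\<^sup>2"
        using norm_diff_sq_le[of "WQ i \<Phi> x" "WP \<Phi> x"] by simp
      from ennreal_le_2_add[OF zero_le_power2 zero_le_power2 this] show ?thesis using True by simp
    qed simp
  qed
  also have "\<dots> = 2 * (\<integral>\<^sup>+x. ennreal ((norm (WQ i \<Phi> x))\<^sup>2) \<partial>lborel) + 2 * (\<integral>\<^sup>+x. ennreal ((norm (WP \<Phi> x))\<^sup>2) \<partial>lborel)"
    by (simp add: nn_integral_add nn_integral_cmult)
  also have "\<dots> \<le> 2 * (ennreal (81 * (T i)\<^sup>2) * curl_energy \<Phi>) + 2 * (ennreal (81 * (2 * R + 4)\<^sup>2) * curl_energy \<Phi>)"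
    by (intro add_mono mult_left_mono WQ_L2 WP_L2 \<Phi> i) auto
  also have "\<dots> = ennreal (162 * ((T i)\<^sup>2 + (2 * R + 4)\<^sup>2)) * curl_energy \<Phi>"
  proof -
    have "ennreal (162 * ((T i)\<^sup>2 + (2 * R + 4)\<^sup>2)) = 2 * ennreal (81 * (T i)\<^sup>2) + 2 * ennreal (81 * (2 * R + 4)\<^sup>2)"
      by (subst ennreal_2_add[symmetric]) (auto simp: algebra_simps)
    then show ?thesis by (simp add: distrib_right mult.assoc)
  qed
  also have "\<dots> \<le> ennreal K0 * curl_energy \<Phi>"
    by (intro mult_right_mono ennreal_leI K0 i) auto
  finally show ?thesis .
qed

text \<open>\<open>m\<close> collects the constants of the Poincare inequality on the patches; they
  depend on \<open>\<Phi>\<close>, while the bounds on them depend on the cover alone.\<close>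

definition "good \<Phi> m \<longleftrightarrow> vec_test \<Omega> \<Phi> \<and>
  (\<forall>i<n. (\<integral>\<^sup>+x. indicator (U i) x * ennreal ((d i \<Phi> x - m i)\<^sup>2) \<partial>lborel) \<le> ennreal (64 * K0) * curl_energy \<Phi>)"

lemma ex_good: assumes \<Phi>: "vec_test \<Omega> \<Phi>" shows "\<exists>m. good \<Phi> m"
proof -
  have "\<exists>m. (\<integral>\<^sup>+x. indicator (U i) x * ennreal ((d i \<Phi> x - m)\<^sup>2) \<partial>lborel) \<le> ennreal (64 * K0) * curl_energy \<Phi>" if i: "i < n" for i
  proof -
    obtain m where "(\<integral>\<^sup>+x. indicator (U i) x * ennreal ((d i \<Phi> x - m)\<^sup>2) \<partial>lborel) \<le> ennreal (64 * (\<rho> i)\<^sup>2) * (\<integral>\<^sup>+x. indicator (U i) x * ennreal ((norm (grad (d i \<Phi>) x))\<^sup>2) \<partial>lborel)"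
      using Poincare_ball[OF smooth_PQ(3)[OF \<Phi>], of "\<rho> i" "c i" i] par[OF i] unfolding U_def by blast
    also have "\<dots> \<le> ennreal 64 * (ennreal K0 * curl_energy \<Phi>)"
      using par[OF i] by (intro mult_mono grad_d_L2 \<Phi> i ennreal_leI) (auto simp: power_le_one)
    also have "\<dots> = ennreal (64 * K0) * curl_energy \<Phi>" using K0(1) by (simp add: ennreal_mult mult.assoc)
    finally show ?thesis by blast
  qed
  then have "\<forall>i. \<exists>m. i < n \<longrightarrow> (\<integral>\<^sup>+x. indicator (U i) x * ennreal ((d i \<Phi> x - m)\<^sup>2) \<partial>lborel) \<le> ennreal (64 * K0) * curl_energy \<Phi>"
    by auto
  from choice[OF this] obtain m where "\<forall>i<n. (\<integral>\<^sup>+x. indicator (U i) x * ennreal ((d i \<Phi> x - m i)\<^sup>2) \<partial>lborel) \<le> ennreal (64 * K0) * curl_energy \<Phi>" by auto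
  then show ?thesis using \<Phi> by (auto simp: good_def)
qed

text \<open>The segment swept from \<open>x\<close> is compact and misses the closed supports of the
  components of \<open>\<Phi>\<close>, so it keeps a positive distance from them. Vanishing on a
  ball, rather than at \<open>x\<close> alone, is what makes the glued potential locally
  constant.\<close>

lemma Q_zero:
  assumes \<Phi>: "vec_test \<Omega> \<Phi>" and i: "i < n" and x: "x \<in> cball (c i) (\<rho> i)" "x \<notin> \<Omega>"
  shows "\<exists>r>0. \<forall>y\<in>ball x r. Q i \<Phi> y = 0"
proof -
  let ?S = "(\<lambda>s. x + s *\<^sub>R e i) ` {0..T i}"
  let ?K = "\<Union>j\<in>UNIV. closure {x. \<Phi> x $ j \<noteq> 0}"
  have cS: "compact ?S" by (intro compact_continuous_image continuous_intros) auto
  have cK: "closed ?K" by (intro closed_UN) auto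
  have "?K \<subseteq> \<Omega>" using test_funD(3)[OF vec_test_test[OF \<Phi>]] by blast
  then have "?S \<inter> ?K = {}" using stay[OF i x] by blast
  from separate_compact_closed[OF cS cK this] obtain r where
    r: "r > 0" "\<And>y z. y \<in> ?S \<Longrightarrow> z \<in> ?K \<Longrightarrow> r \<le> dist y z" by blast
  have "Q i \<Phi> y = 0" if y: "y \<in> ball x r" for y
  proof -
    have "\<Phi> (y + s *\<^sub>R e i) = 0" if s: "s \<in> {0..T i}" for s
    proof (rule ccontr)
      assume "\<Phi> (y + s *\<^sub>R e i) \<noteq> 0"
      then obtain j where "\<Phi> (y + s *\<^sub>R e i) $ j \<noteq> 0" by (auto simp: vec_eq_iff)
      then have "y + s *\<^sub>R e i \<in> ?K" using closure_subset[of "{x. \<Phi> x $ j \<noteq> 0}"] by auto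
      then have "r \<le> dist (x + s *\<^sub>R e i) (y + s *\<^sub>R e i)" by (rule r(2)[rotated]) (use s in auto)
      then show False using y by simp
    qed
    then have "integral {0..T i} (\<lambda>s. \<Phi> (y + s *\<^sub>R e i) \<bullet> e i) = integral {0..T i} (\<lambda>s. 0)"
      by (intro integral_cong) simp
    then show ?thesis by (simp add: Q_def pot_def)
  qed
  with r(1) show ?thesis by blast
qed

lemma d_eq_P: "vec_test \<Omega> \<Phi> \<Longrightarrow> i < n \<Longrightarrow> x \<in> U i \<Longrightarrow> x \<notin> \<Omega> \<Longrightarrow> d i \<Phi> x = P \<Phi> x"
  using Q_zero[of \<Phi> i x] by (force simp: d_def U_def)

text \<open>On \<open>U i - \<Omega>\<close> the potential \<open>Q i\<close> vanishes, so \<open>d i\<close> and \<open>d j\<close> agree on overlaps outside \<open>\<Omega>\<close> and the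
  constants of such patches are comparable; they are made equal along chains of such patches.\<close>
definition "E = {(i, j). i < n \<and> j < n \<and> U i \<inter> U j - \<Omega> \<noteq> {}}"

text \<open>On the exterior part of the overlap \<open>d i\<close> and \<open>d j\<close> both equal
  \<open>P\<close>, so the two constants approximate the same function on an open set of positive
  measure \<open>w\<close>; dividing by \<open>w\<close> bounds their difference. The constant
  depends on the overlap but not on \<open>\<Phi>\<close>.\<close>

lemma edge:
  assumes "(i, j) \<in> E"
  shows "\<exists>C\<ge>0. \<forall>\<Phi> m. good \<Phi> m \<longrightarrow> ennreal ((m i - m j)\<^sup>2) \<le> ennreal C * curl_energy \<Phi>"
proof -
  have i: "i < n" and j: "j < n" using assms by (auto simp: E_def)
  define W where "W = U i \<inter> U j \<inter> interior (- \<Omega>)"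
  have Wo: "open W" by (auto simp: W_def U_def)
  obtain x where x: "x \<in> U i \<inter> U j" "x \<notin> \<Omega>" using assms by (auto simp: E_def)
  have "U i \<inter> U j \<inter> interior (- \<Omega>) \<noteq> {}"
  proof -
    have "open (U i \<inter> U j)" by (auto simp: U_def)
    from open_Int_closure_eq_empty[OF this, of "interior (- \<Omega>)"] show ?thesis using ext[OF x(2)] x(1) by blast
  qed
  then have "emeasure lborel W > 0" by (intro emeasure_lborel_open_pos Wo) (simp add: W_def)
  moreover have "emeasure lborel W \<le> emeasure lborel (U i)" by (intro emeasure_mono) (auto simp: W_def U_def)
  then have "emeasure lborel W < \<infinity>" by (rule le_less_trans) (unfold U_def, rule emeasure_lborel_ball_finite)
  ultimately obtain w where w: "w > 0" "emeasure lborel W = ennreal w"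
    by (cases "emeasure lborel W") auto
  have [measurable]: "W \<in> sets borel" using Wo by simp
  have Wsub: "W \<subseteq> U i" "W \<subseteq> U j" "W \<inter> \<Omega> = {}" using interior_subset by (auto simp: W_def)
  have "ennreal ((m i - m j)\<^sup>2) \<le> ennreal (256 * K0 / w) * curl_energy \<Phi>" if g: "good \<Phi> m" for \<Phi> m
  proof -
    have \<Phi>: "vec_test \<Omega> \<Phi>" using g by (simp add: good_def)
    have [measurable]: "d k \<Phi> \<in> borel_measurable borel" for k
      by (rule borel_measurable_continuous_onI[OF smooth_continuous[OF smooth_PQ(3)[OF \<Phi>]]])
    have "ennreal w * ennreal ((m i - m j)\<^sup>2) = (\<integral>\<^sup>+x. indicator W x * ennreal ((m i - m j)\<^sup>2) \<partial>lborel)"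
      by (subst nn_integral_multc) (auto simp: w(2))
    also have "\<dots> \<le> (\<integral>\<^sup>+x. 2 * (indicator (U i) x * ennreal ((d i \<Phi> x - m i)\<^sup>2)) + 2 * (indicator (U j) x * ennreal ((d j \<Phi> x - m j)\<^sup>2)) \<partial>lborel)"
    proof (rule nn_integral_mono)
      fix x
      show "indicator W x * ennreal ((m i - m j)\<^sup>2) \<le> 2 * (indicator (U i) x * ennreal ((d i \<Phi> x - m i)\<^sup>2)) + 2 * (indicator (U j) x * ennreal ((d j \<Phi> x - m j)\<^sup>2))"
      proof (cases "x \<in> W")
        case True
        then have in': "x \<in> U i" "x \<in> U j" "x \<notin> \<Omega>" using Wsub by auto
        have "(m i - m j)\<^sup>2 \<le> 2 * (d i \<Phi> x - m i)\<^sup>2 + 2 * (d j \<Phi> x - m j)\<^sup>2"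
          using diff_sq_le[of "P \<Phi> x - m j" "P \<Phi> x - m i"] d_eq_P[OF \<Phi> i in'(1,3)] d_eq_P[OF \<Phi> j in'(2,3)] by simp
        from ennreal_le_2_add[OF zero_le_power2 zero_le_power2 this] show ?thesis using in' True by simp
      qed simp
    qed
    also have "\<dots> = 2 * (\<integral>\<^sup>+x. indicator (U i) x * ennreal ((d i \<Phi> x - m i)\<^sup>2) \<partial>lborel) + 2 * (\<integral>\<^sup>+x. indicator (U j) x * ennreal ((d j \<Phi> x - m j)\<^sup>2) \<partial>lborel)"
      by (simp add: nn_integral_add nn_integral_cmult)
    also have "\<dots> \<le> 2 * (ennreal (64 * K0) * curl_energy \<Phi>) + 2 * (ennreal (64 * K0) * curl_energy \<Phi>)"
      using g i j by (intro add_mono mult_left_mono) (auto simp: good_def)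
    also have "\<dots> = ennreal (256 * K0) * curl_energy \<Phi>"
    proof -
      have "ennreal (256 * K0) = 2 * ennreal (64 * K0) + 2 * ennreal (64 * K0)"
        using K0(1) by (subst ennreal_2_add[symmetric]) auto
      then show ?thesis by (simp add: distrib_right mult.assoc)
    qed
    finally have "ennreal (1 / w) * (ennreal w * ennreal ((m i - m j)\<^sup>2)) \<le> ennreal (1 / w) * (ennreal (256 * K0) * curl_energy \<Phi>)"
      by (rule mult_left_mono) simp
    then show ?thesis using w(1) K0(1) by (simp add: mult.assoc[symmetric] ennreal_mult[symmetric])
  qed
  then show ?thesis using w(1) K0(1) by (intro exI[of _ "256 * K0 / w"]) auto
qed

lemma path:
  assumes "(i, j) \<in> E\<^sup>*"
  shows "\<exists>C\<ge>0. \<forall>\<Phi> m. good \<Phi> m \<longrightarrow> ennreal ((m i - m j)\<^sup>2) \<le> ennreal C * curl_energy \<Phi>"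
  using assms
proof (induction rule: rtrancl_induct)
  case base
  show ?case by (intro exI[of _ 0]) auto
next
  case (step j k)
  obtain C where C: "C \<ge> 0" "\<And>\<Phi> m. good \<Phi> m \<Longrightarrow> ennreal ((m i - m j)\<^sup>2) \<le> ennreal C * curl_energy \<Phi>"
    using step.IH by blast
  obtain D where D: "D \<ge> 0" "\<And>\<Phi> m. good \<Phi> m \<Longrightarrow> ennreal ((m j - m k)\<^sup>2) \<le> ennreal D * curl_energy \<Phi>"
    using edge[OF step.hyps(2)] by blast
  have "ennreal ((m i - m k)\<^sup>2) \<le> ennreal (2 * C + 2 * D) * curl_energy \<Phi>" if "good \<Phi> m" for \<Phi> m
  proof -
    have "ennreal ((m i - m k)\<^sup>2) \<le> 2 * ennreal ((m i - m j)\<^sup>2) + 2 * ennreal ((m j - m k)\<^sup>2)"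
      using sum_sq_le[of "m i - m j" "m j - m k"] by (intro ennreal_le_2_add) auto
    also have "\<dots> \<le> 2 * (ennreal C * curl_energy \<Phi>) + 2 * (ennreal D * curl_energy \<Phi>)"
      by (intro add_mono mult_left_mono C(2) D(2) that) auto
    also have "\<dots> = ennreal (2 * C + 2 * D) * curl_energy \<Phi>"
      unfolding ennreal_2_add[OF C(1) D(1)] by (simp add: distrib_right mult.assoc)
    finally show ?thesis .
  qed
  then show ?case using C(1) D(1) by (intro exI[of _ "2 * C + 2 * D"]) auto
qed

text \<open>The least reachable index picks one representative for each connected component of the
  exterior overlap graph, independently of \<open>\<Phi>\<close>.\<close>

definition "rep i = (LEAST j. (i, j) \<in> E\<^sup>*)"

lemma rep: "(i, rep i) \<in> E\<^sup>*" "(i, j) \<in> E \<Longrightarrow> rep i = rep j"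
proof -
  show "(i, rep i) \<in> E\<^sup>*" unfolding rep_def by (rule LeastI[of _ i]) simp
  have "sym E" by (auto simp: sym_def E_def)
  then have "(j, i) \<in> E" if "(i, j) \<in> E" for i j using that by (rule symD)
  then have "(i, k) \<in> E\<^sup>* \<longleftrightarrow> (j, k) \<in> E\<^sup>*" if "(i, j) \<in> E" for k i j
    using that converse_rtrancl_into_rtrancl[of _ _ E] by meson
  then show "(i, j) \<in> E \<Longrightarrow> rep i = rep j" unfolding rep_def by simp
qed

text \<open>Each constant is replaced by that of its representative. By \<open>path\<close> this
  costs a multiple of the curl energy, weighted by the volume of the ball, and afterwards patches
  that meet off \<open>\<Omega>\<close> carry exactly equal constants.\<close>

lemma constants:
  "\<exists>K\<ge>0. \<forall>\<Phi>. vec_test \<Omega> \<Phi> \<longrightarrow> (\<exists>m. (\<forall>i<n. (\<integral>\<^sup>+x. indicator (U i) x * ennreal ((d i \<Phi> x - m i)\<^sup>2) \<partial>lborel) \<le> ennreal K * curl_energy \<Phi>) \<and>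
     (\<forall>i<n. \<forall>j<n. U i \<inter> U j - \<Omega> \<noteq> {} \<longrightarrow> m i = m j))"
proof -
  have "\<forall>i. \<exists>C\<ge>0. \<forall>\<Phi> m. good \<Phi> m \<longrightarrow> ennreal ((m i - m (rep i))\<^sup>2) \<le> ennreal C * curl_energy \<Phi>"
    using path[OF rep(1)] by blast
  then obtain C where C: "\<And>i. C i \<ge> 0" "\<And>i \<Phi> m. good \<Phi> m \<Longrightarrow> ennreal ((m i - m (rep i))\<^sup>2) \<le> ennreal (C i) * curl_energy \<Phi>"
    by metis
  define u where "u i = measure lborel (U i)" for i
  have u: "u i \<ge> 0" "emeasure lborel (U i) = ennreal (u i)" for i
    using emeasure_lborel_ball_finite[of "c i" "\<rho> i"]
    by (auto simp: u_def U_def intro!: emeasure_eq_ennreal_measure)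
  define S where "S = (\<Sum>i<n. u i * C i)"
  have S: "0 \<le> S" "i < n \<Longrightarrow> u i * C i \<le> S" for i
    unfolding S_def using u(1) C(1) by (auto intro!: sum_nonneg member_le_sum)
  define K where "K = 2 * (64 * K0) + 2 * S"
  have "\<exists>m. (\<forall>i<n. (\<integral>\<^sup>+x. indicator (U i) x * ennreal ((d i \<Phi> x - m i)\<^sup>2) \<partial>lborel) \<le> ennreal K * curl_energy \<Phi>) \<and>
     (\<forall>i<n. \<forall>j<n. U i \<inter> U j - \<Omega> \<noteq> {} \<longrightarrow> m i = m j)" if \<Phi>: "vec_test \<Omega> \<Phi>" for \<Phi>
  proof -
    obtain m where g: "good \<Phi> m" using ex_good[OF \<Phi>] by blast
    have [measurable]: "d k \<Phi> \<in> borel_measurable borel" for k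
      by (rule borel_measurable_continuous_onI[OF smooth_continuous[OF smooth_PQ(3)[OF \<Phi>]]])
    have "(\<integral>\<^sup>+x. indicator (U i) x * ennreal ((d i \<Phi> x - m (rep i))\<^sup>2) \<partial>lborel) \<le> ennreal K * curl_energy \<Phi>" if i: "i < n" for i
    proof -
      have "(\<integral>\<^sup>+x. indicator (U i) x * ennreal ((d i \<Phi> x - m (rep i))\<^sup>2) \<partial>lborel) \<le>
        (\<integral>\<^sup>+x. 2 * (indicator (U i) x * ennreal ((d i \<Phi> x - m i)\<^sup>2)) + 2 * (indicator (U i) x * ennreal ((m i - m (rep i))\<^sup>2)) \<partial>lborel)"
      proof (rule nn_integral_mono)
        fix x
        show "indicator (U i) x * ennreal ((d i \<Phi> x - m (rep i))\<^sup>2) \<le> 2 * (indicator (U i) x * ennreal ((d i \<Phi> x - m i)\<^sup>2)) + 2 * (indicator (U i) x * ennreal ((m i - m (rep i))\<^sup>2))"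
          using ennreal_le_2_add[OF zero_le_power2 zero_le_power2 sum_sq_le, of "d i \<Phi> x - m i" "m i - m (rep i)"]
          by (cases "x \<in> U i") auto
      qed
      also have "\<dots> = 2 * (\<integral>\<^sup>+x. indicator (U i) x * ennreal ((d i \<Phi> x - m i)\<^sup>2) \<partial>lborel) + 2 * (ennreal (u i) * ennreal ((m i - m (rep i))\<^sup>2))"
        by (simp add: nn_integral_add nn_integral_cmult nn_integral_multc u(2))
      also have "\<dots> \<le> 2 * (ennreal (64 * K0) * curl_energy \<Phi>) + 2 * (ennreal (u i) * (ennreal (C i) * curl_energy \<Phi>))"
        using g i by (intro add_mono mult_left_mono C(2)) (auto simp: good_def)
      also have "\<dots> = ennreal (2 * (64 * K0) + 2 * (u i * C i)) * curl_energy \<Phi>"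
        using K0(1) u(1)[of i] C(1)[of i] by (subst ennreal_2_add) (auto simp: distrib_right mult.assoc ennreal_mult)
      also have "\<dots> \<le> ennreal K * curl_energy \<Phi>"
        unfolding K_def using S(2)[OF i] by (intro mult_right_mono ennreal_leI) auto
      finally show ?thesis .
    qed
    moreover have "m (rep i) = m (rep j)" if "i < n" "j < n" "U i \<inter> U j - \<Omega> \<noteq> {}" for i j
      using rep(2)[of i j] that by (simp add: E_def)
    ultimately show ?thesis by (intro exI[of _ "\<lambda>i. m (rep i)"]) auto
  qed
  moreover have "K \<ge> 0" using K0(1) S(1) by (simp add: K_def)
  ultimately show ?thesis by blast
qed

text \<open>Near \<open>x\<close> every active patch has \<open>Q i = 0\<close>, so
  \<open>d i = P\<close>, and it shares the constant \<open>m k\<close> of a patch whose cut-off is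
  1 there. The weights sum to 1, so the sum is P - m k and only \<open>m k\<close> remains.\<close>

lemma local_const_near:
  assumes \<Phi>: "vec_test \<Omega> \<Phi>" and m: "\<And>i j. i < n \<Longrightarrow> j < n \<Longrightarrow> U i \<inter> U j - \<Omega> \<noteq> {} \<Longrightarrow> m i = m j"
    and x: "x \<notin> \<Omega>" "norm x < R + 2"
  shows "\<exists>r>0. \<exists>a. \<forall>y\<in>ball x r. P \<Phi> y - (\<Sum>i<n. \<zeta> i y * (d i \<Phi> y - m i)) = a"
proof -
  have "x \<in> cball 0 (R + 2) - \<Omega>" using x by simp
  then obtain k where k: "k < n" "x \<in> ball (c k) (\<rho> k / 2)" using cover by blast
  have kU: "x \<in> U k" using k par[OF k(1)] by (auto simp: U_def)
  have "\<exists>r>0. \<forall>y\<in>ball x r. \<zeta> i y * (d i \<Phi> y - m i) = \<zeta> i y * (P \<Phi> y - m k)" if i: "i < n" for i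
  \<comment> \<open>The factor 3/4 lies strictly between the covering factor 1/2 and 1: a point of
    this closed ball belongs to \<open>U i\<close>, and off the ball \<open>\<zeta> i\<close>
    vanishes in a neighbourhood.\<close>
  proof (cases "x \<in> cball (c i) (3 * \<rho> i / 4)")
    case True
    then have xi: "x \<in> cball (c i) (\<rho> i)" "x \<in> U i" using par[OF i] by (auto simp: U_def)
    have "m i = m k" using xi(2) kU x(1) by (intro m i k(1)) auto
    then show ?thesis using Q_zero[OF \<Phi> i xi(1) x(1)] by (auto simp: d_def)
  next
    case False
    have "open (- cball (c i) (3 * \<rho> i / 4))" by (intro open_Compl closed_cball)
    then obtain r where "r > 0" "ball x r \<subseteq> - cball (c i) (3 * \<rho> i / 4)"
      using False open_contains_ball by (metis ComplI)
    moreover have "\<zeta> i y = 0" if "y \<in> - cball (c i) (3 * \<rho> i / 4)" for y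
      using that by (intro \<zeta>(4)[OF i]) auto
    ultimately show ?thesis by (metis mult_zero_left subsetD)
  qed
  then have "\<forall>i. \<exists>r. i < n \<longrightarrow> r > 0 \<and> (\<forall>y\<in>ball x r. \<zeta> i y * (d i \<Phi> y - m i) = \<zeta> i y * (P \<Phi> y - m k))" by blast
  from choice[OF this] obtain r where r': "\<forall>i. i < n \<longrightarrow> r i > 0 \<and> (\<forall>y\<in>ball x (r i). \<zeta> i y * (d i \<Phi> y - m i) = \<zeta> i y * (P \<Phi> y - m k))" ..
  then have r: "i < n \<Longrightarrow> r i > 0"
    "i < n \<Longrightarrow> y \<in> ball x (r i) \<Longrightarrow> \<zeta> i y * (d i \<Phi> y - m i) = \<zeta> i y * (P \<Phi> y - m k)" for i y by blast+
  obtain r0 where r0: "r0 > 0" "ball x r0 \<subseteq> ball (c k) (\<rho> k / 2)"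
    using k(2) open_contains_ball open_ball by blast
  define r1 where "r1 = Min (insert r0 (r ` {..<n}))"
  have r1: "r1 > 0" "r1 \<le> r0" "\<And>i. i < n \<Longrightarrow> r1 \<le> r i"
    using r(1) r0(1) by (auto simp: r1_def)
  have "P \<Phi> y - (\<Sum>i<n. \<zeta> i y * (d i \<Phi> y - m i)) = m k" if y: "y \<in> ball x r1" for y
  proof -
    have "(\<Sum>i<n. \<zeta> i y * (d i \<Phi> y - m i)) = (\<Sum>i<n. \<zeta> i y * (P \<Phi> y - m k))"
    proof (rule sum.cong[OF refl])
      fix i assume "i \<in> {..<n}"
      then show "\<zeta> i y * (d i \<Phi> y - m i) = \<zeta> i y * (P \<Phi> y - m k)"
        using y r1(3)[of i] by (intro r(2)) auto
    qed
    also have "\<dots> = (\<Sum>i<n. \<zeta> i y) * (P \<Phi> y - m k)" by (simp add: sum_distrib_right)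
    also have "(\<Sum>i<n. \<zeta> i y) = 1"
    proof -
      have "y \<in> ball x r0" using y r1(2) by simp
      then have "y \<in> ball (c k) (\<rho> k / 2)" using r0(2) by blast
      then have "\<beta> k y = 1" by (intro \<beta>(4)[OF k(1)]) auto
      then have "(\<Prod>i<n. 1 - \<beta> i y) = 0" using k(1) by (intro prod_zero) auto
      then show ?thesis by (simp add: sum_\<zeta>)
    qed
    finally show ?thesis by simp
  qed
  then show ?thesis using r1(1) by blast
qed

lemma grad_zero_near:
  assumes "r > 0" "\<And>y. y \<in> ball x r \<Longrightarrow> f y = a" shows "grad f x = 0"
proof -
  have "(f has_derivative (\<lambda>h. 0)) (at x)"
  proof (rule has_derivative_transform_within_open[OF has_derivative_const])
    show "open (ball x r)" "x \<in> ball x r" using assms(1) by auto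
    show "a = f y" if "y \<in> ball x r" for y using assms(2)[OF that] by simp
  qed
  then show ?thesis by (simp add: vec_eq_iff partial_eq)
qed

text \<open>The corrected potential is known to be locally constant off \<open>\<Omega>\<close> only
  where the cover reaches. The annulus between R and R + 2 is connected, so a single constant occurs
  there; subtracting it and cutting off inside the annulus gives a function that vanishes beyond
  radius R and has the same gradient on \<open>\<Omega>\<close>.\<close>

lemma ex_potential:
  assumes \<Phi>: "vec_test \<Omega> \<Phi>" and m: "\<And>i j. i < n \<Longrightarrow> j < n \<Longrightarrow> U i \<inter> U j - \<Omega> \<noteq> {} \<Longrightarrow> m i = m j"
  shows "\<exists>F\<in>TX \<Omega> R. \<forall>x\<in>\<Omega>. grad F x = grad (\<lambda>y. P \<Phi> y - (\<Sum>i<n. \<zeta> i y * (d i \<Phi> y - m i))) x"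
proof -
  define F where "F y = P \<Phi> y - (\<Sum>i<n. \<zeta> i y * (d i \<Phi> y - m i))" for y
  have sF: "smooth F" unfolding F_def[abs_def]
    by (intro smooth_diff smooth_sum smooth_mult smooth_const smooth_PQ \<Phi> \<zeta>(1)) auto
  have loc: "\<exists>r>0. \<exists>a. \<forall>y\<in>ball x r. F y = a" if "x \<notin> \<Omega>" "norm x < R + 2" for x
    unfolding F_def by (rule local_const_near[OF \<Phi> m that])
  define A where "A = {x :: real^3. R < norm (x - 0) \<and> norm (x - 0) < R + 2}"
  have notin: "x \<notin> \<Omega>" if "R \<le> norm x" for x using that sub by auto
  have "open A"
  proof -
    have "A = ball 0 (R + 2) \<inter> - cball 0 R" by (auto simp: A_def)
    then show ?thesis by (simp only:) (intro open_Int open_ball open_Compl closed_cball)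
  qed
  moreover have "connected A" unfolding A_def by (rule connected_annulus) simp
  moreover have "(F has_derivative (\<lambda>h. 0)) (at x)" if "x \<in> A" for x
  proof -
    obtain r a where r: "r > 0" "\<And>y. y \<in> ball x r \<Longrightarrow> F y = a"
      using loc[of x] notin[of x] \<open>x \<in> A\<close> unfolding A_def by auto
    have "grad F x = 0" using r by (rule grad_zero_near)
    then show ?thesis using smooth_deriv[OF sF, of x] by simp
  qed
  ultimately have const: "F x = F y" if "x \<in> A" "y \<in> A" for x y
    using that has_derivative_zero_unique_connected[of A F x y] by blast
  define z :: "real^3" where "z = (R + 1) *\<^sub>R axis 1 1"
  have zA: "z \<in> A" using R by (simp add: z_def A_def)
  \<comment> \<open>The cut-off changes from 1 to 0 inside the annulus, hence only where the shifted
    potential is already 0.\<close>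
  have "0 < R + 1/2" "R + 1/2 < R + 1" using R by auto
  from smooth_cutoff[OF this, of 0] obtain cut :: "real^3 \<Rightarrow> real" where cut: "smooth cut"
    "\<And>x. x \<in> cball 0 (R + 1/2) \<Longrightarrow> cut x = 1" "\<And>x. x \<notin> ball 0 (R + 1) \<Longrightarrow> cut x = 0" by metis
  define G where "G x = cut x * (F x - F z)" for x
  have sG: "smooth G" unfolding G_def[abs_def] by (intro smooth_mult smooth_diff smooth_const sF cut(1))
  have G0: "G x = 0" if "norm x > R" for x
  proof (cases "norm x < R + 2")
    case True
    then have "F x = F z" using that by (intro const zA) (simp add: A_def)
    then show ?thesis by (simp add: G_def)
  next
    case False
    then show ?thesis by (simp add: G_def cut(3))
  qed
  have GF: "G y = F y - F z" if "norm y < R + 1/2" for y using that by (simp add: G_def cut(2))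
  have "\<exists>r>0. \<exists>a. \<forall>y\<in>ball x r. G y = a" if x: "x \<notin> \<Omega>" for x
  proof (cases "norm x < R + 1/2")
    case True
    obtain r a where r: "r > 0" "\<And>y. y \<in> ball x r \<Longrightarrow> F y = a" using loc[OF x] True by auto
    obtain r' where r': "r' > 0" "ball x r' \<subseteq> ball 0 (R + 1/2)"
    proof -
      have "x \<in> ball 0 (R + 1/2)" using True by simp
      then show ?thesis using that open_contains_ball open_ball by blast
    qed
    have "G y = a - F z" if "y \<in> ball x (min r r')" for y
    proof -
      have "y \<in> ball 0 (R + 1/2)" using that r'(2) by auto
      then show ?thesis using GF[of y] r(2)[of y] that by simp
    qed
    then show ?thesis using r(1) r'(1) by (intro exI[of _ "min r r'"]) auto
  next
    case False
    then have "x \<in> - cball 0 R" by simp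
    moreover have "open (- cball (0::real^3) R)" by (intro open_Compl closed_cball)
    ultimately obtain r where r: "r > 0" "ball x r \<subseteq> - cball 0 R" using open_contains_ball by blast
    have "G y = 0" if "y \<in> ball x r" for y using G0[of y] r(2) that by auto
    then show ?thesis using r(1) by blast
  qed
  note Gloc = this
  have "closure {x. grad G x \<noteq> 0} \<subseteq> \<Omega>"
  proof
    fix x assume x: "x \<in> closure {x. grad G x \<noteq> 0}"
    show "x \<in> \<Omega>"
    proof (rule ccontr)
      assume "x \<notin> \<Omega>"
      then obtain r a where r: "r > 0" "\<And>y. y \<in> ball x r \<Longrightarrow> G y = a" using Gloc by blast
      obtain y where y: "grad G y \<noteq> 0" "dist y x < r" using x r(1) by (auto simp: closure_approachable)
      have "y \<in> ball x r" using y(2) by (simp add: dist_commute)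
      then obtain r' where "r' > 0" "ball y r' \<subseteq> ball x r" using open_contains_ball open_ball by blast
      then have "grad G y = 0" using r(2) by (intro grad_zero_near[of r']) auto
      then show False using y(1) by simp
    qed
  qed
  then have "G \<in> TX \<Omega> R" using sG G0 by (simp add: TX_def)
  moreover have "grad G x = grad F x" if "x \<in> \<Omega>" for x
  proof -
    have "x \<in> ball 0 (R + 1/2)" using that sub by auto
    then obtain r where r: "r > 0" "ball x r \<subseteq> ball 0 (R + 1/2)" using open_contains_ball open_ball by blast
    have "grad (\<lambda>y. G y - F y) x = 0"
      by (rule grad_zero_near[OF r(1), where a="- F z"]) (use r(2) GF in \<open>auto simp: subset_eq\<close>)
    then show ?thesis by (simp add: grad_diff sG sF)
  qed
  ultimately show ?thesis unfolding F_def by blast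
qed

lemma \<zeta>_grad: assumes "i < n"
  obtains M where "M \<ge> 0" "\<And>x. norm (grad (\<zeta> i) x) \<le> M * indicator (U i) x"
proof -
  have sub: "{x. \<zeta> i x \<noteq> 0} \<subseteq> cball (c i) (3 * \<rho> i / 4)"
  proof
    fix x assume "x \<in> {x. \<zeta> i x \<noteq> 0}"
    then have "x \<in> ball (c i) (3 * \<rho> i / 4)" using \<zeta>(4)[OF assms, of x] by blast
    then show "x \<in> cball (c i) (3 * \<rho> i / 4)" using ball_subset_cball by blast
  qed
  then have cl: "closure {x. \<zeta> i x \<noteq> 0} \<subseteq> cball (c i) (3 * \<rho> i / 4)" by (rule closure_minimal[OF _ closed_cball])
  have zero: "grad (\<zeta> i) x = 0" if "x \<notin> U i" for x
  proof -
    have "x \<notin> cball (c i) (3 * \<rho> i / 4)" using that par[OF assms] by (auto simp: U_def)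
    then have "x \<notin> closure {x. \<zeta> i x \<noteq> 0}" using cl by blast
    then show ?thesis by (simp add: vec_eq_iff partial_support)
  qed
  have "{x. grad (\<zeta> i) x \<noteq> 0} \<subseteq> U i" using zero by blast
  then have "bounded {x. grad (\<zeta> i) x \<noteq> 0}"
    unfolding U_def by (rule bounded_subset[OF bounded_ball])
  from compact_support_bounded[OF smooth_grad_continuous[OF \<zeta>(1)[OF assms]] this]
  obtain M where "M > 0" "\<And>x. norm (grad (\<zeta> i) x) \<le> M" by blast
  then show ?thesis using zero by (intro that[of M]) (auto simp: indicator_def)
qed

lemma sum_squared_bound: "((a::real) + (\<Sum>i<k. f i))\<^sup>2 \<le> (real k + 1) * (a\<^sup>2 + (\<Sum>i<k. (f i)\<^sup>2))"
proof -
  define g where "g i = (if i = k then a else f i)" for i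
  have "(\<Sum>i<Suc k. g i)\<^sup>2 \<le> (\<Sum>i<Suc k. (g i)\<^sup>2) * real (card {..<Suc k})"
    by (rule sum_squared_le_sum_of_squares)
  then show ?thesis by (simp add: g_def algebra_simps)
qed

text \<open>On \<open>\<Omega>\<close> the error is \<open>WP\<close> plus the sum of (d i - m i)
  grad(\<zeta> i) and \<zeta> i grad(d i). The first term and the gradients of \<open>d i\<close>
  are controlled by line integrals of the curl, and the Poincare inequality with the matched
  constants controls d i - m i on the patches.\<close>

lemma curl_estimate:
  "\<exists>C\<ge>0. \<forall>\<Phi>. vec_test \<Omega> \<Phi> \<longrightarrow> (\<exists>F\<in>TX \<Omega> R.
     (\<integral>\<^sup>+x. ennreal ((norm (\<Phi> x - grad F x))\<^sup>2) \<partial>lborel) \<le> ennreal C * curl_energy \<Phi>)"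
proof -
  obtain K where K: "K \<ge> 0" and Kc: "\<And>\<Phi>. vec_test \<Omega> \<Phi> \<Longrightarrow> \<exists>m. (\<forall>i<n. (\<integral>\<^sup>+x. indicator (U i) x * ennreal ((d i \<Phi> x - m i)\<^sup>2) \<partial>lborel) \<le> ennreal K * curl_energy \<Phi>) \<and>
     (\<forall>i<n. \<forall>j<n. U i \<inter> U j - \<Omega> \<noteq> {} \<longrightarrow> m i = m j)" using constants by blast
  have "\<forall>i. \<exists>M. i < n \<longrightarrow> M \<ge> 0 \<and> (\<forall>x. norm (grad (\<zeta> i) x) \<le> M * indicator (U i) x)"
    using \<zeta>_grad by metis
  from choice[OF this] obtain M where M: "\<And>i. i < n \<Longrightarrow> M i \<ge> 0" "\<And>i x. i < n \<Longrightarrow> norm (grad (\<zeta> i) x) \<le> M i * indicator (U i) x" by auto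
  \<comment> \<open>The square of n + 1 summands is split at once: the error of \<open>P\<close> and
    one term for each patch.\<close>
  define N where "N = real n + 1"
  define C where "C = N * (81 * (2 * R + 4)\<^sup>2) + (\<Sum>i<n. N * (2 * ((M i)\<^sup>2 * K) + 2 * K0))"
  have N: "N \<ge> 0" by (simp add: N_def)
  have C: "C \<ge> 0" unfolding C_def using K K0(1) N by (intro add_nonneg_nonneg sum_nonneg mult_nonneg_nonneg) auto
  have "\<exists>F\<in>TX \<Omega> R. (\<integral>\<^sup>+x. ennreal ((norm (\<Phi> x - grad F x))\<^sup>2) \<partial>lborel) \<le> ennreal C * curl_energy \<Phi>"
    if \<Phi>: "vec_test \<Omega> \<Phi>" for \<Phi>
  proof -
    obtain m where m: "\<And>i. i < n \<Longrightarrow> (\<integral>\<^sup>+x. indicator (U i) x * ennreal ((d i \<Phi> x - m i)\<^sup>2) \<partial>lborel) \<le> ennreal K * curl_energy \<Phi>"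
      and mm: "\<And>i j. i < n \<Longrightarrow> j < n \<Longrightarrow> U i \<inter> U j - \<Omega> \<noteq> {} \<Longrightarrow> m i = m j" using Kc[OF \<Phi>] by blast
    obtain F where F: "F \<in> TX \<Omega> R" and gF: "\<And>x. x \<in> \<Omega> \<Longrightarrow> grad F x = grad (\<lambda>y. P \<Phi> y - (\<Sum>i<n. \<zeta> i y * (d i \<Phi> y - m i))) x"
    proof -
      have "\<exists>F\<in>TX \<Omega> R. \<forall>x\<in>\<Omega>. grad F x = grad (\<lambda>y. P \<Phi> y - (\<Sum>i<n. \<zeta> i y * (d i \<Phi> y - m i))) x"
        by (rule ex_potential[OF \<Phi>]) (rule mm)
      then show ?thesis using that by blast
    qed
    note [measurable] = W_measurable[OF \<Phi>]
    have [measurable]: "d k \<Phi> \<in> borel_measurable borel" "grad (d k \<Phi>) \<in> borel_measurable borel" for k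
      by (intro borel_measurable_continuous_onI smooth_continuous smooth_grad_continuous smooth_PQ \<Phi>)+
    define a where "a i x = indicator (U i) x * ennreal ((d i \<Phi> x - m i)\<^sup>2)" for i x
    define b where "b i x = indicator (U i) x * ennreal ((norm (grad (d i \<Phi>) x))\<^sup>2)" for i x
    have [measurable]: "a i \<in> borel_measurable borel" "b i \<in> borel_measurable borel" for i
      unfolding a_def[abs_def] b_def[abs_def] by measurable
    have pw: "ennreal ((norm (\<Phi> x - grad F x))\<^sup>2) \<le> ennreal N * ennreal ((norm (WP \<Phi> x))\<^sup>2) +
        (\<Sum>i<n. ennreal (N * (2 * (M i)\<^sup>2)) * a i x + ennreal (N * 2) * b i x)" for x
    proof (cases "x \<in> \<Omega>")
      case False
      have "\<Phi> x = 0" by (rule vec_test_zero[OF \<Phi> False])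
      moreover have "grad F x = 0" using F False closure_subset[of "{x. grad F x \<noteq> 0}"] by (auto simp: TX_def)
      ultimately show ?thesis by simp
    next
      case True
      have ds: "smooth (\<lambda>y. d i \<Phi> y - m i)" for i by (intro smooth_diff smooth_const smooth_PQ \<Phi>)
      have gsum: "grad (\<lambda>y. \<Sum>i<k. \<zeta> i y * (d i \<Phi> y - m i)) x = (\<Sum>i<k. (d i \<Phi> x - m i) *\<^sub>R grad (\<zeta> i) x + \<zeta> i x *\<^sub>R grad (d i \<Phi>) x)" if "k \<le> n" for k
        using that
      proof (induction k)
        case (Suc k)
        have "smooth (\<lambda>y. \<Sum>i<k. \<zeta> i y * (d i \<Phi> y - m i))" using Suc.prems
          by (intro smooth_sum smooth_mult ds \<zeta>(1)) auto
        moreover have "smooth (\<zeta> k)" using Suc.prems by (intro \<zeta>(1)) auto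
        moreover have "grad (\<lambda>y. d k \<Phi> y - m k) x = grad (d k \<Phi>) x" by (simp add: grad_diff smooth_PQ \<Phi>)
        ultimately show ?case using Suc by (simp add: grad_add grad_mult smooth_mult ds)
      qed simp
      have sS: "smooth (\<lambda>y. \<Sum>i<n. \<zeta> i y * (d i \<Phi> y - m i))" by (intro smooth_sum smooth_mult ds \<zeta>(1)) auto
      have xn: "norm x < R + 3" using True sub by auto
      define t where "t i = M i * indicator (U i) x * \<bar>d i \<Phi> x - m i\<bar> + indicator (U i) x * norm (grad (d i \<Phi>) x)" for i
      have eq: "\<Phi> x - grad F x = WP \<Phi> x + (\<Sum>i<n. (d i \<Phi> x - m i) *\<^sub>R grad (\<zeta> i) x + \<zeta> i x *\<^sub>R grad (d i \<Phi>) x)"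
        unfolding gF[OF True] WP_eq[OF \<Phi> xn] by (simp add: grad_diff smooth_PQ \<Phi> sS gsum)
      have "norm (\<Phi> x - grad F x) \<le> norm (WP \<Phi> x) + (\<Sum>i<n. norm ((d i \<Phi> x - m i) *\<^sub>R grad (\<zeta> i) x + \<zeta> i x *\<^sub>R grad (d i \<Phi>) x))"
        unfolding eq by (intro order_trans[OF norm_triangle_ineq] add_mono norm_sum order_refl)
      also have "\<dots> \<le> norm (WP \<Phi> x) + (\<Sum>i<n. t i)"
      proof (intro add_mono order_refl sum_mono)
        fix i assume "i \<in> {..<n}"
        then have i: "i < n" by simp
        have "norm ((d i \<Phi> x - m i) *\<^sub>R grad (\<zeta> i) x) \<le> \<bar>d i \<Phi> x - m i\<bar> * (M i * indicator (U i) x)"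
          using M(2)[OF i, of x] by (simp add: mult_left_mono)
        moreover have "norm (\<zeta> i x *\<^sub>R grad (d i \<Phi>) x) \<le> indicator (U i) x * norm (grad (d i \<Phi>) x)"
        proof (cases "x \<in> U i")
          case True
          then show ?thesis using \<zeta>(2,3)[OF i, of x] by (simp add: mult_left_le_one_le)
        next
          case False
          then have "\<zeta> i x = 0" using par[OF i] by (intro \<zeta>(4)[OF i]) (auto simp: U_def)
          then show ?thesis by simp
        qed
        ultimately show "norm ((d i \<Phi> x - m i) *\<^sub>R grad (\<zeta> i) x + \<zeta> i x *\<^sub>R grad (d i \<Phi>) x) \<le> t i"
          unfolding t_def using norm_triangle_ineq[of "(d i \<Phi> x - m i) *\<^sub>R grad (\<zeta> i) x" "\<zeta> i x *\<^sub>R grad (d i \<Phi>) x"]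
          by (simp add: mult_ac)
      qed
      finally have "(norm (\<Phi> x - grad F x))\<^sup>2 \<le> (norm (WP \<Phi> x) + (\<Sum>i<n. t i))\<^sup>2" by (intro power_mono) auto
      also have "\<dots> \<le> N * ((norm (WP \<Phi> x))\<^sup>2 + (\<Sum>i<n. (t i)\<^sup>2))" unfolding N_def by (rule sum_squared_bound)
      also have "\<dots> = N * (norm (WP \<Phi> x))\<^sup>2 + (\<Sum>i<n. N * (t i)\<^sup>2)"
        by (simp add: distrib_left sum_distrib_left)
      finally have "ennreal ((norm (\<Phi> x - grad F x))\<^sup>2) \<le> ennreal (N * (norm (WP \<Phi> x))\<^sup>2 + (\<Sum>i<n. N * (t i)\<^sup>2))"
        by (rule ennreal_leI)
      also have "\<dots> = ennreal N * ennreal ((norm (WP \<Phi> x))\<^sup>2) + (\<Sum>i<n. ennreal (N * (t i)\<^sup>2))"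
      proof -
        have "ennreal (\<Sum>i<n. N * (t i)\<^sup>2) = (\<Sum>i<n. ennreal (N * (t i)\<^sup>2))"
          by (rule sum_ennreal[symmetric]) (use N in simp)
        moreover have "ennreal (N * (norm (WP \<Phi> x))\<^sup>2) = ennreal N * ennreal ((norm (WP \<Phi> x))\<^sup>2)"
          by (rule ennreal_mult) (use N in auto)
        moreover have "ennreal (N * (norm (WP \<Phi> x))\<^sup>2 + (\<Sum>i<n. N * (t i)\<^sup>2)) =
            ennreal (N * (norm (WP \<Phi> x))\<^sup>2) + ennreal (\<Sum>i<n. N * (t i)\<^sup>2)"
          by (rule ennreal_plus) (use N in \<open>auto intro!: sum_nonneg\<close>)
        ultimately show ?thesis by (simp only:)
      qed
      also have "\<dots> \<le> ennreal N * ennreal ((norm (WP \<Phi> x))\<^sup>2) +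
        (\<Sum>i<n. ennreal (N * (2 * (M i)\<^sup>2)) * a i x + ennreal (N * 2) * b i x)"
      proof (intro add_mono order_refl sum_mono)
        fix i
        show "ennreal (N * (t i)\<^sup>2) \<le> ennreal (N * (2 * (M i)\<^sup>2)) * a i x + ennreal (N * 2) * b i x"
        proof (cases "x \<in> U i")
          case True
          have "(t i)\<^sup>2 \<le> 2 * (M i * \<bar>d i \<Phi> x - m i\<bar>)\<^sup>2 + 2 * (norm (grad (d i \<Phi>) x))\<^sup>2"
            unfolding t_def using True sum_sq_le by simp
          then have "N * (t i)\<^sup>2 \<le> N * (2 * (M i * \<bar>d i \<Phi> x - m i\<bar>)\<^sup>2 + 2 * (norm (grad (d i \<Phi>) x))\<^sup>2)"
            using N by (rule mult_left_mono)
          also have "\<dots> = N * (2 * (M i)\<^sup>2) * (d i \<Phi> x - m i)\<^sup>2 + N * 2 * (norm (grad (d i \<Phi>) x))\<^sup>2"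
            by (simp add: power_mult_distrib algebra_simps)
          finally have "ennreal (N * (t i)\<^sup>2) \<le> ennreal (N * (2 * (M i)\<^sup>2) * (d i \<Phi> x - m i)\<^sup>2 + N * 2 * (norm (grad (d i \<Phi>) x))\<^sup>2)"
            by (rule ennreal_leI)
          also have "\<dots> = ennreal (N * (2 * (M i)\<^sup>2)) * ennreal ((d i \<Phi> x - m i)\<^sup>2) + ennreal (N * 2) * ennreal ((norm (grad (d i \<Phi>) x))\<^sup>2)"
            using N by (subst ennreal_plus) (auto simp: ennreal_mult[symmetric])
          finally show ?thesis using True by (simp add: a_def b_def)
        qed (simp add: t_def)
      qed
      finally show ?thesis .
    qed
    have "(\<integral>\<^sup>+x. ennreal ((norm (\<Phi> x - grad F x))\<^sup>2) \<partial>lborel) \<le>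
       (\<integral>\<^sup>+x. ennreal N * ennreal ((norm (WP \<Phi> x))\<^sup>2) + (\<Sum>i<n. ennreal (N * (2 * (M i)\<^sup>2)) * a i x + ennreal (N * 2) * b i x) \<partial>lborel)"
      by (intro nn_integral_mono pw)
    also have "\<dots> = ennreal N * (\<integral>\<^sup>+x. ennreal ((norm (WP \<Phi> x))\<^sup>2) \<partial>lborel) +
       (\<Sum>i<n. ennreal (N * (2 * (M i)\<^sup>2)) * (\<integral>\<^sup>+x. a i x \<partial>lborel) + ennreal (N * 2) * (\<integral>\<^sup>+x. b i x \<partial>lborel))"
      by (subst nn_integral_add, measurable, measurable)
         (simp add: nn_integral_cmult nn_integral_sum nn_integral_add)
    also have "\<dots> \<le> ennreal N * (ennreal (81 * (2 * R + 4)\<^sup>2) * curl_energy \<Phi>) +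
       (\<Sum>i<n. ennreal (N * (2 * (M i)\<^sup>2)) * (ennreal K * curl_energy \<Phi>) + ennreal (N * 2) * (ennreal K0 * curl_energy \<Phi>))"
    proof (intro add_mono mult_left_mono sum_mono WP_L2 \<Phi> zero_le)
      fix i assume "i \<in> {..<n}"
      then show "(\<integral>\<^sup>+x. a i x \<partial>lborel) \<le> ennreal K * curl_energy \<Phi>"
        "(\<integral>\<^sup>+x. b i x \<partial>lborel) \<le> ennreal K0 * curl_energy \<Phi>"
        unfolding a_def b_def using m[of i] grad_d_L2[OF \<Phi>, of i] by auto
    qed
    also have "\<dots> = ennreal C * curl_energy \<Phi>"
    proof -
      have 1: "ennreal N * (ennreal (81 * (2 * R + 4)\<^sup>2) * curl_energy \<Phi>) = ennreal (N * (81 * (2 * R + 4)\<^sup>2)) * curl_energy \<Phi>"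
        using N by (simp add: ennreal_mult mult.assoc)
      have 2: "ennreal (N * (2 * (M i)\<^sup>2)) * (ennreal K * curl_energy \<Phi>) + ennreal (N * 2) * (ennreal K0 * curl_energy \<Phi>)
          = ennreal (N * (2 * ((M i)\<^sup>2 * K) + 2 * K0)) * curl_energy \<Phi>" for i
      proof -
        have "N * (2 * ((M i)\<^sup>2 * K) + 2 * K0) = N * (2 * (M i)\<^sup>2) * K + N * 2 * K0" by (simp add: algebra_simps)
        then have "ennreal (N * (2 * ((M i)\<^sup>2 * K) + 2 * K0)) = ennreal (N * (2 * (M i)\<^sup>2)) * ennreal K + ennreal (N * 2) * ennreal K0"
          using N K K0(1) by (simp add: ennreal_mult[symmetric] ennreal_plus[symmetric] del: ennreal_plus)
        then show ?thesis by (simp add: distrib_right mult.assoc)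
      qed
      have "ennreal C = ennreal (N * (81 * (2 * R + 4)\<^sup>2)) + (\<Sum>i<n. ennreal (N * (2 * ((M i)\<^sup>2 * K) + 2 * K0)))"
        unfolding C_def using N K K0(1)
        by (subst ennreal_plus) (auto intro!: sum_nonneg mult_nonneg_nonneg add_nonneg_nonneg simp: sum_ennreal)
      then show ?thesis unfolding 1 2 by (simp add: distrib_right sum_distrib_right)
    qed
    finally show ?thesis using F by blast
  qed
  with C show ?thesis by blast
qed

end

text \<open>Compactness of the part of the complement within radius R + 2 reduces the exit
  directions, chosen at every point, to a finite family.\<close>

theorem curl_estimate:
  assumes \<Omega>: "C2_boundary_domain \<Omega>" and R: "R > 0" "\<Omega> \<subseteq> ball 0 R"
  shows "\<exists>C\<ge>0. \<forall>\<Phi>. vec_test \<Omega> \<Phi> \<longrightarrow> (\<exists>F\<in>TX \<Omega> R.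
     (\<integral>\<^sup>+x. ennreal ((norm (\<Phi> x - grad F x))\<^sup>2) \<partial>lborel) \<le> ennreal C * curl_energy \<Phi>)"
proof -
  have op: "open \<Omega>" using \<Omega> by (simp add: C2_boundary_domain_def)
  define Z where "Z = cball 0 (R + 2) - \<Omega>"
  have cZ: "compact Z" unfolding Z_def by (intro compact_diff compact_cball op)
  have "\<forall>x. \<exists>p. x \<notin> \<Omega> \<longrightarrow> (case p of (\<rho>, e, T) \<Rightarrow> 0 < \<rho> \<and> \<rho> \<le> 1 \<and> norm e = 1 \<and> 0 \<le> T \<and>
      (\<forall>y\<in>cball x \<rho>. y + T *\<^sub>R e \<notin> \<Omega> \<and> (y \<notin> \<Omega> \<longrightarrow> (\<forall>s\<in>{0..T}. y + s *\<^sub>R e \<notin> \<Omega>))))"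
    using exterior_patch(1)[OF \<Omega>] by (simp add: split_paired_Ex)
  from choice[OF this] obtain p where p: "\<And>x. x \<notin> \<Omega> \<Longrightarrow> (case p x of (\<rho>, e, T) \<Rightarrow> 0 < \<rho> \<and> \<rho> \<le> 1 \<and> norm e = 1 \<and> 0 \<le> T \<and>
      (\<forall>y\<in>cball x \<rho>. y + T *\<^sub>R e \<notin> \<Omega> \<and> (y \<notin> \<Omega> \<longrightarrow> (\<forall>s\<in>{0..T}. y + s *\<^sub>R e \<notin> \<Omega>))))" by blast
  define r where "r x = fst (p x)" for x
  define e where "e x = fst (snd (p x))" for x
  define T where "T x = snd (snd (p x))" for x
  have q: "0 < r x" "r x \<le> 1" "norm (e x) = 1" "0 \<le> T x"
    "\<And>y. y \<in> cball x (r x) \<Longrightarrow> y + T x *\<^sub>R e x \<notin> \<Omega>"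
    "\<And>y s. y \<in> cball x (r x) \<Longrightarrow> y \<notin> \<Omega> \<Longrightarrow> s \<in> {0..T x} \<Longrightarrow> y + s *\<^sub>R e x \<notin> \<Omega>" if "x \<notin> \<Omega>" for x
    using p[OF that] unfolding r_def e_def T_def by (auto simp: case_prod_unfold)
  obtain D where D: "D \<subseteq> Z" "finite D" "Z \<subseteq> (\<Union>x\<in>D. ball x (r x / 2))"
  proof -
    have "Z \<subseteq> (\<Union>x\<in>Z. ball x (r x / 2))" using q(1) by (auto simp: Z_def)
    from compactE_image[OF cZ _ this] that show ?thesis by auto
  qed
  obtain h where h: "bij_betw h {0..<card D} D" using ex_bij_betw_nat_finite[OF D(2)] by blast
  have hD: "h i \<in> D" if "i < card D" for i using bij_betwE[OF h] that by auto
  have hZ: "h i \<notin> \<Omega>" "norm (h i) \<le> R + 2" if "i < card D" for i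
    using hD[OF that] D(1) by (auto simp: Z_def)
  interpret patch_cover \<Omega> R "card D" h "\<lambda>i. e (h i)" "\<lambda>i. r (h i)" "\<lambda>i. T (h i)"
  proof
    show "open \<Omega>" "0 < R" "\<Omega> \<subseteq> ball 0 R" by fact+
    show "0 < r (h i) \<and> r (h i) \<le> 1 \<and> norm (e (h i)) = 1 \<and> 0 \<le> T (h i) \<and> norm (h i) \<le> R + 2" if "i < card D" for i
      using q(1-4)[OF hZ(1)[OF that]] hZ(2)[OF that] by simp
    show "x + T (h i) *\<^sub>R e (h i) \<notin> \<Omega>" if "i < card D" "x \<in> cball (h i) (r (h i))" for i x
      using q(5)[OF hZ(1)[OF that(1)] that(2)] .
    show "x + s *\<^sub>R e (h i) \<notin> \<Omega>" if "i < card D" "x \<in> cball (h i) (r (h i))" "x \<notin> \<Omega>" "s \<in> {0..T (h i)}" for i x s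
      using q(6)[OF hZ(1)[OF that(1)] that(2-4)] .
    show "cball 0 (R + 2) - \<Omega> \<subseteq> (\<Union>i<card D. ball (h i) (r (h i) / 2))"
    proof
      fix x assume "x \<in> cball 0 (R + 2) - \<Omega>"
      then obtain y where y: "y \<in> D" "x \<in> ball y (r y / 2)" using D(3) by (auto simp: Z_def)
      obtain i where "i < card D" "y = h i" using bij_betw_imp_surj_on[OF h] y(1) atLeastLessThan_iff by blast
      then show "x \<in> (\<Union>i<card D. ball (h i) (r (h i) / 2))" using y(2) by blast
    qed
    show "x \<in> closure (interior (- \<Omega>))" if "x \<notin> \<Omega>" for x by (rule exterior_patch(2)[OF \<Omega> that])
  qed
  show ?thesis by (rule curl_estimate)
qed

section \<open>Potentials of the electric field\<close>

lemma power_powr: "0 \<le> x \<Longrightarrow> n > 0 \<Longrightarrow> (x ^ n) powr a = x powr (real n * a)" for x :: real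
  by (cases "x = 0") (auto simp: powr_realpow[symmetric] powr_powr)

lemma norm_toL2_mono:
  assumes "sqint f" "sqint g" "AE x in lebesgue. norm (f x) \<le> norm (g x)"
  shows "norm (toL2 f) \<le> norm (toL2 g)"
proof -
  have "(norm (toL2 f))\<^sup>2 \<le> (norm (toL2 g))\<^sup>2"
    unfolding norm_toL2_sq[OF assms(1)] norm_toL2_sq[OF assms(2)]
    by (rule integral_mono_AE) (use assms in \<open>auto simp: sqint_def elim: eventually_mono intro: power_mono\<close>)
  then show ?thesis by (rule power2_le_imp_le) simp
qed

section \<open>Multiplication operators on L^2\<close>

definition bm :: "(real^3 \<Rightarrow> real) \<Rightarrow> bool" where
  "bm s \<longleftrightarrow> s \<in> borel_measurable lebesgue \<and> (\<exists>C. AE x in lebesgue. \<bar>s x\<bar> \<le> C)"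

lemma bmI: "s \<in> borel_measurable lebesgue \<Longrightarrow> (\<And>x. \<bar>s x\<bar> \<le> C) \<Longrightarrow> bm s"
  by (auto simp: bm_def)

lemma bm_measurable: "bm s \<Longrightarrow> s \<in> borel_measurable lebesgue" by (simp add: bm_def)

lemma bm_sqint: "bm s \<Longrightarrow> sqint f \<Longrightarrow> sqint (\<lambda>x. s x *\<^sub>R f x)"
  unfolding bm_def using sqint_bounded_mult by blast

lemma bm_mult: assumes "bm s" "bm t" shows "bm (\<lambda>x. s x * t x)"
proof -
  obtain C D where C: "AE x in lebesgue. \<bar>s x\<bar> \<le> C" and D: "AE x in lebesgue. \<bar>t x\<bar> \<le> D"
    using assms by (auto simp: bm_def)
  have "AE x in lebesgue. \<bar>s x * t x\<bar> \<le> C * D"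
    using C D
  proof eventually_elim
    case (elim x)
    then show ?case unfolding abs_mult by (intro mult_mono) auto
  qed
  then show ?thesis using assms borel_measurable_times[of s lebesgue t] by (auto simp: bm_def)
qed

definition mulop :: "(real^3 \<Rightarrow> real) \<Rightarrow> 'b::euclidean_space lsq \<Rightarrow> 'b lsq" where
  "mulop s x = toL2 (\<lambda>t. s t *\<^sub>R fn x t)"

lemma mulop_toL2: "bm s \<Longrightarrow> sqint f \<Longrightarrow> mulop s (toL2 f) = toL2 (\<lambda>t. s t *\<^sub>R f t)"
  unfolding mulop_def by (subst toL2_eq_iff) (use fn_toL2[of f] in \<open>auto simp: bm_sqint elim: eventually_mono\<close>)

lemma mulop_add: "bm s \<Longrightarrow> mulop s (x + y) = mulop s x + mulop s y"
  by (cases x rule: lsq_cases, cases y rule: lsq_cases)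
     (simp add: toL2_simps mulop_toL2 bm_sqint scaleR_add_right)

lemma mulop_diff: "bm s \<Longrightarrow> mulop s (x - y) = mulop s x - mulop s y"
  by (cases x rule: lsq_cases, cases y rule: lsq_cases)
     (simp add: toL2_simps mulop_toL2 bm_sqint scaleR_diff_right)

lemma mulop_scaleR: "bm s \<Longrightarrow> mulop s (c *\<^sub>R x) = c *\<^sub>R mulop s x"
  by (cases x rule: lsq_cases) (simp add: toL2_simps mulop_toL2 bm_sqint mult.commute)

lemma mulop_mulop: "bm s \<Longrightarrow> bm t \<Longrightarrow> mulop s (mulop t x) = mulop (\<lambda>z. s z * t z) x"
  by (cases x rule: lsq_cases) (simp add: mulop_toL2 bm_sqint bm_mult)

lemma inner_mulop: "bm s \<Longrightarrow> mulop s x \<bullet> y = x \<bullet> mulop s y"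
  by (cases x rule: lsq_cases, cases y rule: lsq_cases) (simp add: mulop_toL2 toL2_inner bm_sqint)

lemma mulop_cong: "bm s \<Longrightarrow> bm t \<Longrightarrow> (\<And>x. s x = t x) \<Longrightarrow> mulop s x = mulop t x"
  by (simp add: mulop_def)

lemma norm_mulop:
  assumes "bm s" "AE x in lebesgue. \<bar>s x\<bar> \<le> C"
  shows "norm (mulop s x) \<le> C * norm x"
proof (cases x rule: lsq_cases)
  case (1 f)
  have "C \<ge> 0"
  proof (rule ccontr)
    assume "\<not> C \<ge> 0"
    with assms(2) have "AE x in (lebesgue :: (real^3) measure). False" by (auto elim: eventually_mono)
    then have "emeasure lebesgue (UNIV :: (real^3) set) = 0"
      using AE_iff_measurable[of "UNIV :: (real^3) set" lebesgue "\<lambda>_. False"] by simp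
    then show False by (simp add: emeasure_lborel_UNIV)
  qed
  have "norm (toL2 (\<lambda>t. s t *\<^sub>R f t)) \<le> norm (toL2 (\<lambda>t. C *\<^sub>R f t))"
    using assms 1 \<open>C \<ge> 0\<close> by (intro norm_toL2_mono bm_sqint sqint_scaleR) (auto elim!: eventually_mono intro: mult_right_mono)
  then show ?thesis using assms(1) 1 \<open>C \<ge> 0\<close> by (simp add: mulop_toL2 toL2_scaleR[symmetric])
qed

lemma mulop_coercive:
  assumes "bm s" "AE x in lebesgue. c \<le> s x"
  shows "c * (norm x)\<^sup>2 \<le> mulop s x \<bullet> x"
proof (cases x rule: lsq_cases)
  case (1 f)
  have "c * (norm x)\<^sup>2 = (LINT t|lebesgue. c * (norm (f t))\<^sup>2)" using 1 by (simp add: norm_toL2_sq)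
  also have "\<dots> \<le> (LINT t|lebesgue. s t *\<^sub>R f t \<bullet> f t)"
  proof (rule integral_mono_AE)
    show "integrable lebesgue (\<lambda>t. c * (norm (f t))\<^sup>2)" using 1 by (simp add: sqint_def)
    show "integrable lebesgue (\<lambda>t. s t *\<^sub>R f t \<bullet> f t)" using 1 assms(1) by (intro sqint_inner_integrable bm_sqint)
    show "AE t in lebesgue. c * (norm (f t))\<^sup>2 \<le> s t *\<^sub>R f t \<bullet> f t"
      using assms(2) by eventually_elim (simp add: power2_norm_eq_inner mult_right_mono)
  qed
  also have "\<dots> = mulop s x \<bullet> x" using 1 assms(1) by (simp add: mulop_toL2 toL2_inner bm_sqint)
  finally show ?thesis .
qed

lemma sqint_compact_support:
  fixes f :: "real^3 \<Rightarrow> 'b::euclidean_space"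
  assumes "continuous_on UNIV f" "bounded {x. f x \<noteq> 0}"
  shows "sqint f"
  unfolding sqint_def
proof
  show "f \<in> borel_measurable lebesgue"
    by (rule measurable_completion) (simp add: borel_measurable_continuous_onI[OF assms(1)])
  show "integrable lebesgue (\<lambda>x. (norm (f x))\<^sup>2)"
    by (intro compact_support_integrable continuous_intros assms) (use assms(2) in simp)
qed

lemma bm_compact_support:
  assumes "continuous_on UNIV f" "bounded {x. f x \<noteq> (0::real)}" shows "bm f"
proof -
  obtain C where "\<And>x. norm (f x) \<le> C" using compact_support_bounded[OF assms] by metis
  then show ?thesis
    by (intro bmI[of _ C] measurable_completion) (auto simp: borel_measurable_continuous_onI[OF assms(1)])
qed

definition gpair :: "(real^3 \<Rightarrow> real) \<Rightarrow> real lsq \<times> (real^3) lsq" where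
  "gpair f = (toL2 f, toL2 (grad f))"

lemma test_fun_UNIV_facts:
  assumes "smooth f" "bounded {x. f x \<noteq> 0}"
  shows "sqint f" "sqint (grad f)" "bm f" "bounded {x. grad f x \<noteq> 0}"
proof -
  show b: "bounded {x. grad f x \<noteq> 0}"
    by (rule bounded_subset[OF bounded_closure[OF assms(2)]]) (auto simp: vec_eq_iff intro: ccontr partial_support)
  show "sqint f" "sqint (grad f)" "bm f"
    using assms b by (auto intro: sqint_compact_support bm_compact_support smooth_continuous smooth_grad_continuous)
qed

lemma subspace_closure:
  fixes S :: "'a::real_normed_vector set"
  assumes "subspace S" shows "subspace (closure S)"
proof (rule subspaceI)
  show "0 \<in> closure S" using subspace_0[OF assms] closure_subset by blast
  fix x y c assume "x \<in> closure S" "y \<in> closure S"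
  then obtain f g where f: "\<forall>n. f n \<in> S" "f \<longlonglongrightarrow> x" and g: "\<forall>n. g n \<in> S" "g \<longlonglongrightarrow> y"
    unfolding closure_sequential by blast
  show "x + y \<in> closure S" unfolding closure_sequential
    by (rule exI[of _ "\<lambda>n. f n + g n"]) (use f g subspace_add[OF assms] in \<open>auto intro: tendsto_add\<close>)
  show "c *\<^sub>R x \<in> closure S" unfolding closure_sequential
    by (rule exI[of _ "\<lambda>n. c *\<^sub>R f n"]) (use f subspace_scale[OF assms] in \<open>auto intro: tendsto_scaleR\<close>)
qed

lemma logistic_le [simp]: "0 \<le> logistic a k t" "logistic a k t \<le> 1" "\<bar>logistic a k t\<bar> \<le> 1"
  using logistic_bounds[of a k t] by auto

section \<open>Closed spaces of potentials\<close>

locale dom =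
  fixes \<Omega> :: "(real^3) set" and R :: real
  assumes C2: "C2_boundary_domain \<Omega>" and R: "R > 0" and sub: "\<Omega> \<subseteq> ball 0 R"
begin

lemma op: "open \<Omega>" using C2 by (simp add: C2_boundary_domain_def)

lemma \<Omega>_sets [measurable]: "\<Omega> \<in> sets lebesgue" "\<Omega> \<in> sets borel" using op by auto

lemma TX_facts:
  assumes "f \<in> TX \<Omega> R"
  shows "smooth f" "bounded {x. f x \<noteq> 0}" "sqint f" "sqint (grad f)" "bm f" "x \<notin> \<Omega> \<Longrightarrow> grad f x = 0"
proof -
  show s: "smooth f" using assms by (simp add: TX_def)
  have "{x. f x \<noteq> 0} \<subseteq> cball 0 R"
  proof
    fix x assume "x \<in> {x. f x \<noteq> 0}"
    then show "x \<in> cball 0 R" using assms by (cases "norm x \<le> R") (auto simp: TX_def)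
  qed
  then show b: "bounded {x. f x \<noteq> 0}" by (rule bounded_subset[OF bounded_cball])
  show "sqint f" "sqint (grad f)" "bm f" using test_fun_UNIV_facts[OF s b] by auto
  show "grad f x = 0" if "x \<notin> \<Omega>"
    using assms that closure_subset[of "{x. grad f x \<noteq> 0}"] by (auto simp: TX_def)
qed

lemma test_fun_TX: assumes "test_fun \<Omega> f" shows "f \<in> TX \<Omega> R"
proof -
  have "{x. grad f x \<noteq> 0} \<subseteq> closure {x. f x \<noteq> 0}" by (auto simp: vec_eq_iff intro: ccontr partial_support)
  then have "closure {x. grad f x \<noteq> 0} \<subseteq> \<Omega>" using closure_minimal[OF _ closed_closure] test_funD(3)[OF assms] by blast
  moreover have "f x = 0" if "norm x > R" for x
  proof (rule test_funD(4)[OF assms])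
    show "x \<notin> \<Omega>" using sub that by auto
  qed
  ultimately show ?thesis using test_funD(1)[OF assms] by (simp add: TX_def)
qed

text \<open>Closures are taken for pairs of a function and its gradient, so that a limit gradient
  keeps its potential and facts about both pass to the limit together. \<open>PD\<close> is H^1_0;
  \<open>PX\<close> also admits nonzero constants on the bounded components of the
  complement.\<close>

definition "PX = closure (gpair ` TX \<Omega> R)"
definition "PD = closure (gpair ` {f. test_fun \<Omega> f})"

lemma gpair_linear:
  assumes "f \<in> TX \<Omega> R" "g \<in> TX \<Omega> R"
  shows "gpair (\<lambda>x. f x + g x) = gpair f + gpair g" "gpair (\<lambda>x. c * f x) = c *\<^sub>R gpair f"
proof -
  note f = TX_facts[OF assms(1)] and g = TX_facts[OF assms(2)]
  have "grad (\<lambda>x. f x + g x) = (\<lambda>x. grad f x + grad g x)" "grad (\<lambda>x. c * f x) = (\<lambda>x. c *\<^sub>R grad f x)"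
    using f(1) g(1) by (auto simp: grad_add grad_cmult)
  then show "gpair (\<lambda>x. f x + g x) = gpair f + gpair g" "gpair (\<lambda>x. c * f x) = c *\<^sub>R gpair f"
    using f g by (auto simp: gpair_def toL2_simps)
qed

lemma TX_linear:
  assumes "f \<in> TX \<Omega> R" "g \<in> TX \<Omega> R"
  shows "(\<lambda>x. f x + g x) \<in> TX \<Omega> R" "(\<lambda>x. c * f x) \<in> TX \<Omega> R"
proof -
  have s: "smooth f" "smooth g" using assms by (auto simp: TX_def)
  have "{x. grad (\<lambda>x. f x + g x) x \<noteq> 0} \<subseteq> {x. grad f x \<noteq> 0} \<union> {x. grad g x \<noteq> 0}"
    using s by (auto simp: grad_add)
  then have "closure {x. grad (\<lambda>x. f x + g x) x \<noteq> 0} \<subseteq> closure ({x. grad f x \<noteq> 0} \<union> {x. grad g x \<noteq> 0})" by (rule closure_mono)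
  then show "(\<lambda>x. f x + g x) \<in> TX \<Omega> R" using assms s by (auto simp: TX_def closure_Un smooth_add)
  have "{x. grad (\<lambda>x. c * f x) x \<noteq> 0} \<subseteq> {x. grad f x \<noteq> 0}" using s by (auto simp: grad_cmult)
  then have "closure {x. grad (\<lambda>x. c * f x) x \<noteq> 0} \<subseteq> closure {x. grad f x \<noteq> 0}" by (rule closure_mono)
  then show "(\<lambda>x. c * f x) \<in> TX \<Omega> R" using assms s by (auto simp: TX_def smooth_mult)
qed

lemma zero_TX: "(\<lambda>x. 0) \<in> TX \<Omega> R" by (simp add: TX_def)

lemma gpair_zero: "gpair (\<lambda>x. 0) = 0"
  using gpair_linear(2)[OF zero_TX zero_TX, of 0] by simp

lemma subspace_PX: "subspace PX"
  unfolding PX_def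
proof (rule subspace_closure, rule subspaceI)
  show "0 \<in> gpair ` TX \<Omega> R" using gpair_zero[symmetric] zero_TX by (rule image_eqI)
  fix x y c assume "x \<in> gpair ` TX \<Omega> R" "y \<in> gpair ` TX \<Omega> R"
  then obtain f g where "f \<in> TX \<Omega> R" "g \<in> TX \<Omega> R" "x = gpair f" "y = gpair g" by blast
  then have "x + y = gpair (\<lambda>x. f x + g x)" "c *\<^sub>R x = gpair (\<lambda>x. c * f x)"
    "(\<lambda>x. f x + g x) \<in> TX \<Omega> R" "(\<lambda>x. c * f x) \<in> TX \<Omega> R"
    using gpair_linear[of f g] TX_linear[of f g] by simp_all
  then show "x + y \<in> gpair ` TX \<Omega> R" "c *\<^sub>R x \<in> gpair ` TX \<Omega> R"
    by (auto intro: image_eqI)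
qed

lemma subspace_PD: "subspace PD"
  unfolding PD_def
proof (rule subspace_closure, rule subspaceI)
  show "0 \<in> gpair ` {f. test_fun \<Omega> f}" using gpair_zero by (intro image_eqI[of _ _ "\<lambda>x. 0"]) auto
  fix x y c assume "x \<in> gpair ` {f. test_fun \<Omega> f}" "y \<in> gpair ` {f. test_fun \<Omega> f}"
  then obtain f g where fg: "test_fun \<Omega> f" "test_fun \<Omega> g" "x = gpair f" "y = gpair g" by blast
  then have "x + y = gpair (\<lambda>x. f x + g x)" "c *\<^sub>R x = gpair (\<lambda>x. c * f x)"
    using gpair_linear[OF test_fun_TX test_fun_TX, of f g] by auto
  then show "x + y \<in> gpair ` {f. test_fun \<Omega> f}" "c *\<^sub>R x \<in> gpair ` {f. test_fun \<Omega> f}"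
    using test_fun_add[OF fg(1,2)] test_fun_cmult[OF fg(1), of c] by (auto intro: image_eqI)
qed

lemma PD_subset_PX: "PD \<subseteq> PX"
  unfolding PD_def PX_def by (rule closure_mono) (use test_fun_TX in auto)

lemma closed_P [simp]: "closed PX" "closed PD" by (auto simp: PX_def PD_def)

lemma gpair_in: "f \<in> TX \<Omega> R \<Longrightarrow> gpair f \<in> PX" "test_fun \<Omega> f \<Longrightarrow> gpair f \<in> PD"
  unfolding PX_def PD_def by (rule closure_subset[THEN subsetD], simp)+

text \<open>A step of length 2 R + 1 in a fixed direction carries any point of the ball beyond
  radius R, where the function vanishes. The normalisation at infinity thus replaces zero values on
  the inner boundary components.\<close>

lemma Poincare_TX:
  assumes "f \<in> TX \<Omega> R" shows "norm (toL2 f) \<le> (2 * R + 1) * norm (toL2 (grad f))"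
proof -
  note f = TX_facts[OF assms]
  define e where "e = (axis 1 1 :: real^3)"
  define T where "T = 2 * R + 1"
  have T: "T \<ge> 0" "norm e = 1" using R by (auto simp: T_def e_def)
  have [measurable]: "f \<in> borel_measurable borel" "grad f \<in> borel_measurable borel"
    by (intro borel_measurable_continuous_onI smooth_continuous smooth_grad_continuous f)+
  have pw: "ennreal \<bar>f x\<bar> \<le> (\<integral>\<^sup>+s. indicator {0..T} s * ennreal (norm (grad f (x + s *\<^sub>R e))) \<partial>lborel)" for x
  proof (cases "norm x > R")
    case True
    then show ?thesis using assms by (simp add: TX_def)
  next
    case False
    have "norm (x + T *\<^sub>R e) \<ge> T - norm x"
      using norm_triangle_ineq2[of "T *\<^sub>R e" "- x"] T by (simp add: add.commute)
    then have "f (x + T *\<^sub>R e) = 0" using False assms by (simp add: TX_def T_def)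
    then have "ennreal \<bar>f x\<bar> = ennreal \<bar>integral {0..T} (\<lambda>s. e \<bullet> grad f (x + s *\<^sub>R e))\<bar>"
      using line_FTC[OF f(1) T(1), of e x] by simp
    also have "\<dots> \<le> (\<integral>\<^sup>+s. indicator {0..T} s * ennreal \<bar>e \<bullet> grad f (x + s *\<^sub>R e)\<bar> \<partial>lborel)"
      by (intro integral_le_nn_integral continuous_intros continuous_on_line smooth_grad_continuous f)
    also have "\<dots> \<le> (\<integral>\<^sup>+s. indicator {0..T} s * ennreal (norm (grad f (x + s *\<^sub>R e))) \<partial>lborel)"
      by (intro nn_integral_mono mult_left_mono ennreal_leI order_trans[OF Cauchy_Schwarz_ineq2]) (auto simp: T(2))
    finally show ?thesis .
  qed
  have "(\<integral>\<^sup>+x. ennreal ((norm (f x))\<^sup>2) \<partial>lborel) \<le> (\<integral>\<^sup>+x. (\<integral>\<^sup>+s. indicator {0..T} s * ennreal (norm (grad f (x + s *\<^sub>R e))) \<partial>lborel)\<^sup>2 \<partial>lborel)"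
  proof (rule nn_integral_mono)
    fix x
    show "ennreal ((norm (f x))\<^sup>2) \<le> (\<integral>\<^sup>+s. indicator {0..T} s * ennreal (norm (grad f (x + s *\<^sub>R e))) \<partial>lborel)\<^sup>2"
      using power_mono[OF pw[of x], of 2] by (simp add: ennreal_power)
  qed
  also have "\<dots> \<le> ennreal (T\<^sup>2) * (\<integral>\<^sup>+x. (ennreal (norm (grad f x)))\<^sup>2 \<partial>lborel)"
    by (rule line_average_L2[OF _ T(1)]) measurable
  also have "(\<integral>\<^sup>+x. (ennreal (norm (grad f x)))\<^sup>2 \<partial>lborel) = (\<integral>\<^sup>+x. ennreal ((norm (grad f x))\<^sup>2) \<partial>lebesgue)"
    by (simp add: ennreal_power nn_integral_completion)
  also have "\<dots> = ennreal ((norm (toL2 (grad f)))\<^sup>2)" by (rule nn_integral_toL2[OF f(4)])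
  also have "ennreal (T\<^sup>2) * \<dots> = ennreal ((T * norm (toL2 (grad f)))\<^sup>2)"
    by (simp add: ennreal_mult[symmetric] power_mult_distrib)
  finally have "(\<integral>\<^sup>+x. ennreal ((norm (f x))\<^sup>2) \<partial>lebesgue) \<le> ennreal ((T * norm (toL2 (grad f)))\<^sup>2)"
    by (simp add: nn_integral_completion)
  then show ?thesis using sqint_nn(2)[OF sqint_measurable[OF f(3)]] T(1) by (simp add: T_def)
qed

lemma Poincare_PX: assumes "p \<in> PX" shows "norm (fst p) \<le> (2 * R + 1) * norm (snd p)"
proof -
  have "closed {p :: real lsq \<times> (real^3) lsq. norm (fst p) \<le> (2 * R + 1) * norm (snd p)}"
    by (intro closed_Collect_le continuous_intros)
  moreover have "gpair ` TX \<Omega> R \<subseteq> {p. norm (fst p) \<le> (2 * R + 1) * norm (snd p)}"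
    using Poincare_TX by (auto simp: gpair_def)
  ultimately have "PX \<subseteq> {p. norm (fst p) \<le> (2 * R + 1) * norm (snd p)}"
    unfolding PX_def by (intro closure_minimal)
  then show ?thesis using assms by blast
qed

text \<open>By the Poincare inequality a Cauchy sequence of gradients has Cauchy potentials, so the
  pairs converge within the closed set \<open>V\<close>.\<close>

lemma closed_snd:
  assumes V: "V \<subseteq> PX" "closed V" "subspace V" shows "closed (snd ` V)"
  unfolding closed_sequential_limits
proof (intro allI impI, elim conjE)
  fix x l assume x: "\<forall>n. x n \<in> snd ` V" and l: "x \<longlonglongrightarrow> l"
  then have "\<forall>n. \<exists>p. p \<in> V \<and> x n = snd p" by blast
  from choice[OF this] obtain p where p: "\<And>n. p n \<in> V" "\<And>n. x n = snd (p n)" by blast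
  have "Cauchy (\<lambda>n. fst (p n))"
  proof (rule metric_CauchyI)
    fix \<epsilon> :: real assume \<epsilon>: "\<epsilon> > 0"
    obtain N where N: "\<And>m n. m \<ge> N \<Longrightarrow> n \<ge> N \<Longrightarrow> dist (x m) (x n) < \<epsilon> / (2 * R + 1)"
      using metric_CauchyD[OF LIMSEQ_imp_Cauchy[OF l], of "\<epsilon> / (2 * R + 1)"] \<epsilon> R by auto
    have "dist (fst (p m)) (fst (p n)) < \<epsilon>" if "m \<ge> N" "n \<ge> N" for m n
    proof -
      have "p m - p n \<in> PX" using V(1) subspace_diff[OF V(3) p(1) p(1)] by blast
      from Poincare_PX[OF this] have "dist (fst (p m)) (fst (p n)) \<le> (2 * R + 1) * dist (x m) (x n)"
        by (simp add: dist_norm p(2))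
      also have "\<dots> < (2 * R + 1) * (\<epsilon> / (2 * R + 1))"
        by (rule mult_strict_left_mono[OF N[OF that]]) (use R in simp)
      finally show ?thesis using R by simp
    qed
    then show "\<exists>M. \<forall>m\<ge>M. \<forall>n\<ge>M. dist (fst (p m)) (fst (p n)) < \<epsilon>" by blast
  qed
  then obtain a where a: "(\<lambda>n. fst (p n)) \<longlonglongrightarrow> a" using Cauchy_convergent convergent_def by blast
  have "x = (\<lambda>n. snd (p n))" using p(2) by auto
  then have "(\<lambda>n. (fst (p n), snd (p n))) \<longlonglongrightarrow> (a, l)" using a l by (intro tendsto_Pair) auto
  then have "p \<longlonglongrightarrow> (a, l)" by simp
  then have "(a, l) \<in> V" by (rule closed_sequentially[OF V(2), rotated]) (rule p(1))
  then show "l \<in> snd ` V" by force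
qed

text \<open>\<open>D\<close> consists of the gradients of \<open>H\<^sup>1\<^sub>0\<close>; \<open>X\<close> turns out to be the orthogonal complement of the weak curls.\<close>
definition "X = snd ` PX"
definition "D = snd ` PD"

lemma subspace_XD: "subspace X" "subspace D"
  unfolding X_def D_def by (intro linear_subspace_image linear_snd subspace_PX subspace_PD)+

lemma closed_XD: "closed X" "closed D"
  unfolding X_def D_def using closed_snd[of PX] closed_snd[of PD] PD_subset_PX subspace_PX subspace_PD by auto

lemma AE_seq:
  assumes "p \<in> closure (gpair ` S)" "S \<subseteq> TX \<Omega> R"
  obtains f where "\<And>n. f n \<in> S" "(\<lambda>n. toL2 (f n)) \<longlonglongrightarrow> fst p" "(\<lambda>n. toL2 (grad (f n))) \<longlonglongrightarrow> snd p"
    "AE x in lebesgue. (\<lambda>n. f n x) \<longlonglongrightarrow> fn (fst p) x"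
proof -
  obtain q where q: "\<And>n. q n \<in> gpair ` S" "q \<longlonglongrightarrow> p" using assms(1) unfolding closure_sequential by blast
  then have "\<forall>n. \<exists>f. f \<in> S \<and> q n = gpair f" by blast
  from choice[OF this] obtain f where f: "\<And>n. f n \<in> S" "\<And>n. q n = gpair (f n)" by blast
  have l1: "(\<lambda>n. toL2 (f n)) \<longlonglongrightarrow> fst p" and l2: "(\<lambda>n. toL2 (grad (f n))) \<longlonglongrightarrow> snd p"
    using tendsto_fst[OF q(2)] tendsto_snd[OF q(2)] by (auto simp: f(2) gpair_def)
  have s: "sqint (f n)" for n using TX_facts(3) f(1) assms(2) by blast
  obtain r where r: "strict_mono (r :: nat \<Rightarrow> nat)" "AE x in lebesgue. (\<lambda>n. f (r n) x) \<longlonglongrightarrow> fn (fst p) x"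
    using lsq_AE_subseq[of f "fn (fst p)", OF s] l1 by auto
  show ?thesis
    by (rule that[of "\<lambda>n. f (r n)"]) (use f(1) r LIMSEQ_subseq_LIMSEQ[OF l1 r(1)] LIMSEQ_subseq_LIMSEQ[OF l2 r(1)] in \<open>auto simp: o_def\<close>)
qed

lemma Sobolev_TX:
  assumes "f \<in> TX \<Omega> R"
  shows "(\<integral>\<^sup>+x. ennreal (f x ^ 6) \<partial>lebesgue) \<le> ennreal (4096 * norm (toL2 (grad f)) ^ 6)"
proof -
  note f = TX_facts[OF assms]
  have [measurable]: "f \<in> borel_measurable borel" "grad f \<in> borel_measurable borel"
    by (intro borel_measurable_continuous_onI smooth_continuous smooth_grad_continuous f)+
  have "(\<integral>\<^sup>+x. ennreal (f x ^ 6) \<partial>lebesgue) = (\<integral>\<^sup>+x. ennreal (f x ^ 6) \<partial>lborel)" by (simp add: nn_integral_completion)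
  also have "\<dots> \<le> 4096 * (\<integral>\<^sup>+v. ennreal ((norm (grad f v))\<^sup>2) \<partial>lborel) ^ 3" by (rule Sobolev_6[OF f(1,2)])
  also have "(\<integral>\<^sup>+v. ennreal ((norm (grad f v))\<^sup>2) \<partial>lborel) = (\<integral>\<^sup>+v. ennreal ((norm (grad f v))\<^sup>2) \<partial>lebesgue)"
    by (simp add: nn_integral_completion)
  also have "\<dots> = ennreal ((norm (toL2 (grad f)))\<^sup>2)" by (rule nn_integral_toL2[OF f(4)])
  also have "4096 * ennreal ((norm (toL2 (grad f)))\<^sup>2) ^ 3 = ennreal (4096 * norm (toL2 (grad f)) ^ 6)"
    by (simp add: ennreal_power ennreal_mult flip: power_mult)
  finally show ?thesis .
qed

lemma Sobolev_PX:
  assumes p: "p \<in> PX"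
  shows "(\<integral>\<^sup>+x. ennreal (fn (fst p) x ^ 6) \<partial>lebesgue) \<le> ennreal (4096 * norm (snd p) ^ 6)"
proof -
  obtain f where f: "\<And>n. f n \<in> TX \<Omega> R" "(\<lambda>n. toL2 (grad (f n))) \<longlonglongrightarrow> snd p"
    "AE x in lebesgue. (\<lambda>n. f n x) \<longlonglongrightarrow> fn (fst p) x"
    by (rule AE_seq[OF p[unfolded PX_def] order_refl]) (rule that)
  have [measurable]: "f n \<in> borel_measurable lebesgue" "fn (fst p) \<in> borel_measurable lebesgue" for n
    by (rule sqint_measurable[OF TX_facts(3)[OF f(1)]], rule sqint_measurable[OF sqint_fn])
  have "(\<integral>\<^sup>+x. ennreal (fn (fst p) x ^ 6) \<partial>lebesgue) = (\<integral>\<^sup>+x. liminf (\<lambda>n. ennreal (f n x ^ 6)) \<partial>lebesgue)"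
  proof (rule nn_integral_cong_AE, use f(3) in eventually_elim)
    case (elim x)
    have "(\<lambda>n. ennreal (f n x ^ 6)) \<longlonglongrightarrow> ennreal (fn (fst p) x ^ 6)"
      by (intro tendsto_ennrealI tendsto_power elim)
    from lim_imp_Liminf[OF trivial_limit_sequentially this] show ?case by (rule sym)
  qed
  also have "\<dots> \<le> liminf (\<lambda>n. \<integral>\<^sup>+x. ennreal (f n x ^ 6) \<partial>lebesgue)"
    by (rule nn_integral_liminf) measurable
  also have "\<dots> \<le> liminf (\<lambda>n. ennreal (4096 * norm (toL2 (grad (f n))) ^ 6))"
    by (intro Liminf_mono always_eventually allI Sobolev_TX f(1))
  also have "\<dots> = ennreal (4096 * norm (snd p) ^ 6)"
    by (intro lim_imp_Liminf tendsto_ennrealI tendsto_intros f(2)) auto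
  finally show ?thesis .
qed

section \<open>Truncation and the scalar equation\<close>

lemma softplus_lipschitz:
  assumes "a > 0" shows "\<bar>softplus a k x - softplus a k y\<bar> \<le> \<bar>x - y\<bar>"
proof -
  have "norm (softplus a k x - softplus a k y) \<le> 1 * norm (x - y)"
    by (rule field_differentiable_bound[of UNIV _ "logistic a k"])
       (use softplus_deriv[OF assms] in auto)
  then show ?thesis by simp
qed

lemma logistic_continuous: "continuous_on UNIV (logistic a k)"
  by (intro continuous_at_imp_continuous_on ballI DERIV_isCont[OF logistic_deriv])

lemma bm_logistic:
  assumes "\<psi> \<in> borel_measurable lebesgue" shows "bm (\<lambda>x. logistic a k (\<psi> x))"
proof (rule bmI[of _ 1])
  show "(\<lambda>x. logistic a k (\<psi> x)) \<in> borel_measurable lebesgue"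
    by (rule borel_measurable_continuous_on[OF logistic_continuous assms])
qed simp

text \<open>Subtracting \<open>softplus a k 0\<close> restores the value 0 beyond radius R; the
  gradient is merely multiplied by \<open>logistic\<close>, so its support does not grow.\<close>

lemma softplus_TX:
  assumes f: "f \<in> TX \<Omega> R" and a: "a > 0"
  shows "(\<lambda>x. softplus a k (f x) - softplus a k 0) \<in> TX \<Omega> R"
    "grad (\<lambda>x. softplus a k (f x) - softplus a k 0) = (\<lambda>x. logistic a k (f x) *\<^sub>R grad f x)"
proof -
  have s: "smooth f" using f by (simp add: TX_def)
  have sc: "smooth (\<lambda>x. softplus a k (f x))" by (rule smooth_comp[OF rsmooth_softplus[OF a] s])
  show g: "grad (\<lambda>x. softplus a k (f x) - softplus a k 0) = (\<lambda>x. logistic a k (f x) *\<^sub>R grad f x)"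
    by (rule ext) (simp add: grad_diff sc grad_comp_real[OF softplus_deriv[OF a] smooth_differentiable[OF s]])
  have "{x. logistic a k (f x) *\<^sub>R grad f x \<noteq> 0} \<subseteq> {x. grad f x \<noteq> 0}" by auto
  then have "closure {x. logistic a k (f x) *\<^sub>R grad f x \<noteq> 0} \<subseteq> closure {x. grad f x \<noteq> 0}" by (rule closure_mono)
  then show "(\<lambda>x. softplus a k (f x) - softplus a k 0) \<in> TX \<Omega> R"
    using f smooth_diff[OF sc smooth_const] by (auto simp: TX_def g)
qed

text \<open>The chain rule in the limit. Softplus is 1-Lipschitz, which settles the functions. For
  the gradients, the error of the approximants is multiplied by a factor in [0, 1], and the
  remaining product converges by domination along an almost everywhere convergent sequence.\<close>

lemma truncation_PX:
  assumes p: "p \<in> PX" and a: "a > 0"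
  defines "\<psi> \<equiv> fn (fst p)"
  shows "sqint (\<lambda>x. softplus a k (\<psi> x) - softplus a k 0)"
    "(toL2 (\<lambda>x. softplus a k (\<psi> x) - softplus a k 0), mulop (\<lambda>x. logistic a k (\<psi> x)) (snd p)) \<in> PX"
proof -
  let ?S = "\<lambda>f x. softplus a k (f x) - softplus a k 0"
  obtain f where f: "\<And>n. f n \<in> TX \<Omega> R" "(\<lambda>n. toL2 (f n)) \<longlonglongrightarrow> fst p" "(\<lambda>n. toL2 (grad (f n))) \<longlonglongrightarrow> snd p"
    "AE x in lebesgue. (\<lambda>n. f n x) \<longlonglongrightarrow> fn (fst p) x"
    by (rule AE_seq[OF p[unfolded PX_def] order_refl]) (rule that)
  note f = f(1-3) f(4)[folded \<psi>_def]
  have sf: "sqint (f n)" "sqint (grad (f n))" "sqint (?S (f n))" "sqint (grad (?S (f n)))" for n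
    using TX_facts(3,4)[OF f(1)] TX_facts(3,4)[OF softplus_TX(1)[OF f(1) a]] by auto
  have s\<psi>: "sqint \<psi>" by (simp add: \<psi>_def)
  have cs: "continuous_on UNIV (softplus a k)"
    by (intro continuous_at_imp_continuous_on ballI DERIV_isCont[OF softplus_deriv[OF a]])
  show sS: "sqint (?S \<psi>)"
  proof (rule sqint_bound[OF _ sqint_integrable[OF s\<psi>]])
    show "?S \<psi> \<in> borel_measurable lebesgue"
      by (intro borel_measurable_diff borel_measurable_const borel_measurable_continuous_on[OF cs sqint_measurable[OF s\<psi>]])
    show "AE x in lebesgue. (norm (?S \<psi> x))\<^sup>2 \<le> (norm (\<psi> x))\<^sup>2"
    proof (intro always_eventually allI power_mono)
      fix x show "norm (?S \<psi> x) \<le> norm (\<psi> x)" using softplus_lipschitz[OF a, of k "\<psi> x" 0] by simp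
    qed simp
  qed
  have L1: "(\<lambda>n. toL2 (?S (f n))) \<longlonglongrightarrow> toL2 (?S \<psi>)"
  proof (rule LIM_zero_cancel, rule tendsto_norm_zero_cancel, rule tendsto_sandwich[OF _ _ tendsto_const])
    show "(\<lambda>n. norm (toL2 (f n) - fst p)) \<longlonglongrightarrow> 0" by (rule tendsto_norm_zero[OF LIM_zero[OF f(2)]])
    show "\<forall>\<^sub>F n in sequentially. norm (toL2 (?S (f n)) - toL2 (?S \<psi>)) \<le> norm (toL2 (f n) - fst p)"
    proof (intro always_eventually allI)
      fix n
      have "fst p = toL2 \<psi>" by (simp add: \<psi>_def)
      then have "norm (toL2 (f n) - fst p) = norm (toL2 (\<lambda>x. f n x - \<psi> x))"
        by (simp add: toL2_diff sf s\<psi>)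
      moreover have "norm (toL2 (?S (f n)) - toL2 (?S \<psi>)) = norm (toL2 (\<lambda>x. ?S (f n) x - ?S \<psi> x))"
        by (simp add: toL2_diff sf sS)
      moreover have "norm (toL2 (\<lambda>x. ?S (f n) x - ?S \<psi> x)) \<le> norm (toL2 (\<lambda>x. f n x - \<psi> x))"
        by (intro norm_toL2_mono sqint_diff sf sS s\<psi> always_eventually allI)
           (use softplus_lipschitz[OF a] in auto)
      ultimately show "norm (toL2 (?S (f n)) - toL2 (?S \<psi>)) \<le> norm (toL2 (f n) - fst p)" by simp
    qed
    show "\<forall>\<^sub>F n in sequentially. 0 \<le> norm (toL2 (?S (f n)) - toL2 (?S \<psi>))" by simp
  qed
  let ?l = "\<lambda>f x. logistic a k (f x)"
  have bl: "bm (?l (f n))" "bm (?l \<psi>)" for n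
    by (intro bm_logistic sqint_measurable sf s\<psi>)+
  define G where "G = fn (snd p)"
  have sG: "sqint G" "toL2 G = snd p" by (auto simp: G_def)
  have A: "(\<lambda>n. toL2 (\<lambda>x. ?l (f n) x *\<^sub>R G x)) \<longlonglongrightarrow> toL2 (\<lambda>x. ?l \<psi> x *\<^sub>R G x)"
  proof (rule lsq_dominated(3)[OF _ _ sG(1)])
    show "(\<lambda>x. ?l (f n) x *\<^sub>R G x) \<in> borel_measurable lebesgue" for n
      by (rule sqint_measurable[OF bm_sqint[OF bl(1) sG(1)]])
    show "(\<lambda>x. ?l \<psi> x *\<^sub>R G x) \<in> borel_measurable lebesgue"
      by (rule sqint_measurable[OF bm_sqint[OF bl(2) sG(1)]])
    show "AE x in lebesgue. (\<lambda>n. ?l (f n) x *\<^sub>R G x) \<longlonglongrightarrow> ?l \<psi> x *\<^sub>R G x"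
      using f(4)
    proof eventually_elim
      case (elim x)
      have "(\<lambda>n. logistic a k (f n x)) \<longlonglongrightarrow> logistic a k (\<psi> x)"
        by (rule isCont_tendsto_compose[OF DERIV_isCont[OF logistic_deriv] elim])
      then show ?case by (intro tendsto_scaleR tendsto_const)
    qed
    show "AE x in lebesgue. norm (?l (f n) x *\<^sub>R G x) \<le> norm (G x)" for n
      by (intro always_eventually allI) (simp add: mult_left_le_one_le)
  qed
  have B: "(\<lambda>n. mulop (?l (f n)) (toL2 (grad (f n)) - snd p)) \<longlonglongrightarrow> 0"
  proof (rule tendsto_norm_zero_cancel, rule tendsto_sandwich[OF _ _ tendsto_const])
    show "(\<lambda>n. norm (toL2 (grad (f n)) - snd p)) \<longlonglongrightarrow> 0" by (rule tendsto_norm_zero[OF LIM_zero[OF f(3)]])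
    have "norm (mulop (?l (f n)) x) \<le> 1 * norm x" for n and x :: "(real^3) lsq"
      by (rule norm_mulop[OF bl(1)]) auto
    then show "\<forall>\<^sub>F n in sequentially. norm (mulop (?l (f n)) (toL2 (grad (f n)) - snd p)) \<le> norm (toL2 (grad (f n)) - snd p)"
      by simp
    show "\<forall>\<^sub>F n in sequentially. 0 \<le> norm (mulop (?l (f n)) (toL2 (grad (f n)) - snd p))" by simp
  qed
  have eq: "toL2 (grad (?S (f n))) = mulop (?l (f n)) (toL2 (grad (f n)) - snd p) + toL2 (\<lambda>x. ?l (f n) x *\<^sub>R G x)" for n
  proof -
    have "toL2 (grad (?S (f n))) = mulop (?l (f n)) (toL2 (grad (f n)))"
      unfolding softplus_TX(2)[OF f(1) a] by (rule mulop_toL2[symmetric, OF bl(1) sf(2)])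
    moreover have "toL2 (\<lambda>x. ?l (f n) x *\<^sub>R G x) = mulop (?l (f n)) (snd p)"
      using mulop_toL2[OF bl(1) sG(1)] sG(2) by simp
    ultimately show ?thesis by (simp add: mulop_diff bl)
  qed
  have L2: "(\<lambda>n. toL2 (grad (?S (f n)))) \<longlonglongrightarrow> mulop (?l \<psi>) (snd p)"
    unfolding eq using tendsto_add[OF B A] mulop_toL2[OF bl(2) sG(1)] sG(2) by simp
  have "(\<lambda>n. gpair (?S (f n))) \<longlonglongrightarrow> (toL2 (?S \<psi>), mulop (?l \<psi>) (snd p))"
    unfolding gpair_def by (rule tendsto_Pair[OF L1 L2])
  then show "(toL2 (?S \<psi>), mulop (?l \<psi>) (snd p)) \<in> PX"
    by (rule closed_sequentially[OF closed_P(1), rotated]) (intro gpair_in softplus_TX f(1) a)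
qed

definition "weight \<sigma>1 \<sigma>2 s \<longleftrightarrow> s \<in> borel_measurable lebesgue \<and> (\<forall>x :: real^3. \<sigma>1 \<le> s x \<and> s x \<le> (\<sigma>2 :: real))"
text \<open>The weak form of div(s (E0 + grad \<psi>)) = 0. Testing with all of \<open>X\<close>,
  not only with gradients from \<open>D\<close>, also imposes zero flux through the inner boundary
  components.\<close>

definition "solves s E0 p \<longleftrightarrow> p \<in> PX \<and> (\<forall>x\<in>X. mulop s (E0 + snd p) \<bullet> x = 0)"

lemma weight_bm: assumes "0 < \<sigma>1" "weight \<sigma>1 \<sigma>2 s"
  shows "bm s" "bm (\<lambda>x. sqrt (s x))" "bm (\<lambda>x. 1 / sqrt (s x))" "s x > 0" "\<sigma>1 \<le> s x" "s x \<le> \<sigma>2"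
proof -
  have m: "s \<in> borel_measurable lebesgue" using assms by (simp add: weight_def)
  note [measurable] = m
  have b: "\<sigma>1 \<le> s x" "s x \<le> \<sigma>2" for x using assms by (auto simp: weight_def)
  then show "\<sigma>1 \<le> s x" "s x \<le> \<sigma>2" by auto
  have pos: "s x > 0" for x using b(1)[of x] assms(1) by linarith
  then show "s x > 0" .
  show "bm s" using m b pos by (intro bmI[of _ \<sigma>2]) (auto simp: abs_of_pos)
  show "bm (\<lambda>x. sqrt (s x))" using b pos by (intro bmI[of _ "sqrt \<sigma>2"]) (auto simp: less_imp_le)
  show "bm (\<lambda>x. 1 / sqrt (s x))" using b pos assms(1)
    by (intro bmI[of _ "1 / sqrt \<sigma>1"]) (auto simp: less_imp_le intro!: divide_left_mono)
qed

text \<open>Multiplication by the square root of the weight turns the weighted form into the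
  ordinary inner product, so Riesz representation replaces Lax-Milgram. The representative lies in
  the closure of the transformed space, and dividing by the square root returns it to the closed
  space \<open>X\<close>.\<close>

lemma ex_solves:
  assumes \<sigma>: "0 < \<sigma>1" "weight \<sigma>1 \<sigma>2 s"
  shows "\<exists>p. solves s E0 p"
proof -
  note w = weight_bm[OF \<sigma>]
  let ?r = "\<lambda>x. sqrt (s x)" and ?i = "\<lambda>x. 1 / sqrt (s x)"
  have rr: "mulop ?r (mulop ?r x) = mulop s x" for x :: "(real^3) lsq"
    unfolding mulop_mulop[OF w(2,2)] by (rule mulop_cong) (use w bm_mult in \<open>auto simp: less_imp_le\<close>)
  have ir: "mulop ?i (mulop ?r x) = x" for x :: "(real^3) lsq"
    unfolding mulop_mulop[OF w(3,2)] using w(4) by (simp add: mulop_def less_imp_neq[symmetric])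
  have ri: "mulop ?r (mulop ?i x) = x" for x :: "(real^3) lsq"
    unfolding mulop_mulop[OF w(2,3)] using w(4) by (simp add: mulop_def less_imp_neq[symmetric])
  define h where "h x = (mulop ?r x, - (mulop ?r E0 \<bullet> mulop ?r x))" for x
  have lin: "linear h"
    by (rule linearI) (auto simp: h_def mulop_add mulop_scaleR w inner_simps)
  have "subspace (h ` X)" by (rule linear_subspace_image[OF lin subspace_XD(1)])
  moreover have "\<bar>r\<bar> \<le> norm (mulop ?r E0) * norm x" if "(x, r) \<in> h ` X" for x r
    using that by (auto simp: h_def Cauchy_Schwarz_ineq2)
  ultimately have "\<exists>g\<in>closure (fst ` h ` X). norm g \<le> norm (mulop ?r E0) \<and> (\<forall>(x, r)\<in>h ` X. g \<bullet> x = r)"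
    by (intro riesz_graph norm_ge_zero)
  then obtain g where g: "g \<in> closure (fst ` h ` X)" "\<And>x. x \<in> X \<Longrightarrow> g \<bullet> mulop ?r x = - (mulop ?r E0 \<bullet> mulop ?r x)"
    by (force simp: h_def)
  obtain y where y: "\<And>n. y n \<in> fst ` h ` X" "y \<longlonglongrightarrow> g" using g(1) unfolding closure_sequential by blast
  have yX: "mulop ?i (y n) \<in> X" for n
  proof -
    obtain x where "x \<in> X" "y n = mulop ?r x" using y(1)[of n] by (auto simp: h_def)
    then show ?thesis by (simp add: ir)
  qed
  obtain C where C: "AE x in lebesgue. \<bar>?i x\<bar> \<le> C" using w(3) unfolding bm_def by blast
  have yl: "(\<lambda>n. mulop ?i (y n)) \<longlonglongrightarrow> mulop ?i g"
  proof (rule LIM_zero_cancel, rule tendsto_norm_zero_cancel, rule tendsto_sandwich[OF _ _ tendsto_const])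
    have "(\<lambda>n. C * norm (y n - g)) \<longlonglongrightarrow> C * 0"
      by (intro tendsto_mult tendsto_const tendsto_norm_zero LIM_zero y(2))
    then show "(\<lambda>n. C * norm (y n - g)) \<longlonglongrightarrow> 0" by simp
    show "\<forall>\<^sub>F n in sequentially. norm (mulop ?i (y n) - mulop ?i g) \<le> C * norm (y n - g)"
      by (intro always_eventually allI) (simp add: mulop_diff[symmetric] w norm_mulop[OF w(3) C])
  qed simp
  have "mulop ?i g \<in> X" by (rule closed_sequentially[OF closed_XD(1) yX yl])
  then obtain p where p: "p \<in> PX" "snd p = mulop ?i g" by (auto simp: X_def)
  have "mulop s (E0 + snd p) \<bullet> x = 0" if "x \<in> X" for x
  proof -
    have "mulop s (E0 + snd p) \<bullet> x = mulop ?r (E0 + snd p) \<bullet> mulop ?r x"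
      unfolding rr[symmetric] by (rule inner_mulop[OF w(2)])
    also have "\<dots> = mulop ?r E0 \<bullet> mulop ?r x + g \<bullet> mulop ?r x"
      by (simp add: mulop_add w p ri inner_add_left)
    finally show ?thesis using g(2)[OF that] by simp
  qed
  then show ?thesis using p(1) unfolding solves_def by blast
qed

text \<open>The equation is tested with the truncated potential. Writing \<theta> as the square of
  its root gives one root to each factor, so the data enter only through
  \<open>sqrt \<theta>\<close> times \<open>E0\<close>, essentially where the potential exceeds
  \<open>k\<close>.\<close>

lemma trunc_energy:
  fixes k :: real
  assumes \<sigma>: "0 < \<sigma>1" "weight \<sigma>1 \<sigma>2 s" and p: "solves s E0 p" and a: "a > 0"
  defines "\<theta> \<equiv> \<lambda>x. logistic a k (fn (fst p) x)"
  shows "norm (mulop \<theta> (snd p)) \<le> (\<sigma>2 / \<sigma>1) * norm (mulop (\<lambda>x. sqrt (\<theta> x)) E0)"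
proof -
  note w = weight_bm[OF \<sigma>]
  let ?r = "\<lambda>x. sqrt (\<theta> x)" and ?G = "snd p"
  have b\<theta>: "bm \<theta>" unfolding \<theta>_def by (rule bm_logistic[OF sqint_measurable[OF sqint_fn]])
  have \<theta>: "0 \<le> \<theta> x" "\<theta> x \<le> 1" for x by (auto simp: \<theta>_def)
  have br: "bm ?r" using bm_measurable[OF b\<theta>] \<theta> by (intro bmI[of _ 1]) auto
  have rr: "mulop ?r (mulop ?r x) = mulop \<theta> x" for x :: "(real^3) lsq"
    unfolding mulop_mulop[OF br br] by (rule mulop_cong) (use \<theta> br b\<theta> bm_mult in auto)
  have comm: "mulop ?r (mulop s x) = mulop s (mulop ?r x)" for x :: "(real^3) lsq"
    by (simp add: mulop_mulop br w mult.commute)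
  have pX: "p \<in> PX" using p by (simp add: solves_def)
  have "mulop \<theta> ?G \<in> X" using truncation_PX(2)[OF pX a, of k] unfolding X_def \<theta>_def by force
  then have "0 = mulop s (E0 + ?G) \<bullet> mulop \<theta> ?G" using p by (simp add: solves_def)
  also have "\<dots> = mulop s (mulop ?r (E0 + ?G)) \<bullet> mulop ?r ?G"
    unfolding rr[symmetric] comm[symmetric] by (rule inner_mulop[OF br, symmetric])
  also have "\<dots> = mulop s (mulop ?r E0) \<bullet> mulop ?r ?G + mulop s (mulop ?r ?G) \<bullet> mulop ?r ?G"
    by (simp add: mulop_add w br inner_add_left)
  finally have "mulop s (mulop ?r ?G) \<bullet> mulop ?r ?G = - (mulop s (mulop ?r E0) \<bullet> mulop ?r ?G)" by simp
  moreover have "\<sigma>1 * (norm (mulop ?r ?G))\<^sup>2 \<le> mulop s (mulop ?r ?G) \<bullet> mulop ?r ?G"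
    by (rule mulop_coercive[OF w(1)]) (use w(5) in auto)
  moreover have "\<bar>mulop s (mulop ?r E0) \<bullet> mulop ?r ?G\<bar> \<le> \<sigma>2 * norm (mulop ?r E0) * norm (mulop ?r ?G)"
  proof -
    have "norm (mulop s (mulop ?r E0)) \<le> \<sigma>2 * norm (mulop ?r E0)"
      by (rule norm_mulop[OF w(1)]) (use w(4,6) in \<open>auto simp: abs_of_pos\<close>)
    then show ?thesis
      using Cauchy_Schwarz_ineq2[of "mulop s (mulop ?r E0)" "mulop ?r ?G"]
      by (meson mult_right_mono norm_ge_zero order_trans)
  qed
  ultimately have "\<sigma>1 * norm (mulop ?r ?G) * norm (mulop ?r ?G) \<le> \<sigma>2 * norm (mulop ?r E0) * norm (mulop ?r ?G)"
    by (simp add: power2_eq_square mult.assoc)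
  moreover have "\<sigma>2 \<ge> 0" using w(5,6)[of 0] \<sigma>(1) by linarith
  ultimately have "\<sigma>1 * norm (mulop ?r ?G) \<le> \<sigma>2 * norm (mulop ?r E0)"
    by (cases "norm (mulop ?r ?G) = 0") (auto simp: mult_le_cancel_right)
  then have "norm (mulop ?r ?G) \<le> (\<sigma>2 / \<sigma>1) * norm (mulop ?r E0)" using \<sigma>(1) by (simp add: field_simps)
  moreover have "norm (mulop ?r (mulop ?r ?G)) \<le> 1 * norm (mulop ?r ?G)"
    by (rule norm_mulop[OF br]) (use \<theta> in auto)
  ultimately show ?thesis by (simp add: rr)
qed

section \<open>Consequences of the integrability of the data\<close>

text \<open>\<open>\<epsilon>\<close> bounds the norm instead of being equal to it, so it can be
  kept positive and the later estimates scale with it.\<close>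

definition "Ldata q e0 \<epsilon> \<longleftrightarrow> e0 \<in> borel_measurable lebesgue \<and> (\<forall>x. x \<notin> \<Omega> \<longrightarrow> e0 x = 0) \<and>
  integrable lebesgue (\<lambda>x. norm (e0 x :: real^3) powr q) \<and> (LINT x|lebesgue. norm (e0 x) powr q) powr (1/q) \<le> (\<epsilon> :: real)"

lemma emeasure_\<Omega>: "emeasure lebesgue \<Omega> < \<infinity>" "A \<in> sets lebesgue \<Longrightarrow> A \<subseteq> \<Omega> \<Longrightarrow> emeasure lebesgue A < \<infinity>"
proof -
  show 1: "emeasure lebesgue \<Omega> < \<infinity>"
    using emeasure_bounded_finite[OF bounded_subset[OF bounded_ball sub]] op by (simp add: emeasure_completion)
  show "A \<in> sets lebesgue \<Longrightarrow> A \<subseteq> \<Omega> \<Longrightarrow> emeasure lebesgue A < \<infinity>"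
    using emeasure_mono[of A \<Omega> lebesgue] 1 by (auto intro: le_less_trans)
qed

lemma integrable_ind: "A \<in> sets lebesgue \<Longrightarrow> A \<subseteq> \<Omega> \<Longrightarrow> integrable lebesgue (indicator A :: _ \<Rightarrow> real)"
  using emeasure_\<Omega>(2) by simp

lemma Ldata_sqint: assumes "Ldata q e0 \<epsilon>" "q > 2" shows "sqint e0"
proof (rule sqint_bound)
  show "e0 \<in> borel_measurable lebesgue" using assms by (simp add: Ldata_def)
  show "integrable lebesgue (\<lambda>x. indicator \<Omega> x + norm (e0 x) powr q)"
    using assms integrable_ind[of \<Omega>] by (auto simp: Ldata_def)
  show "AE x in lebesgue. (norm (e0 x))\<^sup>2 \<le> indicator \<Omega> x + norm (e0 x) powr q"
  proof (intro always_eventually allI)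
    fix x
    show "(norm (e0 x))\<^sup>2 \<le> indicator \<Omega> x + norm (e0 x) powr q"
    proof (cases "x \<in> \<Omega>")
      case False
      then show ?thesis using assms by (simp add: Ldata_def)
    next
      case True
      show ?thesis
      proof (cases "norm (e0 x) \<le> 1")
        case True
        then have "(norm (e0 x))\<^sup>2 \<le> 1" by (simp add: power_le_one)
        also have "1 \<le> indicator \<Omega> x + norm (e0 x) powr q" using \<open>x \<in> \<Omega>\<close> by simp
        finally show ?thesis .
      next
        case False
        then have "norm (e0 x) powr 2 \<le> norm (e0 x) powr q" using assms(2) by (intro powr_mono) auto
        moreover have "norm (e0 x) powr 2 = (norm (e0 x))\<^sup>2" using False by (subst powr_numeral) auto
        moreover have "0 \<le> (indicator \<Omega> x :: real)" by simp
        ultimately show ?thesis by linarith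
      qed
    qed
  qed
qed

lemma Ldata_power_bound:
  assumes "Ldata q e0 \<epsilon>" "q > 0" "\<alpha> > 0"
  shows "(LINT x|lebesgue. norm (e0 x) powr q) powr (\<alpha> / q) \<le> \<epsilon> powr \<alpha>"
proof -
  have "((LINT x|lebesgue. norm (e0 x) powr q) powr (1/q)) powr \<alpha> \<le> \<epsilon> powr \<alpha>"
    using assms by (intro powr_mono2) (auto simp: Ldata_def)
  then show ?thesis by (simp add: powr_powr)
qed

lemma Ldata_ind:
  assumes d: "Ldata q e0 \<epsilon>" and q: "q > 2" and A: "A \<in> sets lebesgue" "A \<subseteq> \<Omega>"
  shows "(LINT x|lebesgue. (norm (e0 x))\<^sup>2 * indicator A x) \<le> \<epsilon> powr 2 * measure lebesgue A powr (1 - 2/q)"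
proof -
  have [measurable]: "e0 \<in> borel_measurable lebesgue" using d by (simp add: Ldata_def)
  note [measurable] = A(1)
  let ?q' = "q / (q - 2)"
  have e: "\<bar>(norm (e0 x))\<^sup>2\<bar> powr (q/2) = norm (e0 x) powr q" for x
    using power_powr[of "norm (e0 x)" 2 "q/2"] by simp
  have i: "\<bar>indicator A x :: real\<bar> powr ?q' = indicator A x" for x by (auto simp: indicator_def)
  have "(LINT x|lebesgue. \<bar>(norm (e0 x))\<^sup>2 * indicator A x\<bar>) \<le>
    (LINT x|lebesgue. \<bar>(norm (e0 x))\<^sup>2\<bar> powr (q/2)) powr (1/(q/2)) * (LINT x|lebesgue. \<bar>indicator A x :: real\<bar> powr ?q') powr (1/?q')"
  proof (rule Holder_inequality(2))
    show "integrable lebesgue (\<lambda>x. \<bar>(norm (e0 x))\<^sup>2\<bar> powr (q/2))" unfolding e using d by (simp add: Ldata_def)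
    show "integrable lebesgue (\<lambda>x. \<bar>indicator A x :: real\<bar> powr ?q')" unfolding i by (rule integrable_ind[OF A])
  qed (use q in \<open>auto simp: field_simps\<close>)
  also have "\<dots> = (LINT x|lebesgue. norm (e0 x) powr q) powr (2/q) * measure lebesgue A powr (1 - 2/q)"
  proof -
    have "1 / ?q' = 1 - 2/q" using q by (simp add: field_simps)
    moreover have "(LINT x|lebesgue. (indicator A x :: real)) = measure lebesgue A" by simp
    ultimately show ?thesis unfolding e i by simp
  qed
  also have "\<dots> \<le> \<epsilon> powr 2 * measure lebesgue A powr (1 - 2/q)"
    by (intro mult_right_mono Ldata_power_bound[OF d]) (use q in auto)
  finally show ?thesis by (simp add: abs_mult)
qed

text \<open>Hoelder twice: the finite measure of \<open>\<Omega>\<close> lowers the exponent q of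
  the data to 3, and the exponents 3/2 and 3 for the squares pair the data with \<open>f\<close> in
  L^6, which the Sobolev inequality bounds by the gradient.\<close>

lemma Ldata_form_bound:
  assumes q: "q > 3"
  shows "\<exists>C>0. \<forall>e0 \<epsilon> f. Ldata q e0 \<epsilon> \<and> \<epsilon> > 0 \<and> f \<in> TX \<Omega> R \<longrightarrow>
    norm (toL2 (\<lambda>x. f x *\<^sub>R e0 x)) \<le> C * \<epsilon> * norm (toL2 (grad f))"
proof -
  define M where "M = measure lebesgue \<Omega>"
  define K where "K = (M powr (1 - 3/q)) powr (2/3)"
  have K0: "K \<ge> 0" by (simp add: K_def)
  \<comment> \<open>The cube root of the Sobolev constant 4096 is 16, whose root is the 4 in front
    of \<open>sqrt K\<close>; the added 1 keeps the constant positive.\<close>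
  have "norm (toL2 (\<lambda>x. f x *\<^sub>R e0 x)) \<le> (4 * sqrt K + 1) * \<epsilon> * norm (toL2 (grad f))"
    if d: "Ldata q e0 \<epsilon>" and \<epsilon>: "\<epsilon> > 0" and f: "f \<in> TX \<Omega> R" for e0 \<epsilon> f
  proof -
    note F = TX_facts[OF f]
    have s0: "sqint e0" using d q by (intro Ldata_sqint) auto
    have [measurable]: "e0 \<in> borel_measurable lebesgue" "f \<in> borel_measurable lebesgue"
      using d sqint_measurable[OF F(3)] by (auto simp: Ldata_def)
    have [measurable]: "\<Omega> \<in> sets lebesgue" by (rule \<Omega>_sets)
    have e: "\<bar>norm (e0 x) powr 3\<bar> powr (q/3) = norm (e0 x) powr q" for x using powr_powr[of "norm (e0 x)" 3 "q/3"] by (simp del: powr_numeral)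
    have i: "\<bar>indicator \<Omega> x :: real\<bar> powr (q/(q-3)) = indicator \<Omega> x" for x by (auto simp: indicator_def)
    have e3: "norm (e0 x) powr 3 * indicator \<Omega> x = norm (e0 x) powr 3" for x
      using d by (auto simp: Ldata_def indicator_def)
    have hp: "q/3 > 1" "q/(q-3) > 1" "1/(q/3) + 1/(q/(q-3)) = 1" using q by (auto simp: field_simps)
    have hm: "(\<lambda>x. norm (e0 x) powr 3) \<in> borel_measurable lebesgue" "(indicator \<Omega> :: real^3 \<Rightarrow> real) \<in> borel_measurable lebesgue"
      by measurable
    have hi: "integrable lebesgue (\<lambda>x. \<bar>norm (e0 x) powr 3\<bar> powr (q/3))" "integrable lebesgue (\<lambda>x. \<bar>indicator \<Omega> x :: real\<bar> powr (q/(q-3)))"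
      unfolding e i using d integrable_ind[of \<Omega>] by (auto simp: Ldata_def)
    have H1: "integrable lebesgue (\<lambda>x. norm (e0 x) powr 3 * indicator \<Omega> x)"
      "(LINT x|lebesgue. \<bar>norm (e0 x) powr 3 * indicator \<Omega> x\<bar>) \<le> (LINT x|lebesgue. \<bar>norm (e0 x) powr 3\<bar> powr (q/3)) powr (1/(q/3)) * (LINT x|lebesgue. \<bar>indicator \<Omega> x :: real\<bar> powr (q/(q-3))) powr (1/(q/(q-3)))"
      by (rule Holder_inequality[OF hp hm hi])+
    have L3: "(LINT x|lebesgue. norm (e0 x) powr 3) \<le> \<epsilon> powr 3 * M powr (1 - 3/q)"
    proof -
      have "1 / (q/(q-3)) = 1 - 3/q" using q by (simp add: field_simps)
      then have "(LINT x|lebesgue. norm (e0 x) powr 3) \<le> (LINT x|lebesgue. norm (e0 x) powr q) powr (3/q) * M powr (1 - 3/q)"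
        using H1(2) unfolding e i e3 by (simp add: M_def)
      also have "\<dots> \<le> \<epsilon> powr 3 * M powr (1 - 3/q)"
        by (intro mult_right_mono Ldata_power_bound[OF d]) (use q in auto)
      finally show ?thesis .
    qed
    have e2: "\<bar>(norm (e0 x))\<^sup>2\<bar> powr (3/2) = norm (e0 x) powr 3" for x
      using power_powr[of "norm (e0 x)" 2 "3/2"] by (simp del: powr_numeral)
    have f6: "\<bar>(f x)\<^sup>2\<bar> powr 3 = f x ^ 6" for x
      by (subst powr_numeral) (auto simp flip: power_mult)
    have fi: "integrable lebesgue (\<lambda>x. f x ^ 6)"
      by (intro compact_support_integrable continuous_intros smooth_continuous F) (use F(2) in simp)
    have H2: "(LINT x|lebesgue. \<bar>(norm (e0 x))\<^sup>2 * (f x)\<^sup>2\<bar>) \<le> (LINT x|lebesgue. \<bar>(norm (e0 x))\<^sup>2\<bar> powr (3/2)) powr (1/(3/2)) * (LINT x|lebesgue. \<bar>(f x)\<^sup>2\<bar> powr 3) powr (1/3)"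
    proof (rule Holder_inequality(2))
      show "integrable lebesgue (\<lambda>x. \<bar>(norm (e0 x))\<^sup>2\<bar> powr (3/2))" unfolding e2 using H1(1) unfolding e3 .
      show "integrable lebesgue (\<lambda>x. \<bar>(f x)\<^sup>2\<bar> powr 3)" unfolding f6 by (rule fi)
    qed auto
    have f6b: "(LINT x|lebesgue. f x ^ 6) \<le> 4096 * norm (toL2 (grad f)) ^ 6"
    proof -
      have "ennreal (LINT x|lebesgue. f x ^ 6) = (\<integral>\<^sup>+x. ennreal (f x ^ 6) \<partial>lebesgue)"
        by (rule nn_integral_eq_integral[OF fi, symmetric]) simp
      also have "\<dots> \<le> ennreal (4096 * norm (toL2 (grad f)) ^ 6)" by (rule Sobolev_TX[OF f])
      finally show ?thesis by (simp add: ennreal_le_iff)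
    qed
    have sq: "sqint (\<lambda>x. f x *\<^sub>R e0 x)" by (rule bm_sqint[OF F(5) s0])
    have "(norm (toL2 (\<lambda>x. f x *\<^sub>R e0 x)))\<^sup>2 = (LINT x|lebesgue. \<bar>(norm (e0 x))\<^sup>2 * (f x)\<^sup>2\<bar>)"
      unfolding norm_toL2_sq[OF sq] by (simp add: power_mult_distrib abs_mult mult.commute)
    also have "\<dots> \<le> (LINT x|lebesgue. norm (e0 x) powr 3) powr (2/3) * (LINT x|lebesgue. f x ^ 6) powr (1/3)"
      using H2 unfolding e2 f6 by simp
    also have "\<dots> \<le> (\<epsilon> powr 3 * M powr (1 - 3/q)) powr (2/3) * (4096 * norm (toL2 (grad f)) ^ 6) powr (1/3)"
      by (intro mult_mono powr_mono2 L3 f6b) auto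
    also have "(\<epsilon> powr 3 * M powr (1 - 3/q)) powr (2/3) = \<epsilon>\<^sup>2 * K"
    proof -
      have "(\<epsilon> powr 3) powr (2/3) = \<epsilon>\<^sup>2" unfolding powr_powr using \<epsilon> by simp
      then show ?thesis using \<epsilon> by (simp add: powr_mult K_def del: powr_numeral)
    qed
    also have "(4096 * norm (toL2 (grad f)) ^ 6) powr (1/3) = 16 * (norm (toL2 (grad f)))\<^sup>2"
    proof -
      have "4096 * norm (toL2 (grad f)) ^ 6 = (16 * (norm (toL2 (grad f)))\<^sup>2) ^ 3" by (simp add: power_mult_distrib flip: power_mult)
      then have "(4096 * norm (toL2 (grad f)) ^ 6) powr (1/3) = (16 * (norm (toL2 (grad f)))\<^sup>2) powr (real 3 * (1/3))"
        using power_powr[of "16 * (norm (toL2 (grad f)))\<^sup>2" 3 "1/3"] by simp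
      then show ?thesis by simp
    qed
    also have "\<epsilon>\<^sup>2 * K * (16 * (norm (toL2 (grad f)))\<^sup>2) = (4 * sqrt K * \<epsilon> * norm (toL2 (grad f)))\<^sup>2"
      using K0 by (simp add: power_mult_distrib)
    finally have "norm (toL2 (\<lambda>x. f x *\<^sub>R e0 x)) \<le> 4 * sqrt K * \<epsilon> * norm (toL2 (grad f))"
      by (rule power2_le_imp_le) (use K0 \<epsilon> in auto)
    also have "\<dots> \<le> (4 * sqrt K + 1) * \<epsilon> * norm (toL2 (grad f))"
      using \<epsilon> by (intro mult_right_mono) auto
    finally show ?thesis .
  qed
  moreover have "4 * sqrt K + 1 > 0" using K0 by (simp add: add_nonneg_pos)
  ultimately show ?thesis by blast
qed

end

text \<open>Along the levels \<open>t \<epsilon> (1 - 2\<^sup>-\<^sup>n)\<close>, \<open>A\<close> decays like \<open>r\<^sup>n\<close>: the gain \<open>r\<close> to the power \<open>\<beta> - 1\<close>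
  is chosen to offset the factor \<open>2\<^sup>6\<close> by which the level gaps shrink.\<close>
lemma Stampacchia:
  fixes c A0 \<beta> :: real
  assumes c: "c \<ge> 0" and A0: "A0 > 0" and \<beta>: "\<beta> > 1"
  shows "\<exists>t>0. \<forall>A \<epsilon>. \<epsilon> > 0 \<and> (\<forall>k. 0 \<le> A k) \<and> (\<forall>k. A k \<le> A0) \<and> (\<forall>k h. k \<le> h \<longrightarrow> A h \<le> A k) \<and>
    (\<forall>k h. 0 \<le> k \<and> k < h \<longrightarrow> (h - k) ^ 6 * A h \<le> c * \<epsilon> ^ 6 * A k powr \<beta>) \<longrightarrow> A (t * \<epsilon>) = 0"
proof -
  define r :: real where "r = 64 powr (- 1 / (\<beta> - 1))"
  have "r < 64 powr 0" unfolding r_def using \<beta> by (intro powr_less_mono) auto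
  then have r: "0 < r" "r < 1" by (auto simp: r_def)
  have r\<beta>: "r powr (\<beta> - 1) = 1 / 64" unfolding r_def powr_powr using \<beta> by (simp add: powr_minus)
  \<comment> \<open>\<open>B\<close> is the threshold for \<open>t ^ 6\<close> at which the
    induction step closes, and t = 1 + B exceeds it since t^6 \<ge> t. It involves neither
    \<open>A\<close> nor \<open>\<epsilon>\<close>, so one \<open>t\<close> serves all level
    functions.\<close>
  define B where "B = c * 64 * A0 powr (\<beta> - 1) / r"
  define t where "t = 1 + B"
  have B: "B \<ge> 0" using c r by (simp add: B_def)
  have t: "t \<ge> 1" using B by (simp add: t_def)
  have t6: "B \<le> t ^ 6"
  proof -
    have "B \<le> t ^ 1" by (simp add: t_def)
    also have "\<dots> \<le> t ^ 6" by (rule power_increasing[OF _ t]) simp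
    finally show ?thesis .
  qed
  have "A (t * \<epsilon>) = 0" if \<epsilon>: "\<epsilon> > 0" and A: "\<And>k. 0 \<le> A k" "\<And>k. A k \<le> A0" "\<And>k h. k \<le> h \<Longrightarrow> A h \<le> A k"
    and step: "\<And>k h. 0 \<le> k \<Longrightarrow> k < h \<Longrightarrow> (h - k) ^ 6 * A h \<le> c * \<epsilon> ^ 6 * A k powr \<beta>" for A \<epsilon>
  proof -
    define K where "K n = t * \<epsilon> * (1 - (1/2) ^ n)" for n :: nat
    have te: "t * \<epsilon> > 0" using t \<epsilon> by simp
    have K: "0 \<le> K n" "K n \<le> t * \<epsilon>" for n
      using te by (auto simp: K_def power_le_one mult_left_le)
    have Kd: "K (Suc n) - K n = t * \<epsilon> * (1/2) ^ Suc n" for n by (simp add: K_def algebra_simps)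
    have main: "A (K n) \<le> A0 * r ^ n" for n
    proof (induction n)
      case 0
      then show ?case using A(2) by simp
    next
      case (Suc n)
      have pos: "0 < A0 * r ^ n" using A0 r by simp
      have "(K (Suc n) - K n) ^ 6 * A (K (Suc n)) \<le> c * \<epsilon> ^ 6 * A (K n) powr \<beta>"
      proof (rule step)
        have "0 < K (Suc n) - K n" unfolding Kd using te by simp
        then show "K n < K (Suc n)" by simp
      qed (rule K)
      also have "\<dots> \<le> c * \<epsilon> ^ 6 * (A0 * r ^ n) powr \<beta>"
        using c \<epsilon> \<beta> by (intro mult_left_mono powr_mono2 Suc A) auto
      also have "(A0 * r ^ n) powr \<beta> = (A0 * r ^ n) * (A0 powr (\<beta> - 1) * (1/64) ^ n)"
      proof -
        have "(A0 * r ^ n) powr \<beta> = (A0 * r ^ n) powr (1 + (\<beta> - 1))" by simp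
        also have "\<dots> = (A0 * r ^ n) * (A0 * r ^ n) powr (\<beta> - 1)" using pos by (simp only: powr_add) simp
        also have "(A0 * r ^ n) powr (\<beta> - 1) = A0 powr (\<beta> - 1) * (r ^ n) powr (\<beta> - 1)"
          using A0 r by (simp add: powr_mult)
        also have "(r ^ n) powr (\<beta> - 1) = (r powr (\<beta> - 1)) ^ n"
          using r by (simp add: powr_realpow[symmetric] powr_powr mult.commute)
        finally show ?thesis by (simp add: r\<beta>)
      qed
      finally have "(t * \<epsilon> * (1/2) ^ Suc n) ^ 6 * A (K (Suc n)) \<le> c * \<epsilon> ^ 6 * ((A0 * r ^ n) * (A0 powr (\<beta> - 1) * (1/64) ^ n))"
        unfolding Kd .
      moreover have "(t * \<epsilon> * (1/2) ^ Suc n) ^ 6 = t ^ 6 * \<epsilon> ^ 6 * ((1/64) ^ n / 64)"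
      proof -
        have "((1/2 :: real) ^ Suc n) ^ 6 = ((1/2) ^ 6) ^ Suc n" by (simp only: power_mult[symmetric] mult.commute)
        also have "(1/2 :: real) ^ 6 = 1/64" by (simp add: power_divide)
        finally have "((1/2 :: real) ^ Suc n) ^ 6 = (1/64) ^ n / 64" by simp
        then show ?thesis by (simp only: power_mult_distrib)
      qed
      ultimately have "(\<epsilon> ^ 6 * (1/64) ^ n) * (t ^ 6 / 64 * A (K (Suc n))) \<le> (\<epsilon> ^ 6 * (1/64) ^ n) * (c * (A0 * r ^ n) * A0 powr (\<beta> - 1))"
        by (simp only: mult_ac times_divide_eq_left times_divide_eq_right)
      then have "t ^ 6 / 64 * A (K (Suc n)) \<le> c * (A0 * r ^ n) * A0 powr (\<beta> - 1)"
        using \<epsilon> by (subst (asm) mult_le_cancel_left_pos) auto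
      then have "t ^ 6 * A (K (Suc n)) \<le> B * r * (A0 * r ^ n)"
        using r by (simp add: B_def field_simps)
      also have "\<dots> \<le> t ^ 6 * r * (A0 * r ^ n)" using t6 r pos by (intro mult_right_mono) auto
      finally have "t ^ 6 * A (K (Suc n)) \<le> t ^ 6 * (r * (A0 * r ^ n))" by (simp add: mult.assoc)
      then have "A (K (Suc n)) \<le> r * (A0 * r ^ n)" using t by (subst (asm) mult_le_cancel_left_pos) auto
      then show ?case by (simp add: mult_ac)
    qed
    have "A (t * \<epsilon>) \<le> A0 * r ^ n" for n using A(3)[OF K(2), of n] main[of n] by linarith
    moreover have "(\<lambda>n. A0 * r ^ n) \<longlonglongrightarrow> A0 * 0"
      using r by (intro tendsto_mult tendsto_const LIMSEQ_realpow_zero) auto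
    ultimately have "A (t * \<epsilon>) \<le> A0 * 0" by (intro LIMSEQ_le_const[where X="\<lambda>n. A0 * r ^ n"]) auto
    then show ?thesis using A(1)[of "t * \<epsilon>"] by simp
  qed
  then show ?thesis using t by (intro exI[of _ t]) auto
qed

context dom
begin

section \<open>Bounding the potential through its level sets\<close>

text \<open>The truncation level \<open>l\<close> sits midway between \<open>k\<close> and
  \<open>h\<close>: for large sharpness the logistic factor is negligible below \<open>k\<close>,
  while the truncated potential is nearly at least h - l above \<open>h\<close>. The Sobolev
  inequality and the truncated energy give the claim in the limit; the 64 comes from halving h -
  k.\<close>

lemma level_estimate:
  assumes \<sigma>: "0 < \<sigma>1" "weight \<sigma>1 \<sigma>2 s" and e0: "sqint e0" and p: "solves s (toL2 e0) p"
    and kh: "0 \<le> k" "k < h"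
  defines "\<psi> \<equiv> fn (fst p)"
  shows "(h - k) ^ 6 * measure lebesgue (\<Omega> \<inter> {x. h \<le> \<psi> x}) \<le>
    64 * 4096 * (\<sigma>2 / \<sigma>1) ^ 6 * (LINT x|lebesgue. (norm (e0 x))\<^sup>2 * indicator {x. k \<le> \<psi> x} x) ^ 3"
proof -
  define l where "l = (k + h) / 2"
  have l: "0 \<le> l" "k < l" "l < h" "h - l = (h - k) / 2" using kh by (auto simp: l_def field_simps)
  have pX: "p \<in> PX" using p by (simp add: solves_def)
  have m\<psi>[measurable]: "\<psi> \<in> borel_measurable lebesgue" by (simp add: \<psi>_def sqint_measurable)
  have me[measurable]: "e0 \<in> borel_measurable lebesgue" by (rule sqint_measurable[OF e0])
  define S where "S = \<Omega> \<inter> {x. h \<le> \<psi> x}"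
  have S[measurable]: "S \<in> sets lebesgue"
    unfolding S_def using \<Omega>_sets(1) borel_measurable_le[OF borel_measurable_const m\<psi>, of h] by simp
  define m where "m = measure lebesgue S"
  have Sm: "emeasure lebesgue S = ennreal m"
    unfolding m_def by (rule emeasure_eq_ennreal_measure) (use emeasure_\<Omega>(2)[OF S] in \<open>auto simp: S_def less_top\<close>)
  define J where "J = (LINT x|lebesgue. (norm (e0 x))\<^sup>2 * indicator {x. k \<le> \<psi> x} x)"
  define N where "N = (LINT x|lebesgue. (norm (e0 x))\<^sup>2)"
  have kset[measurable]: "{x. k \<le> \<psi> x} \<in> sets lebesgue" using borel_measurable_le[OF borel_measurable_const m\<psi>, of k] by simp
  have Ji: "integrable lebesgue (\<lambda>x. (norm (e0 x))\<^sup>2 * indicator {x. k \<le> \<psi> x} x)"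
    using integrable_mult_indicator[OF kset sqint_integrable[OF e0]] by (simp add: mult.commute)
  \<comment> \<open>Two errors of finite sharpness are kept explicit: ln 2 / a from
    \<open>softplus a l 0\<close>, and the logistic tail 1 / (1 + a (l - k)) below level
    \<open>k\<close>. Both vanish as \<open>a\<close> grows.\<close>
  have step: "(h - l - ln 2 / a) ^ 6 * m \<le> 4096 * (\<sigma>2 / \<sigma>1) ^ 6 * (J + N * (1 / (1 + a * (l - k)))) ^ 3"
    if a: "a > 0" and big: "ln 2 / a \<le> h - l" for a
  proof -
    define \<theta> where "\<theta> x = logistic a l (\<psi> x)" for x
    define w where "w x = softplus a l (\<psi> x) - softplus a l 0" for x
    have tr: "sqint w" "(toL2 w, mulop \<theta> (snd p)) \<in> PX"
      using truncation_PX[OF pX a, of l] by (auto simp: w_def[abs_def] \<theta>_def[abs_def] \<psi>_def)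
    have b\<theta>: "bm \<theta>" unfolding \<theta>_def by (rule bm_logistic[OF m\<psi>])
    have br: "bm (\<lambda>x. sqrt (\<theta> x))"
    proof (rule bmI[of _ 1])
      show "(\<lambda>x. sqrt (\<theta> x)) \<in> borel_measurable lebesgue" 
        using bm_measurable[OF b\<theta>] by measurable
    qed (simp add: \<theta>_def)
    have low: "h - l - ln 2 / a \<le> w x" if "x \<in> S" for x
    proof -
      have "a * (h - l) \<le> a * (\<psi> x - l)" using that a by (simp add: S_def)
      also have "\<dots> = ln (exp (a * (\<psi> x - l)))" by simp
      also have "\<dots> \<le> ln (1 + exp (a * (\<psi> x - l)))" by (subst ln_le_cancel_iff) (auto simp: add_pos_pos)
      finally have "h - l \<le> softplus a l (\<psi> x)" using a by (simp add: softplus_def field_simps)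
      moreover have "softplus a l 0 \<le> ln 2 / a"
      proof -
        have "exp (a * (0 - l)) \<le> 1" using a l by simp
        then have "ln (1 + exp (a * (0 - l))) \<le> ln 2" by (subst ln_le_cancel_iff) (auto simp: add_pos_pos)
        then show ?thesis using a by (simp add: softplus_def divide_right_mono)
      qed
      ultimately show ?thesis by (simp add: w_def)
    qed
    have "ennreal ((h - l - ln 2 / a) ^ 6 * m) = (\<integral>\<^sup>+x. ennreal ((h - l - ln 2 / a) ^ 6) * indicator S x \<partial>lebesgue)"
      by (subst nn_integral_cmult_indicator) (auto simp: Sm ennreal_mult m_def)
    also have "\<dots> \<le> (\<integral>\<^sup>+x. ennreal (w x ^ 6) \<partial>lebesgue)"
    proof (rule nn_integral_mono)
      fix x
      show "ennreal ((h - l - ln 2 / a) ^ 6) * indicator S x \<le> ennreal (w x ^ 6)"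
      proof (cases "x \<in> S")
        case True
        have "(h - l - ln 2 / a) ^ 6 \<le> w x ^ 6" using low[OF True] big by (intro power_mono) auto
        then show ?thesis using True by (simp add: ennreal_leI)
      qed simp
    qed
    also have "\<dots> = (\<integral>\<^sup>+x. ennreal (fn (toL2 w) x ^ 6) \<partial>lebesgue)"
      by (rule nn_integral_cong_AE) (use fn_toL2[OF tr(1)] in \<open>auto elim: eventually_mono\<close>)
    also have "\<dots> \<le> ennreal (4096 * norm (mulop \<theta> (snd p)) ^ 6)" using Sobolev_PX[OF tr(2)] by simp
    finally have 1: "(h - l - ln 2 / a) ^ 6 * m \<le> 4096 * norm (mulop \<theta> (snd p)) ^ 6" by (simp add: ennreal_le_iff)
    have 2: "norm (mulop \<theta> (snd p)) \<le> (\<sigma>2 / \<sigma>1) * norm (mulop (\<lambda>x. sqrt (\<theta> x)) (toL2 e0))"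
      using trunc_energy[OF \<sigma> p a, of l] unfolding \<theta>_def[abs_def] \<psi>_def .
    have 3: "(norm (mulop (\<lambda>x. sqrt (\<theta> x)) (toL2 e0)))\<^sup>2 \<le> J + N * (1 / (1 + a * (l - k)))"
    proof -
      have "(norm (mulop (\<lambda>x. sqrt (\<theta> x)) (toL2 e0)))\<^sup>2 = (LINT x|lebesgue. (norm (sqrt (\<theta> x) *\<^sub>R e0 x))\<^sup>2)"
        unfolding mulop_toL2[OF br e0] by (rule norm_toL2_sq[OF bm_sqint[OF br e0]])
      also have "\<dots> \<le> (LINT x|lebesgue. (norm (e0 x))\<^sup>2 * indicator {x. k \<le> \<psi> x} x + (norm (e0 x))\<^sup>2 * (1 / (1 + a * (l - k))))"
      proof (rule integral_mono)
        show "integrable lebesgue (\<lambda>x. (norm (sqrt (\<theta> x) *\<^sub>R e0 x))\<^sup>2)" by (rule sqint_integrable[OF bm_sqint[OF br e0]])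
        show "integrable lebesgue (\<lambda>x. (norm (e0 x))\<^sup>2 * indicator {x. k \<le> \<psi> x} x + (norm (e0 x))\<^sup>2 * (1 / (1 + a * (l - k))))"
          using Ji sqint_integrable[OF e0] by (intro Bochner_Integration.integrable_add integrable_mult_left)
        fix x
        have "\<theta> x \<le> indicator {x. k \<le> \<psi> x} x + 1 / (1 + a * (l - k))"
        proof (cases "k \<le> \<psi> x")
          case True
          have "0 \<le> 1 / (1 + a * (l - k))" using a l by simp
          then show ?thesis using True logistic_le(2)[of a l "\<psi> x"] unfolding \<theta>_def by (simp add: add_increasing2)
        next
          case False
          then have "a * (l - k) \<le> - (a * (\<psi> x - l))" using a by (simp add: algebra_simps)
          then have "1 + a * (l - k) \<le> exp (- (a * (\<psi> x - l)))"
            using exp_ge_add_one_self[of "- (a * (\<psi> x - l))"] by linarith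
          moreover have "0 < 1 + a * (l - k)" using a l by (simp add: add_pos_pos)
          ultimately have "1 / (1 + exp (- (a * (\<psi> x - l)))) \<le> 1 / (1 + a * (l - k))"
            by (intro divide_left_mono) (auto simp: add_pos_pos)
          then show ?thesis using False by (simp add: \<theta>_def logistic_def)
        qed
        then have "\<theta> x * (norm (e0 x))\<^sup>2 \<le> (indicator {x. k \<le> \<psi> x} x + 1 / (1 + a * (l - k))) * (norm (e0 x))\<^sup>2"
          by (rule mult_right_mono) simp
        then show "(norm (sqrt (\<theta> x) *\<^sub>R e0 x))\<^sup>2 \<le> (norm (e0 x))\<^sup>2 * indicator {x. k \<le> \<psi> x} x + (norm (e0 x))\<^sup>2 * (1 / (1 + a * (l - k)))"
          by (simp add: power_mult_distrib \<theta>_def algebra_simps)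
      qed
      also have "\<dots> = J + N * (1 / (1 + a * (l - k)))"
        unfolding J_def N_def using Ji sqint_integrable[OF e0]
        by (subst Bochner_Integration.integral_add) (auto simp del: times_divide_eq_right)
      finally show ?thesis .
    qed
    have "norm (mulop \<theta> (snd p)) ^ 6 \<le> ((\<sigma>2 / \<sigma>1) * norm (mulop (\<lambda>x. sqrt (\<theta> x)) (toL2 e0))) ^ 6"
      by (intro power_mono 2) simp
    also have "\<dots> = (\<sigma>2 / \<sigma>1) ^ 6 * ((norm (mulop (\<lambda>x. sqrt (\<theta> x)) (toL2 e0)))\<^sup>2) ^ 3"
      unfolding power_mult_distrib by (simp flip: power_mult)
    also have "\<dots> \<le> (\<sigma>2 / \<sigma>1) ^ 6 * (J + N * (1 / (1 + a * (l - k)))) ^ 3"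
      by (intro mult_left_mono power_mono 3) auto
    finally show ?thesis using 1 by simp
  qed
  have inv: "(\<lambda>n. inverse (real (Suc n))) \<longlonglongrightarrow> 0" by (rule LIMSEQ_inverse_real_of_nat)
  have lim1: "(\<lambda>n. (h - l - ln 2 / real (Suc n)) ^ 6 * m) \<longlonglongrightarrow> (h - l - ln 2 * 0) ^ 6 * m"
    unfolding divide_inverse by (intro tendsto_intros inv)
  have lim2: "(\<lambda>n. 4096 * (\<sigma>2 / \<sigma>1) ^ 6 * (J + N * (1 / (1 + real (Suc n) * (l - k)))) ^ 3) \<longlonglongrightarrow> 4096 * (\<sigma>2 / \<sigma>1) ^ 6 * (J + N * 0) ^ 3"
  proof (intro tendsto_intros)
    show "(\<lambda>n. 1 / (1 + real (Suc n) * (l - k))) \<longlonglongrightarrow> 0"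
    proof (rule tendsto_sandwich[OF _ _ tendsto_const])
      have "(\<lambda>n. inverse (real (Suc n)) * inverse (l - k)) \<longlonglongrightarrow> 0 * inverse (l - k)" by (intro tendsto_intros inv)
      then show "(\<lambda>n. inverse (real (Suc n)) * inverse (l - k)) \<longlonglongrightarrow> 0" by simp
      show "\<forall>\<^sub>F n in sequentially. 1 / (1 + real (Suc n) * (l - k)) \<le> inverse (real (Suc n)) * inverse (l - k)"
      proof (intro always_eventually allI)
        fix n
        have "1 / (1 + real (Suc n) * (l - k)) \<le> 1 / (real (Suc n) * (l - k))"
          using l by (intro divide_left_mono) (auto simp: add_pos_pos)
        then show "1 / (1 + real (Suc n) * (l - k)) \<le> inverse (real (Suc n)) * inverse (l - k)"
          by (simp add: divide_inverse)
      qed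
      show "\<forall>\<^sub>F n in sequentially. 0 \<le> 1 / (1 + real (Suc n) * (l - k))" using l by simp
    qed
  qed
  have "(h - l - ln 2 * 0) ^ 6 * m \<le> 4096 * (\<sigma>2 / \<sigma>1) ^ 6 * (J + N * 0) ^ 3"
  proof (rule tendsto_le[OF sequentially_bot lim2 lim1])
    have "(\<lambda>n. ln 2 * inverse (real (Suc n))) \<longlonglongrightarrow> ln 2 * 0" by (intro tendsto_intros inv)
    then have "\<forall>\<^sub>F n in sequentially. ln 2 * inverse (real (Suc n)) < h - l"
      by (rule order_tendstoD(2)) (use l in simp)
    then show "\<forall>\<^sub>F n in sequentially. (h - l - ln 2 / real (Suc n)) ^ 6 * m \<le> 4096 * (\<sigma>2 / \<sigma>1) ^ 6 * (J + N * (1 / (1 + real (Suc n) * (l - k)))) ^ 3"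
    proof eventually_elim
      case (elim n)
      then show ?case by (intro step) (auto simp: divide_inverse)
    qed
  qed
  then have "((h - k) / 2) ^ 6 * m \<le> 4096 * (\<sigma>2 / \<sigma>1) ^ 6 * J ^ 3" using l(4) by simp
  then show ?thesis by (simp add: power_divide m_def S_def J_def)
qed

text \<open>By Hoelder the data have energy at most \<epsilon>^2 |A|^(1 - 2/q) on a set A. Cubing
  gives the exponent \<beta> = 3 (1 - 2/q), and q > 3 is precisely what makes it exceed 1, as the
  level iteration requires. One bound serves all weights between \<open>\<sigma>1\<close> and
  \<open>\<sigma>2\<close>.\<close>

lemma potential_bound_above:
  assumes \<sigma>: "0 < \<sigma>1" and q: "q > 3"
  shows "\<exists>t>0. \<forall>s e0 p \<epsilon>. \<epsilon> > 0 \<and> weight \<sigma>1 \<sigma>2 s \<and> Ldata q e0 \<epsilon> \<and> solves s (toL2 e0) p \<longrightarrow>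
    (AE x in lebesgue. x \<in> \<Omega> \<longrightarrow> fn (fst p) x \<le> t * \<epsilon>)"
proof -
  define c where "c = 64 * 4096 * (\<sigma>2 / \<sigma>1) ^ 6"
  define A0 where "A0 = measure lebesgue \<Omega> + 1"
  define \<beta> where "\<beta> = 3 * (1 - 2/q)"
  have c: "c \<ge> 0" by (simp add: c_def)
  have A0: "A0 > 0" by (simp add: A0_def add_nonneg_pos)
  have \<beta>: "\<beta> > 1" using q by (simp add: \<beta>_def field_simps)
  obtain t where t: "t > 0" and tS: "\<And>A \<epsilon>. \<epsilon> > 0 \<Longrightarrow> (\<And>k. 0 \<le> A k) \<Longrightarrow> (\<And>k. A k \<le> A0) \<Longrightarrow> (\<And>k h. k \<le> h \<Longrightarrow> A h \<le> A k) \<Longrightarrow>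
    (\<And>k h. 0 \<le> k \<Longrightarrow> k < h \<Longrightarrow> (h - k) ^ 6 * A h \<le> c * \<epsilon> ^ 6 * A k powr \<beta>) \<Longrightarrow> A (t * \<epsilon>) = 0"
  proof -
    obtain t where t: "t > 0 \<and> (\<forall>A \<epsilon>. \<epsilon> > 0 \<and> (\<forall>k. 0 \<le> A k) \<and> (\<forall>k. A k \<le> A0) \<and> (\<forall>k h. k \<le> h \<longrightarrow> A h \<le> A k) \<and>
      (\<forall>k h. 0 \<le> k \<and> k < h \<longrightarrow> (h - k) ^ 6 * A h \<le> c * \<epsilon> ^ 6 * A k powr \<beta>) \<longrightarrow> A (t * \<epsilon>) = 0)"
      using Stampacchia[OF c A0 \<beta>] by (rule exE)
    show ?thesis
      by (rule that[OF conjunct1[OF t]], rule conjunct2[OF t, rule_format]) (intro conjI allI impI; (elim conjE)?; assumption | simp)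
  qed
  have "AE x in lebesgue. x \<in> \<Omega> \<longrightarrow> fn (fst p) x \<le> t * \<epsilon>"
    if \<epsilon>: "\<epsilon> > 0" and w: "weight \<sigma>1 \<sigma>2 s" and d: "Ldata q e0 \<epsilon>" and p: "solves s (toL2 e0) p" for s e0 p \<epsilon>
  proof -
    define \<psi> where "\<psi> = fn (fst p)"
    have m\<psi>[measurable]: "\<psi> \<in> borel_measurable lebesgue" by (simp add: \<psi>_def sqint_measurable)
    have e0: "sqint e0" using Ldata_sqint[OF d] q by simp
    define S where "S k = \<Omega> \<inter> {x. k \<le> \<psi> x}" for k
    have S: "S k \<in> sets lebesgue" "S k \<subseteq> \<Omega>" for k
      unfolding S_def using \<Omega>_sets(1) borel_measurable_le[OF borel_measurable_const m\<psi>, of k] by auto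
    have fin: "emeasure lebesgue (S k) \<noteq> \<infinity>" for k using emeasure_\<Omega>(2)[OF S] by (simp add: less_top)
    define A where "A k = measure lebesgue (S k)" for k
    have "A (t * \<epsilon>) = 0"
    proof (rule tS[OF \<epsilon>])
      show "0 \<le> A k" for k by (simp add: A_def)
      have "A k \<le> measure lebesgue \<Omega>" for k
        unfolding A_def using emeasure_\<Omega>(1) by (intro measure_mono_fmeasurable S fmeasurableI \<Omega>_sets) auto
      then show "A k \<le> A0" for k using order_trans[of "A k" "measure lebesgue \<Omega>" A0] by (simp add: A0_def)
      show "A h \<le> A k" if "k \<le> h" for k h
        unfolding A_def using that fin[of k]
        by (intro measure_mono_fmeasurable S fmeasurableI) (auto simp: S_def less_top)
      show "(h - k) ^ 6 * A h \<le> c * \<epsilon> ^ 6 * A k powr \<beta>" if kh: "0 \<le> k" "k < h" for k h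
      proof -
        have J: "(LINT x|lebesgue. (norm (e0 x))\<^sup>2 * indicator {x. k \<le> \<psi> x} x) \<le> \<epsilon> powr 2 * A k powr (1 - 2/q)"
        proof -
          have "(\<lambda>x. (norm (e0 x))\<^sup>2 * indicator {x. k \<le> \<psi> x} x) = (\<lambda>x. (norm (e0 x))\<^sup>2 * indicator (S k) x)"
            using d by (auto simp: fun_eq_iff S_def indicator_def Ldata_def)
          then show ?thesis unfolding A_def using Ldata_ind[OF d _ S] q by simp
        qed
        have "0 \<le> (LINT x|lebesgue. (norm (e0 x))\<^sup>2 * indicator {x. k \<le> \<psi> x} x)" by simp
        then have "(LINT x|lebesgue. (norm (e0 x))\<^sup>2 * indicator {x. k \<le> \<psi> x} x) ^ 3 \<le> (\<epsilon> powr 2 * A k powr (1 - 2/q)) ^ 3"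
          by (intro power_mono J)
        also have "\<dots> = \<epsilon> ^ 6 * A k powr \<beta>"
        proof -
          have "(A k powr (1 - 2/q)) ^ 3 = A k powr \<beta>"
          proof (cases "A k = 0")
            case False
            then have "A k > 0" by (simp add: A_def less_le)
            then show ?thesis by (simp add: \<beta>_def powr_power mult.commute)
          qed simp
          moreover have "(\<epsilon> powr 2) ^ 3 = \<epsilon> ^ 6" using \<epsilon> by (simp flip: power_mult)
          ultimately show ?thesis by (simp add: power_mult_distrib)
        qed
        finally have "(LINT x|lebesgue. (norm (e0 x))\<^sup>2 * indicator {x. k \<le> \<psi> x} x) ^ 3 \<le> \<epsilon> ^ 6 * A k powr \<beta>" .
        then have "c * (LINT x|lebesgue. (norm (e0 x))\<^sup>2 * indicator {x. k \<le> \<psi> x} x) ^ 3 \<le> c * (\<epsilon> ^ 6 * A k powr \<beta>)"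
          using c by (rule mult_left_mono)
        moreover have "(h - k) ^ 6 * A h \<le> c * (LINT x|lebesgue. (norm (e0 x))\<^sup>2 * indicator {x. k \<le> \<psi> x} x) ^ 3"
          using level_estimate[OF \<sigma> w e0 p kh] unfolding A_def S_def \<psi>_def c_def by simp
        ultimately show ?thesis by (simp add: mult.assoc)
      qed
    qed
    then have "emeasure lebesgue (S (t * \<epsilon>)) = 0"
      using fin[of "t * \<epsilon>"] by (simp add: A_def emeasure_eq_ennreal_measure)
    then have "AE x in lebesgue. x \<notin> S (t * \<epsilon>)" by (intro AE_not_in) (simp add: null_setsI S)
    then show ?thesis by eventually_elim (auto simp: S_def \<psi>_def)
  qed
  with t show ?thesis by blast
qed

text \<open>The equation is linear: the negated potential solves it with negated data, so the
  one-sided bound applies twice.\<close>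

lemma potential_bound:
  assumes \<sigma>: "0 < \<sigma>1" and q: "q > 3"
  shows "\<exists>t>0. \<forall>s e0 p \<epsilon>. \<epsilon> > 0 \<and> weight \<sigma>1 \<sigma>2 s \<and> Ldata q e0 \<epsilon> \<and> solves s (toL2 e0) p \<longrightarrow>
    (AE x in lebesgue. x \<in> \<Omega> \<longrightarrow> \<bar>fn (fst p) x\<bar> \<le> t * \<epsilon>)"
proof -
  obtain t where t: "t > 0" and tb: "\<And>s e0 p \<epsilon>. \<epsilon> > 0 \<Longrightarrow> weight \<sigma>1 \<sigma>2 s \<Longrightarrow> Ldata q e0 \<epsilon> \<Longrightarrow> solves s (toL2 e0) p \<Longrightarrow>
    (AE x in lebesgue. x \<in> \<Omega> \<longrightarrow> fn (fst p) x \<le> t * \<epsilon>)"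
  proof -
    obtain t where t: "t > 0 \<and> (\<forall>s e0 p \<epsilon>. \<epsilon> > 0 \<and> weight \<sigma>1 \<sigma>2 s \<and> Ldata q e0 \<epsilon> \<and> solves s (toL2 e0) p \<longrightarrow>
      (AE x in lebesgue. x \<in> \<Omega> \<longrightarrow> fn (fst p) x \<le> t * \<epsilon>))"
      using potential_bound_above[OF \<sigma> q] by (rule exE)
    show ?thesis by (rule that[OF conjunct1[OF t]], rule conjunct2[OF t, rule_format]) (intro conjI)
  qed
  have "AE x in lebesgue. x \<in> \<Omega> \<longrightarrow> \<bar>fn (fst p) x\<bar> \<le> t * \<epsilon>"
    if \<epsilon>: "\<epsilon> > 0" and w: "weight \<sigma>1 \<sigma>2 s" and d: "Ldata q e0 \<epsilon>" and p: "solves s (toL2 e0) p" for s e0 p \<epsilon>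
  proof -
    have e0: "sqint e0" using Ldata_sqint[OF d] q by simp
    have bs: "bm s" by (rule weight_bm[OF \<sigma> w])
    have d': "Ldata q (\<lambda>x. - e0 x) \<epsilon>" using d by (auto simp: Ldata_def)
    have p': "solves s (toL2 (\<lambda>x. - e0 x)) (- p)"
    proof -
      have "mulop s (toL2 (\<lambda>x. - e0 x) + snd (- p)) = - mulop s (toL2 e0 + snd p)"
        using mulop_scaleR[OF bs, of "-1" "toL2 e0 + snd p"] by (simp add: toL2_uminus[OF e0, symmetric])
      moreover have "- p \<in> PX" using p subspace_neg[OF subspace_PX] by (simp add: solves_def)
      ultimately show ?thesis using p by (simp add: solves_def)
    qed
    have "AE x in lebesgue. fn (fst (- p)) x = - fn (fst p) x"
      using fn_toL2[OF sqint_minus[OF sqint_fn[of "fst p"]]] toL2_uminus[OF sqint_fn[of "fst p"]] by simp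
    moreover note tb[OF \<epsilon> w d p] tb[OF \<epsilon> w d' p']
    ultimately show ?thesis by eventually_elim (auto simp: abs_le_iff)
  qed
  with t show ?thesis by blast
qed

text \<open>The potential of the solution is bounded, so \<open>\<psi> \<phi>\<^sup>2\<close> is an admissible test function.\<close>
lemma test_form_bound:
  assumes \<sigma>: "0 < \<sigma>1" "weight \<sigma>1 \<sigma>2 s" and e0: "sqint e0" and p: "solves s (toL2 e0) p"
    and M: "AE x in lebesgue. x \<in> \<Omega> \<longrightarrow> \<bar>fn (fst p) x\<bar> \<le> M" "M \<ge> 0" and \<phi>: "test_fun \<Omega> \<phi>"
  shows "norm (mulop \<phi> (toL2 e0 + snd p)) \<le> sqrt (\<sigma>2 / \<sigma>1) * (norm (mulop \<phi> (toL2 e0)) + 2 * M * norm (toL2 (grad \<phi>)))"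
proof -
  note w = weight_bm[OF \<sigma>]
  let ?E = "toL2 e0 + snd p"
  have t\<phi>: "\<phi> \<in> TX \<Omega> R" by (rule test_fun_TX[OF \<phi>])
  note F = TX_facts[OF t\<phi>]
  have pX: "p \<in> PX" using p by (simp add: solves_def)
  define \<psi> where "\<psi> = fn (fst p)"
  define E where "E x = e0 x + fn (snd p) x" for x
  have sE: "sqint E" "toL2 E = ?E"
    using sqint_add[OF e0 sqint_fn] toL2_add[OF e0 sqint_fn[of "snd p"]] by (auto simp: E_def[abs_def])
  have s\<psi>: "sqint \<psi>" "toL2 \<psi> = fst p" by (auto simp: \<psi>_def)
  obtain B where B: "B > 0" "\<And>x. norm (grad \<phi> x) \<le> B"
    using compact_support_bounded[OF smooth_grad_continuous[OF F(1)] test_fun_UNIV_facts(4)[OF F(1,2)]] by metis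
  have m: "grad \<phi> \<in> borel_measurable lebesgue" "E \<in> borel_measurable lebesgue" "s \<in> borel_measurable lebesgue" "\<phi> \<in> borel_measurable lebesgue"
    using sqint_measurable[OF F(4)] sqint_measurable[OF sE(1)] bm_measurable[OF w(1)] bm_measurable[OF F(5)] by auto
  note [measurable] = m
  \<comment> \<open>The gradient of \<phi>^2 f has two parts; \<open>a\<close> gathers the
    coefficient of \<open>f\<close> itself, which leaves \<phi>^2 s E as the coefficient of grad
    f.\<close>
  define a where "a x = 2 * \<phi> x * s x * (E x \<bullet> grad \<phi> x)" for x
  have sa: "sqint a"
  proof (rule sqint_bound)
    have bs\<phi>: "bm (\<lambda>x. s x * \<phi> x)" by (rule bm_mult[OF w(1) F(5)])
    show "a \<in> borel_measurable lebesgue" unfolding a_def by measurable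
    show "integrable lebesgue (\<lambda>x. (2 * B)\<^sup>2 * (norm ((s x * \<phi> x) *\<^sub>R E x))\<^sup>2)"
      using sqint_integrable[OF bm_sqint[OF bs\<phi> sE(1)]] by (rule integrable_mult_right)
    show "AE x in lebesgue. (norm (a x))\<^sup>2 \<le> (2 * B)\<^sup>2 * (norm ((s x * \<phi> x) *\<^sub>R E x))\<^sup>2"
    proof (intro always_eventually allI)
      fix x
      have "\<bar>E x \<bullet> grad \<phi> x\<bar> \<le> norm (E x) * B"
        using Cauchy_Schwarz_ineq2[of "E x" "grad \<phi> x"] mult_left_mono[OF B(2)[of x] norm_ge_zero[of "E x"]] by linarith
      then have "2 * \<bar>s x * \<phi> x\<bar> * \<bar>E x \<bullet> grad \<phi> x\<bar> \<le> 2 * \<bar>s x * \<phi> x\<bar> * (norm (E x) * B)"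
        by (rule mult_left_mono) simp
      moreover have "norm (a x) = 2 * \<bar>s x * \<phi> x\<bar> * \<bar>E x \<bullet> grad \<phi> x\<bar>" by (simp add: a_def abs_mult mult_ac)
      moreover have "(2 * B) * norm ((s x * \<phi> x) *\<^sub>R E x) = 2 * \<bar>s x * \<phi> x\<bar> * (norm (E x) * B)" by (simp add: mult_ac)
      ultimately have "norm (a x) \<le> (2 * B) * norm ((s x * \<phi> x) *\<^sub>R E x)" by (simp only:)
      then have "(norm (a x))\<^sup>2 \<le> ((2 * B) * norm ((s x * \<phi> x) *\<^sub>R E x))\<^sup>2"
        by (intro power_mono) auto
      then show "(norm (a x))\<^sup>2 \<le> (2 * B)\<^sup>2 * (norm ((s x * \<phi> x) *\<^sub>R E x))\<^sup>2" by (simp add: power_mult_distrib)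
    qed
  qed
  have b2: "bm (\<lambda>x. \<phi> x * \<phi> x)" by (rule bm_mult[OF F(5,5)])
  define y where "y = (toL2 a, mulop (\<lambda>x. \<phi> x * \<phi> x) (mulop s ?E))"
  \<comment> \<open>Against a smooth potential \<open>f\<close> the pairing is the equation tested
    with \<phi>^2 f, a genuine test function. The pairing is continuous in (f, grad f), so it also
    vanishes at \<open>p\<close>, which need not be smooth.\<close>
  have zero: "y \<bullet> p = 0"
  proof (rule orthogonal_closure[of "gpair ` TX \<Omega> R"])
    show "p \<in> closure (gpair ` TX \<Omega> R)" using pX by (simp add: PX_def)
    fix g assume "g \<in> gpair ` TX \<Omega> R"
    then obtain f where f: "f \<in> TX \<Omega> R" "g = gpair f" by blast
    note f' = TX_facts[OF f(1)]
    have tf: "test_fun \<Omega> (\<lambda>x. \<phi> x * \<phi> x * f x)"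
      by (intro test_fun_mult(1) \<phi> F(1) f'(1))
    have gr: "grad (\<lambda>x. \<phi> x * \<phi> x * f x) = (\<lambda>x. (\<phi> x * \<phi> x) *\<^sub>R grad f x + f x *\<^sub>R ((2 * \<phi> x) *\<^sub>R grad \<phi> x))"
      by (rule ext) (simp add: grad_mult smooth_mult F(1) f'(1) scaleR_add_left[symmetric] scaleR_add_right algebra_simps)
    have "toL2 (grad (\<lambda>x. \<phi> x * \<phi> x * f x)) \<in> X"
      using gpair_in(1)[OF test_fun_TX[OF tf]] unfolding X_def gpair_def by force
    then have "mulop s ?E \<bullet> toL2 (grad (\<lambda>x. \<phi> x * \<phi> x * f x)) = 0" using p by (simp add: solves_def)
    also have "mulop s ?E = toL2 (\<lambda>x. s x *\<^sub>R E x)"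
      unfolding sE(2)[symmetric] by (rule mulop_toL2[OF w(1) sE(1)])
    also have "toL2 (\<lambda>x. s x *\<^sub>R E x) \<bullet> toL2 (grad (\<lambda>x. \<phi> x * \<phi> x * f x)) = (LINT x|lebesgue. s x *\<^sub>R E x \<bullet> grad (\<lambda>x. \<phi> x * \<phi> x * f x) x)"
      by (rule toL2_inner[OF bm_sqint[OF w(1) sE(1)] TX_facts(4)[OF test_fun_TX[OF tf]]])
    also have "\<dots> = (LINT x|lebesgue. a x \<bullet> f x + (\<phi> x * \<phi> x) *\<^sub>R (s x *\<^sub>R E x) \<bullet> grad f x)"
      unfolding gr by (rule Bochner_Integration.integral_cong) (auto simp: a_def inner_simps algebra_simps)
    also have "\<dots> = (LINT x|lebesgue. a x \<bullet> f x) + (LINT x|lebesgue. (\<phi> x * \<phi> x) *\<^sub>R (s x *\<^sub>R E x) \<bullet> grad f x)"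
      by (intro Bochner_Integration.integral_add sqint_inner_integrable sa f' bm_sqint b2 w sE)
    also have "\<dots> = toL2 a \<bullet> toL2 f + mulop (\<lambda>x. \<phi> x * \<phi> x) (toL2 (\<lambda>x. s x *\<^sub>R E x)) \<bullet> toL2 (grad f)"
      unfolding mulop_toL2[OF b2 bm_sqint[OF w(1) sE(1)]] toL2_inner[OF sa f'(3)]
        toL2_inner[OF bm_sqint[OF b2 bm_sqint[OF w(1) sE(1)]] f'(4)] ..
    finally show "y \<bullet> g = 0"
      unfolding y_def f(2) gpair_def inner_prod_def
      by (simp add: mulop_toL2[OF w(1) sE(1), unfolded sE(2)])
  qed
  define r where "r x = sqrt (s x)" for x
  have br: "bm r" unfolding r_def by (rule w(2))
  have rr: "r x * r x = s x" for x using w(4)[of x] by (simp add: r_def less_imp_le)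
  define W where "W = mulop (\<lambda>x. r x * \<phi> x) ?E"
  have br\<phi>: "bm (\<lambda>x. r x * \<phi> x)" by (rule bm_mult[OF br F(5)])
  have W': "W = toL2 (\<lambda>x. (r x * \<phi> x) *\<^sub>R E x)" unfolding W_def sE(2)[symmetric] by (rule mulop_toL2[OF br\<phi> sE(1)])
  have sWf: "sqint (\<lambda>x. (r x * \<phi> x) *\<^sub>R E x)" by (rule bm_sqint[OF br\<phi> sE(1)])
  define V where "V x = \<psi> x *\<^sub>R grad \<phi> x" for x
  have mV: "V \<in> borel_measurable lebesgue"
    unfolding V_def by (rule borel_measurable_scaleR[OF sqint_measurable[OF s\<psi>(1)] m(1)])
  \<comment> \<open>Here the bound on the potential enters: the cross term contains \<psi> grad
    \<phi>, which is supported in \<open>\<Omega>\<close>.\<close>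
  have Vb: "AE x in lebesgue. norm (V x) \<le> norm (M *\<^sub>R grad \<phi> x)"
    using M(1)
  proof eventually_elim
    case (elim x)
    show ?case
    proof (cases "x \<in> \<Omega>")
      case True
      then show ?thesis using elim M(2) by (simp add: V_def \<psi>_def mult_right_mono)
    next
      case False
      then show ?thesis using F(6) by (simp add: V_def)
    qed
  qed
  have sV: "sqint V"
  proof (rule sqint_bound[OF mV sqint_integrable[OF sqint_scaleR[OF F(4)]]])
    show "AE x in lebesgue. (norm (V x))\<^sup>2 \<le> (norm (M *\<^sub>R grad \<phi> x))\<^sup>2"
      using Vb by eventually_elim (intro power_mono, auto)
  qed
  have nV: "norm (toL2 V) \<le> M * norm (toL2 (grad \<phi>))"
    using norm_toL2_mono[OF sV sqint_scaleR[OF F(4)] Vb] M(2) by (simp add: toL2_scaleR[OF F(4), symmetric])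
  have i1: "toL2 a \<bullet> fst p = 2 * (W \<bullet> mulop r (toL2 V))"
  proof -
    have "toL2 a \<bullet> fst p = (LINT x|lebesgue. a x \<bullet> \<psi> x)" unfolding s\<psi>(2)[symmetric] by (rule toL2_inner[OF sa s\<psi>(1)])
    also have "\<dots> = (LINT x|lebesgue. 2 * ((r x * \<phi> x) *\<^sub>R E x \<bullet> r x *\<^sub>R V x))"
    proof (rule Bochner_Integration.integral_cong[OF refl])
      fix x
      have "a x \<bullet> \<psi> x = 2 * \<phi> x * (r x * r x) * (E x \<bullet> grad \<phi> x) * \<psi> x" by (simp add: a_def rr)
      then show "a x \<bullet> \<psi> x = 2 * ((r x * \<phi> x) *\<^sub>R E x \<bullet> r x *\<^sub>R V x)" by (simp add: V_def mult_ac)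
    qed
    also have "\<dots> = 2 * (W \<bullet> mulop r (toL2 V))"
      unfolding W' mulop_toL2[OF br sV] toL2_inner[OF sWf bm_sqint[OF br sV]] by simp
    finally show ?thesis .
  qed
  \<comment> \<open>Writing the gradient of the potential as the field minus the data turns the
    leading term into the weighted energy \<open>W \<bullet> W\<close> and a term linear in
    \<open>W\<close>.\<close>
  have i2: "mulop (\<lambda>x. \<phi> x * \<phi> x) (mulop s ?E) \<bullet> snd p = W \<bullet> W - W \<bullet> mulop r (mulop \<phi> (toL2 e0))"
  proof -
    have "mulop (\<lambda>x. \<phi> x * \<phi> x) (mulop s ?E) = mulop (\<lambda>x. r x * \<phi> x) W"
      unfolding W_def mulop_mulop[OF b2 w(1)] mulop_mulop[OF br\<phi> br\<phi>]
      by (rule mulop_cong[OF bm_mult[OF b2 w(1)] bm_mult[OF br\<phi> br\<phi>]]) (simp add: rr[symmetric] mult_ac)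
    then have "mulop (\<lambda>x. \<phi> x * \<phi> x) (mulop s ?E) \<bullet> snd p = W \<bullet> mulop (\<lambda>x. r x * \<phi> x) (snd p)"
      by (simp add: inner_mulop[OF br\<phi>])
    also have "mulop (\<lambda>x. r x * \<phi> x) (snd p) = W - mulop r (mulop \<phi> (toL2 e0))"
      unfolding W_def mulop_mulop[OF br F(5)] by (simp add: mulop_add br\<phi>)
    finally show ?thesis by (simp add: inner_diff_right)
  qed
  have "W \<bullet> W = W \<bullet> mulop r (mulop \<phi> (toL2 e0)) - 2 * (W \<bullet> mulop r (toL2 V))"
    using zero i1 i2 by (simp add: y_def inner_prod_def)
  moreover have nr: "norm (mulop r x) \<le> sqrt \<sigma>2 * norm x" for x :: "(real^3) lsq"
    by (rule norm_mulop[OF br]) (use w(4,6) in \<open>auto simp: r_def less_imp_le\<close>)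
  have "W \<bullet> mulop r (mulop \<phi> (toL2 e0)) \<le> norm W * (sqrt \<sigma>2 * norm (mulop \<phi> (toL2 e0)))"
    using norm_cauchy_schwarz[of W "mulop r (mulop \<phi> (toL2 e0))"] mult_left_mono[OF nr norm_ge_zero] by (meson order_trans)
  moreover have "- (W \<bullet> mulop r (toL2 V)) \<le> norm W * (sqrt \<sigma>2 * (M * norm (toL2 (grad \<phi>))))"
  proof -
    have "\<sigma>2 \<ge> 0" using w(5,6)[of 0] \<sigma>(1) by linarith
    have "- (W \<bullet> mulop r (toL2 V)) \<le> norm W * norm (mulop r (toL2 V))"
      using norm_cauchy_schwarz[of "- W" "mulop r (toL2 V)"] by simp
    also have "\<dots> \<le> norm W * (sqrt \<sigma>2 * norm (toL2 V))" by (intro mult_left_mono nr) simp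
    also have "\<dots> \<le> norm W * (sqrt \<sigma>2 * (M * norm (toL2 (grad \<phi>))))"
      using \<open>\<sigma>2 \<ge> 0\<close> by (intro mult_left_mono nV) auto
    finally show ?thesis .
  qed
  ultimately have "norm W * norm W \<le> norm W * (sqrt \<sigma>2 * (norm (mulop \<phi> (toL2 e0)) + 2 * M * norm (toL2 (grad \<phi>))))"
    by (simp add: power2_norm_eq_inner[symmetric] power2_eq_square algebra_simps)
  moreover have "\<sigma>2 \<ge> 0" using w(5,6)[of 0] \<sigma>(1) by linarith
  then have "0 \<le> sqrt \<sigma>2 * (norm (mulop \<phi> (toL2 e0)) + 2 * M * norm (toL2 (grad \<phi>)))" using M(2) by simp
  ultimately have W1: "norm W \<le> sqrt \<sigma>2 * (norm (mulop \<phi> (toL2 e0)) + 2 * M * norm (toL2 (grad \<phi>)))"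
    by (cases "norm W = 0") (auto simp: mult_le_cancel_left)
  have "mulop \<phi> ?E = mulop (\<lambda>x. 1 / sqrt (s x)) W"
  proof -
    have "(1 / sqrt (s x)) * (r x * \<phi> x) = \<phi> x" for x using w(4)[of x] by (simp add: r_def)
    then show ?thesis unfolding W_def mulop_mulop[OF w(3) br\<phi>] by (simp add: mulop_def)
  qed
  moreover have "norm (mulop (\<lambda>x. 1 / sqrt (s x)) W) \<le> (1 / sqrt \<sigma>1) * norm W"
    by (rule norm_mulop[OF w(3)]) (use w(4,5) \<sigma>(1) in \<open>auto simp: less_imp_le intro!: divide_left_mono\<close>)
  ultimately have "norm (mulop \<phi> ?E) \<le> (1 / sqrt \<sigma>1) * (sqrt \<sigma>2 * (norm (mulop \<phi> (toL2 e0)) + 2 * M * norm (toL2 (grad \<phi>))))"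
    using W1 \<sigma>(1) mult_left_mono[OF W1, of "1 / sqrt \<sigma>1"] by simp
  then show ?thesis by (simp add: real_sqrt_divide)
qed

text \<open>The bound for test functions passes to all of \<open>PD\<close> by Fatou's lemma, which
  also yields square integrability of the product for unbounded temperatures. The constant combines
  the data part \<open>C\<close> with the potential bound \<open>t\<close>; the added 1 keeps it
  positive.\<close>

lemma form_bound:
  assumes \<sigma>: "0 < \<sigma>1" and q: "q > 3"
  shows "\<exists>K>0. \<forall>s e0 p \<epsilon> v. \<epsilon> > 0 \<and> weight \<sigma>1 \<sigma>2 s \<and> Ldata q e0 \<epsilon> \<and> solves s (toL2 e0) p \<and> v \<in> PD \<longrightarrow>
    sqint (\<lambda>x. fn (fst v) x *\<^sub>R fn (toL2 e0 + snd p) x) \<and>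
    norm (toL2 (\<lambda>x. fn (fst v) x *\<^sub>R fn (toL2 e0 + snd p) x)) \<le> K * \<epsilon> * norm (snd v)"
proof -
  obtain t where t: "t > 0" and tb: "\<And>s e0 p \<epsilon>. \<epsilon> > 0 \<Longrightarrow> weight \<sigma>1 \<sigma>2 s \<Longrightarrow> Ldata q e0 \<epsilon> \<Longrightarrow> solves s (toL2 e0) p \<Longrightarrow>
    (AE x in lebesgue. x \<in> \<Omega> \<longrightarrow> \<bar>fn (fst p) x\<bar> \<le> t * \<epsilon>)"
  proof -
    obtain t where t: "t > 0 \<and> (\<forall>s e0 p \<epsilon>. \<epsilon> > 0 \<and> weight \<sigma>1 \<sigma>2 s \<and> Ldata q e0 \<epsilon> \<and> solves s (toL2 e0) p \<longrightarrow>
      (AE x in lebesgue. x \<in> \<Omega> \<longrightarrow> \<bar>fn (fst p) x\<bar> \<le> t * \<epsilon>))"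
      using potential_bound[OF \<sigma> q] by (rule exE)
    show ?thesis by (rule that[OF conjunct1[OF t]], rule conjunct2[OF t, rule_format]) (intro conjI)
  qed
  obtain C where C: "C > 0" and Cb: "\<And>e0 \<epsilon> f. Ldata q e0 \<epsilon> \<Longrightarrow> \<epsilon> > 0 \<Longrightarrow> f \<in> TX \<Omega> R \<Longrightarrow>
    norm (toL2 (\<lambda>x. f x *\<^sub>R e0 x)) \<le> C * \<epsilon> * norm (toL2 (grad f))"
    using Ldata_form_bound[OF q] by blast
  define K where "K = sqrt \<bar>\<sigma>2 / \<sigma>1\<bar> * (C + 2 * t) + 1"
  have K: "K > 0" using C t by (simp add: K_def add_nonneg_pos)
  have "sqint (\<lambda>x. fn (fst v) x *\<^sub>R fn (toL2 e0 + snd p) x) \<and>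
    norm (toL2 (\<lambda>x. fn (fst v) x *\<^sub>R fn (toL2 e0 + snd p) x)) \<le> K * \<epsilon> * norm (snd v)"
    if \<epsilon>: "\<epsilon> > 0" and w: "weight \<sigma>1 \<sigma>2 s" and d: "Ldata q e0 \<epsilon>" and p: "solves s (toL2 e0) p" and v: "v \<in> PD" for s e0 p \<epsilon> v
  proof -
    let ?E = "toL2 e0 + snd p"
    have e0: "sqint e0" using Ldata_sqint[OF d] q by simp
    obtain f where f: "\<And>n. f n \<in> {f. test_fun \<Omega> f}" "(\<lambda>n. toL2 (f n)) \<longlonglongrightarrow> fst v" "(\<lambda>n. toL2 (grad (f n))) \<longlonglongrightarrow> snd v"
      "AE x in lebesgue. (\<lambda>n. f n x) \<longlonglongrightarrow> fn (fst v) x"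
      by (rule AE_seq[OF v[unfolded PD_def]]) (use test_fun_TX in blast, rule that)
    have tf: "test_fun \<Omega> (f n)" "f n \<in> TX \<Omega> R" for n using f(1) test_fun_TX by auto
    have bf: "bm (f n)" for n by (rule TX_facts(5)[OF tf(2)])
    have est: "norm (toL2 (\<lambda>x. f n x *\<^sub>R fn ?E x)) \<le> K * \<epsilon> * norm (toL2 (grad (f n)))" for n
    proof -
      have "toL2 (\<lambda>x. f n x *\<^sub>R fn ?E x) = mulop (f n) ?E" by (simp add: mulop_def)
      also have "norm \<dots> \<le> sqrt (\<sigma>2 / \<sigma>1) * (norm (mulop (f n) (toL2 e0)) + 2 * (t * \<epsilon>) * norm (toL2 (grad (f n))))"
        by (rule test_form_bound[OF \<sigma> w e0 p tb[OF \<epsilon> w d p] _ tf(1)]) (use t \<epsilon> in simp)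
      also have "\<dots> \<le> sqrt \<bar>\<sigma>2 / \<sigma>1\<bar> * (C * \<epsilon> * norm (toL2 (grad (f n))) + 2 * (t * \<epsilon>) * norm (toL2 (grad (f n))))"
      proof (intro mult_mono add_mono order_refl real_sqrt_le_mono abs_ge_self)
        show "norm (mulop (f n) (toL2 e0)) \<le> C * \<epsilon> * norm (toL2 (grad (f n)))"
          unfolding mulop_toL2[OF bf e0] by (rule Cb[OF d \<epsilon> tf(2)])
      qed (use t \<epsilon> in auto)
      also have "\<dots> = (K - 1) * \<epsilon> * norm (toL2 (grad (f n)))" by (simp add: K_def algebra_simps)
      also have "\<dots> \<le> K * \<epsilon> * norm (toL2 (grad (f n)))" using \<epsilon> by (intro mult_right_mono) auto
      finally show ?thesis .
    qed
    have sn: "sqint (\<lambda>x. f n x *\<^sub>R fn ?E x)" for n by (rule bm_sqint[OF bf sqint_fn])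
    have mm: "(\<lambda>x. fn (fst v) x *\<^sub>R fn ?E x) \<in> borel_measurable lebesgue"
      by (rule borel_measurable_scaleR[OF sqint_measurable[OF sqint_fn] sqint_measurable[OF sqint_fn]])
    have lim: "AE x in lebesgue. (\<lambda>n. f n x *\<^sub>R fn ?E x) \<longlonglongrightarrow> fn (fst v) x *\<^sub>R fn ?E x"
      using f(4) by eventually_elim (intro tendsto_scaleR tendsto_const)
    have cl: "(\<lambda>n. K * \<epsilon> * norm (toL2 (grad (f n)))) \<longlonglongrightarrow> K * \<epsilon> * norm (snd v)"
      by (intro tendsto_mult tendsto_const tendsto_norm f(3))
    show ?thesis using sqint_Fatou[OF sn mm lim est cl] by blast
  qed
  with K show ?thesis by blast
qed

end

section \<open>Weak derivatives and the fixed point\<close>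

lemma bounded_linear_mulop:
  assumes "bm s" shows "bounded_linear (mulop s :: 'b::euclidean_space lsq \<Rightarrow> _)"
proof -
  obtain C where C: "AE x in lebesgue. \<bar>s x\<bar> \<le> C" using assms unfolding bm_def by blast
  show ?thesis
    by (rule bounded_linear_intro[of _ C])
       (use norm_mulop[OF assms C] in \<open>simp_all add: mulop_add mulop_scaleR assms mult.commute\<close>)
qed

lemma vec_test_linear:
  assumes "vec_test \<Omega> \<Phi>" "vec_test \<Omega> \<Psi>"
  shows "vec_test \<Omega> (\<lambda>x. \<Phi> x + \<Psi> x)" "vec_test \<Omega> (\<lambda>x. c *\<^sub>R \<Phi> x)"
    "ccurl (\<lambda>x. \<Phi> x + \<Psi> x) = (\<lambda>x. ccurl \<Phi> x + ccurl \<Psi> x)" "ccurl (\<lambda>x. c *\<^sub>R \<Phi> x) = (\<lambda>x. c *\<^sub>R ccurl \<Phi> x)"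
proof -
  show "vec_test \<Omega> (\<lambda>x. \<Phi> x + \<Psi> x)" "vec_test \<Omega> (\<lambda>x. c *\<^sub>R \<Phi> x)"
    using assms by (auto simp: vec_test_def test_fun_add test_fun_cmult)
  have d: "(\<lambda>x. \<Phi> x $ j) differentiable (at x)" "(\<lambda>x. \<Psi> x $ j) differentiable (at x)" for j x
    by (rule smooth_differentiable[OF test_funD(1)[OF vec_test_test[OF assms(1)]]],
        rule smooth_differentiable[OF test_funD(1)[OF vec_test_test[OF assms(2)]]])
  show "ccurl (\<lambda>x. \<Phi> x + \<Psi> x) = (\<lambda>x. ccurl \<Phi> x + ccurl \<Psi> x)"
    by (rule ext) (simp add: ccurl_def vec_eq_iff forall_3 vector_3 partial_add d)
  show "ccurl (\<lambda>x. c *\<^sub>R \<Phi> x) = (\<lambda>x. c *\<^sub>R ccurl \<Phi> x)"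
    by (rule ext) (simp add: ccurl_def vec_eq_iff forall_3 vector_3 partial_cmult d right_diff_distrib)
qed

lemma sqint_vec_test: "vec_test \<Omega> \<Phi> \<Longrightarrow> sqint \<Phi>" "vec_test \<Omega> \<Phi> \<Longrightarrow> sqint (ccurl \<Phi>)"
  by (intro sqint_compact_support vec_test_continuous vec_test_bounded vec_test_ccurl, assumption+)+

context dom
begin

section \<open>Fields on the domain as classes on the whole space\<close>

text \<open>Extension by zero realises L^2 of \<open>\<Omega>\<close> inside the Hilbert space over
  the whole space, so that fields on \<open>\<Omega>\<close> and potentials, which may be nonzero
  outside, are handled by the same operations. \<open>Z\<close> below is the image of this
  embedding.\<close>

definition ext0 :: "(real^3 \<Rightarrow> 'b::euclidean_space) \<Rightarrow> real^3 \<Rightarrow> 'b" where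
  "ext0 f x = indicator \<Omega> x *\<^sub>R f x"

definition LQ :: "(real^3 \<Rightarrow> 'b::euclidean_space) \<Rightarrow> 'b lsq" where "LQ f = toL2 (ext0 f)"

definition Z :: "'b::euclidean_space lsq set" where "Z = {a. mulop (indicator \<Omega>) a = a}"

lemma ext0_simps [simp]: "x \<in> \<Omega> \<Longrightarrow> ext0 f x = f x" "x \<notin> \<Omega> \<Longrightarrow> ext0 f x = 0"
  by (auto simp: ext0_def)

lemma ext0_ext0 [simp]: "ext0 (ext0 f) = ext0 f" by (auto simp: ext0_def fun_eq_iff indicator_def)

lemma ext0_id: "(\<And>x. x \<notin> \<Omega> \<Longrightarrow> f x = 0) \<Longrightarrow> ext0 f = f"
  by (auto simp: ext0_def fun_eq_iff indicator_def)

lemma ext0_arith: "ext0 (\<lambda>x. f x + g x) = (\<lambda>x. ext0 f x + ext0 g x)" "ext0 (\<lambda>x. f x - g x) = (\<lambda>x. ext0 f x - ext0 g x)"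
  by (auto simp: ext0_def scaleR_add_right scaleR_diff_right)

lemma LQ_arith:
  assumes "sqint (ext0 f)" "sqint (ext0 g)"
  shows "LQ (\<lambda>x. f x + g x) = LQ f + LQ g" "LQ (\<lambda>x. f x - g x) = LQ f - LQ g"
  using assms by (simp_all add: LQ_def ext0_arith toL2_simps)

lemma bm_ind: "bm (indicator \<Omega>)"
  by (rule bmI[of _ 1]) (auto simp: indicator_def)

lemma sqint_ext0: "sqint f \<Longrightarrow> sqint (ext0 f)"
  unfolding ext0_def[abs_def] by (rule bm_sqint[OF bm_ind])

lemma LQ_Z: "sqint (ext0 f) \<Longrightarrow> LQ f \<in> Z"
  using mulop_toL2[OF bm_ind, of "ext0 f"] ext0_ext0[of f] by (simp add: Z_def LQ_def ext0_def[abs_def])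

lemma LQ_fn: "a \<in> Z \<Longrightarrow> LQ (fn a) = a"
  by (simp add: Z_def LQ_def mulop_def ext0_def[abs_def])

lemma toL2_Z: assumes "sqint f" "\<And>x. x \<notin> \<Omega> \<Longrightarrow> f x = 0" shows "toL2 f \<in> Z"
  using LQ_Z[of f] ext0_id[OF assms(2)] assms(1) by (simp add: LQ_def)

lemma closed_Z: "closed Z"
  unfolding Z_def by (intro closed_Collect_eq bounded_linear.continuous_on[OF bounded_linear_mulop[OF bm_ind]] continuous_on_id)

lemma subspace_Z: "subspace Z"
  by (rule subspaceI) (auto simp: Z_def mulop_add mulop_scaleR bm_ind linear_0[OF bounded_linear.linear[OF bounded_linear_mulop[OF bm_ind]]])

lemma Z_inner: "a \<in> Z \<Longrightarrow> mulop (indicator \<Omega>) b \<bullet> a = b \<bullet> a"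
  by (simp add: Z_def inner_mulop[OF bm_ind])

lemma mulop_Z: "bm s \<Longrightarrow> a \<in> Z \<Longrightarrow> mulop s a \<in> Z"
proof -
  assume s: "bm s" and a: "a \<in> Z"
  have "mulop (indicator \<Omega>) (mulop s a) = mulop s (mulop (indicator \<Omega>) a)"
    unfolding mulop_mulop[OF bm_ind s] mulop_mulop[OF s bm_ind] by (simp add: mult.commute)
  then show ?thesis using a by (simp add: Z_def)
qed

lemma Z_AE: assumes "a \<in> Z" shows "AE x in lebesgue. x \<notin> \<Omega> \<longrightarrow> fn a x = 0"
proof -
  have "toL2 (ext0 (fn a)) = a" using LQ_fn[OF assms] by (simp add: LQ_def)
  then show ?thesis using fn_toL2[OF sqint_ext0[OF sqint_fn[of a]]] by (auto elim: eventually_mono)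
qed

lemma set_integral_ext0: "(LINT x:\<Omega>|lebesgue. h x) = (LINT x|lebesgue. ext0 h x)" for h :: "real^3 \<Rightarrow> real"
  by (simp add: set_lebesgue_integral_def ext0_def)

lemma LQ_inner:
  assumes "sqint (ext0 f)" "sqint (ext0 g)"
  shows "LQ f \<bullet> LQ g = (LINT x:\<Omega>|lebesgue. f x \<bullet> g x)"
proof -
  have "ext0 (\<lambda>x. f x \<bullet> g x) = (\<lambda>x. ext0 f x \<bullet> ext0 g x)" by (auto simp: ext0_def fun_eq_iff indicator_def)
  then show ?thesis using assms by (simp add: LQ_def toL2_inner set_integral_ext0)
qed

lemma LQ_eq_iff:
  assumes "sqint (ext0 f)" "sqint (ext0 g)"
  shows "LQ f = LQ g \<longleftrightarrow> (AE x in lebesgue. x \<in> \<Omega> \<longrightarrow> f x = g x)"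
proof -
  have "(ext0 f x = ext0 g x) = (x \<in> \<Omega> \<longrightarrow> f x = g x)" for x by (auto simp: ext0_def indicator_def)
  then show ?thesis using assms by (simp add: LQ_def toL2_eq_iff)
qed

lemma fn_LQ:
  assumes "sqint (ext0 f)" shows "AE x in lebesgue. x \<in> \<Omega> \<longrightarrow> fn (LQ f) x = f x"
  using fn_toL2[OF assms] unfolding LQ_def by eventually_elim auto

lemma Lp_2: "Lp 2 \<Omega> f \<longleftrightarrow> sqint (ext0 f)" "Lp_vec 2 \<Omega> F \<longleftrightarrow> sqint (ext0 F)"
proof -
  have "(\<lambda>x. indicator \<Omega> x *\<^sub>R (\<bar>f x\<bar> powr 2)) = (\<lambda>x. (norm (ext0 f x))\<^sup>2)"
    "(\<lambda>x. indicator \<Omega> x *\<^sub>R (norm (F x) powr 2)) = (\<lambda>x. (norm (ext0 F x))\<^sup>2)"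
    by (auto simp: fun_eq_iff ext0_def indicator_def)
  then show "Lp 2 \<Omega> f \<longleftrightarrow> sqint (ext0 f)" "Lp_vec 2 \<Omega> F \<longleftrightarrow> sqint (ext0 F)"
    unfolding Lp_def Lp_vec_def sqint_def set_borel_measurable_def set_integrable_def ext0_def[abs_def] by simp_all
qed

lemma Lp_norm_2:
  "sqint (ext0 f) \<Longrightarrow> Lp_norm 2 \<Omega> f = norm (LQ f)"
  "sqint (ext0 F) \<Longrightarrow> Lp_norm_vec 2 \<Omega> F = norm (LQ F)"
proof -
  have "ext0 (\<lambda>x. \<bar>f x\<bar> powr 2) = (\<lambda>x. (norm (ext0 f x))\<^sup>2)" "ext0 (\<lambda>x. norm (F x) powr 2) = (\<lambda>x. (norm (ext0 F x))\<^sup>2)"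
    by (auto simp: fun_eq_iff ext0_def indicator_def)
  then have *: "Lp_norm 2 \<Omega> f = sqrt (LINT x|lebesgue. (norm (ext0 f x))\<^sup>2)"
    "Lp_norm_vec 2 \<Omega> F = sqrt (LINT x|lebesgue. (norm (ext0 F x))\<^sup>2)"
    unfolding Lp_norm_def Lp_norm_vec_def set_integral_ext0 by (simp_all add: powr_half_sqrt)
  show "sqint (ext0 f) \<Longrightarrow> Lp_norm 2 \<Omega> f = norm (LQ f)" "sqint (ext0 F) \<Longrightarrow> Lp_norm_vec 2 \<Omega> F = norm (LQ F)"
    unfolding * LQ_def norm_toL2_sq[symmetric] by simp_all
qed

lemma sqint_ext0_integrable:
  assumes "sqint (ext0 F)" shows "integrable lebesgue (ext0 F)"
proof (rule Bochner_Integration.integrable_bound)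
  show "integrable lebesgue (\<lambda>x. indicator \<Omega> x + (norm (ext0 F x))\<^sup>2)"
    by (intro Bochner_Integration.integrable_add integrable_ind sqint_integrable assms) auto
  show "AE x in lebesgue. norm (ext0 F x) \<le> norm (indicator \<Omega> x + (norm (ext0 F x))\<^sup>2)"
  proof (intro always_eventually allI)
    fix x
    have "norm (F x) \<le> 1 + (norm (F x))\<^sup>2"
      using sum_power2_ge_zero[of "norm (F x) - 1" "norm (F x)"] norm_ge_zero[of "F x"]
      by (simp add: power2_eq_square algebra_simps)
    then show "norm (ext0 F x) \<le> norm (indicator \<Omega> x + (norm (ext0 F x))\<^sup>2)" by (cases "x \<in> \<Omega>") auto
  qed
qed (rule sqint_measurable[OF assms])

lemma Lp_vec_1: "Lp_vec 1 \<Omega> F \<longleftrightarrow> integrable lebesgue (ext0 F)"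
proof -
  have "(\<lambda>x. indicator \<Omega> x *\<^sub>R (norm (F x) powr 1)) = (\<lambda>x. norm (ext0 F x))"
    by (auto simp: fun_eq_iff ext0_def indicator_def)
  then show ?thesis
    unfolding Lp_vec_def set_borel_measurable_def set_integrable_def ext0_def[symmetric, abs_def]
    using integrable_norm_iff[of "ext0 F" lebesgue] by auto
qed

section \<open>Uniqueness of weak derivatives\<close>

lemma test_mult_integrable:
  fixes g :: "real^3 \<Rightarrow> real"
  assumes "set_integrable lebesgue \<Omega> g" "test_fun \<Omega> \<phi>"
  shows "set_integrable lebesgue \<Omega> (\<lambda>x. g x * \<phi> x)"
  unfolding set_integrable_def
proof -
  note t = test_funD[OF assms(2)]
  obtain C where C: "C > 0" "\<And>x. norm (\<phi> x) \<le> C" using compact_support_bounded[OF smooth_continuous[OF t(1)] t(2)] by metis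
  have i: "integrable lebesgue (\<lambda>x. indicator \<Omega> x *\<^sub>R g x)" using assms(1) by (simp add: set_integrable_def)
  have "\<phi> \<in> borel_measurable lebesgue" by (rule measurable_completion) (simp add: borel_measurable_continuous_onI[OF smooth_continuous[OF t(1)]])
  then have m: "(\<lambda>x. (indicator \<Omega> x *\<^sub>R g x) * \<phi> x) \<in> borel_measurable lebesgue"
    using borel_measurable_integrable[OF i] by (rule borel_measurable_times[rotated])
  have "integrable lebesgue (\<lambda>x. (indicator \<Omega> x *\<^sub>R g x) * \<phi> x)"
  proof (rule Bochner_Integration.integrable_bound[OF integrable_mult_left[OF i, of C] m], intro always_eventually allI)
    fix x
    have "\<bar>g x\<bar> * \<bar>\<phi> x\<bar> \<le> \<bar>g x\<bar> * C" using C(2)[of x] by (intro mult_left_mono) auto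
    then show "norm ((indicator \<Omega> x *\<^sub>R g x) * \<phi> x) \<le> norm ((indicator \<Omega> x *\<^sub>R g x) * C)"
      using C(1) by (auto simp: abs_mult indicator_def)
  qed
  then show "integrable lebesgue (\<lambda>x. indicator \<Omega> x *\<^sub>R (g x * \<phi> x))" by (simp add: mult.assoc)
qed

lemma fundamental_unique:
  fixes g h :: "real^3 \<Rightarrow> real"
  assumes g: "set_integrable lebesgue \<Omega> g" and h: "set_integrable lebesgue \<Omega> h"
    and e: "\<And>\<phi>. test_fun \<Omega> \<phi> \<Longrightarrow> (LINT x:\<Omega>|lebesgue. g x * \<phi> x) = (LINT x:\<Omega>|lebesgue. h x * \<phi> x)"
  shows "AE x in lebesgue. x \<in> \<Omega> \<longrightarrow> g x = h x"
proof -
  have "AE x in lebesgue. x \<in> \<Omega> \<longrightarrow> g x - h x = 0"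
  proof (rule fundamental_lemma[OF op set_integral_diff(1)[OF g h]])
    fix \<phi> assume t: "test_fun \<Omega> \<phi>"
    have "(LINT x:\<Omega>|lebesgue. g x * \<phi> x - h x * \<phi> x) = 0"
      unfolding set_integral_diff(2)[OF test_mult_integrable[OF g t] test_mult_integrable[OF h t]] using e[OF t] by simp
    then show "(LINT x:\<Omega>|lebesgue. (g x - h x) * \<phi> x) = 0" by (simp add: left_diff_distrib)
  qed
  then show ?thesis by eventually_elim auto
qed

lemma component_integrable:
  fixes c :: "real^3 \<Rightarrow> real^3"
  assumes "integrable lebesgue (ext0 c)" shows "set_integrable lebesgue \<Omega> (\<lambda>x. c x $ j)"
proof -
  have "integrable lebesgue (\<lambda>x. ext0 c x \<bullet> axis j 1)" using assms by (rule integrable_inner_left)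
  then show ?thesis by (simp add: set_integrable_def ext0_def inner_axis)
qed

lemma components_unique:
  fixes c d :: "real^3 \<Rightarrow> real^3"
  assumes "integrable lebesgue (ext0 c)" "integrable lebesgue (ext0 d)"
    and "\<And>\<phi> j. test_fun \<Omega> \<phi> \<Longrightarrow> (LINT x:\<Omega>|lebesgue. c x $ j * \<phi> x) = (LINT x:\<Omega>|lebesgue. d x $ j * \<phi> x)"
  shows "AE x in lebesgue. ext0 c x = ext0 d x"
proof -
  have "AE x in lebesgue. \<forall>j. x \<in> \<Omega> \<longrightarrow> c x $ j = d x $ j"
    unfolding AE_all_countable by (intro allI fundamental_unique component_integrable assms)
  then show ?thesis by eventually_elim (auto simp: ext0_def vec_eq_iff indicator_def)
qed

lemma vec_test_axis: "test_fun \<Omega> \<phi> \<Longrightarrow> vec_test \<Omega> (\<lambda>x. \<phi> x *\<^sub>R axis j 1)"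
  unfolding vec_test_def
proof (intro allI)
  fix k assume "test_fun \<Omega> \<phi>"
  then show "test_fun \<Omega> (\<lambda>x. (\<phi> x *\<^sub>R axis j 1) $ k)" by (cases "k = j") (simp_all add: axis_def)
qed

text \<open>The weak curl and, below, the weak gradient as relations between classes. They are
  expressed by inner products with fixed elements, so they are linear and survive limits.\<close>

definition "wc a b \<longleftrightarrow> (\<forall>\<Phi>. vec_test \<Omega> \<Phi> \<longrightarrow> a \<bullet> toL2 (ccurl \<Phi>) = b \<bullet> toL2 \<Phi>)"

definition "wg a b \<longleftrightarrow> (\<forall>\<phi> i. test_fun \<Omega> \<phi> \<longrightarrow> a \<bullet> toL2 (partial i \<phi>) = - (b \<bullet> toL2 (\<lambda>x. \<phi> x *\<^sub>R axis i 1)))"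

lemma vec_test_LQ:
  assumes "vec_test \<Omega> \<Phi>" shows "ext0 \<Phi> = \<Phi>" "LQ \<Phi> = toL2 \<Phi>"
proof -
  show "ext0 \<Phi> = \<Phi>" by (rule ext0_id) (rule vec_test_zero[OF assms])
  then show "LQ \<Phi> = toL2 \<Phi>" by (simp add: LQ_def)
qed

lemma test_fun_LQ:
  assumes "test_fun \<Omega> \<phi>" shows "ext0 \<phi> = \<phi>" "LQ \<phi> = toL2 \<phi>" "sqint \<phi>"
proof -
  show "ext0 \<phi> = \<phi>" by (rule ext0_id) (rule test_funD(4)[OF assms])
  then show "LQ \<phi> = toL2 \<phi>" by (simp add: LQ_def)
qed (rule TX_facts(3)[OF test_fun_TX[OF assms]])

lemma weak_curl_iff:
  assumes "sqint (ext0 H)" "sqint (ext0 c)"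
  shows "weak_curl \<Omega> H c \<longleftrightarrow> wc (LQ H) (LQ c)"
proof -
  have "(LINT x:\<Omega>|lebesgue. H x \<bullet> ccurl \<Phi> x) = LQ H \<bullet> toL2 (ccurl \<Phi>)"
    "(LINT x:\<Omega>|lebesgue. c x \<bullet> \<Phi> x) = LQ c \<bullet> toL2 \<Phi>" if "vec_test \<Omega> \<Phi>" for \<Phi>
    using LQ_inner[OF assms(1), of "ccurl \<Phi>"] LQ_inner[OF assms(2), of \<Phi>] that vec_test_LQ[OF that]
      vec_test_LQ[OF vec_test_ccurl[OF that]] sqint_vec_test[OF that] by auto
  then show ?thesis unfolding weak_curl_def wc_def by simp
qed

lemma weak_grad_iff:
  assumes "sqint (ext0 u)" "sqint (ext0 g)"
  shows "weak_grad \<Omega> u g \<longleftrightarrow> wg (LQ u) (LQ g)"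
proof -
  have "(LINT x:\<Omega>|lebesgue. u x * partial i \<phi> x) = LQ u \<bullet> toL2 (partial i \<phi>)"
    "(LINT x:\<Omega>|lebesgue. g x $ i * \<phi> x) = LQ g \<bullet> toL2 (\<lambda>x. \<phi> x *\<^sub>R axis i 1)" if t: "test_fun \<Omega> \<phi>" for \<phi> i
  proof -
    note p = test_fun_partial[OF t, of i]
    show "(LINT x:\<Omega>|lebesgue. u x * partial i \<phi> x) = LQ u \<bullet> toL2 (partial i \<phi>)"
      using LQ_inner[OF assms(1), of "partial i \<phi>"] test_fun_LQ[OF p] by simp
    note v = vec_test_axis[OF t, of i]
    show "(LINT x:\<Omega>|lebesgue. g x $ i * \<phi> x) = LQ g \<bullet> toL2 (\<lambda>x. \<phi> x *\<^sub>R axis i 1)"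
      using LQ_inner[OF assms(2), of "\<lambda>x. \<phi> x *\<^sub>R axis i 1"] vec_test_LQ[OF v] sqint_vec_test(1)[OF v]
      by (simp add: inner_axis mult.commute)
  qed
  then show ?thesis unfolding weak_grad_def wg_def by simp
qed

text \<open>The choice behind \<open>wcurl\<close> only promises an integrable field. Uniqueness of
  weak curls among integrable fields makes it agree almost everywhere on \<open>\<Omega>\<close>
  with the square-integrable one.\<close>

lemma wcurl_eq:
  assumes H: "sqint (ext0 H)" and c: "sqint (ext0 c)" "weak_curl \<Omega> H c"
  shows "sqint (ext0 (wcurl \<Omega> H))" "LQ (wcurl \<Omega> H) = LQ c"
proof -
  have "Lp_vec 1 \<Omega> c \<and> weak_curl \<Omega> H c" using c sqint_ext0_integrable by (simp add: Lp_vec_1)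
  then have w: "Lp_vec 1 \<Omega> (wcurl \<Omega> H) \<and> weak_curl \<Omega> H (wcurl \<Omega> H)" unfolding wcurl_def by (rule someI[where P="\<lambda>c. Lp_vec 1 \<Omega> c \<and> weak_curl \<Omega> H c"])
  have i: "integrable lebesgue (ext0 (wcurl \<Omega> H))" using w by (simp add: Lp_vec_1)
  have ae: "AE x in lebesgue. ext0 c x = ext0 (wcurl \<Omega> H) x"
  proof (rule components_unique[OF sqint_ext0_integrable[OF c(1)] i])
    fix \<phi> and j :: 3 assume t: "test_fun \<Omega> \<phi>"
    note v = vec_test_axis[OF t, of j]
    have "(LINT x:\<Omega>|lebesgue. c x \<bullet> \<phi> x *\<^sub>R axis j 1) = (LINT x:\<Omega>|lebesgue. wcurl \<Omega> H x \<bullet> \<phi> x *\<^sub>R axis j 1)"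
      using c(2)[unfolded weak_curl_def, rule_format, OF v] conjunct2[OF w, unfolded weak_curl_def, rule_format, OF v] by simp
    then show "(LINT x:\<Omega>|lebesgue. c x $ j * \<phi> x) = (LINT x:\<Omega>|lebesgue. wcurl \<Omega> H x $ j * \<phi> x)"
      by (simp add: inner_axis mult.commute)
  qed
  show s: "sqint (ext0 (wcurl \<Omega> H))" by (rule sqint_AE_cong[OF c(1) borel_measurable_integrable[OF i] ae])
  show "LQ (wcurl \<Omega> H) = LQ c" unfolding LQ_def by (subst toL2_eq_iff[OF s c(1)]) (use ae in \<open>auto elim: eventually_mono\<close>)
qed

lemma wgrad_eq:
  assumes u: "sqint (ext0 u)" and g: "sqint (ext0 g)" "weak_grad \<Omega> u g"
  shows "sqint (ext0 (wgrad \<Omega> u))" "LQ (wgrad \<Omega> u) = LQ g"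
proof -
  have "Lp_vec 1 \<Omega> g \<and> weak_grad \<Omega> u g" using g sqint_ext0_integrable by (simp add: Lp_vec_1)
  then have w: "Lp_vec 1 \<Omega> (wgrad \<Omega> u) \<and> weak_grad \<Omega> u (wgrad \<Omega> u)" unfolding wgrad_def by (rule someI[where P="\<lambda>g. Lp_vec 1 \<Omega> g \<and> weak_grad \<Omega> u g"])
  have i: "integrable lebesgue (ext0 (wgrad \<Omega> u))" using w by (simp add: Lp_vec_1)
  have ae: "AE x in lebesgue. ext0 g x = ext0 (wgrad \<Omega> u) x"
  proof (rule components_unique[OF sqint_ext0_integrable[OF g(1)] i])
    fix \<phi> and j :: 3 assume t: "test_fun \<Omega> \<phi>"
    have "(LINT x:\<Omega>|lebesgue. u x * partial j \<phi> x) = - (LINT x:\<Omega>|lebesgue. g x $ j * \<phi> x)"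
      "(LINT x:\<Omega>|lebesgue. u x * partial j \<phi> x) = - (LINT x:\<Omega>|lebesgue. wgrad \<Omega> u x $ j * \<phi> x)"
      using g(2) w t by (auto simp: weak_grad_def)
    then show "(LINT x:\<Omega>|lebesgue. g x $ j * \<phi> x) = (LINT x:\<Omega>|lebesgue. wgrad \<Omega> u x $ j * \<phi> x)" by linarith
  qed
  show s: "sqint (ext0 (wgrad \<Omega> u))" by (rule sqint_AE_cong[OF g(1) borel_measurable_integrable[OF i] ae])
  show "LQ (wgrad \<Omega> u) = LQ g" unfolding LQ_def by (subst toL2_eq_iff[OF s g(1)]) (use ae in \<open>auto elim: eventually_mono\<close>)
qed

lemma H1_wgrad:
  assumes "H1 \<Omega> u"
  shows "sqint (ext0 u)" "sqint (ext0 (wgrad \<Omega> u))" "wg (LQ u) (LQ (wgrad \<Omega> u))"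
proof -
  obtain g where u: "sqint (ext0 u)" and g: "sqint (ext0 g)" "weak_grad \<Omega> u g"
    using assms by (auto simp: W1_def Lp_2)
  show "sqint (ext0 u)" "sqint (ext0 (wgrad \<Omega> u))" "wg (LQ u) (LQ (wgrad \<Omega> u))"
    using u wgrad_eq[OF u g] weak_grad_iff[OF u g(1)] g(2) by auto
qed

lemma H1_intro:
  assumes u: "sqint (ext0 u)" and b: "b \<in> Z" "wg (LQ u) b"
  shows "H1 \<Omega> u" "LQ (wgrad \<Omega> u) = b"
proof -
  have g: "sqint (ext0 (fn b))" "LQ (fn b) = b" by (auto simp: sqint_ext0 LQ_fn b)
  then have w: "weak_grad \<Omega> u (fn b)" using b(2) weak_grad_iff[OF u g(1)] by simp
  show "H1 \<Omega> u" unfolding W1_def using u g w by (auto simp: Lp_2)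
  show "LQ (wgrad \<Omega> u) = b" using wgrad_eq[OF u g(1) w] g by simp
qed

lemma Hcurl_wcurl:
  assumes "Hcurl \<Omega> H"
  shows "sqint (ext0 H)" "sqint (ext0 (wcurl \<Omega> H))" "wc (LQ H) (LQ (wcurl \<Omega> H))"
proof -
  obtain c where H: "sqint (ext0 H)" and c: "sqint (ext0 c)" "weak_curl \<Omega> H c"
    using assms by (auto simp: Hcurl_def Lp_2)
  show "sqint (ext0 H)" "sqint (ext0 (wcurl \<Omega> H))" "wc (LQ H) (LQ (wcurl \<Omega> H))"
    using H wcurl_eq[OF H c] weak_curl_iff[OF H c(1)] c(2) by auto
qed

lemma Hcurl_intro:
  assumes H: "sqint (ext0 H)" and b: "b \<in> Z" "wc (LQ H) b"
  shows "Hcurl \<Omega> H" "LQ (wcurl \<Omega> H) = b"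
proof -
  have g: "sqint (ext0 (fn b))" "LQ (fn b) = b" by (auto simp: sqint_ext0 LQ_fn b)
  then have w: "weak_curl \<Omega> H (fn b)" using b(2) weak_curl_iff[OF H g(1)] by simp
  show "Hcurl \<Omega> H" unfolding Hcurl_def using H g w by (auto simp: Lp_2)
  show "LQ (wcurl \<Omega> H) = b" using wcurl_eq[OF H g(1) w] g by simp
qed

section \<open>Weak gradients in the closed spaces and H^1_0\<close>

lemma PX_Z: assumes "p \<in> PX" shows "snd p \<in> Z"
proof -
  have "gpair ` TX \<Omega> R \<subseteq> {p. snd p \<in> Z}"
    using toL2_Z[OF TX_facts(4) TX_facts(6)] by (auto simp: gpair_def)
  moreover have "closed {p :: real lsq \<times> (real^3) lsq. snd p \<in> Z}"
    using closed_vimage[OF closed_Z continuous_on_snd[OF continuous_on_id]] by (simp add: vimage_def)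
  ultimately have "PX \<subseteq> {p. snd p \<in> Z}" unfolding PX_def by (rule closure_minimal)
  then show ?thesis using assms by blast
qed

text \<open>All three properties are closed conditions that hold for test functions, the last one by
  integration by parts.\<close>

lemma PD_Z: assumes "p \<in> PD" shows "fst p \<in> Z" "snd p \<in> Z" "wg (fst p) (snd p)"
proof -
  have "gpair ` {f. test_fun \<Omega> f} \<subseteq> {p. fst p \<in> Z}"
    using toL2_Z[OF test_fun_LQ(3) test_funD(4)] by (auto simp: gpair_def)
  moreover have "closed {p :: real lsq \<times> (real^3) lsq. fst p \<in> Z}"
    using closed_vimage[OF closed_Z continuous_on_fst[OF continuous_on_id]] by (simp add: vimage_def)
  ultimately have "PD \<subseteq> {p. fst p \<in> Z}" unfolding PD_def by (rule closure_minimal)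
  then show "fst p \<in> Z" using assms by blast
  show "snd p \<in> Z" using PX_Z PD_subset_PX assms by blast
  show "wg (fst p) (snd p)"
    unfolding wg_def
  proof (intro allI impI)
    fix \<phi> i assume t: "test_fun \<Omega> \<phi>"
    let ?A = "toL2 (partial i \<phi>)" and ?B = "toL2 (\<lambda>x. \<phi> x *\<^sub>R axis i 1) :: (real^3) lsq"
    have "closed {p. fst p \<bullet> ?A = - (snd p \<bullet> ?B)}" by (intro closed_Collect_eq continuous_intros)
    moreover have "gpair ` {f. test_fun \<Omega> f} \<subseteq> {p. fst p \<bullet> ?A = - (snd p \<bullet> ?B)}"
    proof (rule image_subsetI, simp)
      fix f assume f: "test_fun \<Omega> f"
      note F = TX_facts[OF test_fun_TX[OF f]] and P = TX_facts[OF test_fun_TX[OF t]]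
      have "toL2 f \<bullet> ?A = (LINT x|lebesgue. f x * partial i \<phi> x)"
        using toL2_inner[OF F(3) test_fun_LQ(3)[OF test_fun_partial[OF t]]] by simp
      also have "\<dots> = - (LINT x|lebesgue. partial i f x * \<phi> x)" using integral_by_parts[OF F(1) P(1,2), of i] by simp
      also have "(LINT x|lebesgue. partial i f x * \<phi> x) = toL2 (grad f) \<bullet> ?B"
        using toL2_inner[OF F(4) sqint_vec_test(1)[OF vec_test_axis[OF t, of i]]]
        by (simp add: inner_axis grad_def mult.commute)
      finally show "fst (gpair f) \<bullet> ?A = - (snd (gpair f) \<bullet> ?B)" by (simp add: gpair_def)
    qed
    ultimately have "PD \<subseteq> {p. fst p \<bullet> ?A = - (snd p \<bullet> ?B)}" unfolding PD_def by (intro closure_minimal)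
    then show "fst p \<bullet> ?A = - (snd p \<bullet> ?B)" using assms by blast
  qed
qed

lemma grad_test_LQ:
  assumes "test_fun \<Omega> \<phi>" shows "sqint (ext0 (grad \<phi>))" "LQ (grad \<phi>) = toL2 (grad \<phi>)"
proof -
  note F = TX_facts[OF test_fun_TX[OF assms]]
  have "ext0 (grad \<phi>) = grad \<phi>" by (rule ext0_id) (rule F(6))
  then show "sqint (ext0 (grad \<phi>))" "LQ (grad \<phi>) = toL2 (grad \<phi>)" using F(4) by (auto simp: LQ_def)
qed

text \<open>The two limits in the definition of \<open>H10\<close> amount to the convergence of one
  sequence of pairs, which is how \<open>H10\<close> corresponds to \<open>PD\<close>.\<close>

lemma H10_limit:
  assumes w: "sqint (ext0 w)" "sqint (ext0 (wgrad \<Omega> w))" and t: "\<And>n. test_fun \<Omega> (\<phi> n)"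
  shows "((\<lambda>n. Lp_norm 2 \<Omega> (\<lambda>x. \<phi> n x - w x)) \<longlonglongrightarrow> 0 \<and>
      (\<lambda>n. Lp_norm_vec 2 \<Omega> (\<lambda>x. grad (\<phi> n) x - wgrad \<Omega> w x)) \<longlonglongrightarrow> 0) \<longleftrightarrow>
    (\<lambda>n. gpair (\<phi> n)) \<longlonglongrightarrow> (LQ w, LQ (wgrad \<Omega> w))"
proof -
  have s: "sqint (ext0 (\<phi> n))" for n using test_fun_LQ[OF t] by simp
  have a: "Lp_norm 2 \<Omega> (\<lambda>x. \<phi> n x - w x) = norm (toL2 (\<phi> n) - LQ w)" for n
    using Lp_norm_2(1)[of "\<lambda>x. \<phi> n x - w x"] LQ_arith(2)[OF s w(1)] test_fun_LQ(2)[OF t] s w(1)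
    by (simp add: ext0_arith sqint_diff)
  have b: "Lp_norm_vec 2 \<Omega> (\<lambda>x. grad (\<phi> n) x - wgrad \<Omega> w x) = norm (toL2 (grad (\<phi> n)) - LQ (wgrad \<Omega> w))" for n
    using Lp_norm_2(2)[of "\<lambda>x. grad (\<phi> n) x - wgrad \<Omega> w x"] LQ_arith(2)[OF grad_test_LQ(1)[OF t] w(2)] grad_test_LQ[OF t] w(2)
    by (simp add: ext0_arith sqint_diff)
  have "((\<lambda>n. gpair (\<phi> n)) \<longlonglongrightarrow> (LQ w, LQ (wgrad \<Omega> w))) \<longleftrightarrow>
    ((\<lambda>n. toL2 (\<phi> n)) \<longlonglongrightarrow> LQ w \<and> (\<lambda>n. toL2 (grad (\<phi> n))) \<longlonglongrightarrow> LQ (wgrad \<Omega> w))"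
    unfolding gpair_def by (auto intro: tendsto_Pair dest: tendsto_fst tendsto_snd)
  then show ?thesis unfolding a b by (simp add: tendsto_norm_zero_iff LIM_zero_iff)
qed

lemma H10_PD:
  assumes "H10 \<Omega> w"
  shows "sqint (ext0 w)" "sqint (ext0 (wgrad \<Omega> w))" "(LQ w, LQ (wgrad \<Omega> w)) \<in> PD"
proof -
  have h: "H1 \<Omega> w" using assms by (simp add: H10_def)
  note w = H1_wgrad[OF h]
  obtain \<phi> where t: "\<And>n. test_fun \<Omega> (\<phi> n)" and l: "(\<lambda>n. Lp_norm 2 \<Omega> (\<lambda>x. \<phi> n x - w x)) \<longlonglongrightarrow> 0 \<and>
      (\<lambda>n. Lp_norm_vec 2 \<Omega> (\<lambda>x. grad (\<phi> n) x - wgrad \<Omega> w x)) \<longlonglongrightarrow> 0"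
    using assms unfolding H10_def by blast
  have "(\<lambda>n. gpair (\<phi> n)) \<longlonglongrightarrow> (LQ w, LQ (wgrad \<Omega> w))" using H10_limit[of w \<phi>, OF w(1,2) t] l by blast
  then show "(LQ w, LQ (wgrad \<Omega> w)) \<in> PD"
    by (rule closed_sequentially[OF closed_P(2), rotated]) (rule gpair_in(2)[OF t])
  show "sqint (ext0 w)" "sqint (ext0 (wgrad \<Omega> w))" by (fact w)+
qed

lemma PD_H10:
  assumes p: "p \<in> PD" and w: "sqint (ext0 w)" "LQ w = fst p"
  shows "H10 \<Omega> w" "LQ (wgrad \<Omega> w) = snd p"
proof -
  note h = H1_intro[OF w(1) PD_Z(2)[OF p]] 
  have h: "H1 \<Omega> w" "LQ (wgrad \<Omega> w) = snd p" using h PD_Z(3)[OF p] w(2) by auto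
  then show "LQ (wgrad \<Omega> w) = snd p" by simp
  obtain g where g: "\<And>n. g n \<in> gpair ` {f. test_fun \<Omega> f}" "g \<longlonglongrightarrow> p"
    using p unfolding PD_def closure_sequential by blast
  then have "\<forall>n. \<exists>f. test_fun \<Omega> f \<and> g n = gpair f" by blast
  from choice[OF this] obtain f where f: "\<And>n. test_fun \<Omega> (f n)" "\<And>n. g n = gpair (f n)" by blast
  have "g = (\<lambda>n. gpair (f n))" using f(2) by auto
  then have "(\<lambda>n. gpair (f n)) \<longlonglongrightarrow> (LQ w, LQ (wgrad \<Omega> w))" using g(2) w(2) h(2) by simp
  then have "(\<lambda>n. Lp_norm 2 \<Omega> (\<lambda>x. f n x - w x)) \<longlonglongrightarrow> 0 \<and>
      (\<lambda>n. Lp_norm_vec 2 \<Omega> (\<lambda>x. grad (f n) x - wgrad \<Omega> w x)) \<longlonglongrightarrow> 0"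
    using H10_limit[of w f, OF H1_wgrad(1,2)[OF h(1)] f(1)] by blast
  then show "H10 \<Omega> w" unfolding H10_def using h(1) f(1) by blast
qed

section \<open>Divergence-free fields and the curl equation\<close>

text \<open>Orthogonality to \<open>Gr\<close> is the weak form of zero divergence together with
  zero normal component; \<open>HNs\<close> is the class version of the harmonic fields
  \<open>HN\<close>.\<close>

definition "Gr = closure ((\<lambda>\<phi>. LQ (grad \<phi>)) ` {\<phi>. smooth \<phi>})"

definition "HNs = {a \<in> Z. wc a 0 \<and> (\<forall>g\<in>Gr. a \<bullet> g = 0)}"

lemma sqint_smooth_grad:
  assumes "smooth \<phi>" shows "sqint (ext0 (grad \<phi>))"
proof -
  have "compact (grad \<phi> ` cball 0 R)"
    by (rule compact_continuous_image[OF smooth_grad_continuous[OF assms] compact_cball])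
  then have "bounded (grad \<phi> ` cball 0 R)" by (rule compact_imp_bounded)
  then obtain C where C: "\<forall>y\<in>grad \<phi> ` cball 0 R. norm y \<le> C" unfolding bounded_iff by blast
  show ?thesis
  proof (rule sqint_bound)
    have "grad \<phi> \<in> borel_measurable lebesgue"
      by (rule measurable_completion) (simp add: borel_measurable_continuous_onI[OF smooth_grad_continuous[OF assms]])
    then show "ext0 (grad \<phi>) \<in> borel_measurable lebesgue"
      unfolding ext0_def[abs_def] by (intro borel_measurable_scaleR borel_measurable_indicator \<Omega>_sets)
    show "integrable lebesgue (\<lambda>x. indicator \<Omega> x * C\<^sup>2)" by (intro integrable_mult_left integrable_ind) auto
    show "AE x in lebesgue. (norm (ext0 (grad \<phi>) x))\<^sup>2 \<le> indicator \<Omega> x * C\<^sup>2"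
    proof (intro always_eventually allI)
      fix x
      show "(norm (ext0 (grad \<phi>) x))\<^sup>2 \<le> indicator \<Omega> x * C\<^sup>2"
      proof (cases "x \<in> \<Omega>")
        case True
        then have "x \<in> cball 0 R" using sub by auto
        then have "norm (grad \<phi> x) \<le> C" using C by blast
        then have "(norm (grad \<phi> x))\<^sup>2 \<le> C\<^sup>2" by (rule power_mono) simp
        then show ?thesis using True by simp
      qed simp
    qed
  qed
qed

lemma subspace_Gr: "subspace Gr"
  unfolding Gr_def
proof (rule subspace_closure, rule subspaceI)
  have lin: "LQ (grad (\<lambda>x. \<phi> x + \<psi> x)) = LQ (grad \<phi>) + LQ (grad \<psi>)" "LQ (grad (\<lambda>x. c * \<phi> x)) = c *\<^sub>R LQ (grad \<phi>)"
    if "smooth \<phi>" "smooth \<psi>" for \<phi> \<psi> c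
  proof -
    have e: "grad (\<lambda>x. \<phi> x + \<psi> x) = (\<lambda>x. grad \<phi> x + grad \<psi> x)" "grad (\<lambda>x. c * \<phi> x) = (\<lambda>x. c *\<^sub>R grad \<phi> x)"
      using that by (auto simp: grad_add grad_cmult)
    show "LQ (grad (\<lambda>x. \<phi> x + \<psi> x)) = LQ (grad \<phi>) + LQ (grad \<psi>)"
      unfolding e by (rule LQ_arith(1)[OF sqint_smooth_grad[OF that(1)] sqint_smooth_grad[OF that(2)]])
    have "ext0 (\<lambda>x. c *\<^sub>R grad \<phi> x) = (\<lambda>x. c *\<^sub>R ext0 (grad \<phi>) x)" by (auto simp: ext0_def mult.commute)
    then show "LQ (grad (\<lambda>x. c * \<phi> x)) = c *\<^sub>R LQ (grad \<phi>)"
      unfolding e LQ_def using sqint_smooth_grad[OF that(1)] by (simp add: toL2_scaleR)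
  qed
  show "0 \<in> (\<lambda>\<phi>. LQ (grad \<phi>)) ` {\<phi>. smooth \<phi>}"
    using lin(2)[of "\<lambda>x. 0" "\<lambda>x. 0" 0] by (intro image_eqI[of _ _ "\<lambda>x. 0"]) auto
  fix a b c assume "a \<in> (\<lambda>\<phi>. LQ (grad \<phi>)) ` {\<phi>. smooth \<phi>}" "b \<in> (\<lambda>\<phi>. LQ (grad \<phi>)) ` {\<phi>. smooth \<phi>}"
  then obtain \<phi> \<psi> where *: "smooth \<phi>" "smooth \<psi>" "a = LQ (grad \<phi>)" "b = LQ (grad \<psi>)" by blast
  show "a + b \<in> (\<lambda>\<phi>. LQ (grad \<phi>)) ` {\<phi>. smooth \<phi>}"
    by (rule image_eqI[of _ _ "\<lambda>x. \<phi> x + \<psi> x"]) (simp_all add: lin(1) * smooth_add)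
  show "c *\<^sub>R a \<in> (\<lambda>\<phi>. LQ (grad \<phi>)) ` {\<phi>. smooth \<phi>}"
    by (rule image_eqI[of _ _ "\<lambda>x. c * \<phi> x"]) (simp_all add: lin(2)[OF *(1,2)] * smooth_mult)
qed

lemma closed_Gr: "closed Gr" by (simp add: Gr_def)

lemma Gr_Z: "Gr \<subseteq> Z"
  unfolding Gr_def by (rule closure_minimal[OF _ closed_Z]) (use LQ_Z sqint_smooth_grad in auto)

lemma Gr_wc: assumes "g \<in> Gr" shows "wc g 0"
  unfolding wc_def
proof (intro allI impI)
  fix \<Phi> assume P: "vec_test \<Omega> \<Phi>"
  have "toL2 (ccurl \<Phi>) \<bullet> g = 0"
  proof (rule orthogonal_closure[OF _ assms[unfolded Gr_def]])
    fix s assume "s \<in> (\<lambda>\<phi>. LQ (grad \<phi>)) ` {\<phi>. smooth \<phi>}"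
    then obtain \<phi> where \<phi>: "smooth \<phi>" "s = LQ (grad \<phi>)" by blast
    note c = vec_test_ccurl[OF P]
    have "LQ (grad \<phi>) \<bullet> LQ (ccurl \<Phi>) = (LINT x:\<Omega>|lebesgue. grad \<phi> x \<bullet> ccurl \<Phi> x)"
      by (rule LQ_inner[OF sqint_smooth_grad[OF \<phi>(1)]]) (simp add: vec_test_LQ[OF c] sqint_vec_test[OF P])
    also have "\<dots> = (LINT x|lebesgue. grad \<phi> x \<bullet> ccurl \<Phi> x)"
      by (rule set_integral_support) (simp add: vec_test_zero[OF c])
    also have "\<dots> = 0" by (rule grad_orth_ccurl[OF \<phi>(1) P])
    finally show "toL2 (ccurl \<Phi>) \<bullet> s = 0" by (simp add: \<phi>(2) vec_test_LQ[OF c] inner_commute)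
  qed
  then show "g \<bullet> toL2 (ccurl \<Phi>) = 0 \<bullet> toL2 \<Phi>" by (simp add: inner_commute)
qed

lemma wc_diff: "wc a b \<Longrightarrow> wc a' b' \<Longrightarrow> wc (a - a') (b - b')"
  by (simp add: wc_def inner_diff_left)

lemma subspace_HNs: "subspace HNs" "closed HNs"
proof -
  show "subspace HNs"
    by (rule subspaceI) (auto simp: HNs_def wc_def inner_add_left subspace_0[OF subspace_Z] subspace_add[OF subspace_Z] subspace_scale[OF subspace_Z])
  have "HNs = Z \<inter> (\<Inter>\<Phi>\<in>{\<Phi>. vec_test \<Omega> \<Phi>}. {a. a \<bullet> toL2 (ccurl \<Phi>) = 0}) \<inter> (\<Inter>g\<in>Gr. {a. a \<bullet> g = 0})"
    by (auto simp: HNs_def wc_def)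
  moreover have "closed {a. a \<bullet> g = (0::real)}" for g :: "(real^3) lsq"
    by (intro closed_Collect_eq continuous_intros)
  ultimately show "closed HNs" using closed_Z by (auto intro!: closed_Int closed_INT)
qed

lemma X_Z: "X \<subseteq> Z" unfolding X_def using PX_Z by auto

text \<open>Sending \<open>ccurl \<Phi>\<close> to B \<bullet> \<Phi> is a bounded functional:
  \<open>B\<close> annihilates the gradient supplied by the curl estimate, so only the part of
  \<open>\<Phi>\<close> controlled by its curl contributes. The Riesz representative has weak curl
  \<open>B\<close>. In the graph formulation, well-definedness is part of the bound.\<close>

lemma ex_curl:
  assumes B: "\<And>x. x \<in> X \<Longrightarrow> B \<bullet> x = 0"
  shows "\<exists>w\<in>Z. wc w B"
proof -
  obtain C where C: "C \<ge> 0" and est: "\<And>\<Phi>. vec_test \<Omega> \<Phi> \<Longrightarrow> \<exists>F\<in>TX \<Omega> R.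
     (\<integral>\<^sup>+x. ennreal ((norm (\<Phi> x - grad F x))\<^sup>2) \<partial>lborel) \<le> ennreal C * curl_energy \<Phi>"
    using curl_estimate[OF C2 R sub] by blast
  define S where "S = (\<lambda>\<Phi>. (toL2 (ccurl \<Phi>), B \<bullet> toL2 \<Phi>)) ` {\<Phi>. vec_test \<Omega> \<Phi>}"
  have lin: "toL2 (ccurl (\<lambda>x. \<Phi> x + \<Psi> x)) = toL2 (ccurl \<Phi>) + toL2 (ccurl \<Psi>)" "toL2 (\<lambda>x. \<Phi> x + \<Psi> x) = toL2 \<Phi> + toL2 \<Psi>"
    "toL2 (ccurl (\<lambda>x. c *\<^sub>R \<Phi> x)) = c *\<^sub>R toL2 (ccurl \<Phi>)" "toL2 (\<lambda>x. c *\<^sub>R \<Phi> x) = c *\<^sub>R toL2 \<Phi>"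
    if "vec_test \<Omega> \<Phi>" "vec_test \<Omega> \<Psi>" for \<Phi> \<Psi> c
    using sqint_vec_test[OF that(1)] sqint_vec_test[OF that(2)] by (simp_all add: vec_test_linear(3,4)[OF that] toL2_simps)
  have v0: "vec_test \<Omega> (\<lambda>x. 0)" by (simp add: vec_test_def)
  have "subspace S"
  proof (rule subspaceI)
    show "0 \<in> S" unfolding S_def
      using lin(3,4)[OF v0 v0, of 0] by (intro image_eqI[of _ _ "\<lambda>x. 0"]) (auto simp: v0 zero_prod_def)
    fix x y c assume "x \<in> S" "y \<in> S"
    then obtain \<Phi> \<Psi> where *: "vec_test \<Omega> \<Phi>" "vec_test \<Omega> \<Psi>" "x = (toL2 (ccurl \<Phi>), B \<bullet> toL2 \<Phi>)" "y = (toL2 (ccurl \<Psi>), B \<bullet> toL2 \<Psi>)"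
      by (auto simp: S_def)
    show "x + y \<in> S" unfolding S_def
      by (rule image_eqI[of _ _ "\<lambda>x. \<Phi> x + \<Psi> x"]) (simp_all add: lin(1,2)[OF *(1,2)] * vec_test_linear(1) inner_add_right)
    show "c *\<^sub>R x \<in> S" unfolding S_def
      by (rule image_eqI[of _ _ "\<lambda>x. c *\<^sub>R \<Phi> x"]) (simp_all add: lin(3,4)[OF *(1,2)] * vec_test_linear(2)[OF *(1) *(1)])
  qed
  moreover have "\<bar>r\<bar> \<le> norm B * sqrt C * norm s" if srS: "(s, r) \<in> S" for s r
  proof -
    obtain \<Phi> where P: "vec_test \<Omega> \<Phi>" and sr: "s = toL2 (ccurl \<Phi>)" "r = B \<bullet> toL2 \<Phi>" using srS by (auto simp: S_def)
    obtain F where F: "F \<in> TX \<Omega> R" "(\<integral>\<^sup>+x. ennreal ((norm (\<Phi> x - grad F x))\<^sup>2) \<partial>lborel) \<le> ennreal C * curl_energy \<Phi>"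
      using est[OF P] by blast
    note f = TX_facts[OF F(1)]
    note sP = sqint_vec_test[OF P]
    have mb: "(\<lambda>x. \<Phi> x - grad F x) \<in> borel_measurable borel" "ccurl \<Phi> \<in> borel_measurable borel"
      by (intro borel_measurable_continuous_onI continuous_intros vec_test_continuous[OF P] smooth_grad_continuous[OF f(1)]
            vec_test_continuous[OF vec_test_ccurl[OF P]])+
    have n1: "ennreal ((norm (toL2 (\<lambda>x. \<Phi> x - grad F x)))\<^sup>2) = (\<integral>\<^sup>+x. ennreal ((norm (\<Phi> x - grad F x))\<^sup>2) \<partial>lborel)"
      unfolding nn_integral_toL2[OF sqint_diff[OF sP(1) f(4)], symmetric] using mb by (simp add: nn_integral_completion)
    have n2: "ennreal ((norm s)\<^sup>2) = curl_energy \<Phi>"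
      unfolding sr nn_integral_toL2[OF sP(2), symmetric] curl_energy_def using mb by (simp add: nn_integral_completion)
    have "ennreal ((norm (toL2 (\<lambda>x. \<Phi> x - grad F x)))\<^sup>2) \<le> ennreal (C * (norm s)\<^sup>2)"
      using F(2) unfolding n1 n2[symmetric] using C by (simp add: ennreal_mult)
    then have "(norm (toL2 (\<lambda>x. \<Phi> x - grad F x)))\<^sup>2 \<le> C * (norm s)\<^sup>2" using C by (simp add: ennreal_le_iff)
    also have "\<dots> = (sqrt C * norm s)\<^sup>2" using C by (simp add: power_mult_distrib)
    finally have n: "norm (toL2 (\<lambda>x. \<Phi> x - grad F x)) \<le> sqrt C * norm s" by (rule power2_le_imp_le) (use C in simp)
    have "toL2 (grad F) \<in> X" using gpair_in(1)[OF F(1)] unfolding X_def gpair_def by force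
    then have "B \<bullet> toL2 (grad F) = 0" by (rule B)
    then have "r = B \<bullet> toL2 (\<lambda>x. \<Phi> x - grad F x)"
      unfolding sr by (simp add: toL2_diff[OF sP(1) f(4), symmetric] inner_diff_right)
    then have "\<bar>r\<bar> \<le> norm B * norm (toL2 (\<lambda>x. \<Phi> x - grad F x))" using Cauchy_Schwarz_ineq2 by metis
    also have "\<dots> \<le> norm B * (sqrt C * norm s)" by (rule mult_left_mono[OF n]) simp
    finally show ?thesis by (simp add: mult.assoc)
  qed
  moreover have "0 \<le> norm B * sqrt C" using C by simp
  ultimately obtain w where w: "w \<in> closure (fst ` S)" "\<forall>(s, r)\<in>S. w \<bullet> s = r" using riesz_graph[of S "norm B * sqrt C"] by blast
  have "fst ` S \<subseteq> Z" unfolding S_def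
    using toL2_Z[OF sqint_vec_test(2) vec_test_zero[OF vec_test_ccurl]] by auto
  then have "w \<in> Z" using w(1) closure_minimal[OF _ closed_Z] by blast
  moreover have "wc w B" using w(2) by (auto simp: wc_def S_def)
  ultimately show ?thesis by blast
qed

text \<open>Subtracting the projections onto \<open>Gr\<close> and \<open>HNs\<close> leaves the
  weak curl unchanged, as both consist of curl-free fields. The second subtraction preserves
  orthogonality to \<open>Gr\<close> because \<open>HNs\<close> is orthogonal to it.\<close>

lemma ex_curl_perp:
  assumes B: "\<And>x. x \<in> X \<Longrightarrow> B \<bullet> x = 0"
  shows "\<exists>w\<in>Z. wc w B \<and> (\<forall>g\<in>Gr. w \<bullet> g = 0) \<and> (\<forall>h\<in>HNs. w \<bullet> h = 0)"
proof -
  obtain w where w: "w \<in> Z" "wc w B" using ex_curl[OF B] by blast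
  obtain g where g: "g \<in> Gr" "\<And>v. v \<in> Gr \<Longrightarrow> (w - g) \<bullet> v = 0" using closed_projection[OF subspace_Gr closed_Gr] by metis
  obtain h where h: "h \<in> HNs" "\<And>v. v \<in> HNs \<Longrightarrow> (w - g - h) \<bullet> v = 0" using closed_projection[OF subspace_HNs] by metis
  have h': "h \<in> Z" "wc h 0" "\<And>v. v \<in> Gr \<Longrightarrow> h \<bullet> v = 0" using h(1) by (auto simp: HNs_def)
  have "w - g - h \<in> Z" using w(1) g(1) h'(1) Gr_Z by (intro subspace_diff[OF subspace_Z]) auto
  moreover have "wc (w - g - h) B" using wc_diff[OF wc_diff[OF w(2) Gr_wc[OF g(1)]] h'(2)] by simp
  moreover have "(w - g - h) \<bullet> v = 0" if "v \<in> Gr" for v using g(2)[OF that] h'(3)[OF that] by (simp add: inner_diff_left)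
  ultimately show ?thesis using h(2) by blast
qed

lemma H0div0_iff: "H0div0 \<Omega> w \<longleftrightarrow> sqint (ext0 w) \<and> (\<forall>g\<in>Gr. LQ w \<bullet> g = 0)"
proof -
  have "(\<forall>\<phi>. smooth \<phi> \<longrightarrow> (LINT x:\<Omega>|lebesgue. w x \<bullet> grad \<phi> x) = 0) \<longleftrightarrow> (\<forall>g\<in>Gr. LQ w \<bullet> g = 0)" if s: "sqint (ext0 w)"
  proof
    assume *: "\<forall>\<phi>. smooth \<phi> \<longrightarrow> (LINT x:\<Omega>|lebesgue. w x \<bullet> grad \<phi> x) = 0"
    show "\<forall>g\<in>Gr. LQ w \<bullet> g = 0"
    proof
      fix g assume "g \<in> Gr"
      then show "LQ w \<bullet> g = 0"
        unfolding Gr_def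
        by (rule orthogonal_closure[rotated]) (use * LQ_inner[OF s sqint_smooth_grad] in auto)
    qed
  next
    assume *: "\<forall>g\<in>Gr. LQ w \<bullet> g = 0"
    show "\<forall>\<phi>. smooth \<phi> \<longrightarrow> (LINT x:\<Omega>|lebesgue. w x \<bullet> grad \<phi> x) = 0"
    proof (intro allI impI)
      fix \<phi> :: "real^3 \<Rightarrow> real" assume \<phi>: "smooth \<phi>"
      have "LQ (grad \<phi>) \<in> Gr" unfolding Gr_def by (rule subsetD[OF closure_subset]) (use \<phi> in auto)
      then show "(LINT x:\<Omega>|lebesgue. w x \<bullet> grad \<phi> x) = 0"
        using * LQ_inner[OF s sqint_smooth_grad[OF \<phi>]] by simp
    qed
  qed
  then show ?thesis unfolding H0div0_def Lp_2 by blast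
qed

lemma ext0_zero: "ext0 (\<lambda>_. 0) = (\<lambda>_. 0)" by (auto simp: ext0_def)

lemma LQ_zero: "LQ (\<lambda>_. 0) = 0" by (simp add: LQ_def ext0_zero zero_lsq_def)

lemma HN_iff: "HN \<Omega> h \<longleftrightarrow> sqint (ext0 h) \<and> LQ h \<in> HNs"
proof -
  have "weak_curl \<Omega> h (\<lambda>_. 0) \<longleftrightarrow> wc (LQ h) 0" if "sqint (ext0 h)"
    using weak_curl_iff[OF that, of "\<lambda>_. 0"] by (simp add: ext0_zero LQ_zero)
  then show ?thesis unfolding HN_def Lp_2 H0div0_iff HNs_def using LQ_Z by blast
qed

lemma perp_HN_iff:
  assumes s: "sqint (ext0 H)" shows "perp_HN \<Omega> H \<longleftrightarrow> (\<forall>h\<in>HNs. LQ H \<bullet> h = 0)"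
proof
  assume p: "perp_HN \<Omega> H"
  show "\<forall>h\<in>HNs. LQ H \<bullet> h = 0"
  proof
    fix h assume h: "h \<in> HNs"
    then have e: "LQ (fn h) = h" "sqint (ext0 (fn h))" using LQ_fn sqint_ext0[OF sqint_fn] by (auto simp: HNs_def)
    then have "HN \<Omega> (fn h)" using h by (simp add: HN_iff)
    then show "LQ H \<bullet> h = 0" using p LQ_inner[OF s e(2)] e(1) by (simp add: perp_HN_def)
  qed
next
  assume "\<forall>h\<in>HNs. LQ H \<bullet> h = 0"
  then show "perp_HN \<Omega> H" unfolding perp_HN_def HN_iff using LQ_inner[OF s] by auto
qed

text \<open>The gradient of a function in \<open>TX\<close> is itself a test field with zero curl,
  so its pairing with any weak curl vanishes; this property is closed.\<close>

lemma wc_orth_X: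
  assumes "wc a b" "x \<in> X" shows "b \<bullet> x = 0"
proof -
  obtain p where p: "p \<in> PX" "x = snd p" using assms(2) by (auto simp: X_def)
  have "closed {p :: real lsq \<times> (real^3) lsq. b \<bullet> snd p = 0}" by (intro closed_Collect_eq continuous_intros)
  moreover have "gpair ` TX \<Omega> R \<subseteq> {p. b \<bullet> snd p = 0}"
  proof (rule image_subsetI, simp)
    fix f assume f: "f \<in> TX \<Omega> R"
    note F = TX_facts[OF f]
    have v: "vec_test \<Omega> (grad f)"
      by (rule vec_test_grad[OF F(1) _ test_fun_UNIV_facts(4)[OF F(1,2)]]) (use f in \<open>simp add: TX_def\<close>)
    have "ccurl (grad f) = (\<lambda>_. 0)" using ccurl_grad[OF F(1)] by auto
    then have "toL2 (ccurl (grad f)) = 0" by (simp add: zero_lsq_def)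
    then show "b \<bullet> snd (gpair f) = 0" using assms(1) v by (auto simp: wc_def gpair_def)
  qed
  ultimately have "PX \<subseteq> {p. b \<bullet> snd p = 0}" unfolding PX_def by (intro closure_minimal)
  then show ?thesis using p by blast
qed

text \<open>By double orthogonality it suffices to treat \<open>z\<close> orthogonal to
  \<open>X\<close>. Its restriction to \<open>\<Omega>\<close> is the curl of an admissible field,
  and the hypothesis makes \<open>E\<close> orthogonal to that curl. In this way a potential is
  recovered from the magnetic equation.\<close>

lemma mem_X:
  assumes E: "E \<in> Z" and o: "\<And>w. H0div0 \<Omega> w \<Longrightarrow> Hcurl \<Omega> w \<Longrightarrow> E \<bullet> LQ (wcurl \<Omega> w) = 0"
  shows "E \<in> X"
proof (rule double_orthogonal[OF subspace_XD(1) closed_XD(1)])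
  fix z assume z: "\<And>v. v \<in> X \<Longrightarrow> z \<bullet> v = 0"
  let ?z = "mulop (indicator \<Omega>) z"
  have zX: "?z \<bullet> v = 0" if "v \<in> X" for v using Z_inner[of v z] z[OF that] X_Z that by auto
  have zZ: "?z \<in> Z" unfolding Z_def by (simp add: mulop_mulop bm_ind flip: indicator_inter_arith)
  obtain w where w: "w \<in> Z" "wc w ?z" "\<forall>g\<in>Gr. w \<bullet> g = 0" using ex_curl_perp[OF zX] by blast
  have e: "LQ (fn w) = w" "sqint (ext0 (fn w))" using w(1) LQ_fn sqint_ext0[OF sqint_fn] by auto
  have "H0div0 \<Omega> (fn w)" using w(3) e by (simp add: H0div0_iff)
  moreover have "Hcurl \<Omega> (fn w)" "LQ (wcurl \<Omega> (fn w)) = ?z" using Hcurl_intro[OF e(2) zZ] w(2) e(1) by auto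
  ultimately have "E \<bullet> ?z = 0" using o by metis
  then show "z \<bullet> E = 0" using Z_inner[OF E, of z] by (simp add: inner_commute)
qed

section \<open>Products of temperatures and fields\<close>

text \<open>The product of a scalar class with a field class is in general merely integrable;
  \<open>Tdom\<close>, defined next, collects the scalars for which it is square integrable, as the
  form bound guarantees.\<close>

definition Tm :: "real lsq \<Rightarrow> (real^3) lsq \<Rightarrow> (real^3) lsq" where
  "Tm w a = toL2 (\<lambda>x. fn w x *\<^sub>R fn a x)"

definition "Tdom a = {w. sqint (\<lambda>x. fn w x *\<^sub>R fn a x :: real^3)}"

lemma fn_arith:
  "AE x in lebesgue. fn (v + w) x = fn v x + fn w x" "AE x in lebesgue. fn (v - w) x = fn v x - fn w x"
  "AE x in lebesgue. fn (c *\<^sub>R v) x = c *\<^sub>R fn v x"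
  using fn_toL2[OF sqint_add[OF sqint_fn[of v] sqint_fn[of w]]] fn_toL2[OF sqint_diff[OF sqint_fn[of v] sqint_fn[of w]]]
    fn_toL2[OF sqint_scaleR[OF sqint_fn[of v], of c]] toL2_add[OF sqint_fn[of v] sqint_fn[of w]]
    toL2_diff[OF sqint_fn[of v] sqint_fn[of w]] toL2_scaleR[OF sqint_fn[of v], of c] by simp_all

lemma Tm_eqI:
  assumes "sqint F" "AE x in lebesgue. F x = fn w x *\<^sub>R fn a x"
  shows "w \<in> Tdom a" "Tm w a = toL2 F"
proof -
  have s: "sqint (\<lambda>x. fn w x *\<^sub>R fn a x)"
    by (rule sqint_AE_cong[OF assms(1) _ assms(2)]) (intro borel_measurable_scaleR sqint_measurable sqint_fn)
  then show "w \<in> Tdom a" by (simp add: Tdom_def)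
  show "Tm w a = toL2 F" unfolding Tm_def by (subst toL2_eq_iff[OF s assms(1)]) (use assms(2) in \<open>auto elim: eventually_mono\<close>)
qed

lemma Tm_arith:
  assumes "v \<in> Tdom a" "w \<in> Tdom a"
  shows "Tm (v + w) a = Tm v a + Tm w a" "Tm (v - w) a = Tm v a - Tm w a" "Tm (c *\<^sub>R v) a = c *\<^sub>R Tm v a"
    "v - w \<in> Tdom a"
proof -
  have s: "sqint (\<lambda>x. fn v x *\<^sub>R fn a x)" "sqint (\<lambda>x. fn w x *\<^sub>R fn a x)" using assms by (auto simp: Tdom_def)
  show "Tm (v + w) a = Tm v a + Tm w a"
    unfolding Tm_def[of v] Tm_def[of w] toL2_add[OF s]
    by (rule Tm_eqI(2)[OF sqint_add[OF s]]) (use fn_arith(1)[of v w] in \<open>auto elim: eventually_mono simp: scaleR_add_left\<close>)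
  have d: "AE x in lebesgue. fn v x *\<^sub>R fn a x - fn w x *\<^sub>R fn a x = fn (v - w) x *\<^sub>R fn a x"
    using fn_arith(2)[of v w] by eventually_elim (simp add: scaleR_diff_left)
  show "Tm (v - w) a = Tm v a - Tm w a" "v - w \<in> Tdom a"
    unfolding Tm_def[of v] Tm_def[of w] toL2_diff[OF s]
    using Tm_eqI[OF sqint_diff[OF s] d] by auto
  show "Tm (c *\<^sub>R v) a = c *\<^sub>R Tm v a"
    unfolding Tm_def[of v] toL2_scaleR[OF s(1)]
    by (rule Tm_eqI(2)[OF sqint_scaleR[OF s(1)]]) (use fn_arith(3)[of c v] in \<open>auto elim: eventually_mono\<close>)
qed

text \<open>Pointwise the scalar may stand on either factor. This lets the difference of two Joule
  terms be expressed through the difference of the fields.\<close>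

lemma Tm_swap:
  assumes "w \<in> Tdom a" "w \<in> Tdom b" and s: "bm s"
  shows "mulop s (Tm w a) \<bullet> b = mulop s a \<bullet> Tm w b"
proof -
  have t: "sqint (\<lambda>x. fn w x *\<^sub>R fn a x)" "sqint (\<lambda>x. fn w x *\<^sub>R fn b x)" using assms by (auto simp: Tdom_def)
  have "mulop s (Tm w a) \<bullet> toL2 (fn b) = (LINT x|lebesgue. s x *\<^sub>R (fn w x *\<^sub>R fn a x) \<bullet> fn b x)"
    unfolding Tm_def mulop_toL2[OF s t(1)] by (rule toL2_inner[OF bm_sqint[OF s t(1)] sqint_fn])
  also have "\<dots> = (LINT x|lebesgue. s x *\<^sub>R fn a x \<bullet> fn w x *\<^sub>R fn b x)" by (simp add: mult_ac)
  also have "\<dots> = mulop s (toL2 (fn a)) \<bullet> Tm w b"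
    unfolding Tm_def mulop_toL2[OF s sqint_fn] by (rule toL2_inner[OF bm_sqint[OF s sqint_fn] t(2), symmetric])
  finally show ?thesis by simp
qed

lemma snd_D: "v \<in> PD \<Longrightarrow> snd v \<in> D" by (simp add: D_def)

end

section \<open>The heat iteration as a contraction\<close>

text \<open>\<open>U\<close> stands for the extended boundary temperature, \<open>g0\<close> for its
  gradient, and \<kappa> for the form-bound constant multiplied by the size of the data. The left
  side of \<open>small\<close> is the Lipschitz constant of the iteration.\<close>

locale thermistor = dom +
  fixes \<sigma> :: "real \<Rightarrow> real" and \<sigma>1 \<sigma>2 L :: real and U :: "real^3 \<Rightarrow> real" and g0 :: "(real^3) lsq"
    and e0 :: "real^3 \<Rightarrow> real^3" and \<kappa> :: real
  assumes \<sigma>_cont: "continuous_on UNIV \<sigma>" and \<sigma>1: "0 < \<sigma>1" and \<sigma>_bounds: "\<sigma>1 \<le> \<sigma> t" "\<sigma> t \<le> \<sigma>2"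
    and L: "L > 0" and lip: "\<bar>\<sigma> r - \<sigma> t\<bar> \<le> L * \<bar>r - t\<bar>"
    and U: "sqint U" and \<kappa>: "\<kappa> > 0"
    and fb: "weight \<sigma>1 \<sigma>2 s \<Longrightarrow> solves s (toL2 e0) p \<Longrightarrow> v \<in> PD \<Longrightarrow> fst v \<in> Tdom (toL2 e0 + snd p)"
      "weight \<sigma>1 \<sigma>2 s \<Longrightarrow> solves s (toL2 e0) p \<Longrightarrow> v \<in> PD \<Longrightarrow> norm (Tm (fst v) (toL2 e0 + snd p)) \<le> \<kappa> * norm (snd v)"
    and small: "\<kappa>\<^sup>2 * (L * (1 + 2 * (\<sigma>2 / \<sigma>1))) \<le> 1/2"
begin

definition "E p = toL2 e0 + snd p" for p :: "real lsq \<times> (real^3) lsq"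

definition wt :: "real lsq \<times> (real^3) lsq \<Rightarrow> real^3 \<Rightarrow> real" where "wt v x = \<sigma> (U x + fn (fst v) x)"

text \<open>\<open>v'\<close> is heated by the Joule heat of the field at temperature \<open>U + v\<close>.\<close>
definition "heat v p v' \<longleftrightarrow> (\<forall>w\<in>PD. (snd v' + g0) \<bullet> snd w = mulop (wt v) (E p) \<bullet> Tm (fst w) (E p))"

lemma wt_weight: "weight \<sigma>1 \<sigma>2 (wt v)"
proof -
  have "(\<lambda>x. \<sigma> (U x + fn (fst v) x)) \<in> borel_measurable lebesgue"
    by (rule borel_measurable_continuous_on[OF \<sigma>_cont]) (intro borel_measurable_add sqint_measurable U sqint_fn)
  then show ?thesis using \<sigma>_bounds by (simp add: weight_def wt_def[abs_def])
qed

lemmas wt_bm = weight_bm[OF \<sigma>1 wt_weight]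

lemma fbE:
  assumes "solves (wt v) (toL2 e0) p" "w \<in> PD"
  shows "fst w \<in> Tdom (E p)" "norm (Tm (fst w) (E p)) \<le> \<kappa> * norm (snd w)"
  using fb[OF wt_weight assms] by (auto simp: E_def)

lemma norm_mulop_wt: "norm (mulop (wt v) a) \<le> \<sigma>2 * norm a" for a :: "(real^3) lsq"
  by (rule norm_mulop[OF wt_bm(1)]) (use wt_bm(4,6) in \<open>auto simp: abs_of_pos\<close>)

lemma \<sigma>2: "\<sigma>2 \<ge> 0" using \<sigma>_bounds[of 0] \<sigma>1 by linarith

text \<open>\<open>U\<close> cancels in the difference of temperatures, and the Lipschitz bound on
  \<sigma> trades the change of coefficient for multiplication by v1 - v2, to which the form bound
  applies.\<close>

lemma wt_diff:
  assumes "fst v1 - fst v2 \<in> Tdom a"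
  shows "norm (mulop (wt v1) a - mulop (wt v2) a) \<le> L * norm (Tm (fst v1 - fst v2) a)"
proof -
  have t: "sqint (\<lambda>x. fn (fst v1 - fst v2) x *\<^sub>R fn a x)" using assms by (simp add: Tdom_def)
  note s = bm_sqint[OF wt_bm(1) sqint_fn[of a]]
  have "norm (toL2 (\<lambda>x. wt v1 x *\<^sub>R fn a x - wt v2 x *\<^sub>R fn a x)) \<le> norm (toL2 (\<lambda>x. L *\<^sub>R (fn (fst v1 - fst v2) x *\<^sub>R fn a x)))"
  proof (rule norm_toL2_mono[OF sqint_diff[OF s s] sqint_scaleR[OF t]], use fn_arith(2)[of "fst v1" "fst v2"] in eventually_elim)
    case (elim x)
    have "\<bar>wt v1 x - wt v2 x\<bar> \<le> L * \<bar>fn (fst v1 - fst v2) x\<bar>"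
      using lip[of "U x + fn (fst v1) x" "U x + fn (fst v2) x"] elim by (simp add: wt_def)
    then have "\<bar>wt v1 x - wt v2 x\<bar> * norm (fn a x) \<le> L * \<bar>fn (fst v1 - fst v2) x\<bar> * norm (fn a x)" by (rule mult_right_mono) simp
    then show ?case using L by (simp add: scaleR_diff_left[symmetric] mult.assoc abs_mult)
  qed
  then show ?thesis
    unfolding toL2_diff[OF s s, symmetric] toL2_scaleR[OF t, symmetric] mulop_def Tm_def using L by simp
qed

lemma PD_diff: "v \<in> PD \<Longrightarrow> w \<in> PD \<Longrightarrow> v - w \<in> PD"
  by (rule subspace_diff[OF subspace_PD])

text \<open>Subtracting the two equations and testing with the difference of the gradients leaves
  the change of coefficient acting on one field; coercivity provides the factor 1 /
  \<sigma>1.\<close>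

lemma E_diff:
  assumes v: "v1 \<in> PD" "v2 \<in> PD" and p: "solves (wt v1) (toL2 e0) p1" "solves (wt v2) (toL2 e0) p2"
  shows "norm (snd p1 - snd p2) \<le> L / \<sigma>1 * (\<kappa> * norm (snd v1 - snd v2))"
proof -
  let ?d = "snd p1 - snd p2"
  have PX: "p1 \<in> PX" "p2 \<in> PX" using p by (auto simp: solves_def)
  have d: "?d \<in> X" using subspace_diff[OF subspace_PX PX] unfolding X_def by (metis imageI snd_diff)
  have z: "mulop (wt v1) (E p1) \<bullet> ?d = 0" "mulop (wt v2) (E p2) \<bullet> ?d = 0" using p d by (auto simp: solves_def E_def)
  have "E p1 - E p2 = ?d" by (simp add: E_def)
  then have "mulop (wt v2) ?d = mulop (wt v2) (E p1) - mulop (wt v2) (E p2)" by (simp add: mulop_diff[OF wt_bm(1), symmetric])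
  then have "mulop (wt v2) ?d \<bullet> ?d = - ((mulop (wt v1) (E p1) - mulop (wt v2) (E p1)) \<bullet> ?d)"
    using z by (simp add: inner_diff_left)
  also have "\<dots> \<le> norm (mulop (wt v1) (E p1) - mulop (wt v2) (E p1)) * norm ?d"
    using norm_cauchy_schwarz[of "- (mulop (wt v1) (E p1) - mulop (wt v2) (E p1))" ?d]
    by (simp only: inner_minus_left norm_minus_cancel)
  also have "\<dots> \<le> L * (\<kappa> * norm (snd v1 - snd v2)) * norm ?d"
  proof (rule mult_right_mono)
    note f = fbE[OF p(1) PD_diff[OF v]]
    have "norm (mulop (wt v1) (E p1) - mulop (wt v2) (E p1)) \<le> L * norm (Tm (fst v1 - fst v2) (E p1))"
      by (rule wt_diff) (use f(1) in simp)
    also have "\<dots> \<le> L * (\<kappa> * norm (snd v1 - snd v2))" using f(2) L by (intro mult_left_mono) auto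
    finally show "norm (mulop (wt v1) (E p1) - mulop (wt v2) (E p1)) \<le> L * (\<kappa> * norm (snd v1 - snd v2))" .
  qed simp
  finally have up: "mulop (wt v2) ?d \<bullet> ?d \<le> L * (\<kappa> * norm (snd v1 - snd v2)) * norm ?d" .
  have "\<sigma>1 * (norm ?d)\<^sup>2 \<le> mulop (wt v2) ?d \<bullet> ?d"
    by (rule mulop_coercive[OF wt_bm(1)]) (use wt_bm(5) in auto)
  with up have "(\<sigma>1 * norm ?d) * norm ?d \<le> (L * (\<kappa> * norm (snd v1 - snd v2))) * norm ?d"
    by (simp add: power2_eq_square mult.assoc)
  moreover have "0 \<le> L * (\<kappa> * norm (snd v1 - snd v2))" using L \<kappa> by simp
  ultimately have "\<sigma>1 * norm ?d \<le> L * (\<kappa> * norm (snd v1 - snd v2))"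
    by (cases "norm ?d = 0") (auto simp: mult_le_cancel_right)
  then show ?thesis using \<sigma>1 by (simp add: field_simps)
qed

text \<open>With w the difference of the new temperatures, the squared norm of grad w is a
  difference of Joule terms, which splits into s1 w E1 (E1 - E2) + (s1 - s2) w E1 E2 + s2 w E2 (E1 -
  E2). In each summand w multiplies a field, giving one factor \<kappa>, and the change of field or
  coefficient gives another.\<close>

lemma contraction:
  assumes v: "v1 \<in> PD" "v2 \<in> PD" and p: "solves (wt v1) (toL2 e0) p1" "solves (wt v2) (toL2 e0) p2"
    and v': "v1' \<in> PD" "v2' \<in> PD" and h: "heat v1 p1 v1'" "heat v2 p2 v2'"
  shows "norm (snd v1' - snd v2') \<le> 1/2 * norm (snd v1 - snd v2)"
proof -
  let ?w = "v1' - v2'" and ?d = "snd p1 - snd p2" and ?V = "norm (snd v1 - snd v2)"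
  let ?N = "norm (snd v1' - snd v2')"
  have w: "?w \<in> PD" by (rule PD_diff[OF v'])
  note f1 = fbE[OF p(1) w] and f2 = fbE[OF p(2) w]
  define T1 where "T1 = Tm (fst ?w) (E p1)"
  define T2 where "T2 = Tm (fst ?w) (E p2)"
  have n: "norm T1 \<le> \<kappa> * ?N" "norm T2 \<le> \<kappa> * ?N" using f1(2) f2(2) by (simp_all add: T1_def T2_def)
  note dd = E_diff[OF v p]
  have Ed: "E p1 - E p2 = ?d" by (simp add: E_def)
  have "?N\<^sup>2 = (snd v1' + g0) \<bullet> snd ?w - (snd v2' + g0) \<bullet> snd ?w"
    by (simp add: power2_norm_eq_inner inner_add_left inner_diff_left)
  also have "\<dots> = mulop (wt v1) (E p1) \<bullet> T1 - mulop (wt v2) (E p2) \<bullet> T2"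
    using h(1)[unfolded heat_def, rule_format, OF w] h(2)[unfolded heat_def, rule_format, OF w] by (simp only: T1_def T2_def)
  also have "\<dots> = mulop (wt v1) T1 \<bullet> ?d + (mulop (wt v1) (E p1) - mulop (wt v2) (E p1)) \<bullet> T2 + mulop (wt v2) ?d \<bullet> T2"
  proof -
    have "mulop (wt v1) T1 \<bullet> E p1 = mulop (wt v1) (E p1) \<bullet> T1" "mulop (wt v1) T1 \<bullet> E p2 = mulop (wt v1) (E p1) \<bullet> T2"
      unfolding T1_def T2_def using f1(1) f2(1) by (auto intro!: Tm_swap wt_bm)
    then show ?thesis unfolding Ed[symmetric] by (simp add: mulop_diff[OF wt_bm(1)] inner_diff_left inner_diff_right)
  qed
  also have "\<dots> \<le> \<sigma>2 * (\<kappa> * ?N) * (L / \<sigma>1 * (\<kappa> * ?V)) + L * (\<kappa> * ?V) * (\<kappa> * ?N) + \<sigma>2 * (L / \<sigma>1 * (\<kappa> * ?V)) * (\<kappa> * ?N)"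
  proof (intro add_mono)
    have ge: "0 \<le> \<kappa> * ?N" "0 \<le> \<kappa> * ?V" "0 \<le> L / \<sigma>1 * (\<kappa> * ?V)" using \<kappa> L \<sigma>1 by auto
    have "mulop (wt v1) T1 \<bullet> ?d \<le> norm (mulop (wt v1) T1) * norm ?d" by (rule norm_cauchy_schwarz)
    also have "\<dots> \<le> (\<sigma>2 * (\<kappa> * ?N)) * (L / \<sigma>1 * (\<kappa> * ?V))"
      using ge \<sigma>2 by (intro mult_mono dd order_trans[OF norm_mulop_wt] mult_left_mono n) auto
    finally show "mulop (wt v1) T1 \<bullet> ?d \<le> \<sigma>2 * (\<kappa> * ?N) * (L / \<sigma>1 * (\<kappa> * ?V))" .
    note f = fbE[OF p(1) PD_diff[OF v]]
    have a: "norm (mulop (wt v1) (E p1) - mulop (wt v2) (E p1)) \<le> L * (\<kappa> * ?V)"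
    proof (rule order_trans[OF wt_diff])
      show "L * norm (Tm (fst v1 - fst v2) (E p1)) \<le> L * (\<kappa> * ?V)" using f(2) L by (intro mult_left_mono) auto
    qed (use f(1) in simp)
    have "(mulop (wt v1) (E p1) - mulop (wt v2) (E p1)) \<bullet> T2 \<le> norm (mulop (wt v1) (E p1) - mulop (wt v2) (E p1)) * norm T2"
      by (rule norm_cauchy_schwarz)
    also have "\<dots> \<le> (L * (\<kappa> * ?V)) * (\<kappa> * ?N)" using ge L by (intro mult_mono a n) auto
    finally show "(mulop (wt v1) (E p1) - mulop (wt v2) (E p1)) \<bullet> T2 \<le> L * (\<kappa> * ?V) * (\<kappa> * ?N)" .
    have "mulop (wt v2) ?d \<bullet> T2 \<le> norm (mulop (wt v2) ?d) * norm T2" by (rule norm_cauchy_schwarz)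
    also have "\<dots> \<le> (\<sigma>2 * (L / \<sigma>1 * (\<kappa> * ?V))) * (\<kappa> * ?N)"
      using ge(1) mult_nonneg_nonneg[OF \<sigma>2 ge(3)] \<sigma>2 by (intro mult_mono n order_trans[OF norm_mulop_wt] mult_left_mono dd) auto
    finally show "mulop (wt v2) ?d \<bullet> T2 \<le> \<sigma>2 * (L / \<sigma>1 * (\<kappa> * ?V)) * (\<kappa> * ?N)" .
  qed
  also have "\<dots> = (\<kappa>\<^sup>2 * (L * (1 + 2 * (\<sigma>2 / \<sigma>1)))) * (?V * ?N)"
    by (simp add: power2_eq_square algebra_simps)
  also have "\<dots> \<le> 1/2 * (?V * ?N)" by (intro mult_right_mono small) simp
  finally have "?N * ?N \<le> (1/2 * ?V) * ?N" by (simp add: power2_eq_square)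
  then show ?thesis by (cases "?N = 0") (auto simp: mult_le_cancel_right)
qed

text \<open>The form bound makes the Joule source a bounded functional of the test gradient; Riesz
  representation in the closed space of gradients then solves the heat equation.\<close>

lemma ex_heat:
  assumes p: "solves (wt v) (toL2 e0) p"
  shows "\<exists>v'\<in>PD. heat v p v'"
proof -
  define r where "r w = mulop (wt v) (E p) \<bullet> Tm (fst w) (E p) - g0 \<bullet> snd w" for w :: "real lsq \<times> (real^3) lsq"
  define S where "S = (\<lambda>w. (snd w, r w)) ` PD"
  note f = fbE[OF p]
  have "subspace S"
  proof (rule subspaceI)
    have "Tm (0 :: real lsq) (E p) = 0"
      using Tm_arith(3)[OF f(1) f(1), OF subspace_0[OF subspace_PD] subspace_0[OF subspace_PD], of 0] by simp
    then show "0 \<in> S" unfolding S_def using subspace_0[OF subspace_PD]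
      by (intro image_eqI[of _ _ 0]) (auto simp: r_def zero_prod_def)
    fix x y c assume "x \<in> S" "y \<in> S"
    then obtain a b where *: "a \<in> PD" "b \<in> PD" "x = (snd a, r a)" "y = (snd b, r b)" by (auto simp: S_def)
    show "x + y \<in> S" unfolding S_def
      by (rule image_eqI[OF _ subspace_add[OF subspace_PD *(1,2)]])
         (simp add: * r_def Tm_arith(1)[OF f(1)[OF *(1)] f(1)[OF *(2)]] inner_add_right)
    show "c *\<^sub>R x \<in> S" unfolding S_def
      by (rule image_eqI[OF _ subspace_scale[OF subspace_PD *(1), of c]])
         (simp add: * r_def Tm_arith(3)[OF f(1)[OF *(1)] f(1)[OF *(1)]] right_diff_distrib)
  qed
  moreover have "\<bar>y\<bar> \<le> (norm (mulop (wt v) (E p)) * \<kappa> + norm g0) * norm x" if xy: "(x, y) \<in> S" for x y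
  proof -
    obtain w where w: "w \<in> PD" "x = snd w" "y = r w" using xy by (auto simp: S_def)
    have "\<bar>mulop (wt v) (E p) \<bullet> Tm (fst w) (E p)\<bar> \<le> norm (mulop (wt v) (E p)) * norm (Tm (fst w) (E p))" by (rule Cauchy_Schwarz_ineq2)
    also have "\<dots> \<le> norm (mulop (wt v) (E p)) * (\<kappa> * norm x)" unfolding w(2) by (rule mult_left_mono[OF f(2)[OF w(1)]]) simp
    finally have "\<bar>mulop (wt v) (E p) \<bullet> Tm (fst w) (E p)\<bar> \<le> norm (mulop (wt v) (E p)) * \<kappa> * norm x" by (simp add: mult.assoc)
    moreover have "\<bar>g0 \<bullet> x\<bar> \<le> norm g0 * norm x" by (rule Cauchy_Schwarz_ineq2)
    ultimately show ?thesis unfolding w(3) r_def w(2)[symmetric] distrib_right by linarith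
  qed
  moreover have "0 \<le> norm (mulop (wt v) (E p)) * \<kappa> + norm g0" using \<kappa> by simp
  ultimately obtain g where g: "g \<in> closure (fst ` S)" "\<forall>(x, y)\<in>S. g \<bullet> x = y"
    using riesz_graph[of S "norm (mulop (wt v) (E p)) * \<kappa> + norm g0"] by blast
  have "fst ` S \<subseteq> D" unfolding S_def using snd_D by auto
  then have "g \<in> D" using g(1) closure_minimal[OF _ closed_XD(2)] by blast
  then obtain v' where v': "v' \<in> PD" "snd v' = g" by (auto simp: D_def)
  have "heat v p v'" unfolding heat_def
  proof
    fix w assume "w \<in> PD"
    then have "(snd w, r w) \<in> S" unfolding S_def by (rule imageI)
    with g(2) have "case (snd w, r w) of (x, y) \<Rightarrow> g \<bullet> x = y" by (rule bspec)
    then have "g \<bullet> snd w = r w" by simp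
    then show "(snd v' + g0) \<bullet> snd w = mulop (wt v) (E p) \<bullet> Tm (fst w) (E p)" by (simp add: r_def v' inner_add_left)
  qed
  then show ?thesis using v'(1) by blast
qed

definition "sol v p \<longleftrightarrow> v \<in> PD \<and> solves (wt v) (toL2 e0) p \<and> heat v p v"

lemma ex_sol: "\<exists>v p. sol v p"
proof -
  \<comment> \<open>The iteration is a relation between gradients, as the potential and the next
    temperature are only known to exist. Any selection will do, since \<open>contraction\<close>
    holds for all choices.\<close>
  define rel where "rel g g' \<longleftrightarrow> (\<exists>v p v'. v \<in> PD \<and> snd v = g \<and> solves (wt v) (toL2 e0) p \<and> v' \<in> PD \<and> snd v' = g' \<and> heat v p v')" for g g'
  have "\<forall>g\<in>D. \<exists>g'. rel g g'"
  proof
    fix g assume "g \<in> D"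
    then obtain v where v: "v \<in> PD" "snd v = g" by (auto simp: D_def)
    obtain p where p: "solves (wt v) (toL2 e0) p" using ex_solves[OF \<sigma>1 wt_weight] by blast
    obtain v' where "v' \<in> PD" "heat v p v'" using ex_heat[OF p] by blast
    then show "\<exists>g'. rel g g'" unfolding rel_def using v p by blast
  qed
  from bchoice[OF this] obtain F where F: "\<forall>g\<in>D. rel g (F g)" by blast
  have FD: "F ` D \<subseteq> D" 
  proof (rule image_subsetI)
    fix g assume "g \<in> D"
    then have "rel g (F g)" using F by blast
    then obtain v' where "v' \<in> PD" "snd v' = F g" unfolding rel_def by blast
    then show "F g \<in> D" using snd_D[of v'] by simp
  qed
  have Fc: "dist (F x) (F y) \<le> 1/2 * dist x y" if xy: "x \<in> D" "y \<in> D" for x y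
  proof -
    obtain v p v' where 1: "v \<in> PD" "snd v = x" "solves (wt v) (toL2 e0) p" "v' \<in> PD" "snd v' = F x" "heat v p v'"
      using F xy(1) unfolding rel_def by blast
    obtain w q w' where 2: "w \<in> PD" "snd w = y" "solves (wt w) (toL2 e0) q" "w' \<in> PD" "snd w' = F y" "heat w q w'"
      using F xy(2) unfolding rel_def by blast
    show ?thesis using contraction[OF 1(1) 2(1) 1(3) 2(3) 1(4) 2(4) 1(6) 2(6)] 1 2 by (simp add: dist_norm)
  qed
  have "complete D" using closed_XD(2) by (simp add: complete_eq_closed)
  moreover have "D \<noteq> {}" using subspace_0[OF subspace_XD(2)] by blast
  ultimately have "\<exists>!x. x \<in> D \<and> F x = x"
    by (rule Banach_fix[of D "1/2" F]) (use FD Fc in auto)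
  then obtain g where "g \<in> D" "F g = g" by blast
  then have "rel g g" using F by metis
  then obtain v p v' where 1: "v \<in> PD" "snd v = g" "solves (wt v) (toL2 e0) p" "v' \<in> PD" "snd v' = g" "heat v p v'"
    unfolding rel_def by blast
  \<comment> \<open>\<open>heat\<close> depends on the new temperature only through its gradient, so
    at the fixed point it may be replaced by \<open>v\<close> itself.\<close>
  then have "heat v p v" by (simp add: heat_def)
  then show ?thesis unfolding sol_def using 1 by blast
qed

text \<open>A solution reproduces itself under the iteration, so the contraction forces the
  gradients to agree; the Poincare inequality recovers the temperatures, and \<open>E_diff\<close>
  the fields.\<close>

lemma sol_unique:
  assumes "sol v p" "sol v' p'"
  shows "v = v'" "snd p = snd p'"
proof -
  have s: "v \<in> PD" "v' \<in> PD" "solves (wt v) (toL2 e0) p" "solves (wt v') (toL2 e0) p'" "heat v p v" "heat v' p' v'"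
    using assms by (auto simp: sol_def)
  have "norm (snd v - snd v') \<le> 1/2 * norm (snd v - snd v')" by (rule contraction[OF s(1-4) s(1,2) s(5,6)])
  then have z: "norm (snd v - snd v') = 0" using norm_ge_zero[of "snd v - snd v'"] by linarith
  have "norm (fst (v - v')) \<le> (2 * R + 1) * norm (snd (v - v'))"
    by (rule Poincare_PX) (use PD_diff[OF s(1,2)] PD_subset_PX in blast)
  then have "fst v = fst v'" using z by simp
  then show "v = v'" using z by (simp add: prod_eq_iff)
  have "norm (snd p - snd p') \<le> L / \<sigma>1 * (\<kappa> * norm (snd v - snd v'))" by (rule E_diff[OF s(1-4)])
  then show "snd p = snd p'" using z by simp
qed

text \<open>The weak formulation tests with bounded functions, whereas \<open>heat\<close> ranges
  over all of \<open>PD\<close>. Both sides are continuous in the test gradient, the right one by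
  the form bound, so test functions suffice.\<close>

lemma heat_from_test:
  assumes p: "solves (wt v) (toL2 e0) p"
    and t: "\<And>\<phi>. test_fun \<Omega> \<phi> \<Longrightarrow> (snd v + g0) \<bullet> toL2 (grad \<phi>) = mulop (wt v) (E p) \<bullet> Tm (toL2 \<phi>) (E p)"
  shows "heat v p v"
  unfolding heat_def
proof
  fix w assume w: "w \<in> PD"
  obtain f where f: "\<And>n. f n \<in> {f. test_fun \<Omega> f}" "(\<lambda>n. toL2 (grad (f n))) \<longlonglongrightarrow> snd w"
    by (rule AE_seq[OF w[unfolded PD_def]]) (use test_fun_TX in blast, rule that)
  have tf: "test_fun \<Omega> (f n)" for n using f(1) by simp
  have fP: "gpair (f n) \<in> PD" for n by (rule gpair_in(2)[OF tf])
  note b = fbE[OF p]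
  have "(\<lambda>n. Tm (toL2 (f n)) (E p) - Tm (fst w) (E p)) \<longlonglongrightarrow> 0"
  proof (rule tendsto_norm_zero_cancel, rule tendsto_sandwich[OF _ _ tendsto_const])
    have "(\<lambda>n. \<kappa> * norm (toL2 (grad (f n)) - snd w)) \<longlonglongrightarrow> \<kappa> * 0"
      by (intro tendsto_mult tendsto_const tendsto_norm_zero LIM_zero f(2))
    then show "(\<lambda>n. \<kappa> * norm (toL2 (grad (f n)) - snd w)) \<longlonglongrightarrow> 0" by simp
    show "\<forall>\<^sub>F n in sequentially. norm (Tm (toL2 (f n)) (E p) - Tm (fst w) (E p)) \<le> \<kappa> * norm (toL2 (grad (f n)) - snd w)"
    proof (intro always_eventually allI)
      fix n
      show "norm (Tm (toL2 (f n)) (E p) - Tm (fst w) (E p)) \<le> \<kappa> * norm (toL2 (grad (f n)) - snd w)"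
        using b(2)[OF PD_diff[OF fP[of n] w]] Tm_arith(2)[OF b(1)[OF fP[of n]] b(1)[OF w]] by (simp add: gpair_def)
    qed
  qed simp
  then have l: "(\<lambda>n. Tm (toL2 (f n)) (E p)) \<longlonglongrightarrow> Tm (fst w) (E p)" by (rule LIM_zero_cancel)
  have "(\<lambda>n. (snd v + g0) \<bullet> toL2 (grad (f n))) \<longlonglongrightarrow> (snd v + g0) \<bullet> snd w" by (intro tendsto_inner tendsto_const f(2))
  moreover have "(\<lambda>n. (snd v + g0) \<bullet> toL2 (grad (f n))) \<longlonglongrightarrow> mulop (wt v) (E p) \<bullet> Tm (fst w) (E p)"
    unfolding t[OF tf] by (intro tendsto_inner tendsto_const l)
  ultimately show "(snd v + g0) \<bullet> snd w = mulop (wt v) (E p) \<bullet> Tm (fst w) (E p)" by (rule LIMSEQ_unique)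
qed

end

section \<open>Translation to weak solutions\<close>

locale thermistor_data = thermistor +
  fixes u0 :: "real^3 \<Rightarrow> real" and E0 :: "real^3 \<Rightarrow> real^3"
  assumes U_eq: "U = ext0 u0" and g0_eq: "g0 = LQ (wgrad \<Omega> u0)" and e0_eq: "e0 = ext0 E0"
    and u0: "H1 \<Omega> u0" and e0: "sqint e0"
begin

lemma E0_facts: "sqint (ext0 E0)" "toL2 e0 = LQ E0" "LQ E0 \<in> Z"
  using e0 LQ_Z[of E0] by (simp_all add: e0_eq LQ_def)

lemma E_Z: "p \<in> PX \<Longrightarrow> E p \<in> Z"
  unfolding E_def E0_facts(2) by (intro subspace_add[OF subspace_Z] E0_facts PX_Z)

lemma wt_AE:
  assumes u: "sqint (ext0 u)" "LQ u = LQ u0 + fst v"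
  shows "AE x in lebesgue. x \<in> \<Omega> \<longrightarrow> wt v x = \<sigma> (u x)"
  using fn_LQ[OF u(1)] fn_LQ[OF H1_wgrad(1)[OF u0]] fn_arith(1)[of "LQ u0" "fst v"] unfolding u(2)
  unfolding wt_def by eventually_elim (simp add: U_eq)

lemma fn_mulop: "bm s \<Longrightarrow> AE x in lebesgue. fn (mulop s a) x = s x *\<^sub>R fn a x"
  unfolding mulop_def by (rule fn_toL2[OF bm_sqint[OF _ sqint_fn]])

lemma \<sigma>_pos: "\<sigma> t > 0" using \<sigma>_bounds(1)[of t] \<sigma>1 by linarith

text \<open>With curl H = \<sigma> E the Joule term |curl H|^2 / \<sigma> equals \<sigma> |E|^2, and
  the test function is absorbed into one copy of E.\<close>

lemma Joule_integral:
  assumes c: "sqint (ext0 c)" "LQ c = mulop (wt v) e" and u: "sqint (ext0 u)" "LQ u = LQ u0 + fst v"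
    and \<phi>: "sqint (ext0 \<phi>)" "LQ \<phi> \<in> Tdom e"
  shows "(LINT x:\<Omega>|lebesgue. (norm (c x))\<^sup>2 / \<sigma> (u x) * \<phi> x) = mulop (wt v) e \<bullet> Tm (LQ \<phi>) e"
proof -
  have t: "sqint (\<lambda>x. fn (LQ \<phi>) x *\<^sub>R fn e x)" using \<phi>(2) by (simp add: Tdom_def)
  have "mulop (wt v) e \<bullet> Tm (LQ \<phi>) e = (LINT x|lebesgue. wt v x *\<^sub>R fn e x \<bullet> fn (LQ \<phi>) x *\<^sub>R fn e x)"
    unfolding mulop_def Tm_def by (rule toL2_inner[OF bm_sqint[OF wt_bm(1) sqint_fn] t])
  also have "\<dots> = (LINT x|lebesgue. ext0 (\<lambda>x. (norm (c x))\<^sup>2 / \<sigma> (u x) * \<phi> x) x)"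
  proof (rule integral_cong_AE)
    show "(\<lambda>x. wt v x *\<^sub>R fn e x \<bullet> fn (LQ \<phi>) x *\<^sub>R fn e x) \<in> borel_measurable lebesgue"
      by (intro borel_measurable_inner sqint_measurable[OF t] sqint_measurable[OF bm_sqint[OF wt_bm(1) sqint_fn]])
    have "ext0 (\<lambda>x. (norm (c x))\<^sup>2 / \<sigma> (u x) * \<phi> x) = (\<lambda>x. (norm (ext0 c x))\<^sup>2 / \<sigma> (ext0 u x) * ext0 \<phi> x)"
      by (auto simp: ext0_def fun_eq_iff indicator_def)
    moreover have [measurable]: "ext0 c \<in> borel_measurable lebesgue" "ext0 \<phi> \<in> borel_measurable lebesgue"
      "(\<lambda>x. \<sigma> (ext0 u x)) \<in> borel_measurable lebesgue"
      by (intro sqint_measurable c \<phi>, intro sqint_measurable c \<phi>,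
          intro borel_measurable_continuous_on[OF \<sigma>_cont] sqint_measurable u)
    have "(\<lambda>x. (norm (ext0 c x))\<^sup>2 / \<sigma> (ext0 u x) * ext0 \<phi> x) \<in> borel_measurable lebesgue" by measurable
    ultimately show "ext0 (\<lambda>x. (norm (c x))\<^sup>2 / \<sigma> (u x) * \<phi> x) \<in> borel_measurable lebesgue" by simp
    show "AE x in lebesgue. wt v x *\<^sub>R fn e x \<bullet> fn (LQ \<phi>) x *\<^sub>R fn e x = ext0 (\<lambda>x. (norm (c x))\<^sup>2 / \<sigma> (u x) * \<phi> x) x"
      using wt_AE[OF u] fn_LQ[OF c(1)] fn_mulop[OF wt_bm(1), of v e] fn_LQ[OF \<phi>(1)] Z_AE[OF LQ_Z[OF \<phi>(1)]]
      unfolding c(2)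
    proof eventually_elim
      case (elim x)
      show ?case
      proof (cases "x \<in> \<Omega>")
        case True
        then have "c x = \<sigma> (u x) *\<^sub>R fn e x" using elim by simp
        then show ?thesis using True elim \<sigma>_pos[of "u x"] by (simp add: dot_square_norm power2_eq_square)
      next
        case False
        then show ?thesis using elim by simp
      qed
    qed
  qed
  finally show ?thesis by (simp add: set_integral_ext0)
qed

lemma curl_form_integral:
  assumes c: "sqint (ext0 c)" "LQ c = mulop (wt v) e" and u: "sqint (ext0 u)" "LQ u = LQ u0 + fst v"
    and d: "sqint (ext0 d)" and e: "e \<in> Z"
  shows "(LINT x:\<Omega>|lebesgue. (c x \<bullet> d x) / \<sigma> (u x)) = e \<bullet> LQ d"
proof -
  have s: "sqint (ext0 (fn e))" by (rule sqint_ext0[OF sqint_fn])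
  have "e \<bullet> LQ d = (LINT x|lebesgue. ext0 (\<lambda>x. fn e x \<bullet> d x) x)"
    using LQ_inner[OF s d] LQ_fn[OF e] by (simp add: set_integral_ext0)
  also have "\<dots> = (LINT x|lebesgue. ext0 (\<lambda>x. (c x \<bullet> d x) / \<sigma> (u x)) x)"
  proof (rule integral_cong_AE)
    have "ext0 (\<lambda>x. fn e x \<bullet> d x) = (\<lambda>x. ext0 (fn e) x \<bullet> ext0 d x)"
      by (auto simp: ext0_def fun_eq_iff indicator_def)
    then show "ext0 (\<lambda>x. fn e x \<bullet> d x) \<in> borel_measurable lebesgue"
      using borel_measurable_inner[OF sqint_measurable[OF s] sqint_measurable[OF d]] by simp
    have "ext0 (\<lambda>x. (c x \<bullet> d x) / \<sigma> (u x)) = (\<lambda>x. (ext0 c x \<bullet> ext0 d x) / \<sigma> (ext0 u x))"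
      by (auto simp: ext0_def fun_eq_iff indicator_def)
    moreover have "(\<lambda>x. (ext0 c x \<bullet> ext0 d x) / \<sigma> (ext0 u x)) \<in> borel_measurable lebesgue"
      by (intro borel_measurable_inner borel_measurable_divide borel_measurable_continuous_on[OF \<sigma>_cont] sqint_measurable c u d)
    ultimately show "ext0 (\<lambda>x. (c x \<bullet> d x) / \<sigma> (u x)) \<in> borel_measurable lebesgue" by simp
    show "AE x in lebesgue. ext0 (\<lambda>x. fn e x \<bullet> d x) x = ext0 (\<lambda>x. (c x \<bullet> d x) / \<sigma> (u x)) x"
      using wt_AE[OF u] fn_LQ[OF c(1)] fn_mulop[OF wt_bm(1), of v e]
      unfolding c(2)
    proof eventually_elim
      case (elim x)
      show ?case
      proof (cases "x \<in> \<Omega>")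
        case True
        then have "c x = \<sigma> (u x) *\<^sub>R fn e x" using elim by simp
        then show ?thesis using True \<sigma>_pos[of "u x"] by simp
      qed simp
    qed
  qed
  finally show ?thesis by (simp add: set_integral_ext0)
qed

lemma wg_add: "wg a b \<Longrightarrow> wg a' b' \<Longrightarrow> wg (a + a') (b + b')"
  by (simp add: wg_def inner_add_left)

lemma H1_shift:
  assumes u: "sqint (ext0 u)" "LQ u = LQ u0 + fst v" and v: "v \<in> PD"
  shows "H1 \<Omega> u" "LQ (wgrad \<Omega> u) = snd v + g0"
proof -
  note h = H1_wgrad[OF u0]
  have "wg (LQ u) (snd v + g0)"
    unfolding u(2) g0_eq using wg_add[OF PD_Z(3)[OF v] h(3)] by (simp add: add.commute)
  moreover have "snd v + g0 \<in> Z"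
    unfolding g0_eq by (intro subspace_add[OF subspace_Z] PD_Z(2)[OF v] LQ_Z h(2))
  ultimately show "H1 \<Omega> u" "LQ (wgrad \<Omega> u) = snd v + g0" using H1_intro[OF u(1)] by auto
qed

text \<open>The current \<sigma> E of the fixed point is orthogonal to \<open>X\<close>, hence the
  curl of an admissible H orthogonal to the harmonic fields. In the equation for H the potential
  gradient disappears, because weak curls are orthogonal to \<open>X\<close>.\<close>

lemma ex_weak_solution: "\<exists>u H. weak_solution \<Omega> \<sigma> u0 E0 u H \<and> perp_HN \<Omega> H"
proof -
  obtain v p where "sol v p" using ex_sol by blast
  then have v: "v \<in> PD" and p: "solves (wt v) (toL2 e0) p" and h: "heat v p v" by (auto simp: sol_def)
  define B where "B = mulop (wt v) (E p)"
  have pX: "p \<in> PX" using p by (simp add: solves_def)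
  have EZ: "E p \<in> Z" by (rule E_Z[OF pX])
  have BZ: "B \<in> Z" unfolding B_def by (rule mulop_Z[OF wt_bm(1) EZ])
  have "B \<bullet> x = 0" if "x \<in> X" for x using p that by (simp add: B_def solves_def E_def)
  then obtain b where b: "b \<in> Z" "wc b B" "\<forall>g\<in>Gr. b \<bullet> g = 0" "\<forall>h\<in>HNs. b \<bullet> h = 0" using ex_curl_perp by metis
  define H where "H = fn b"
  have sH: "sqint (ext0 H)" "LQ H = b" using sqint_ext0[OF sqint_fn] LQ_fn[OF b(1)] by (auto simp: H_def)
  have Hc: "Hcurl \<Omega> H" "LQ (wcurl \<Omega> H) = B" using Hcurl_intro[OF sH(1) BZ] b(2) sH(2) by auto
  define u where "u x = u0 x + fn (fst v) x" for x
  have su: "sqint (ext0 u)" unfolding u_def[abs_def] ext0_arith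
    by (intro sqint_add H1_wgrad(1)[OF u0] sqint_ext0 sqint_fn)
  have Lu: "LQ u = LQ u0 + fst v" unfolding u_def[abs_def]
    using LQ_arith(1)[OF H1_wgrad(1)[OF u0] sqint_ext0[OF sqint_fn]] LQ_fn[OF PD_Z(1)[OF v]] by simp
  note Hu = H1_shift[OF su Lu v]
  have c: "sqint (ext0 (wcurl \<Omega> H))" "LQ (wcurl \<Omega> H) = mulop (wt v) (E p)"
    using Hcurl_wcurl(2)[OF Hc(1)] Hc(2) by (auto simp: B_def)
  have "weak_solution \<Omega> \<sigma> u0 E0 u H"
    unfolding weak_solution_def
  proof (intro conjI allI impI)
    show "H1 \<Omega> u" by (rule Hu(1))
    show "H0div0 \<Omega> H" using b(3) sH by (simp add: H0div0_iff)
    show "Hcurl \<Omega> H" by (rule Hc(1))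
    show "H10 \<Omega> (\<lambda>x. u x - u0 x)"
      using PD_H10(1)[OF v sqint_ext0[OF sqint_fn] LQ_fn[OF PD_Z(1)[OF v]]] by (simp add: u_def)
  next
    fix \<phi> assume "H10 \<Omega> \<phi> \<and> Linfty \<Omega> \<phi>"
    note f = H10_PD[OF conjunct1[OF this]]
    have "(LINT x:\<Omega>|lebesgue. wgrad \<Omega> u x \<bullet> wgrad \<Omega> \<phi> x) = (snd v + g0) \<bullet> LQ (wgrad \<Omega> \<phi>)"
      using LQ_inner[OF H1_wgrad(2)[OF Hu(1)] f(2)] Hu(2) by simp
    also have "\<dots> = mulop (wt v) (E p) \<bullet> Tm (LQ \<phi>) (E p)"
      using h[unfolded heat_def, rule_format, OF f(3)] by simp
    also have "\<dots> = (LINT x:\<Omega>|lebesgue. (norm (wcurl \<Omega> H x))\<^sup>2 / \<sigma> (u x) * \<phi> x)"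
      by (rule Joule_integral[OF c su Lu f(1), symmetric]) (use fbE(1)[OF p f(3)] in simp)
    finally show "(LINT x:\<Omega>|lebesgue. wgrad \<Omega> u x \<bullet> wgrad \<Omega> \<phi> x) =
      (LINT x:\<Omega>|lebesgue. (norm (wcurl \<Omega> H x))\<^sup>2 / \<sigma> (u x) * \<phi> x)" .
  next
    fix w assume "H0div0 \<Omega> w \<and> Hcurl \<Omega> w"
    note W = Hcurl_wcurl[OF conjunct2[OF this]]
    have "(LINT x:\<Omega>|lebesgue. (wcurl \<Omega> H x \<bullet> wcurl \<Omega> w x) / \<sigma> (u x)) = E p \<bullet> LQ (wcurl \<Omega> w)"
      by (rule curl_form_integral[OF c su Lu W(2) EZ])
    also have "\<dots> = LQ E0 \<bullet> LQ (wcurl \<Omega> w)"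
      using wc_orth_X[OF W(3), of "snd p"] pX by (simp add: E_def E0_facts inner_add_left inner_commute[of "snd p"] X_def)
    also have "\<dots> = (LINT x:\<Omega>|lebesgue. E0 x \<bullet> wcurl \<Omega> w x)" by (rule LQ_inner[OF E0_facts(1) W(2)])
    finally show "(LINT x:\<Omega>|lebesgue. (wcurl \<Omega> H x \<bullet> wcurl \<Omega> w x) / \<sigma> (u x)) = (LINT x:\<Omega>|lebesgue. E0 x \<bullet> wcurl \<Omega> w x)" .
  qed
  moreover have "perp_HN \<Omega> H" using perp_HN_iff[OF sH(1)] b(4) sH(2) by simp
  ultimately show ?thesis by blast
qed

lemma Linfty_test: assumes "test_fun \<Omega> \<phi>" shows "Linfty \<Omega> \<phi>"
proof -
  note t = test_funD[OF assms]
  obtain C where C: "C > 0" "\<And>x. norm (\<phi> x) \<le> C" using compact_support_bounded[OF smooth_continuous[OF t(1)] t(2)] by metis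
  then have "AE x in lebesgue. x \<in> \<Omega> \<longrightarrow> \<bar>\<phi> x\<bar> \<le> C" by (intro always_eventually) auto
  moreover have "ext0 \<phi> \<in> borel_measurable lebesgue"
    using sqint_measurable[OF test_fun_LQ(3)[OF assms]] test_fun_LQ(1)[OF assms] by simp
  ultimately show ?thesis unfolding Linfty_def set_borel_measurable_def ext0_def[abs_def] by blast
qed

lemma weak_solution_sol:
  assumes ws: "weak_solution \<Omega> \<sigma> u0 E0 u H"
  shows "\<exists>v p. sol v p \<and> LQ u = LQ u0 + fst v \<and> LQ (wcurl \<Omega> H) = mulop (wt v) (E p)"
proof -
  have u: "H1 \<Omega> u" and Hc: "Hcurl \<Omega> H" and d: "H10 \<Omega> (\<lambda>x. u x - u0 x)"
    and heq: "\<And>v. H10 \<Omega> v \<Longrightarrow> Linfty \<Omega> v \<Longrightarrow> (LINT x:\<Omega>|lebesgue. wgrad \<Omega> u x \<bullet> wgrad \<Omega> v x)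
        = (LINT x:\<Omega>|lebesgue. (norm (wcurl \<Omega> H x))\<^sup>2 / \<sigma> (u x) * v x)"
    and ceq: "\<And>w. H0div0 \<Omega> w \<Longrightarrow> Hcurl \<Omega> w \<Longrightarrow> (LINT x:\<Omega>|lebesgue. (wcurl \<Omega> H x \<bullet> wcurl \<Omega> w x) / \<sigma> (u x))
        = (LINT x:\<Omega>|lebesgue. E0 x \<bullet> wcurl \<Omega> w x)"
    using ws unfolding weak_solution_def by auto
  define v where "v = (LQ (\<lambda>x. u x - u0 x), LQ (wgrad \<Omega> (\<lambda>x. u x - u0 x)))"
  have v: "v \<in> PD" using H10_PD(3)[OF d] by (simp add: v_def)
  have su: "sqint (ext0 u)" by (rule H1_wgrad(1)[OF u])
  have Lu: "LQ u = LQ u0 + fst v" using LQ_arith(2)[OF su H1_wgrad(1)[OF u0]] by (simp add: v_def)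
  note Hu = H1_shift[OF su Lu v]
  let ?c = "wcurl \<Omega> H" and ?i = "\<lambda>x. 1 / wt v x"
  note c = Hcurl_wcurl[OF Hc]
  have bi: "bm ?i"
  proof (rule bmI[of _ "1 / \<sigma>1"])
    show "?i \<in> borel_measurable lebesgue"
      using bm_measurable[OF wt_bm(1)[of v]] by (intro borel_measurable_divide borel_measurable_const)
    show "\<bar>?i x\<bar> \<le> 1 / \<sigma>1" for x
      using wt_bm(4,5)[of v x] \<sigma>1 by (simp add: divide_left_mono)
  qed
  define e where "e = mulop ?i (LQ ?c)"
  have eZ: "e \<in> Z" unfolding e_def by (rule mulop_Z[OF bi LQ_Z[OF c(2)]])
  have Lc: "LQ ?c = mulop (wt v) e"
    unfolding e_def mulop_mulop[OF wt_bm(1) bi] using wt_bm(4)[of v] by (simp add: mulop_def less_imp_neq[symmetric])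
  have "e - LQ E0 \<in> X"
  proof (rule mem_X)
    show "e - LQ E0 \<in> Z" by (rule subspace_diff[OF subspace_Z eZ E0_facts(3)])
    fix w assume w: "H0div0 \<Omega> w" "Hcurl \<Omega> w"
    note W = Hcurl_wcurl[OF w(2)]
    have "e \<bullet> LQ (wcurl \<Omega> w) = LQ E0 \<bullet> LQ (wcurl \<Omega> w)"
      using ceq[OF w] curl_form_integral[OF c(2) Lc su Lu W(2) eZ] LQ_inner[OF E0_facts(1) W(2)] by simp
    then show "(e - LQ E0) \<bullet> LQ (wcurl \<Omega> w) = 0" by (simp add: inner_diff_left)
  qed
  then obtain p where p: "p \<in> PX" "snd p = e - LQ E0" unfolding X_def by force
  have Ep: "E p = e" by (simp add: E_def p(2) E0_facts)
  have sp: "solves (wt v) (toL2 e0) p"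
    unfolding solves_def using p(1) wc_orth_X[OF c(3)] Ep Lc by (auto simp: E_def)
  have "heat v p v"
  proof (rule heat_from_test[OF sp])
    fix \<phi> assume t: "test_fun \<Omega> \<phi>"
    have g: "gpair \<phi> \<in> PD" by (rule gpair_in(2)[OF t])
    have s\<phi>: "sqint (ext0 \<phi>)" "LQ \<phi> = fst (gpair \<phi>)" using test_fun_LQ[OF t] by (auto simp: gpair_def)
    note w = PD_H10[OF g s\<phi>]
    have Td: "LQ \<phi> \<in> Tdom e" using fbE(1)[OF sp g] s\<phi>(2) Ep by simp
    have "(snd v + g0) \<bullet> toL2 (grad \<phi>) = (LINT x:\<Omega>|lebesgue. wgrad \<Omega> u x \<bullet> wgrad \<Omega> \<phi> x)"
      using LQ_inner[OF H1_wgrad(2)[OF u] H10_PD(2)[OF w(1)]] Hu(2) w(2) by (simp add: gpair_def)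
    also have "\<dots> = mulop (wt v) e \<bullet> Tm (LQ \<phi>) e"
      unfolding heq[OF w(1) Linfty_test[OF t]] by (rule Joule_integral[OF c(2) Lc su Lu s\<phi>(1) Td])
    finally show "(snd v + g0) \<bullet> toL2 (grad \<phi>) = mulop (wt v) (E p) \<bullet> Tm (toL2 \<phi>) (E p)"
      by (simp add: Ep test_fun_LQ(2)[OF t])
  qed
  then show ?thesis unfolding sol_def using v sp Lu Lc Ep by blast
qed

text \<open>Uniqueness of the fixed point determines u and the curl of H. Then H - H' is curl-free,
  divergence-free and tangential, hence harmonic, and orthogonality to the harmonic fields leaves
  only 0.\<close>

lemma weak_solution_unique:
  assumes s: "weak_solution \<Omega> \<sigma> u0 E0 u H" "perp_HN \<Omega> H" and s': "weak_solution \<Omega> \<sigma> u0 E0 u' H'" "perp_HN \<Omega> H'"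
  shows "AE x in lebesgue. x \<in> \<Omega> \<longrightarrow> u x = u' x \<and> H x = H' x"
proof -
  obtain v p where 1: "sol v p" "LQ u = LQ u0 + fst v" "LQ (wcurl \<Omega> H) = mulop (wt v) (E p)"
    using weak_solution_sol[OF s(1)] by blast
  obtain v' p' where 2: "sol v' p'" "LQ u' = LQ u0 + fst v'" "LQ (wcurl \<Omega> H') = mulop (wt v') (E p')"
    using weak_solution_sol[OF s'(1)] by blast
  note eq = sol_unique[OF 1(1) 2(1)]
  have h: "H1 \<Omega> u" "H1 \<Omega> u'" "Hcurl \<Omega> H" "Hcurl \<Omega> H'" "H0div0 \<Omega> H" "H0div0 \<Omega> H'"
    using s(1) s'(1) by (auto simp: weak_solution_def)
  have "LQ u = LQ u'" using 1(2) 2(2) eq by simp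
  then have a: "AE x in lebesgue. x \<in> \<Omega> \<longrightarrow> u x = u' x" using LQ_eq_iff[OF H1_wgrad(1)[OF h(1)] H1_wgrad(1)[OF h(2)]] by simp
  note c = Hcurl_wcurl[OF h(3)] and c' = Hcurl_wcurl[OF h(4)]
  have "LQ (wcurl \<Omega> H) = LQ (wcurl \<Omega> H')" using 1(3) 2(3) eq by (simp add: E_def)
  then have "wc (LQ H - LQ H') 0" using wc_diff[OF c(3) c'(3)] by simp
  moreover have "LQ H - LQ H' \<in> Z" by (intro subspace_diff[OF subspace_Z] LQ_Z c(1) c'(1))
  moreover have "(LQ H - LQ H') \<bullet> g = 0" if "g \<in> Gr" for g using h(5,6) that by (simp add: H0div0_iff inner_diff_left)
  ultimately have m: "LQ H - LQ H' \<in> HNs" by (simp add: HNs_def)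
  have "LQ H \<bullet> (LQ H - LQ H') = 0" "LQ H' \<bullet> (LQ H - LQ H') = 0"
    using s(2) s'(2) m perp_HN_iff[OF c(1)] perp_HN_iff[OF c'(1)] by auto
  then have "(LQ H - LQ H') \<bullet> (LQ H - LQ H') = 0" by (simp only: inner_diff_left)
  then have "LQ H = LQ H'" by simp
  then have b: "AE x in lebesgue. x \<in> \<Omega> \<longrightarrow> H x = H' x" using LQ_eq_iff[OF c(1) c'(1)] by simp
  show ?thesis using a b by eventually_elim blast
qed

end

section \<open>From L^q data to the abstract setting\<close>

context dom
begin

lemma Lp_vec_Ldata:
  assumes "Lp_vec q \<Omega> F" "q > 0" "Lp_norm_vec q \<Omega> F \<le> \<epsilon>" shows "Ldata q (ext0 F) \<epsilon>"
proof -
  have e: "(\<lambda>x. norm (ext0 F x) powr q) = ext0 (\<lambda>x. norm (F x) powr q)" by (auto simp: ext0_def fun_eq_iff indicator_def)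
  have "ext0 F \<in> borel_measurable lebesgue" "integrable lebesgue (ext0 (\<lambda>x. norm (F x) powr q))"
    using assms(1) unfolding Lp_vec_def set_borel_measurable_def set_integrable_def ext0_def[abs_def] by auto
  then show ?thesis using assms(3) unfolding Ldata_def e Lp_norm_vec_def set_integral_ext0 by simp
qed

lemma Lp_vec_sqint: "Lp_vec q \<Omega> F \<Longrightarrow> q > 2 \<Longrightarrow> sqint (ext0 F)"
  by (rule Ldata_sqint[OF Lp_vec_Ldata[OF _ _ order_refl]]) auto

text \<open>The scalar case is reduced to the vector case by placing the function along a coordinate
  axis.\<close>

lemma Lp_sqint: assumes "Lp q \<Omega> f" "q > 2" shows "sqint (ext0 f)"
proof -
  have "Lp_vec q \<Omega> (\<lambda>x. f x *\<^sub>R axis 1 1)"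
  proof -
    have "(\<lambda>x. indicator \<Omega> x *\<^sub>R (f x *\<^sub>R axis 1 1) :: real^3) = (\<lambda>x. (indicator \<Omega> x *\<^sub>R f x) *\<^sub>R axis 1 1)" by simp
    moreover have "(\<lambda>x. indicator \<Omega> x *\<^sub>R f x) \<in> borel_measurable lebesgue"
      using assms(1) by (simp add: Lp_def set_borel_measurable_def)
    ultimately show ?thesis
      using assms(1) by (simp add: Lp_def Lp_vec_def set_borel_measurable_def del: scaleR_scaleR)
  qed
  then have "sqint (ext0 (\<lambda>x. f x *\<^sub>R axis 1 1 :: real^3))" using assms(2) by (rule Lp_vec_sqint)
  then have "integrable lebesgue (\<lambda>x. (norm (ext0 (\<lambda>x. f x *\<^sub>R axis 1 1 :: real^3) x))\<^sup>2)" by (simp add: sqint_def)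
  moreover have "norm (ext0 (\<lambda>x. f x *\<^sub>R axis 1 1 :: real^3) x) = norm (ext0 f x)" for x by (simp add: ext0_def)
  moreover have "ext0 f \<in> borel_measurable lebesgue"
    using assms(1) unfolding Lp_def set_borel_measurable_def ext0_def[abs_def] by simp
  ultimately show ?thesis by (simp add: sqint_def)
qed

lemma W1_H1: "W1 q \<Omega> u \<Longrightarrow> q > 2 \<Longrightarrow> H1 \<Omega> u"
  unfolding W1_def Lp_2 using Lp_sqint Lp_vec_sqint by blast

end

theorem theorem5p2:
  fixes \<Omega> :: "(real^3) set" and \<sigma> :: "real \<Rightarrow> real" and \<sigma>1 \<sigma>2 L q :: real
    and u0 :: "real^3 \<Rightarrow> real"
  assumes "C2_boundary_domain \<Omega>"
    and "continuous_on UNIV \<sigma>"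
    and "0 < \<sigma>1" and "\<sigma>1 \<le> \<sigma>2"
    and "\<forall>s. \<sigma>1 \<le> \<sigma> s \<and> \<sigma> s \<le> \<sigma>2"
    and "L > 0" and "\<forall>s t. \<bar>\<sigma> s - \<sigma> t\<bar> \<le> L * \<bar>s - t\<bar>"
    and "q > 3" and "W1 q \<Omega> u0"
  shows "\<exists>\<eta>>0. \<forall>E0. Lp_vec q \<Omega> E0 \<and> weak_curl \<Omega> E0 (\<lambda>_. 0) \<and> Lp_norm_vec q \<Omega> E0 < \<eta> \<longrightarrow>
           (\<exists>u H. weak_solution \<Omega> \<sigma> u0 E0 u H \<and> perp_HN \<Omega> H) \<and>
           (\<forall>u H u' H'. weak_solution \<Omega> \<sigma> u0 E0 u H \<and> perp_HN \<Omega> H \<and>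
                         weak_solution \<Omega> \<sigma> u0 E0 u' H' \<and> perp_HN \<Omega> H' \<longrightarrow>
              (AE x in lebesgue. x \<in> \<Omega> \<longrightarrow> u x = u' x \<and> H x = H' x))"
proof -
  have "bounded \<Omega>" using assms(1) by (simp add: C2_boundary_domain_def)
  then obtain R where R: "R > 0" "\<Omega> \<subseteq> ball 0 R" using bounded_subset_ballD by blast
  interpret dom \<Omega> R by unfold_locales (rule assms(1) R)+
  obtain K where K: "K > 0 \<and> (\<forall>s e0 p \<epsilon> v. \<epsilon> > 0 \<and> weight \<sigma>1 \<sigma>2 s \<and> Ldata q e0 \<epsilon> \<and> solves s (toL2 e0) p \<and> v \<in> PD \<longrightarrow>
    sqint (\<lambda>x. fn (fst v) x *\<^sub>R fn (toL2 e0 + snd p) x) \<and>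
    norm (toL2 (\<lambda>x. fn (fst v) x *\<^sub>R fn (toL2 e0 + snd p) x)) \<le> K * \<epsilon> * norm (snd v))"
    using form_bound[OF assms(3,8)] by (rule exE)
  have K0: "K > 0" by (rule conjunct1[OF K])
  define A where "A = L * (1 + 2 * (\<sigma>2 / \<sigma>1))"
  have A: "A \<ge> 0" using assms(3,4,6) by (simp add: A_def)
  \<comment> \<open>The choice makes K \<eta> = 1 / (1 + 2 A), and (1 + 2 A)^2 \<ge> 2 A then gives
    the contraction condition. Neither \<open>K\<close> nor \<open>A\<close> involves
    \<open>E0\<close>, so \<eta> is fixed before the data.\<close>
  define \<eta> where "\<eta> = 1 / (K * (1 + 2 * A))"
  have \<eta>: "\<eta> > 0" using K0 A by (simp add: \<eta>_def)
  have \<kappa>: "K * \<eta> = 1 / (1 + 2 * A)" using K0 by (simp add: \<eta>_def)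
  have small: "(K * \<eta>)\<^sup>2 * A \<le> 1/2"
  proof -
    have "A \<le> 1/2 * (1 + 2 * A)\<^sup>2" using A by (simp add: power2_eq_square algebra_simps)
    then show ?thesis unfolding \<kappa> using A by (simp add: power_divide divide_le_eq)
  qed
  have u0: "H1 \<Omega> u0" by (rule W1_H1[OF assms(9)]) (use assms(8) in simp)
  have "(\<exists>u H. weak_solution \<Omega> \<sigma> u0 E0 u H \<and> perp_HN \<Omega> H) \<and>
     (\<forall>u H u' H'. weak_solution \<Omega> \<sigma> u0 E0 u H \<and> perp_HN \<Omega> H \<and> weak_solution \<Omega> \<sigma> u0 E0 u' H' \<and> perp_HN \<Omega> H' \<longrightarrow>
        (AE x in lebesgue. x \<in> \<Omega> \<longrightarrow> u x = u' x \<and> H x = H' x))"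
    if E0: "Lp_vec q \<Omega> E0" "Lp_norm_vec q \<Omega> E0 < \<eta>" for E0
  proof -
    \<comment> \<open>\<eta> itself serves as the size \<epsilon> of the data, so \<kappa> = K
      \<eta> is the same for all admissible \<open>E0\<close> and positive even when
      \<open>E0\<close> vanishes.\<close>
    have d: "Ldata q (ext0 E0) \<eta>" by (rule Lp_vec_Ldata[OF E0(1)]) (use E0(2) assms(8) in auto)
    note Kb = conjunct2[OF K, rule_format, OF conjI[OF \<eta> conjI[OF _ conjI[OF d conjI]]]]
    interpret thermistor_data \<Omega> R \<sigma> \<sigma>1 \<sigma>2 L "ext0 u0" "LQ (wgrad \<Omega> u0)" "ext0 E0" "K * \<eta>" u0 E0
    proof unfold_locales
      show "fst v \<in> Tdom (toL2 (ext0 E0) + snd p)" if "weight \<sigma>1 \<sigma>2 s" "solves s (toL2 (ext0 E0)) p" "v \<in> PD" for s p v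
        using conjunct1[OF Kb[OF that]] by (simp add: Tdom_def)
      show "norm (Tm (fst v) (toL2 (ext0 E0) + snd p)) \<le> K * \<eta> * norm (snd v)" if "weight \<sigma>1 \<sigma>2 s" "solves s (toL2 (ext0 E0)) p" "v \<in> PD" for s p v
        using conjunct2[OF Kb[OF that]] by (simp add: Tm_def)
      show "sqint (ext0 E0)" using assms(8) by (intro Lp_vec_sqint[OF E0(1)]) simp
      show "(K * \<eta>)\<^sup>2 * (L * (1 + 2 * (\<sigma>2 / \<sigma>1))) \<le> 1/2" using small by (simp only: A_def)
    qed (use assms K0 \<eta> H1_wgrad(1)[OF u0] u0 in auto)
    show ?thesis using ex_weak_solution weak_solution_unique by blast
  qed
  then show ?thesis using \<eta> by blast
qed

end
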